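(* Let $k$ be a field of characteristic zero and let $R$ be a $k$-algebra which is pure $Q$-solvable, i.e. $R$ is a $Q$-solvable algebra (with generators $x_1,\dots,x_n$) and is also a pure $Q$-algebra. Let $A=\mathrm{gr}(R)$. Then $\mathrm{Fract}(R)$ is isomorphic to $\mathrm{Fract}(A)$. In particular, the skew field of fractions of $R$ is isomorphic to the skew field of twisted rational functions $\mathrm{Fract}(A_Q)$.
   Context: All algebras are associative with unit. $k$ is a field of characteristic zero. $Q=(q_{ij})$ is an $n\times n$ matrix with $q_{ij}q_{ji}=q_{ii}=1$, where each entry $q_{ij}$ is either an element of $k^*$ or an indeterminate (entries that are Laurent monomials in indeterminates, such as $q^{s_{ij}}$ with $s_{ij}\in\mathbf{Z}$, are also allowed). $k[Q]$ is the commutative domain generated by $k$ and all $q_{ij}^{\pm1}$. A $k$-algebra $R$ is a $Q$-algebra if $k[Q]$ is contained in the center of $R$. $R$ is $Q$-solvable if it is a $Q$-algebra, there are elements $x_1,\dots,x_n\in R$ such that $R$ is free as a $k[Q]$-module with basis $x^{\overline m}=x_1^{m_1}\cdots x_n^{m_n}$, $\overline m=(m_1,\dots,m_n)\in\mathbf{Z}_+^n$ ($\mathbf{Z}_+$ denotes the nonnegative integers), and for all $i<j$ one has $x_ix_j-q_{ij}x_jx_i=r_{ij}$ with $r_{ij}\in R_{i+1}$, where $R_{i+1}$ is the $k[Q]$-subalgebra generated by $x_{i+1},\dots,x_n$ (and $R_{n+1}=k[Q]$). Every $Q$-solvable algebra is a Noetherian domain. Order $\mathbf{Z}_+^n$ lexicographically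 with $e_1>e_2>\dots>e_n$ ($e_i$ the standard basis vectors). Let $R(\overline m)$ be the $k[Q]$-submodule generated by $\{x^{\overline p}:\overline p\le\overline m\}$. This makes $R$ a $\mathbf{Z}_+^n$-filtered algebra, and $\mathrm{gr}(R)$ is its associated graded algebra; it is generated over $k[Q]$ by the symbols $X_1,\dots,X_n$ of $x_1,\dots,x_n$, with $X_iX_j=q_{ij}X_jX_i$. For a $Q$-algebra $R$ and a prime ideal $E\in\mathrm{Spec}(k[Q])$ put $I_E=RE$, $R_E=R/I_E$, and let $Z_E$ be the center of $R_E$. Let $\Omega\subset\mathrm{Spec}(k[Q])$ be the set of primes $E$ such that $R_E$ is a domain and $R_E$ is finitely generated as a $Z_E$-module. $R$ is a pure $Q$-algebra if $\Omega$ is dense in $\mathrm{Spec}(k[Q])$ in the Jacobson (Zariski) topology; since $k[Q]$ is a domain this means $\bigcap_{E\in\Omega}E=0$. The algebra of twisted polynomials $A_Q$ is the $k[Q]$-algebra (with $k[Q]$ central) generated by $y_1,\dots,y_n$ with defining relations $y_iy_j=q_{ij}y_jy_i$; it is a Noetherian domain, and its skew field of fractions $\mathrm{Fract}(A_Q)$ is called the skew field of twisted rational functions. $\mathrm{Fract}$ denotes the (Ore) skew field of fractions of a Noetherian domain; isomorphisms are isomorphisms of $k$-algebras. *)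

theory Defs
  imports "HOL-Analysis.Analysis" "HOL-Algebra.Algebra" "HOL-Algebra.Algebraic_Closure_Type"
    "HOL-Library.Poly_Mapping"
begin

section \<open>The coefficient ring k[Q]\<close>

text \<open>
  Laurent polynomials over \<open>'k\<close> in the indeterminates \<open>t_0, t_1, \<dots>\<close> are finitely supported
  functions on exponent vectors with the convolution product.
\<close>

type_synonym 'k laurent = "(nat \<Rightarrow>\<^sub>0 int) \<Rightarrow>\<^sub>0 'k"

definition const :: "'k::field_char_0 \<Rightarrow> 'k laurent" where
  "const c = Poly_Mapping.single 0 c"

definition laurent_monomial :: "(nat \<Rightarrow>\<^sub>0 int) \<Rightarrow> 'k::field_char_0 laurent" where
  "laurent_monomial a = Poly_Mapping.single a 1"

definition Q_matrix :: "nat \<Rightarrow> (nat \<Rightarrow> nat \<Rightarrow> 'k::field_char_0 laurent) \<Rightarrow> bool" where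
  "Q_matrix n q \<longleftrightarrow>
     (\<forall>i\<in>{1..n}. \<forall>j\<in>{1..n}.
        q i j * q j i = 1 \<and> q i i = 1 \<and>
        ((\<exists>c. c \<noteq> 0 \<and> q i j = const c) \<or> (\<exists>a. q i j = laurent_monomial a)))"

text \<open>The inverse of \<open>q i j\<close> is the entry \<open>q j i\<close>, so it need not be listed as a generator.\<close>

definition kQ :: "nat \<Rightarrow> (nat \<Rightarrow> nat \<Rightarrow> 'k::field_char_0 laurent) \<Rightarrow> 'k laurent ring" where
  "kQ n q = ring_of_type_algebra
     \<lparr>carrier := generate_ring ring_of_type_algebra
        (range const \<union> {q i j | i j. i \<in> {1..n} \<and> j \<in> {1..n}})\<rparr>"


section \<open>Q-algebras and Q-solvable algebras\<close>

text \<open>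
  A Q-algebra is given by a ring \<open>R\<close> together with the inclusion \<open>\<eta>\<close> of k[Q] into its center; the
  k-algebra structure of \<open>R\<close> is the restriction of \<open>\<eta>\<close> to the constants.
\<close>

definition ring_center :: "('r, 'm) ring_scheme \<Rightarrow> 'r set" where
  "ring_center R = {z \<in> carrier R. \<forall>r\<in>carrier R. z \<otimes>\<^bsub>R\<^esub> r = r \<otimes>\<^bsub>R\<^esub> z}"

definition Q_algebra ::
  "nat \<Rightarrow> (nat \<Rightarrow> nat \<Rightarrow> 'k::field_char_0 laurent) \<Rightarrow> ('r, 'm) ring_scheme \<Rightarrow>
   ('k laurent \<Rightarrow> 'r) \<Rightarrow> bool" where
  "Q_algebra n q R \<eta> \<longleftrightarrow>
     ring R \<and> \<eta> \<in> ring_hom (kQ n q) R \<and> inj_on \<eta> (carrier (kQ n q)) \<and>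
     \<eta> ` carrier (kQ n q) \<subseteq> ring_center R"

definition multi_exponents :: "nat \<Rightarrow> (nat \<Rightarrow>\<^sub>0 nat) set" where
  "multi_exponents n = {m. Poly_Mapping.keys m \<subseteq> {1..n}}"

definition ordered_monomial ::
  "nat \<Rightarrow> ('r, 'm) ring_scheme \<Rightarrow> (nat \<Rightarrow> 'r) \<Rightarrow> (nat \<Rightarrow>\<^sub>0 nat) \<Rightarrow> 'r" where
  "ordered_monomial n R x m =
     foldr (\<lambda>i y. (x i [^]\<^bsub>R\<^esub> Poly_Mapping.lookup m i) \<otimes>\<^bsub>R\<^esub> y) [1..<Suc n] \<one>\<^bsub>R\<^esub>"

definition kQ_coeffs ::
  "nat \<Rightarrow> (nat \<Rightarrow> nat \<Rightarrow> 'k::field_char_0 laurent) \<Rightarrow> 'i set \<Rightarrow> ('i \<Rightarrow>\<^sub>0 'k laurent) set" where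
  "kQ_coeffs n q S =
     {c. Poly_Mapping.keys c \<subseteq> S \<and> range (Poly_Mapping.lookup c) \<subseteq> carrier (kQ n q)}"

definition lin_comb ::
  "('r, 'm) ring_scheme \<Rightarrow> ('k::field_char_0 laurent \<Rightarrow> 'r) \<Rightarrow> ('i \<Rightarrow> 'r) \<Rightarrow>
   ('i \<Rightarrow>\<^sub>0 'k laurent) \<Rightarrow> 'r" where
  "lin_comb R \<eta> b c =
     (\<Oplus>\<^bsub>R\<^esub> i \<in> Poly_Mapping.keys c. \<eta> (Poly_Mapping.lookup c i) \<otimes>\<^bsub>R\<^esub> b i)"

definition Q_solvable ::
  "nat \<Rightarrow> (nat \<Rightarrow> nat \<Rightarrow> 'k::field_char_0 laurent) \<Rightarrow> ('r, 'm) ring_scheme \<Rightarrow>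
   ('k laurent \<Rightarrow> 'r) \<Rightarrow> (nat \<Rightarrow> 'r) \<Rightarrow> bool" where
  "Q_solvable n q R \<eta> x \<longleftrightarrow>
     Q_algebra n q R \<eta> \<and>
     (\<forall>i\<in>{1..n}. x i \<in> carrier R) \<and>
     bij_betw (lin_comb R \<eta> (ordered_monomial n R x))
       (kQ_coeffs n q (multi_exponents n)) (carrier R) \<and>
     (\<forall>i\<in>{1..n}. \<forall>j\<in>{1..n}. i < j \<longrightarrow>
        (x i \<otimes>\<^bsub>R\<^esub> x j) \<ominus>\<^bsub>R\<^esub> (\<eta> (q i j) \<otimes>\<^bsub>R\<^esub> (x j \<otimes>\<^bsub>R\<^esub> x i))
          \<in> generate_ring R (\<eta> ` carrier (kQ n q) \<union> x ` {i+1..n}))"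


section \<open>Pure Q-algebras\<close>

definition noncomm_domain :: "('r, 'm) ring_scheme \<Rightarrow> bool" where
  "noncomm_domain R \<longleftrightarrow> ring R \<and> \<one>\<^bsub>R\<^esub> \<noteq> \<zero>\<^bsub>R\<^esub> \<and>
     (\<forall>a\<in>carrier R. \<forall>b\<in>carrier R. a \<otimes>\<^bsub>R\<^esub> b = \<zero>\<^bsub>R\<^esub> \<longrightarrow> a = \<zero>\<^bsub>R\<^esub> \<or> b = \<zero>\<^bsub>R\<^esub>)"

definition finite_over_center :: "('r, 'm) ring_scheme \<Rightarrow> bool" where
  "finite_over_center R \<longleftrightarrow>
     (\<exists>F. finite F \<and> F \<subseteq> carrier R \<and>
       (\<forall>r\<in>carrier R. \<exists>z \<in> F \<rightarrow> ring_center R. r = (\<Oplus>\<^bsub>R\<^esub> f \<in> F. z f \<otimes>\<^bsub>R\<^esub> f)))"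

definition prime_spec :: "('a, 'm) ring_scheme \<Rightarrow> 'a set set" where
  "prime_spec P = {E. primeideal E P}"

definition zariski :: "('a, 'm) ring_scheme \<Rightarrow> 'a set topology" where
  "zariski P = topology_generated_by ((\<lambda>f. {E \<in> prime_spec P. f \<notin> E}) ` carrier P)"

text \<open>As \<open>\<eta> ` E\<close> is central, the two-sided ideal it generates is \<open>RE\<close>.\<close>

definition specialization ::
  "('r, 'm) ring_scheme \<Rightarrow> ('k::field_char_0 laurent \<Rightarrow> 'r) \<Rightarrow> 'k laurent set \<Rightarrow> 'r set ring" where
  "specialization R \<eta> E = R Quot (genideal R (\<eta> ` E))"

definition pure_points ::
  "nat \<Rightarrow> (nat \<Rightarrow> nat \<Rightarrow> 'k::field_char_0 laurent) \<Rightarrow> ('r, 'm) ring_scheme \<Rightarrow>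
   ('k laurent \<Rightarrow> 'r) \<Rightarrow> 'k laurent set set" where
  "pure_points n q R \<eta> =
     {E \<in> prime_spec (kQ n q). noncomm_domain (specialization R \<eta> E) \<and>
        finite_over_center (specialization R \<eta> E)}"

definition pure_Q_algebra ::
  "nat \<Rightarrow> (nat \<Rightarrow> nat \<Rightarrow> 'k::field_char_0 laurent) \<Rightarrow> ('r, 'm) ring_scheme \<Rightarrow>
   ('k laurent \<Rightarrow> 'r) \<Rightarrow> bool" where
  "pure_Q_algebra n q R \<eta> \<longleftrightarrow> Q_algebra n q R \<eta> \<and>
     zariski (kQ n q) closure_of pure_points n q R \<eta> = prime_spec (kQ n q)"


section \<open>The associated graded algebra\<close>

text \<open>
  The order of \<^typ>\<open>nat \<Rightarrow>\<^sub>0 nat\<close> in the library is the lexicographic one in which the smallest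
  index dominates, so \<open>e_1 > e_2 > \<dots>\<close>.
\<close>

definition monomial_span ::
  "nat \<Rightarrow> (nat \<Rightarrow> nat \<Rightarrow> 'k::field_char_0 laurent) \<Rightarrow> ('r, 'm) ring_scheme \<Rightarrow>
   ('k laurent \<Rightarrow> 'r) \<Rightarrow> (nat \<Rightarrow> 'r) \<Rightarrow> (nat \<Rightarrow>\<^sub>0 nat) set \<Rightarrow> 'r set" where
  "monomial_span n q R \<eta> x S =
     lin_comb R \<eta> (ordered_monomial n R x) ` kQ_coeffs n q S"

definition filt ::
  "nat \<Rightarrow> (nat \<Rightarrow> nat \<Rightarrow> 'k::field_char_0 laurent) \<Rightarrow> ('r, 'm) ring_scheme \<Rightarrow>
   ('k laurent \<Rightarrow> 'r) \<Rightarrow> (nat \<Rightarrow> 'r) \<Rightarrow> (nat \<Rightarrow>\<^sub>0 nat) \<Rightarrow> 'r set" where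
  "filt n q R \<eta> x m = monomial_span n q R \<eta> x {p \<in> multi_exponents n. p \<le> m}"

definition filt_below ::
  "nat \<Rightarrow> (nat \<Rightarrow> nat \<Rightarrow> 'k::field_char_0 laurent) \<Rightarrow> ('r, 'm) ring_scheme \<Rightarrow>
   ('k laurent \<Rightarrow> 'r) \<Rightarrow> (nat \<Rightarrow> 'r) \<Rightarrow> (nat \<Rightarrow>\<^sub>0 nat) \<Rightarrow> 'r set" where
  "filt_below n q R \<eta> x m = monomial_span n q R \<eta> x {p \<in> multi_exponents n. p < m}"

text \<open>
  An element of the direct sum of the quotients \<open>filt m / filt_below m\<close> is a family of cosets,
  almost all of them trivial.
\<close>

definition gr ::
  "nat \<Rightarrow> (nat \<Rightarrow> nat \<Rightarrow> 'k::field_char_0 laurent) \<Rightarrow> ('r, 'm) ring_scheme \<Rightarrow>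
   ('k laurent \<Rightarrow> 'r) \<Rightarrow> (nat \<Rightarrow> 'r) \<Rightarrow> ((nat \<Rightarrow>\<^sub>0 nat) \<Rightarrow> 'r set) ring" where
  "gr n q R \<eta> x =
     (let M = multi_exponents n; F = filt n q R \<eta> x; F' = filt_below n q R \<eta> x in
      \<lparr>carrier = {f \<in> (\<Pi>\<^sub>E m\<in>M. (\<lambda>a. F' m +>\<^bsub>R\<^esub> a) ` F m). finite {m \<in> M. f m \<noteq> F' m}},
       monoid.mult = (\<lambda>f g. \<lambda>m\<in>M.
         finprod (R A_Mod F' m)
           (\<lambda>(p, s). \<Union>a\<in>f p. \<Union>b\<in>g s. F' m +>\<^bsub>R\<^esub> (a \<otimes>\<^bsub>R\<^esub> b)) {(p, s). p + s = m}),
       monoid.one = (\<lambda>m\<in>M. if m = 0 then F' m +>\<^bsub>R\<^esub> \<one>\<^bsub>R\<^esub> else F' m),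
       ring.zero = (\<lambda>m\<in>M. F' m),
       ring.add = (\<lambda>f g. \<lambda>m\<in>M. f m <+>\<^bsub>R\<^esub> g m)\<rparr>)"

definition gr_scalar ::
  "nat \<Rightarrow> (nat \<Rightarrow> nat \<Rightarrow> 'k::field_char_0 laurent) \<Rightarrow> ('r, 'm) ring_scheme \<Rightarrow>
   ('k laurent \<Rightarrow> 'r) \<Rightarrow> (nat \<Rightarrow> 'r) \<Rightarrow> 'k laurent \<Rightarrow> (nat \<Rightarrow>\<^sub>0 nat) \<Rightarrow> 'r set" where
  "gr_scalar n q R \<eta> x c =
     (\<lambda>m\<in>multi_exponents n.
        if m = 0 then filt_below n q R \<eta> x m +>\<^bsub>R\<^esub> \<eta> c else filt_below n q R \<eta> x m)"


section \<open>Twisted polynomials\<close>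

definition free_algebra ::
  "nat \<Rightarrow> (nat \<Rightarrow> nat \<Rightarrow> 'k::field_char_0 laurent) \<Rightarrow> (nat list \<Rightarrow>\<^sub>0 'k laurent) ring" where
  "free_algebra n q =
     \<lparr>carrier = kQ_coeffs n q {w. set w \<subseteq> {1..n}},
      monoid.mult = (\<lambda>f g. \<Sum>u\<in>Poly_Mapping.keys f. \<Sum>v\<in>Poly_Mapping.keys g.
        Poly_Mapping.single (u @ v) (Poly_Mapping.lookup f u * Poly_Mapping.lookup g v)),
      monoid.one = Poly_Mapping.single [] 1,
      ring.zero = 0,
      ring.add = (+)\<rparr>"

definition twisted_ideal ::
  "nat \<Rightarrow> (nat \<Rightarrow> nat \<Rightarrow> 'k::field_char_0 laurent) \<Rightarrow> (nat list \<Rightarrow>\<^sub>0 'k laurent) set" where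
  "twisted_ideal n q = genideal (free_algebra n q)
     {Poly_Mapping.single [i, j] 1 - Poly_Mapping.single [j, i] (q i j) | i j.
        i \<in> {1..n} \<and> j \<in> {1..n}}"

definition twisted_poly ::
  "nat \<Rightarrow> (nat \<Rightarrow> nat \<Rightarrow> 'k::field_char_0 laurent) \<Rightarrow> (nat list \<Rightarrow>\<^sub>0 'k laurent) set ring" where
  "twisted_poly n q = free_algebra n q Quot twisted_ideal n q"

definition twisted_scalar ::
  "nat \<Rightarrow> (nat \<Rightarrow> nat \<Rightarrow> 'k::field_char_0 laurent) \<Rightarrow> 'k laurent \<Rightarrow>
   (nat list \<Rightarrow>\<^sub>0 'k laurent) set" where
  "twisted_scalar n q c = twisted_ideal n q +>\<^bsub>free_algebra n q\<^esub> Poly_Mapping.single [] c"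


section \<open>Ore fractions\<close>

text \<open>
  A pair \<open>(a, s)\<close> stands for the right fraction \<open>a s\<^sup>-\<^sup>1\<close>.  Two fractions are added on a common
  denominator, and \<open>a s\<^sup>-\<^sup>1\<close> is multiplied by \<open>(s c) t\<^sup>-\<^sup>1\<close> to give \<open>(a c) t\<^sup>-\<^sup>1\<close>; in an Ore domain
  such representatives exist and the resulting class does not depend on them.
\<close>

definition fract_pairs :: "('a, 'm) ring_scheme \<Rightarrow> ('a \<times> 'a) set" where
  "fract_pairs R = carrier R \<times> (carrier R - {\<zero>\<^bsub>R\<^esub>})"

definition fract_rel :: "('a, 'm) ring_scheme \<Rightarrow> (('a \<times> 'a) \<times> ('a \<times> 'a)) set" where
  "fract_rel R = {((a, s), (b, t)). (a, s) \<in> fract_pairs R \<and> (b, t) \<in> fract_pairs R \<and>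
     (\<exists>u\<in>carrier R. \<exists>v\<in>carrier R.
        s \<otimes>\<^bsub>R\<^esub> u = t \<otimes>\<^bsub>R\<^esub> v \<and> s \<otimes>\<^bsub>R\<^esub> u \<noteq> \<zero>\<^bsub>R\<^esub> \<and> a \<otimes>\<^bsub>R\<^esub> u = b \<otimes>\<^bsub>R\<^esub> v)}"

definition fract_class :: "('a, 'm) ring_scheme \<Rightarrow> 'a \<Rightarrow> 'a \<Rightarrow> ('a \<times> 'a) set" where
  "fract_class R a s = fract_rel R `` {(a, s)}"

definition ore_Fract :: "('a, 'm) ring_scheme \<Rightarrow> ('a \<times> 'a) set ring" where
  "ore_Fract R =
     \<lparr>carrier = fract_pairs R // fract_rel R,
      monoid.mult = (\<lambda>\<xi> \<zeta>. \<Union>{fract_class R (a \<otimes>\<^bsub>R\<^esub> c) t | a s c t.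
        (a, s) \<in> \<xi> \<and> c \<in> carrier R \<and> (s \<otimes>\<^bsub>R\<^esub> c, t) \<in> \<zeta>}),
      monoid.one = fract_class R \<one>\<^bsub>R\<^esub> \<one>\<^bsub>R\<^esub>,
      ring.zero = fract_class R \<zero>\<^bsub>R\<^esub> \<one>\<^bsub>R\<^esub>,
      ring.add = (\<lambda>\<xi> \<zeta>. \<Union>{fract_class R (a \<oplus>\<^bsub>R\<^esub> b) s | a b s. (a, s) \<in> \<xi> \<and> (b, s) \<in> \<zeta>})\<rparr>"

definition fract_embed :: "('a, 'm) ring_scheme \<Rightarrow> 'a \<Rightarrow> ('a \<times> 'a) set" where
  "fract_embed R a = fract_class R a \<one>\<^bsub>R\<^esub>"

text \<open>Isomorphism of k-algebras whose structure maps are \<open>\<alpha>\<close> and \<open>\<beta>\<close>.\<close>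

definition k_algebra_iso ::
  "('a, 'm) ring_scheme \<Rightarrow> ('k \<Rightarrow> 'a) \<Rightarrow> ('b, 'l) ring_scheme \<Rightarrow> ('k \<Rightarrow> 'b) \<Rightarrow> bool" where
  "k_algebra_iso A \<alpha> B \<beta> \<longleftrightarrow> (\<exists>\<phi>\<in>ring_iso A B. \<forall>c. \<phi> (\<alpha> c) = \<beta> c)"

end

theory Submission
  imports Defs "HOL-Computational_Algebra.Fraction_Field"
begin

text \<open>
  Both algebras are embedded in the quantum torus \<open>L\<close> over the field of fractions \<open>F\<close> of \<open>k[Q]\<close>, so
  that the image is a right Ore subring whose right fractions exhaust \<open>L\<close>; then all skew fields in
  question are the skew field of fractions of \<open>L\<close>. For twisted polynomials and for \<open>gr(R)\<close> the
  embedding is obvious. For \<open>R\<close> the generators are sent to \<open>Y_i + W_i\<close> with \<open>W_i\<close> in the torus on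
  \<open>Y_{i+1}, \<dots>, Y_n\<close>, constructed for \<open>i = n, \<dots>, 1\<close>: the skew derivation \<open>[x_i, -]\<close> of the
  subalgebra generated by \<open>x_{i+1}, \<dots>, x_n\<close> has to become inner, with \<open>W_i\<close> as the implementing element.
  On a torus a skew derivation is a sum of monomial components; a component is inner unless its
  weight commutes with the automorphism (the resonant part). Purity excludes the resonant part:
  modulo a dense set of primes the algebra is finite over its centre, so some element with a positive degree
  in \<open>x_i\<close> is central up to scalars, and comparing the two leading coefficients in the commutation
  relations shows that the resonant part vanishes modulo these primes, as the characteristic is 0.
\<close>

section \<open>Right Ore domains\<close>

text \<open>The case n = 2, q_12 = 1, x_1 x_2 - x_2 x_1 = 1 shows the obstacle. The derivation
  d/dx_2 is not inner on the Laurent polynomials in x_2, the algebra is the Weyl algebra, and its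
  skew field is not the commutative field of rational functions. So innerness cannot come from the
  relations alone. Characteristic 0 enters through a factor m: moving an element past x_i^m collects
  m equal copies of the resonant term, and m has to stay invertible modulo the primes in use.

  Two features of W_i are forced. Solving for a nonresonant component means dividing by a number 1 -
  beta, hence the scalars F instead of k[Q]. And W_i must have the same weight as Y_i under
  conjugation by every earlier Y_h; otherwise that conjugation would not correspond to the
  automorphism through which x_h acts, and the construction could not continue with x_h.

  The W_i have denominators, so reduction modulo a prime makes sense only at primes that avoid them.
  Therefore the prime is chosen after the elements that are to be compared.\<close>

definition right_ore :: "('a, 'm) ring_scheme \<Rightarrow> 'a set \<Rightarrow> bool" where
  "right_ore G S \<longleftrightarrow> (\<forall>a\<in>S. \<forall>b\<in>S. b \<noteq> \<zero>\<^bsub>G\<^esub> \<longrightarrow>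
     (\<exists>u\<in>S. \<exists>v\<in>S. v \<noteq> \<zero>\<^bsub>G\<^esub> \<and> a \<otimes>\<^bsub>G\<^esub> v = b \<otimes>\<^bsub>G\<^esub> u))"

locale nc_domain = ring G for G (structure) +
  assumes nontrivial: "\<one> \<noteq> \<zero>"
    and no_zero_divisors: "\<lbrakk>a \<in> carrier G; b \<in> carrier G; a \<otimes> b = \<zero>\<rbrakk> \<Longrightarrow> a = \<zero> \<or> b = \<zero>"
begin

lemma mult_nonzero:
  "\<lbrakk>a \<in> carrier G; b \<in> carrier G; a \<noteq> \<zero>; b \<noteq> \<zero>\<rbrakk> \<Longrightarrow> a \<otimes> b \<noteq> \<zero>"
  using no_zero_divisors by blast

lemma cancel_left:
  assumes "a \<in> carrier G" "b \<in> carrier G" "c \<in> carrier G" "c \<noteq> \<zero>" "c \<otimes> a = c \<otimes> b"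
  shows "a = b"
proof -
  have "c \<otimes> (a \<ominus> b) = c \<otimes> a \<ominus> c \<otimes> b" using assms by (simp add: a_minus_def r_distr r_minus)
  also have "\<dots> = \<zero>" using assms by (simp add: a_minus_def r_neg)
  finally have "a \<ominus> b = \<zero>" using no_zero_divisors[of c "a \<ominus> b"] assms by auto
  then show ?thesis using assms by (simp add: r_right_minus_eq)
qed

lemma mult_assoc_shift:
  assumes "s \<otimes> u = t \<otimes> v" "s \<in> carrier G" "u \<in> carrier G" "t \<in> carrier G" "v \<in> carrier G" "x \<in> carrier G"
  shows "s \<otimes> (u \<otimes> x) = t \<otimes> (v \<otimes> x)"
  using assms by (simp add: m_assoc[symmetric])

lemma cancel_right:
  assumes "a \<in> carrier G" "b \<in> carrier G" "c \<in> carrier G" "c \<noteq> \<zero>" "a \<otimes> c = b \<otimes> c"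
  shows "a = b"
proof -
  have "(a \<ominus> b) \<otimes> c = a \<otimes> c \<ominus> b \<otimes> c" using assms by (simp add: a_minus_def l_distr l_minus)
  also have "\<dots> = \<zero>" using assms by (simp add: a_minus_def r_neg)
  finally have "a \<ominus> b = \<zero>" using no_zero_divisors[of "a \<ominus> b" c] assms by auto
  then show ?thesis using assms by (simp add: r_right_minus_eq)
qed

text \<open>Gaussian elimination: the pivot column is removed by means of common right multiples.\<close>

lemma ore_linear_system:
  assumes S: "subring S G" and ore: "right_ore G S"
    and "finite I" "finite J" "card I < card J"
    and "\<And>i j. \<lbrakk>i \<in> I; j \<in> J\<rbrakk> \<Longrightarrow> c i j \<in> S"
  shows "\<exists>u. (\<forall>j\<in>J. u j \<in> S) \<and> (\<exists>j\<in>J. u j \<noteq> \<zero>) \<and> (\<forall>i\<in>I. (\<Oplus>j\<in>J. c i j \<otimes> u j) = \<zero>)"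
  using assms(3-6)
proof (induction I arbitrary: J c rule: finite_induct)
  case empty
  then have "J \<noteq> {}" by auto
  then show ?case using subringE(3)[OF S] nontrivial by (intro exI[of _ "\<lambda>_. \<one>"]) auto
next
  case (insert i0 I)
  note SE = subringE[OF S]
  have Sc: "x \<in> S \<Longrightarrow> x \<in> carrier G" for x using SE(1) by auto
  have cS: "\<And>i j. \<lbrakk>i \<in> insert i0 I; j \<in> J\<rbrakk> \<Longrightarrow> c i j \<in> S" by fact
  show ?case
  proof (cases "\<forall>j\<in>J. c i0 j = \<zero>")
    case True
    obtain u where u: "\<forall>j\<in>J. u j \<in> S" "\<exists>j\<in>J. u j \<noteq> \<zero>" "\<forall>i\<in>I. (\<Oplus>j\<in>J. c i j \<otimes> u j) = \<zero>"
      using insert.IH[of J c] insert.prems insert.hyps by auto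
    have "(\<Oplus>j\<in>J. c i0 j \<otimes> u j) = (\<Oplus>j\<in>J. \<zero>)"
      by (rule finsum_cong') (use True u Sc in auto)
    then show ?thesis using u by (intro exI[of _ u]) auto
  next
    case False
    then obtain j0 where j0: "j0 \<in> J" "c i0 j0 \<noteq> \<zero>" by auto
    \<comment> \<open>The Ore condition replaces division by the pivot: column \<open>j\<close>
      scaled by \<open>s\<close>, plus the pivot column times \<open>p\<close>, vanishes in row
      \<open>i0\<close>.\<close>
    have "\<exists>p s. p \<in> S \<and> s \<in> S \<and> s \<noteq> \<zero> \<and> c i0 j \<otimes> s \<oplus> c i0 j0 \<otimes> p = \<zero>" if j: "j \<in> J" for j
    proof -
      obtain u v where uv: "u \<in> S" "v \<in> S" "v \<noteq> \<zero>" "c i0 j \<otimes> v = c i0 j0 \<otimes> u"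
        using ore j0 cS[of i0 j] cS[of i0 j0] j unfolding right_ore_def by blast
      show ?thesis
        by (rule exI[of _ "\<ominus> u"], rule exI[of _ v])
          (use uv SE(5) Sc cS[of i0 j0] j0 in \<open>auto simp: r_minus r_neg\<close>)
    qed
    then obtain p s where ps: "\<And>j. j \<in> J \<Longrightarrow> p j \<in> S \<and> s j \<in> S \<and> s j \<noteq> \<zero> \<and>
        c i0 j \<otimes> s j \<oplus> c i0 j0 \<otimes> p j = \<zero>" by metis
    let ?J = "J - {j0}"
    let ?c = "\<lambda>i j. c i j \<otimes> s j \<oplus> c i j0 \<otimes> p j"
    have "\<exists>u. (\<forall>j\<in>?J. u j \<in> S) \<and> (\<exists>j\<in>?J. u j \<noteq> \<zero>) \<and> (\<forall>i\<in>I. (\<Oplus>j\<in>?J. ?c i j \<otimes> u j) = \<zero>)"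
    proof (rule insert.IH)
      show "card I < card ?J" using insert.prems insert.hyps j0 by auto
      show "?c i j \<in> S" if "i \<in> I" "j \<in> ?J" for i j
        using that ps[of j] cS[of i j] cS[of i j0] j0 SE(6,7) by auto
    qed (use insert.prems in auto)
    then obtain u where u: "\<forall>j\<in>?J. u j \<in> S" "\<exists>j\<in>?J. u j \<noteq> \<zero>"
      "\<forall>i\<in>I. (\<Oplus>j\<in>?J. ?c i j \<otimes> u j) = \<zero>" by auto
    have u0: "\<forall>i\<in>insert i0 I. (\<Oplus>j\<in>?J. ?c i j \<otimes> u j) = \<zero>"
    proof -
      have "(\<Oplus>j\<in>?J. ?c i0 j \<otimes> u j) = (\<Oplus>j\<in>?J. \<zero>)"
        by (rule finsum_cong') (use ps u Sc in auto)
      then show ?thesis using u by auto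
    qed
    \<comment> \<open>Undoing the column operations: \<open>u\<close> solves the reduced system, and
      the pivot coordinate collects the multiples \<open>p j \<otimes> u j\<close>. A nonzero
      coordinate of \<open>u\<close> stays nonzero because \<open>s j\<close> is nonzero.\<close>
    define U where "U = (\<lambda>j. if j = j0 then (\<Oplus>j\<in>?J. p j \<otimes> u j) else s j \<otimes> u j)"
    have sumS: "(\<Oplus>j\<in>A. f j) \<in> S" if "finite A" "\<And>j. j \<in> A \<Longrightarrow> f j \<in> S" for A f
      using that
    proof (induction A rule: finite_induct)
      case (insert a A)
      then show ?case using Sc by (subst finsum_insert) (auto intro!: SE(7))
    qed (use SE in auto)
    have puS: "p j \<otimes> u j \<in> S" if "j \<in> ?J" for j using ps[of j] u that by (auto intro!: SE(6))
    have "U j0 \<in> S" unfolding U_def using puS insert.prems by (auto intro!: sumS)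
    then have US: "\<forall>j\<in>J. U j \<in> S" using ps u SE(6) by (auto simp: U_def)
    have nz: "\<exists>j\<in>J. U j \<noteq> \<zero>"
    proof -
      obtain j where "j \<in> ?J" "u j \<noteq> \<zero>" using u by auto
      moreover have "s j \<in> carrier G" "s j \<noteq> \<zero>" "u j \<in> carrier G" using ps[of j] u Sc \<open>j \<in> ?J\<close> by auto
      ultimately have "U j \<noteq> \<zero>" using mult_nonzero[of "s j" "u j"] by (auto simp: U_def)
      then show ?thesis using \<open>j \<in> ?J\<close> by auto
    qed
    have "(\<Oplus>j\<in>J. c i j \<otimes> U j) = \<zero>" if i: "i \<in> insert i0 I" for i
    proof -
      have cc: "c i j \<in> carrier G" if "j \<in> J" for j using cS[OF i that] Sc by auto
      have pc: "p j \<in> carrier G" "s j \<in> carrier G" if "j \<in> J" for j using ps[OF that] Sc by auto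
      have uc: "u j \<in> carrier G" if "j \<in> ?J" for j using u that Sc by auto
      have fin: "finite ?J" using insert.prems by auto
      have "(\<Oplus>j\<in>J. c i j \<otimes> U j) = (\<Oplus>j\<in>insert j0 ?J. c i j \<otimes> U j)"
        using j0 by (simp add: insert_absorb)
      also have "\<dots> = c i j0 \<otimes> U j0 \<oplus> (\<Oplus>j\<in>?J. c i j \<otimes> U j)"
        by (rule finsum_insert) (use fin cc US Sc j0 in auto)
      also have "c i j0 \<otimes> U j0 = (\<Oplus>j\<in>?J. c i j0 \<otimes> (p j \<otimes> u j))"
        unfolding U_def using cc j0 pc uc fin by (auto intro!: finsum_rdistr)
      also have "(\<Oplus>j\<in>?J. c i j \<otimes> U j) = (\<Oplus>j\<in>?J. c i j \<otimes> (s j \<otimes> u j))"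
        by (rule finsum_cong') (use cc pc uc in \<open>auto simp: U_def\<close>)
      also have "(\<Oplus>j\<in>?J. c i j0 \<otimes> (p j \<otimes> u j)) \<oplus> (\<Oplus>j\<in>?J. c i j \<otimes> (s j \<otimes> u j)) =
          (\<Oplus>j\<in>?J. c i j0 \<otimes> (p j \<otimes> u j) \<oplus> c i j \<otimes> (s j \<otimes> u j))"
        by (rule finsum_addf[symmetric]) (use cc pc uc j0 in auto)
      also have "\<dots> = (\<Oplus>j\<in>?J. ?c i j \<otimes> u j)"
        by (rule finsum_cong') (use cc pc uc j0 in \<open>auto simp: l_distr m_assoc a_comm\<close>)
      also have "\<dots> = \<zero>" using u0 i by blast
      finally show ?thesis .
    qed
    then show ?thesis using US nz by (intro exI[of _ U]) auto
  qed
qed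

end

lemma nc_domain_iff: "nc_domain G \<longleftrightarrow> noncomm_domain G"
  by (auto simp: nc_domain_def nc_domain_axioms_def noncomm_domain_def)

section \<open>Right fractions over a right Ore domain\<close>

locale ore_domain = nc_domain +
  assumes ore: "right_ore G (carrier G)"
begin

lemma common_multiple:
  assumes "a \<in> carrier G" "b \<in> carrier G" "b \<noteq> \<zero>"
  obtains u v where "u \<in> carrier G" "v \<in> carrier G" "v \<noteq> \<zero>" "a \<otimes> v = b \<otimes> u"
  using ore assms unfolding right_ore_def by blast

abbreviation "fpairs \<equiv> fract_pairs G"
abbreviation "frel \<equiv> fract_rel G"

lemma fract_relI:
  assumes "a \<in> carrier G" "s \<in> carrier G" "s \<noteq> \<zero>" "b \<in> carrier G" "t \<in> carrier G" "t \<noteq> \<zero>"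
    "u \<in> carrier G" "v \<in> carrier G" "u \<noteq> \<zero>" "s \<otimes> u = t \<otimes> v" "a \<otimes> u = b \<otimes> v"
  shows "((a, s), (b, t)) \<in> frel"
  using assms mult_nonzero[of s u] unfolding fract_rel_def fract_pairs_def by blast

lemma fract_relD:
  assumes "((a, s), (b, t)) \<in> frel"
  shows "a \<in> carrier G" "s \<in> carrier G" "s \<noteq> \<zero>" "b \<in> carrier G" "t \<in> carrier G" "t \<noteq> \<zero>"
  using assms unfolding fract_rel_def fract_pairs_def by auto

lemma fract_relE:
  assumes "((a, s), (b, t)) \<in> frel"
  obtains u v where "u \<in> carrier G" "v \<in> carrier G" "u \<noteq> \<zero>" "v \<noteq> \<zero>"
    "s \<otimes> u = t \<otimes> v" "a \<otimes> u = b \<otimes> v"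
proof -
  obtain u v where uv: "u \<in> carrier G" "v \<in> carrier G" "s \<otimes> u \<noteq> \<zero>" "s \<otimes> u = t \<otimes> v" "a \<otimes> u = b \<otimes> v"
    using assms unfolding fract_rel_def by auto
  then have "u \<noteq> \<zero>" "v \<noteq> \<zero>" using fract_relD[OF assms] by auto
  then show thesis using uv that by blast
qed

text \<open>The relation asks for one pair of multipliers; this passes to every pair that equalizes
  the denominators. A common right multiple of \<open>u\<close> and the known \<open>u0\<close>
  reduces the claim to the known pair, and the extra right factor is cancelled. It is the reason why
  sums and products of fractions do not depend on representatives.\<close>

lemma fract_rel_multiplier:
  assumes "((a, s), (b, t)) \<in> frel" "u \<in> carrier G" "v \<in> carrier G" "s \<otimes> u = t \<otimes> v"
  shows "a \<otimes> u = b \<otimes> v"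
proof (cases "u = \<zero>")
  case True
  then have "v = \<zero>" using fract_relD[OF assms(1)] assms no_zero_divisors[of t v] by auto
  then show ?thesis using True fract_relD[OF assms(1)] by simp
next
  case False
  note D = fract_relD[OF assms(1)]
  obtain u0 v0 where 0: "u0 \<in> carrier G" "v0 \<in> carrier G" "u0 \<noteq> \<zero>" "v0 \<noteq> \<zero>"
    "s \<otimes> u0 = t \<otimes> v0" "a \<otimes> u0 = b \<otimes> v0" using fract_relE[OF assms(1)] .
  obtain x y where xy: "x \<in> carrier G" "y \<in> carrier G" "y \<noteq> \<zero>" "u \<otimes> y = u0 \<otimes> x"
    using common_multiple[OF assms(2) 0(1,3)] .
  have "t \<otimes> (v0 \<otimes> x) = s \<otimes> (u \<otimes> y)"
    using mult_assoc_shift[OF 0(5), of x] 0 xy D by simp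
  also have "\<dots> = t \<otimes> (v \<otimes> y)" using mult_assoc_shift[OF assms(4), of y] assms xy D by simp
  finally have e: "v0 \<otimes> x = v \<otimes> y" using cancel_left[of "v0 \<otimes> x" "v \<otimes> y" t] D 0 xy assms(2,3) by auto
  have "a \<otimes> u \<otimes> y = a \<otimes> (u0 \<otimes> x)" using xy D assms(2,3) by (simp add: m_assoc)
  also have "\<dots> = b \<otimes> (v0 \<otimes> x)" using mult_assoc_shift[OF 0(6), of x] 0 xy D by simp
  also have "\<dots> = b \<otimes> v \<otimes> y" unfolding e using xy D assms(2,3) by (simp add: m_assoc)
  finally show ?thesis using cancel_right[of "a \<otimes> u" "b \<otimes> v" y] D assms xy by auto
qed

lemma fract_rel_refl: "\<lbrakk>a \<in> carrier G; s \<in> carrier G; s \<noteq> \<zero>\<rbrakk> \<Longrightarrow> ((a, s), (a, s)) \<in> frel"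
  using nontrivial by (intro fract_relI[where u = \<one> and v = \<one>]) auto

lemma equiv_fract_rel: "equiv fpairs frel"
proof (rule equivI)
  show "frel \<subseteq> fpairs \<times> fpairs" unfolding fract_rel_def by auto
  show "refl_on fpairs frel"
    by (rule refl_onI) (auto simp: fract_pairs_def intro: fract_rel_refl)
  show "sym frel"
  proof (rule symI, clarify)
    fix a s b t assume h: "((a, s), (b, t)) \<in> frel"
    obtain u v where "u \<in> carrier G" "v \<in> carrier G" "u \<noteq> \<zero>" "v \<noteq> \<zero>"
      "s \<otimes> u = t \<otimes> v" "a \<otimes> u = b \<otimes> v" using fract_relE[OF h] .
    then show "((b, t), (a, s)) \<in> frel" using fract_relD[OF h] by (intro fract_relI[where u = v and v = u]) auto
  qed
  show "trans frel"
  proof (rule transI, clarify)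
    fix a s b t c w assume h: "((a, s), (b, t)) \<in> frel" and k: "((b, t), (c, w)) \<in> frel"
    note D = fract_relD[OF h] fract_relD[OF k]
    obtain u v where 1: "u \<in> carrier G" "v \<in> carrier G" "u \<noteq> \<zero>" "v \<noteq> \<zero>"
      "s \<otimes> u = t \<otimes> v" "a \<otimes> u = b \<otimes> v" using fract_relE[OF h] .
    obtain u' v' where 2: "u' \<in> carrier G" "v' \<in> carrier G" "u' \<noteq> \<zero>" "v' \<noteq> \<zero>"
      "t \<otimes> u' = w \<otimes> v'" "b \<otimes> u' = c \<otimes> v'" using fract_relE[OF k] .
    \<comment> \<open>The two relations multiply the middle denominator \<open>t\<close> by
      \<open>v\<close> and by \<open>u'\<close>; a common right multiple of these links the outer
      fractions.\<close>
    obtain x y where xy: "x \<in> carrier G" "y \<in> carrier G" "y \<noteq> \<zero>" "u' \<otimes> y = v \<otimes> x"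
      using common_multiple[OF 2(1) 1(2,4)] .
    have "x \<noteq> \<zero>" using xy 1 2 mult_nonzero[of u' y] by auto
    have e1: "s \<otimes> (u \<otimes> x) = w \<otimes> (v' \<otimes> y)"
      using mult_assoc_shift[OF 1(5), of x] mult_assoc_shift[OF 2(5), of y] 1 2 xy D by simp
    have e2: "a \<otimes> (u \<otimes> x) = c \<otimes> (v' \<otimes> y)"
      using mult_assoc_shift[OF 1(6), of x] mult_assoc_shift[OF 2(6), of y] 1 2 xy D by simp
    show "((a, s), (c, w)) \<in> frel"
      using D 1 2 xy e1 e2 \<open>x \<noteq> \<zero>\<close> mult_nonzero[of u x]
      by (intro fract_relI[where u = "u \<otimes> x" and v = "v' \<otimes> y"]) auto
  qed
qed

lemma fract_class_eq_iff:
  assumes "a \<in> carrier G" "s \<in> carrier G" "s \<noteq> \<zero>" "b \<in> carrier G" "t \<in> carrier G" "t \<noteq> \<zero>"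
  shows "fract_class G a s = fract_class G b t \<longleftrightarrow> ((a, s), (b, t)) \<in> frel"
  unfolding fract_class_def using assms
  by (intro eq_equiv_class_iff[OF equiv_fract_rel]) (auto simp: fract_pairs_def)

lemma mem_fract_class: "(b, t) \<in> fract_class G a s \<longleftrightarrow> ((a, s), (b, t)) \<in> frel"
  by (simp add: fract_class_def)

lemma fract_class_in:
  assumes "a \<in> carrier G" "s \<in> carrier G" "s \<noteq> \<zero>"
  shows "fract_class G a s \<in> carrier (ore_Fract G)"
  using assms by (auto simp: ore_Fract_def fract_class_def fract_pairs_def intro: quotientI)

lemma ore_Fract_cases:
  assumes "\<xi> \<in> carrier (ore_Fract G)"
  obtains a s where "a \<in> carrier G" "s \<in> carrier G" "s \<noteq> \<zero>" "\<xi> = fract_class G a s"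
  using assms by (auto simp: ore_Fract_def fract_class_def fract_pairs_def elim!: quotientE)

lemma fract_sym: "((a, s), (b, t)) \<in> frel \<Longrightarrow> ((b, t), (a, s)) \<in> frel"
  using equiv_fract_rel by (meson equivE symE)

text \<open>The union that defines the product runs over all composable representatives. By
  \<open>fract_rel_multiplier\<close> they all give one class, so the union has a single
  member.\<close>

lemma fract_mult:
  assumes a: "a \<in> carrier G" "s \<in> carrier G" "s \<noteq> \<zero>"
    and c: "c \<in> carrier G" "t \<in> carrier G" "t \<noteq> \<zero>"
  shows "fract_class G a s \<otimes>\<^bsub>ore_Fract G\<^esub> fract_class G (s \<otimes> c) t = fract_class G (a \<otimes> c) t"
proof -
  let ?A = "{fract_class G (a' \<otimes> c') t' | a' s' c' t'.
        (a', s') \<in> fract_class G a s \<and> c' \<in> carrier G \<and> (s' \<otimes> c', t') \<in> fract_class G (s \<otimes> c) t}"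
  have "Z = fract_class G (a \<otimes> c) t" if Z: "Z \<in> ?A" for Z
  proof -
    obtain a' s' c' t' where Z: "Z = fract_class G (a' \<otimes> c') t'" and r1: "((a, s), (a', s')) \<in> frel"
      and c': "c' \<in> carrier G" and r2: "((s \<otimes> c, t), (s' \<otimes> c', t')) \<in> frel"
      using Z by (auto simp: mem_fract_class)
    note D = fract_relD[OF r1] fract_relD[OF r2]
    obtain u v where uv: "u \<in> carrier G" "v \<in> carrier G" "u \<noteq> \<zero>"
      "t \<otimes> u = t' \<otimes> v" "s \<otimes> c \<otimes> u = s' \<otimes> c' \<otimes> v" using fract_relE[OF r2] .
    have "a \<otimes> (c \<otimes> u) = a' \<otimes> (c' \<otimes> v)"
      by (rule fract_rel_multiplier[OF r1]) (use uv c c' D in \<open>auto simp: m_assoc[symmetric]\<close>)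
    then have "((a \<otimes> c, t), (a' \<otimes> c', t')) \<in> frel"
      using D c c' uv by (intro fract_relI[where u = u and v = v]) (auto simp: m_assoc)
    then show ?thesis unfolding Z using D c c' by (subst fract_class_eq_iff) (auto intro: fract_sym)
  qed
  moreover have "fract_class G (a \<otimes> c) t \<in> ?A"
    using assms by (intro CollectI exI[of _ a] exI[of _ s] exI[of _ c] exI[of _ t])
      (auto simp: mem_fract_class intro!: fract_rel_refl)
  ultimately have "?A = {fract_class G (a \<otimes> c) t}" by blast
  then show ?thesis by (simp add: ore_Fract_def)
qed

lemma fract_add:
  assumes "a \<in> carrier G" "b \<in> carrier G" "s \<in> carrier G" "s \<noteq> \<zero>"
  shows "fract_class G a s \<oplus>\<^bsub>ore_Fract G\<^esub> fract_class G b s = fract_class G (a \<oplus> b) s"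
proof -
  let ?A = "{fract_class G (a' \<oplus> b') s' | a' b' s'.
        (a', s') \<in> fract_class G a s \<and> (b', s') \<in> fract_class G b s}"
  have "Z = fract_class G (a \<oplus> b) s" if Z: "Z \<in> ?A" for Z
  proof -
    obtain a' b' s' where Z: "Z = fract_class G (a' \<oplus> b') s'" and r1: "((a, s), (a', s')) \<in> frel"
      and r2: "((b, s), (b', s')) \<in> frel"
      using Z by (auto simp: mem_fract_class)
    note D = fract_relD[OF r1] fract_relD[OF r2]
    obtain u v where uv: "u \<in> carrier G" "v \<in> carrier G" "u \<noteq> \<zero>"
      "s \<otimes> u = s' \<otimes> v" "a \<otimes> u = a' \<otimes> v" using fract_relE[OF r1] .
    have "b \<otimes> u = b' \<otimes> v" by (rule fract_rel_multiplier[OF r2]) (use uv in auto)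
    then have "((a \<oplus> b, s), (a' \<oplus> b', s')) \<in> frel"
      using D uv by (intro fract_relI[where u = u and v = v]) (auto simp: l_distr)
    then show ?thesis unfolding Z using D by (subst fract_class_eq_iff) (auto intro: fract_sym)
  qed
  moreover have "fract_class G (a \<oplus> b) s \<in> ?A"
    using assms by (intro CollectI exI[of _ a] exI[of _ b] exI[of _ s])
      (auto simp: mem_fract_class intro!: fract_rel_refl)
  ultimately have "?A = {fract_class G (a \<oplus> b) s}" by blast
  then show ?thesis by (simp add: ore_Fract_def)
qed

lemma fract_class_expand:
  assumes "a \<in> carrier G" "s \<in> carrier G" "s \<noteq> \<zero>" "u \<in> carrier G" "u \<noteq> \<zero>"
  shows "fract_class G (a \<otimes> u) (s \<otimes> u) = fract_class G a s"
proof -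
  have "((a, s), (a \<otimes> u, s \<otimes> u)) \<in> frel"
    using assms nontrivial mult_nonzero[of s u] by (intro fract_relI[where u = u and v = \<one>]) auto
  then show ?thesis using assms mult_nonzero[of s u] by (subst fract_class_eq_iff) (auto intro: fract_sym)
qed

text \<open>The Ore condition, applied to the numerator of the second fraction and the denominator
  of the first, makes any two fractions composable.\<close>

lemma fract_mult_cases:
  assumes "\<xi> \<in> carrier (ore_Fract G)" "\<zeta> \<in> carrier (ore_Fract G)"
  obtains a s c t where "a \<in> carrier G" "s \<in> carrier G" "s \<noteq> \<zero>" "c \<in> carrier G" "t \<in> carrier G" "t \<noteq> \<zero>"
    "\<xi> = fract_class G a s" "\<zeta> = fract_class G (s \<otimes> c) t"
proof -
  obtain a s where a: "a \<in> carrier G" "s \<in> carrier G" "s \<noteq> \<zero>" "\<xi> = fract_class G a s"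
    using ore_Fract_cases[OF assms(1)] .
  obtain b t where b: "b \<in> carrier G" "t \<in> carrier G" "t \<noteq> \<zero>" "\<zeta> = fract_class G b t"
    using ore_Fract_cases[OF assms(2)] .
  obtain c v where cv: "c \<in> carrier G" "v \<in> carrier G" "v \<noteq> \<zero>" "b \<otimes> v = s \<otimes> c"
    using common_multiple[OF b(1) a(2,3)] .
  have "\<zeta> = fract_class G (s \<otimes> c) (t \<otimes> v)"
    using fract_class_expand[OF b(1-3) cv(2,3)] b cv by simp
  then show thesis using that[OF a(1-3) cv(1) _ _ a(4), of "t \<otimes> v"] b cv mult_nonzero by auto
qed

lemma fract_add_cases:
  assumes "\<xi> \<in> carrier (ore_Fract G)" "\<zeta> \<in> carrier (ore_Fract G)"
  obtains a b s where "a \<in> carrier G" "b \<in> carrier G" "s \<in> carrier G" "s \<noteq> \<zero>"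
    "\<xi> = fract_class G a s" "\<zeta> = fract_class G b s"
proof -
  obtain a s where a: "a \<in> carrier G" "s \<in> carrier G" "s \<noteq> \<zero>" "\<xi> = fract_class G a s"
    using ore_Fract_cases[OF assms(1)] .
  obtain b t where b: "b \<in> carrier G" "t \<in> carrier G" "t \<noteq> \<zero>" "\<zeta> = fract_class G b t"
    using ore_Fract_cases[OF assms(2)] .
  obtain c v where cv: "c \<in> carrier G" "v \<in> carrier G" "v \<noteq> \<zero>" "t \<otimes> v = s \<otimes> c"
    using common_multiple[OF b(2) a(2,3)] .
  have nz: "t \<otimes> v \<noteq> \<zero>" using b cv mult_nonzero by auto
  then have "c \<noteq> \<zero>" using cv a by auto
  have "\<xi> = fract_class G (a \<otimes> c) (s \<otimes> c)" using a cv \<open>c \<noteq> \<zero>\<close> by (simp add: fract_class_expand)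
  moreover have "\<zeta> = fract_class G (b \<otimes> v) (s \<otimes> c)" using b fract_class_expand[OF b(1-3) cv(2,3)] cv by simp
  ultimately show thesis using that[of "a \<otimes> c" "b \<otimes> v" "s \<otimes> c"] a b cv nz by auto
qed

lemma ore_Fract_closed:
  assumes "\<xi> \<in> carrier (ore_Fract G)" "\<zeta> \<in> carrier (ore_Fract G)"
  shows "\<xi> \<otimes>\<^bsub>ore_Fract G\<^esub> \<zeta> \<in> carrier (ore_Fract G)" "\<xi> \<oplus>\<^bsub>ore_Fract G\<^esub> \<zeta> \<in> carrier (ore_Fract G)"
proof -
  show "\<xi> \<otimes>\<^bsub>ore_Fract G\<^esub> \<zeta> \<in> carrier (ore_Fract G)"
    by (rule fract_mult_cases[OF assms]) (auto simp: fract_mult fract_class_in)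
  show "\<xi> \<oplus>\<^bsub>ore_Fract G\<^esub> \<zeta> \<in> carrier (ore_Fract G)"
    by (rule fract_add_cases[OF assms]) (auto simp: fract_add fract_class_in)
qed

end

text \<open>
  Elements with a denominator in \<open>S\<close>; for a right Ore subring they form a subring containing the
  inverses of its units.
\<close>

definition denominated :: "('a, 'm) ring_scheme \<Rightarrow> 'a set \<Rightarrow> 'a set" where
  "denominated G S = {l \<in> carrier G. \<exists>s\<in>S. s \<noteq> \<zero>\<^bsub>G\<^esub> \<and> l \<otimes>\<^bsub>G\<^esub> s \<in> S}"

context nc_domain
begin

context
  fixes S assumes S: "subring S G" and oreS: "right_ore G S"
begin

lemma denominated_base: "S \<subseteq> denominated G S"
  using subringE[OF S] nontrivial unfolding denominated_def by force

lemma denominated_mult: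
  assumes "a \<in> denominated G S" "b \<in> denominated G S" shows "a \<otimes> b \<in> denominated G S"
proof -
  note SE = subringE[OF S]
  obtain s t where h: "a \<in> carrier G" "b \<in> carrier G" "s \<in> S" "t \<in> S" "s \<noteq> \<zero>" "t \<noteq> \<zero>"
    "a \<otimes> s \<in> S" "b \<otimes> t \<in> S" using assms unfolding denominated_def by auto
  obtain u v where uv: "u \<in> S" "v \<in> S" "v \<noteq> \<zero>" "b \<otimes> t \<otimes> v = s \<otimes> u"
    using oreS h unfolding right_ore_def by blast
  have car: "s \<in> carrier G" "t \<in> carrier G" "u \<in> carrier G" "v \<in> carrier G" using h uv SE by auto
  have "a \<otimes> b \<otimes> (t \<otimes> v) = a \<otimes> (b \<otimes> t \<otimes> v)" using h car by (simp add: m_assoc)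
  also have "\<dots> = a \<otimes> s \<otimes> u" using h car uv by (simp add: m_assoc)
  finally have "a \<otimes> b \<otimes> (t \<otimes> v) \<in> S" using SE(6) h uv by auto
  then show ?thesis unfolding denominated_def
    using SE(6) h uv car mult_nonzero[of t v] by (auto intro!: bexI[of _ "t \<otimes> v"])
qed

lemma denominated_add:
  assumes "a \<in> denominated G S" "b \<in> denominated G S" shows "a \<oplus> b \<in> denominated G S"
proof -
  note SE = subringE[OF S]
  obtain s t where h: "a \<in> carrier G" "b \<in> carrier G" "s \<in> S" "t \<in> S" "s \<noteq> \<zero>" "t \<noteq> \<zero>"
    "a \<otimes> s \<in> S" "b \<otimes> t \<in> S" using assms unfolding denominated_def by auto
  obtain u v where uv: "u \<in> S" "v \<in> S" "v \<noteq> \<zero>" "t \<otimes> v = s \<otimes> u"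
    using oreS h unfolding right_ore_def by blast
  have car: "s \<in> carrier G" "t \<in> carrier G" "u \<in> carrier G" "v \<in> carrier G" using h uv SE by auto
  have "(a \<oplus> b) \<otimes> (t \<otimes> v) = a \<otimes> s \<otimes> u \<oplus> b \<otimes> t \<otimes> v"
    using h car uv by (simp add: l_distr m_assoc)
  then have "(a \<oplus> b) \<otimes> (t \<otimes> v) \<in> S" using SE(6,7) h uv by auto
  then show ?thesis unfolding denominated_def
    using SE(6) h uv car mult_nonzero[of t v] by (auto intro!: bexI[of _ "t \<otimes> v"])
qed

text \<open>\<open>a \<otimes> s\<close> is a denominator of \<open>b\<close>, since
  \<open>b \<otimes> (a \<otimes> s) = s\<close>. In the torus this supplies the inverses of the
  \<open>Y l\<close>.\<close>

lemma denominated_inverse: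
  assumes "a \<in> denominated G S" "b \<in> carrier G" "b \<otimes> a = \<one>" shows "b \<in> denominated G S"
proof -
  note SE = subringE[OF S]
  obtain s where h: "a \<in> carrier G" "s \<in> S" "s \<noteq> \<zero>" "a \<otimes> s \<in> S"
    using assms unfolding denominated_def by auto
  have car: "s \<in> carrier G" using h SE by auto
  have e: "b \<otimes> (a \<otimes> s) = s" using h car assms by (simp add: m_assoc[symmetric])
  then have "a \<otimes> s \<noteq> \<zero>" using h assms by auto
  then show ?thesis unfolding denominated_def using e h assms by auto
qed

lemma right_ore_of_denominated:
  assumes "denominated G S = carrier G" shows "right_ore G (carrier G)"
  unfolding right_ore_def
proof (intro ballI impI)
  fix a b assume ab: "a \<in> carrier G" "b \<in> carrier G" "b \<noteq> \<zero>"
  note SE = subringE[OF S]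
  obtain s t where h: "s \<in> S" "t \<in> S" "s \<noteq> \<zero>" "t \<noteq> \<zero>"
    "a \<otimes> s \<in> S" "b \<otimes> t \<in> S" using assms ab unfolding denominated_def by blast
  have car: "s \<in> carrier G" "t \<in> carrier G" using h SE by auto
  have "b \<otimes> t \<noteq> \<zero>" using ab h car mult_nonzero by auto
  then obtain u v where uv: "u \<in> S" "v \<in> S" "v \<noteq> \<zero>" "a \<otimes> s \<otimes> v = b \<otimes> t \<otimes> u"
    using oreS h unfolding right_ore_def by blast
  have car': "u \<in> carrier G" "v \<in> carrier G" using uv SE by auto
  show "\<exists>u\<in>carrier G. \<exists>v\<in>carrier G. v \<noteq> \<zero> \<and> a \<otimes> v = b \<otimes> u"
    using uv ab car car' h mult_nonzero[of s v]
    by (intro bexI[of _ "t \<otimes> u"] bexI[of _ "s \<otimes> v"]) (auto simp: m_assoc[symmetric])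
qed

end
end

text \<open>Every element of \<open>L\<close> is a right fraction of the image of \<open>P\<close>,
  so a fraction over \<open>L\<close> can be expanded until numerator and denominator lie in the
  image. The target is \<open>ore_Fract L\<close> because \<open>L\<close> need not be a skew field;
  algebras with different images in \<open>L\<close> thus acquire the same fractions.\<close>

theorem ore_Fract_iso_of_denominated:
  assumes P: "ring P" and L: "nc_domain L" and hom: "h \<in> ring_hom P L" and inj: "inj_on h (carrier P)"
    and ore: "right_ore L (h ` carrier P)" and den: "denominated L (h ` carrier P) = carrier L"
  shows "ore_domain P" and "ore_domain L"
    and "\<exists>\<Phi>\<in>ring_iso (ore_Fract P) (ore_Fract L). \<forall>a\<in>carrier P. \<Phi> (fract_embed P a) = fract_embed L (h a)"
proof -
  interpret P: ring P by fact
  interpret L: nc_domain L by fact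
  interpret h: ring_hom_ring P L h
    by (rule ring_hom_ringI2) (use P L hom in \<open>auto simp: nc_domain_def\<close>)
  have hz: "h a = \<zero>\<^bsub>L\<^esub> \<longleftrightarrow> a = \<zero>\<^bsub>P\<^esub>" if "a \<in> carrier P" for a
    using inj_onD[OF inj, of a "\<zero>\<^bsub>P\<^esub>"] that by auto
  have S: "subring (h ` carrier P) L"
    using h.img_is_subring[OF P.carrier_is_subring] .
  show P': "ore_domain P"
  proof unfold_locales
    show "\<one>\<^bsub>P\<^esub> \<noteq> \<zero>\<^bsub>P\<^esub>" using L.nontrivial h.hom_one h.hom_zero by metis
    show "a = \<zero>\<^bsub>P\<^esub> \<or> b = \<zero>\<^bsub>P\<^esub>" if "a \<in> carrier P" "b \<in> carrier P" "a \<otimes>\<^bsub>P\<^esub> b = \<zero>\<^bsub>P\<^esub>" for a b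
      using L.no_zero_divisors[of "h a" "h b"] that hz h.hom_mult[of a b] by auto
    show "right_ore P (carrier P)"
      unfolding right_ore_def
    proof (intro ballI impI)
      fix a b assume ab: "a \<in> carrier P" "b \<in> carrier P" "b \<noteq> \<zero>\<^bsub>P\<^esub>"
      then obtain u v where uv: "u \<in> carrier P" "v \<in> carrier P" "h v \<noteq> \<zero>\<^bsub>L\<^esub>" "h a \<otimes>\<^bsub>L\<^esub> h v = h b \<otimes>\<^bsub>L\<^esub> h u"
        using ore hz[of b] unfolding right_ore_def by blast
      then have "h (a \<otimes>\<^bsub>P\<^esub> v) = h (b \<otimes>\<^bsub>P\<^esub> u)" using ab by simp
      then have "a \<otimes>\<^bsub>P\<^esub> v = b \<otimes>\<^bsub>P\<^esub> u" using inj_onD[OF inj] ab uv by auto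
      then show "\<exists>u\<in>carrier P. \<exists>v\<in>carrier P. v \<noteq> \<zero>\<^bsub>P\<^esub> \<and> a \<otimes>\<^bsub>P\<^esub> v = b \<otimes>\<^bsub>P\<^esub> u" using uv hz by auto
    qed
  qed
  show L': "ore_domain L"
    by (intro ore_domain.intro L ore_domain_axioms.intro L.right_ore_of_denominated[OF S ore den])
  interpret P: ore_domain P by fact
  interpret L: ore_domain L by fact
  have dn: "\<exists>s\<in>carrier P. s \<noteq> \<zero>\<^bsub>P\<^esub> \<and> (\<exists>p\<in>carrier P. l \<otimes>\<^bsub>L\<^esub> h s = h p)" if "l \<in> carrier L" for l
  proof -
    have "l \<in> denominated L (h ` carrier P)" using that den by simp
    then show ?thesis unfolding denominated_def using hz by auto
  qed
  have rel: "((h a, h s), (h b, h t)) \<in> fract_rel L \<longleftrightarrow> ((a, s), (b, t)) \<in> fract_rel P"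
    if c: "a \<in> carrier P" "s \<in> carrier P" "s \<noteq> \<zero>\<^bsub>P\<^esub>" "b \<in> carrier P" "t \<in> carrier P" "t \<noteq> \<zero>\<^bsub>P\<^esub>" for a s b t
  proof
    assume "((a, s), (b, t)) \<in> fract_rel P"
    then obtain u v where uv: "u \<in> carrier P" "v \<in> carrier P" "u \<noteq> \<zero>\<^bsub>P\<^esub>"
      "s \<otimes>\<^bsub>P\<^esub> u = t \<otimes>\<^bsub>P\<^esub> v" "a \<otimes>\<^bsub>P\<^esub> u = b \<otimes>\<^bsub>P\<^esub> v" by (rule P.fract_relE)
    then have "h s \<otimes>\<^bsub>L\<^esub> h u = h t \<otimes>\<^bsub>L\<^esub> h v" "h a \<otimes>\<^bsub>L\<^esub> h u = h b \<otimes>\<^bsub>L\<^esub> h v"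
      using c by (metis h.hom_mult)+
    then show "((h a, h s), (h b, h t)) \<in> fract_rel L"
      using c uv hz by (intro L.fract_relI[where u = "h u" and v = "h v"]) auto
  next
    assume r: "((h a, h s), (h b, h t)) \<in> fract_rel L"
    obtain u v where uv: "u \<in> carrier L" "v \<in> carrier L" "u \<noteq> \<zero>\<^bsub>L\<^esub>"
      "h s \<otimes>\<^bsub>L\<^esub> u = h t \<otimes>\<^bsub>L\<^esub> v" "h a \<otimes>\<^bsub>L\<^esub> u = h b \<otimes>\<^bsub>L\<^esub> v" by (rule L.fract_relE[OF r])
    \<comment> \<open>The multipliers live in \<open>L\<close>. With \<open>w\<close> clearing
      \<open>u\<close> and \<open>x\<close> clearing \<open>v \<otimes> h w\<close>, the factor
      \<open>h w \<otimes> h x\<close> moves both into the image at once.\<close>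
    obtain w u' where w: "w \<in> carrier P" "w \<noteq> \<zero>\<^bsub>P\<^esub>" "u' \<in> carrier P" "u \<otimes>\<^bsub>L\<^esub> h w = h u'"
      using dn[OF uv(1)] by blast
    obtain x v' where x: "x \<in> carrier P" "x \<noteq> \<zero>\<^bsub>P\<^esub>" "v' \<in> carrier P" "v \<otimes>\<^bsub>L\<^esub> h w \<otimes>\<^bsub>L\<^esub> h x = h v'"
      using dn[of "v \<otimes>\<^bsub>L\<^esub> h w"] uv w by auto
    have ux: "h u' \<otimes>\<^bsub>L\<^esub> h x = u \<otimes>\<^bsub>L\<^esub> (h w \<otimes>\<^bsub>L\<^esub> h x)" and vx: "h v' = v \<otimes>\<^bsub>L\<^esub> (h w \<otimes>\<^bsub>L\<^esub> h x)"
      using w x uv by (auto simp: w(4)[symmetric] x(4)[symmetric] L.m_assoc)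
    have "h (s \<otimes>\<^bsub>P\<^esub> (u' \<otimes>\<^bsub>P\<^esub> x)) = h (t \<otimes>\<^bsub>P\<^esub> v')"
      using L.mult_assoc_shift[OF uv(4), of "h w \<otimes>\<^bsub>L\<^esub> h x"] c w x uv by (simp add: ux vx)
    then have e1: "s \<otimes>\<^bsub>P\<^esub> (u' \<otimes>\<^bsub>P\<^esub> x) = t \<otimes>\<^bsub>P\<^esub> v'" using inj_onD[OF inj] c w x by auto
    have "h (a \<otimes>\<^bsub>P\<^esub> (u' \<otimes>\<^bsub>P\<^esub> x)) = h (b \<otimes>\<^bsub>P\<^esub> v')"
      using L.mult_assoc_shift[OF uv(5), of "h w \<otimes>\<^bsub>L\<^esub> h x"] c w x uv by (simp add: ux vx)
    then have e2: "a \<otimes>\<^bsub>P\<^esub> (u' \<otimes>\<^bsub>P\<^esub> x) = b \<otimes>\<^bsub>P\<^esub> v'" using inj_onD[OF inj] c w x by auto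
    have "h u' \<noteq> \<zero>\<^bsub>L\<^esub>" using w(4)[symmetric] uv w hz L.mult_nonzero by auto
    then have "u' \<noteq> \<zero>\<^bsub>P\<^esub>" using w by auto
    then show "((a, s), (b, t)) \<in> fract_rel P" using c w x e1 e2 P.mult_nonzero[of u' x]
      by (intro P.fract_relI[where u = "u' \<otimes>\<^bsub>P\<^esub> x" and v = v']) auto
  qed
  \<comment> \<open>A union over representatives, as in the definition of the operations; by
    \<open>rel\<close> they all give the same class.\<close>
  define \<Phi> where "\<Phi> = (\<lambda>\<xi>. \<Union>{fract_class L (h a) (h s) | a s. (a, s) \<in> \<xi>})"
  have Phi: "\<Phi> (fract_class P a s) = fract_class L (h a) (h s)"
    if c: "a \<in> carrier P" "s \<in> carrier P" "s \<noteq> \<zero>\<^bsub>P\<^esub>" for a s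
  proof -
    have "Z = fract_class L (h a) (h s)"
      if Z: "Z \<in> {fract_class L (h b) (h t) | b t. (b, t) \<in> fract_class P a s}" for Z
    proof -
      obtain b t where Z: "Z = fract_class L (h b) (h t)" and r: "((a, s), (b, t)) \<in> fract_rel P"
        using Z by (auto simp: P.mem_fract_class)
      note D = P.fract_relD[OF r]
      show ?thesis unfolding Z using D hz rel[of b t a s] P.fract_sym[OF r]
        by (subst L.fract_class_eq_iff) auto
    qed
    moreover have "fract_class L (h a) (h s) \<in> {fract_class L (h b) (h t) | b t. (b, t) \<in> fract_class P a s}"
      using c by (intro CollectI exI[of _ a] exI[of _ s]) (auto simp: P.mem_fract_class intro!: P.fract_rel_refl)
    ultimately have "{fract_class L (h b) (h t) | b t. (b, t) \<in> fract_class P a s} = {fract_class L (h a) (h s)}"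
      by blast
    then show ?thesis by (simp add: \<Phi>_def)
  qed
  have "\<Phi> \<in> ring_hom (ore_Fract P) (ore_Fract L)"
  proof (rule ring_hom_memI)
    show "\<Phi> \<xi> \<in> carrier (ore_Fract L)" if "\<xi> \<in> carrier (ore_Fract P)" for \<xi>
      by (rule P.ore_Fract_cases[OF that]) (auto simp: Phi hz intro!: L.fract_class_in)
    show "\<Phi> (\<xi> \<otimes>\<^bsub>ore_Fract P\<^esub> \<zeta>) = \<Phi> \<xi> \<otimes>\<^bsub>ore_Fract L\<^esub> \<Phi> \<zeta>"
      if "\<xi> \<in> carrier (ore_Fract P)" "\<zeta> \<in> carrier (ore_Fract P)" for \<xi> \<zeta>
      by (rule P.fract_mult_cases[OF that]) (simp add: Phi P.fract_mult L.fract_mult hz)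
    show "\<Phi> (\<xi> \<oplus>\<^bsub>ore_Fract P\<^esub> \<zeta>) = \<Phi> \<xi> \<oplus>\<^bsub>ore_Fract L\<^esub> \<Phi> \<zeta>"
      if "\<xi> \<in> carrier (ore_Fract P)" "\<zeta> \<in> carrier (ore_Fract P)" for \<xi> \<zeta>
      by (rule P.fract_add_cases[OF that]) (simp add: Phi P.fract_add L.fract_add hz)
    show "\<Phi> \<one>\<^bsub>ore_Fract P\<^esub> = \<one>\<^bsub>ore_Fract L\<^esub>"
      using Phi[of "\<one>\<^bsub>P\<^esub>" "\<one>\<^bsub>P\<^esub>"] P.nontrivial by (simp add: ore_Fract_def)
  qed
  moreover have "bij_betw \<Phi> (carrier (ore_Fract P)) (carrier (ore_Fract L))"
  proof (rule bij_betw_imageI)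
    show "inj_on \<Phi> (carrier (ore_Fract P))"
    proof (rule inj_onI)
      fix \<xi> \<zeta> assume x: "\<xi> \<in> carrier (ore_Fract P)" and z: "\<zeta> \<in> carrier (ore_Fract P)" and e: "\<Phi> \<xi> = \<Phi> \<zeta>"
      obtain a s where a: "a \<in> carrier P" "s \<in> carrier P" "s \<noteq> \<zero>\<^bsub>P\<^esub>" "\<xi> = fract_class P a s"
        using P.ore_Fract_cases[OF x] .
      obtain b t where b: "b \<in> carrier P" "t \<in> carrier P" "t \<noteq> \<zero>\<^bsub>P\<^esub>" "\<zeta> = fract_class P b t"
        using P.ore_Fract_cases[OF z] .
      have "((h a, h s), (h b, h t)) \<in> fract_rel L"
        using e a b by (simp add: Phi L.fract_class_eq_iff hz)
      then show "\<xi> = \<zeta>" using a b by (simp add: rel P.fract_class_eq_iff)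
    qed
    show "\<Phi> ` carrier (ore_Fract P) = carrier (ore_Fract L)"
    proof (rule subset_antisym)
      show "\<Phi> ` carrier (ore_Fract P) \<subseteq> carrier (ore_Fract L)"
        using calculation by (auto simp: ring_hom_def)
      show "carrier (ore_Fract L) \<subseteq> \<Phi> ` carrier (ore_Fract P)"
      proof
        fix \<xi> assume x: "\<xi> \<in> carrier (ore_Fract L)"
        obtain l m where l: "l \<in> carrier L" "m \<in> carrier L" "m \<noteq> \<zero>\<^bsub>L\<^esub>" "\<xi> = fract_class L l m"
          using L.ore_Fract_cases[OF x] .
        obtain w u' where w: "w \<in> carrier P" "w \<noteq> \<zero>\<^bsub>P\<^esub>" "u' \<in> carrier P" "l \<otimes>\<^bsub>L\<^esub> h w = h u'"
          using dn[OF l(1)] by blast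
        obtain y v' where y: "y \<in> carrier P" "y \<noteq> \<zero>\<^bsub>P\<^esub>" "v' \<in> carrier P" "m \<otimes>\<^bsub>L\<^esub> h w \<otimes>\<^bsub>L\<^esub> h y = h v'"
          using dn[of "m \<otimes>\<^bsub>L\<^esub> h w"] l w by auto
        have nz: "h w \<otimes>\<^bsub>L\<^esub> h y \<noteq> \<zero>\<^bsub>L\<^esub>" using w y hz by (intro L.mult_nonzero) auto
        have e1: "l \<otimes>\<^bsub>L\<^esub> (h w \<otimes>\<^bsub>L\<^esub> h y) = h (u' \<otimes>\<^bsub>P\<^esub> y)" using l w y by (simp add: w(4)[symmetric] L.m_assoc)
        have e2: "m \<otimes>\<^bsub>L\<^esub> (h w \<otimes>\<^bsub>L\<^esub> h y) = h v'" using l w y by (simp add: y(4)[symmetric] L.m_assoc)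
        have "h v' \<noteq> \<zero>\<^bsub>L\<^esub>" unfolding e2[symmetric] using nz l w y by (intro L.mult_nonzero) auto
        then have v': "v' \<noteq> \<zero>\<^bsub>P\<^esub>" by auto
        have "\<xi> = fract_class L (l \<otimes>\<^bsub>L\<^esub> (h w \<otimes>\<^bsub>L\<^esub> h y)) (m \<otimes>\<^bsub>L\<^esub> (h w \<otimes>\<^bsub>L\<^esub> h y))"
          unfolding l(4) using l w y nz by (subst L.fract_class_expand) auto
        also have "\<dots> = \<Phi> (fract_class P (u' \<otimes>\<^bsub>P\<^esub> y) v')" using w y v' by (simp add: e1 e2 Phi)
        finally show "\<xi> \<in> \<Phi> ` carrier (ore_Fract P)" using w y v' by (auto intro!: P.fract_class_in)
      qed
    qed
  qed
  moreover have "\<forall>a\<in>carrier P. \<Phi> (fract_embed P a) = fract_embed L (h a)"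
    unfolding fract_embed_def using Phi P.nontrivial by auto
  ultimately show "\<exists>\<Phi>\<in>ring_iso (ore_Fract P) (ore_Fract L). \<forall>a\<in>carrier P. \<Phi> (fract_embed P a) = fract_embed L (h a)"
    unfolding ring_iso_def by (intro bexI[of _ \<Phi>]) auto
qed

lemma k_algebra_iso_via:
  assumes P: "ore_domain P" and Q: "ore_domain Q"
    and F: "\<Phi> \<in> ring_iso (ore_Fract P) (ore_Fract L)" and G: "\<Psi> \<in> ring_iso (ore_Fract Q) (ore_Fract L)"
    and a: "\<And>c. \<alpha> c \<in> carrier (ore_Fract P)" and b: "\<And>c. \<beta> c \<in> carrier (ore_Fract Q)"
    and e: "\<And>c. \<Phi> (\<alpha> c) = \<Psi> (\<beta> c)"
  shows "k_algebra_iso (ore_Fract P) \<alpha> (ore_Fract Q) \<beta>"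
proof -
  interpret Q: ore_domain Q by fact
  let ?Q = "ore_Fract Q" and ?L = "ore_Fract L"
  define \<Theta> where "\<Theta> = inv_into (carrier ?Q) \<Psi>"
  have bij: "bij_betw \<Psi> (carrier ?Q) (carrier ?L)" and hG: "\<Psi> \<in> ring_hom ?Q ?L"
    using G by (auto simp: ring_iso_def)
  have bijF: "bij_betw \<Phi> (carrier (ore_Fract P)) (carrier ?L)" and hF: "\<Phi> \<in> ring_hom (ore_Fract P) ?L"
    using F by (auto simp: ring_iso_def)
  have bT: "bij_betw \<Theta> (carrier ?L) (carrier ?Q)" unfolding \<Theta>_def by (rule bij_betw_inv_into[OF bij])
  have TG: "\<Theta> (\<Psi> x) = x" if "x \<in> carrier ?Q" for x
    unfolding \<Theta>_def by (rule bij_betw_inv_into_left[OF bij that])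
  have GT: "\<Psi> (\<Theta> x) = x" if "x \<in> carrier ?L" for x
    unfolding \<Theta>_def by (rule bij_betw_inv_into_right[OF bij that])
  have Tc: "\<Theta> x \<in> carrier ?Q" if "x \<in> carrier ?L" for x using bT that by (auto simp: bij_betw_def)
  have one: "\<one>\<^bsub>?Q\<^esub> \<in> carrier ?Q" using Q.fract_class_in[of "\<one>\<^bsub>Q\<^esub>" "\<one>\<^bsub>Q\<^esub>"] Q.nontrivial
    by (simp add: ore_Fract_def)
  \<comment> \<open>About \<open>ore_Fract Q\<close> only closure under its operations has been
    shown, not that it is a ring; this is enough to invert \<open>\<Psi>\<close>.\<close>
  have hT: "\<Theta> \<in> ring_hom ?L ?Q"
  proof (rule ring_hom_memI)
    fix x y assume x: "x \<in> carrier ?L" and y: "y \<in> carrier ?L"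
    show "\<Theta> (x \<otimes>\<^bsub>?L\<^esub> y) = \<Theta> x \<otimes>\<^bsub>?Q\<^esub> \<Theta> y"
      using TG[OF Q.ore_Fract_closed(1)[OF Tc[OF x] Tc[OF y]]] ring_hom_mult[OF hG Tc[OF x] Tc[OF y]] GT x y by simp
    show "\<Theta> (x \<oplus>\<^bsub>?L\<^esub> y) = \<Theta> x \<oplus>\<^bsub>?Q\<^esub> \<Theta> y"
      using TG[OF Q.ore_Fract_closed(2)[OF Tc[OF x] Tc[OF y]]] ring_hom_add[OF hG Tc[OF x] Tc[OF y]] GT x y by simp
  next
    show "\<Theta> \<one>\<^bsub>?L\<^esub> = \<one>\<^bsub>?Q\<^esub>" using TG[OF one] ring_hom_one[OF hG] by simp
  qed (use Tc in auto)
  have "\<Theta> \<circ> \<Phi> \<in> ring_iso (ore_Fract P) ?Q"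
    unfolding ring_iso_def using ring_hom_trans[OF hF hT] bij_betw_trans[OF bijF bT] by auto
  moreover have "(\<Theta> \<circ> \<Phi>) (\<alpha> c) = \<beta> c" for c using e TG[OF b] by simp
  ultimately show ?thesis unfolding k_algebra_iso_def by blast
qed

section \<open>Algebras with a basis\<close>

abbreviation "lkp \<equiv> Poly_Mapping.lookup"
abbreviation "kys \<equiv> Poly_Mapping.keys"
abbreviation "sgl \<equiv> Poly_Mapping.single"

text \<open>A diagonal operator on the basis. Constant \<open>g\<close> gives scalar multiples, a
  character of the exponents gives an automorphism of the torus, a coordinate of the exponent gives
  an Euler derivation.\<close>

definition scl :: "('e \<Rightarrow> 'a::comm_ring_1) \<Rightarrow> ('e \<Rightarrow>\<^sub>0 'a) \<Rightarrow> ('e \<Rightarrow>\<^sub>0 'a)" where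
  "scl g v = Poly_Mapping.mapp (\<lambda>k c. g k * c) v"

abbreviation smul :: "'a::comm_ring_1 \<Rightarrow> ('e \<Rightarrow>\<^sub>0 'a) \<Rightarrow> ('e \<Rightarrow>\<^sub>0 'a)" where
  "smul c \<equiv> scl (\<lambda>_. c)"

lemma lookup_scl [simp]: "lkp (scl g v) k = g k * lkp v k"
  by (auto simp: scl_def lookup_mapp when_def in_keys_iff)

lemma keys_scl: "kys (scl g v) \<subseteq> kys v"
  by (auto simp: in_keys_iff)

lemma scl_add: "scl g (v + w) = scl g v + scl g w"
  by (rule poly_mapping_eqI) (simp add: lookup_add algebra_simps)

lemma scl_diff: "scl g (v - w) = scl g v - scl g w"
  by (rule poly_mapping_eqI) (simp add: lookup_minus algebra_simps)

lemma scl_zero [simp]: "scl g 0 = 0"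
  by (rule poly_mapping_eqI) simp

lemma scl_single [simp]: "scl g (sgl k c) = sgl k (g k * c)"
  by (rule poly_mapping_eqI) (auto simp: lookup_single when_def)

lemma scl_scl: "scl g (scl h v) = scl (\<lambda>k. g k * h k) v"
  by (rule poly_mapping_eqI) (simp add: algebra_simps)

lemma scl_commute: "scl g (scl h v) = scl h (scl g v)"
  by (rule poly_mapping_eqI) (simp add: algebra_simps)

lemma scl_cong: "(\<And>k. k \<in> kys v \<Longrightarrow> g k = h k) \<Longrightarrow> scl g v = scl h v"
  by (rule poly_mapping_eqI) (metis in_keys_iff lookup_scl mult_zero_right)

lemma scl_sum: "scl g (sum f A) = (\<Sum>a\<in>A. scl g (f a))"
  by (induction A rule: infinite_finite_induct) (auto simp: scl_add)

lemma smul_one [simp]: "smul 1 v = v"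
  by (rule poly_mapping_eqI) simp

lemma smul_zero_left [simp]: "smul 0 v = 0"
  by (rule poly_mapping_eqI) simp

lemma smul_plus: "smul (c + d) v = smul c v + smul d v"
  by (rule poly_mapping_eqI) (simp add: lookup_add algebra_simps)

lemma smul_uminus: "smul (- c) v = - smul c v"
  by (rule poly_mapping_eqI) simp

lemma smul_smul: "smul c (smul d v) = smul (c * d) v"
  by (simp add: scl_scl)

lemma pm_sum_single: "(v :: 'e \<Rightarrow>\<^sub>0 'a::comm_monoid_add) = (\<Sum>a\<in>kys v. sgl a (lkp v a))"
  by (rule poly_mapping_eqI) (auto simp: lookup_sum lookup_single when_def in_keys_iff sum.delta)

lemma pm_induct_keys [consumes 1, case_names zero single add]:
  fixes v :: "'e \<Rightarrow>\<^sub>0 'a::comm_monoid_add"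
  assumes "kys v \<subseteq> T" "P 0" "\<And>m c. m \<in> T \<Longrightarrow> P (sgl m c)" "\<And>v w. P v \<Longrightarrow> P w \<Longrightarrow> P (v + w)"
  shows "P v"
proof -
  have "P (\<Sum>a\<in>A. sgl a (lkp v a))" if "finite A" "A \<subseteq> T" for A
    using that by (induction A rule: finite_induct) (auto intro: assms)
  then have "P (\<Sum>a\<in>kys v. sgl a (lkp v a))" using assms(1) by simp
  then show ?thesis by (simp only: pm_sum_single[symmetric])
qed

definition lin :: "('e \<Rightarrow> ('f \<Rightarrow>\<^sub>0 'a::comm_ring_1)) \<Rightarrow> ('e \<Rightarrow>\<^sub>0 'a) \<Rightarrow> ('f \<Rightarrow>\<^sub>0 'a)" where
  "lin h v = (\<Sum>a\<in>kys v. smul (lkp v a) (h a))"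

lemma lin_superset:
  assumes "finite A" "kys v \<subseteq> A" shows "lin h v = (\<Sum>a\<in>A. smul (lkp v a) (h a))"
  unfolding lin_def by (rule sum.mono_neutral_left) (use assms in \<open>auto simp: in_keys_iff\<close>)

lemma lin_zero [simp]: "lin h 0 = 0"
  by (simp add: lin_def)

lemma lin_add: "lin h (v + w) = lin h v + lin h w"
proof -
  let ?A = "kys v \<union> kys w"
  have "lin h (v + w) = (\<Sum>a\<in>?A. smul (lkp (v + w) a) (h a))"
    by (rule lin_superset) (auto simp: keys_add)
  also have "\<dots> = (\<Sum>a\<in>?A. smul (lkp v a) (h a)) + (\<Sum>a\<in>?A. smul (lkp w a) (h a))"
    by (simp add: lookup_add smul_plus sum.distrib)
  also have "(\<Sum>a\<in>?A. smul (lkp v a) (h a)) = lin h v" by (rule lin_superset[symmetric]) auto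
  also have "(\<Sum>a\<in>?A. smul (lkp w a) (h a)) = lin h w" by (rule lin_superset[symmetric]) auto
  finally show ?thesis .
qed

lemma lin_smul: "lin h (smul c v) = smul c (lin h v)"
proof -
  have "lin h (smul c v) = (\<Sum>a\<in>kys v. smul (lkp (smul c v) a) (h a))"
    by (rule lin_superset) (auto simp: keys_scl)
  also have "\<dots> = smul c (lin h v)"
    by (simp add: lin_def scl_sum scl_scl)
  finally show ?thesis .
qed

lemma lin_uminus: "lin h (- v) = - lin h v"
  using lin_smul[of h "- 1" v] by (simp add: smul_uminus)

lemma lin_diff: "lin h (v - w) = lin h v - lin h w"
  using lin_add[of h v "- w"] by (simp add: lin_uminus)

lemma lin_single [simp]: "lin h (sgl a c) = smul c (h a)"
  by (cases "c = 0") (simp_all add: lin_def)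

lemma lin_sum: "lin h (sum f A) = (\<Sum>a\<in>A. lin h (f a))"
  by (induction A rule: infinite_finite_induct) (auto simp: lin_add)

lemma lin_fun_add: "lin (\<lambda>a. h a + k a) v = lin h v + lin k v"
  by (simp add: lin_def scl_add sum.distrib)

lemma lin_fun_smul: "lin (\<lambda>a. smul c (h a)) v = smul c (lin h v)"
  by (simp add: lin_def scl_sum scl_commute)

lemma keys_lin: "kys (lin h v) \<subseteq> (\<Union>a\<in>kys v. kys (h a))"
proof -
  have "kys (lin h v) \<subseteq> (\<Union>a\<in>kys v. kys (smul (lkp v a) (h a)))" unfolding lin_def by (rule keys_sum)
  then show ?thesis using keys_scl by fastforce
qed

definition coeff_in :: "'a set \<Rightarrow> ('e \<Rightarrow>\<^sub>0 'a::zero) \<Rightarrow> bool" where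
  "coeff_in C v \<longleftrightarrow> (\<forall>k. lkp v k \<in> C)"

lemma coeff_in_sum:
  assumes "0 \<in> C" "\<And>x y. x \<in> C \<Longrightarrow> y \<in> C \<Longrightarrow> x + y \<in> C" "\<And>a. a \<in> A \<Longrightarrow> coeff_in C (f a)"
  shows "coeff_in C (sum f A)"
  using assms(3) by (induction A rule: infinite_finite_induct) (auto simp: coeff_in_def lookup_add assms)

lemma coeff_in_lin:
  assumes "0 \<in> D" "\<And>x y. x \<in> D \<Longrightarrow> y \<in> D \<Longrightarrow> x + y \<in> D"
    "coeff_in I v" "\<And>a. a \<in> kys v \<Longrightarrow> coeff_in J (h a)" "\<And>x y. x \<in> I \<Longrightarrow> y \<in> J \<Longrightarrow> x * y \<in> D"
  shows "coeff_in D (lin h v)"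
  unfolding lin_def by (rule coeff_in_sum) (use assms in \<open>auto simp: coeff_in_def\<close>)

definition bil :: "('e \<Rightarrow> 'e \<Rightarrow> ('e \<Rightarrow>\<^sub>0 'a::comm_ring_1)) \<Rightarrow> ('e \<Rightarrow>\<^sub>0 'a) \<Rightarrow> ('e \<Rightarrow>\<^sub>0 'a) \<Rightarrow> ('e \<Rightarrow>\<^sub>0 'a)" where
  "bil B f g = lin (\<lambda>a. lin (B a) g) f"

lemma bil_add_left: "bil B (f + g) h = bil B f h + bil B g h"
  by (simp add: bil_def lin_add)

lemma bil_add_right: "bil B f (g + h) = bil B f g + bil B f h"
  by (simp add: bil_def lin_add lin_fun_add)

lemma bil_smul_left: "bil B (smul c f) g = smul c (bil B f g)"
  by (simp add: bil_def lin_smul)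

lemma bil_smul_right: "bil B f (smul c g) = smul c (bil B f g)"
  by (simp add: bil_def lin_smul lin_fun_smul)

lemma bil_zero [simp]: "bil B 0 g = 0" "bil B f 0 = 0"
  by (auto simp: bil_def lin_def)

lemma bil_uminus_left: "bil B (- f) g = - bil B f g"
  using bil_smul_left[of B "-1" f g] by (simp add: smul_uminus)

lemma bil_uminus_right: "bil B f (- g) = - bil B f g"
  using bil_smul_right[of B f "-1" g] by (simp add: smul_uminus)

lemma bil_diff_left: "bil B (f - g) h = bil B f h - bil B g h"
  using bil_add_left[of B f "- g" h] by (simp add: bil_uminus_left)

lemma bil_diff_right: "bil B f (g - h) = bil B f g - bil B f h"
  using bil_add_right[of B f g "- h"] by (simp add: bil_uminus_right)

lemma bil_sum_left: "bil B (sum f A) g = (\<Sum>a\<in>A. bil B (f a) g)"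
  by (induction A rule: infinite_finite_induct) (auto simp: bil_add_left)

lemma bil_sum_right: "bil B g (sum f A) = (\<Sum>a\<in>A. bil B g (f a))"
  by (induction A rule: infinite_finite_induct) (auto simp: bil_add_right)

lemma bil_single: "bil B (sgl a c) (sgl b d) = smul (c * d) (B a b)"
  by (simp add: bil_def scl_scl)

lemmas bil_distribs = bil_add_left bil_add_right bil_diff_left bil_diff_right
  bil_uminus_left bil_uminus_right bil_smul_left bil_smul_right

lemma keys_bil:
  assumes "\<And>a b. a \<in> kys f \<Longrightarrow> b \<in> kys g \<Longrightarrow> kys (B a b) \<subseteq> T" shows "kys (bil B f g) \<subseteq> T"
proof -
  have "kys (bil B f g) \<subseteq> (\<Union>a\<in>kys f. kys (lin (B a) g))" unfolding bil_def by (rule keys_lin)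
  also have "\<dots> \<subseteq> (\<Union>a\<in>kys f. \<Union>b\<in>kys g. kys (B a b))" using keys_lin by fast
  finally show ?thesis using assms by blast
qed

text \<open>The two factors have separate coefficient sets: an ideal for one and a ring for the
  other yields the ideal property modulo a prime, equal sets yield closure under products.\<close>

lemma coeff_in_bil:
  assumes "0 \<in> D" "\<And>x y. x \<in> D \<Longrightarrow> y \<in> D \<Longrightarrow> x + y \<in> D"
    "coeff_in I f" "coeff_in J g"
    "\<And>a b x y k. x \<in> I \<Longrightarrow> y \<in> J \<Longrightarrow> x * (y * lkp (B a b) k) \<in> D"
  shows "coeff_in D (bil B f g)"
  unfolding bil_def lin_def scl_sum
  by (intro coeff_in_sum) (use assms in \<open>auto simp: coeff_in_def\<close>)

text \<open>An algebra given by its structure constants, with associativity required for basis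
  elements only. Instances are the torus, the coordinate form of R, the twisted polynomials and the
  free algebra on words.\<close>

locale balg =
  fixes B :: "'e \<Rightarrow> 'e \<Rightarrow> ('e \<Rightarrow>\<^sub>0 'a::comm_ring_1)" and e :: 'e
  assumes basis_assoc: "bil B (B a b) (sgl c 1) = bil B (sgl a 1) (B b c)"
    and basis_unit: "B e a = sgl a 1" "B a e = sgl a 1"
begin

abbreviation mul (infixl "\<diamondop>" 70) where "f \<diamondop> g \<equiv> bil B f g"
abbreviation bone where "bone \<equiv> sgl e 1"

lemma mul_assoc: "f \<diamondop> g \<diamondop> h = f \<diamondop> (g \<diamondop> h)"
proof -
  have 1: "sgl a x \<diamondop> sgl b y \<diamondop> sgl c z = sgl a x \<diamondop> (sgl b y \<diamondop> sgl c z)" for a b c x y z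
  proof -
    have "sgl a x \<diamondop> sgl b y \<diamondop> sgl c z = smul (x * y) (B a b) \<diamondop> smul z (sgl c 1)"
      by (simp add: bil_single)
    also have "\<dots> = smul (x * (y * z)) (B a b \<diamondop> sgl c 1)"
      by (simp only: bil_smul_left bil_smul_right scl_scl mult.assoc mult.left_commute mult.commute)
    also have "\<dots> = smul x (sgl a 1) \<diamondop> smul (y * z) (B b c)"
      by (simp only: basis_assoc bil_smul_left bil_smul_right scl_scl mult.assoc mult.left_commute mult.commute)
    also have "\<dots> = sgl a x \<diamondop> (sgl b y \<diamondop> sgl c z)"
      by (simp add: bil_single)
    finally show ?thesis .
  qed
  have 2: "sgl a x \<diamondop> sgl b y \<diamondop> h = sgl a x \<diamondop> (sgl b y \<diamondop> h)" for a b x y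
    using subset_UNIV[of "kys h"] by (induction h rule: pm_induct_keys) (auto simp: 1 bil_distribs)
  have 3: "sgl a x \<diamondop> g \<diamondop> h = sgl a x \<diamondop> (g \<diamondop> h)" for a x
    using subset_UNIV[of "kys g"] by (induction g rule: pm_induct_keys) (auto simp: 2 bil_distribs)
  show ?thesis
    using subset_UNIV[of "kys f"] by (induction f rule: pm_induct_keys) (auto simp: 3 bil_distribs)
qed

lemma mul_one [simp]: "bone \<diamondop> f = f" "f \<diamondop> bone = f"
proof -
  show "bone \<diamondop> f = f" using subset_UNIV[of "kys f"]
    by (induction f rule: pm_induct_keys) (auto simp: bil_distribs bil_single basis_unit)
  show "f \<diamondop> bone = f" using subset_UNIV[of "kys f"]
    by (induction f rule: pm_induct_keys) (auto simp: bil_distribs bil_single basis_unit)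
qed

primrec pw where "pw x 0 = bone" | "pw x (Suc k) = x \<diamondop> pw x k"

definition omon :: "nat \<Rightarrow> (nat \<Rightarrow> ('e \<Rightarrow>\<^sub>0 'a)) \<Rightarrow> (nat \<Rightarrow>\<^sub>0 nat) \<Rightarrow> ('e \<Rightarrow>\<^sub>0 'a)" where
  "omon n x m = foldr (\<lambda>i y. pw (x i) (lkp m i) \<diamondop> y) [1..<Suc n] bone"

text \<open>The coefficient type is larger than the intended ring of scalars. The subring
  \<open>C\<close> and the admissible exponents \<open>T\<close> enter through the carrier alone, so
  that identities can be proved without side conditions.\<close>

definition ring_of :: "'a set \<Rightarrow> 'e set \<Rightarrow> ('e \<Rightarrow>\<^sub>0 'a) ring" where
  "ring_of C T = \<lparr>carrier = {f. kys f \<subseteq> T \<and> coeff_in C f}, monoid.mult = (\<diamondop>), monoid.one = bone,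
     ring.zero = 0, ring.add = (+)\<rparr>"

end

definition exps :: "nat set \<Rightarrow> (nat \<Rightarrow>\<^sub>0 'b::zero) set" where "exps S = {m. kys m \<subseteq> S}"

lemma exps_mono: "S \<subseteq> T \<Longrightarrow> exps S \<subseteq> exps T" by (auto simp: exps_def)
lemma exps_zero [simp]: "0 \<in> exps S" by (auto simp: exps_def)
lemma exps_add: "a \<in> exps S \<Longrightarrow> b \<in> exps S \<Longrightarrow> a + b \<in> exps S"
  using keys_add[of a b] by (auto simp: exps_def)
lemma exps_uminus [simp]: "- a \<in> exps S \<longleftrightarrow> (a :: nat \<Rightarrow>\<^sub>0 int) \<in> exps S" by (auto simp: exps_def in_keys_iff)
lemma exps_single: "i \<in> S \<Longrightarrow> sgl i c \<in> exps S" by (auto simp: exps_def)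

text \<open>The variable taken off is the smallest one that occurs, so \<open>sgl i 1 + m\<close>
  corresponds to left multiplication of an ordered monomial by its first generator and involves no
  reordering.\<close>

lemma exponent_induct [consumes 1, case_names zero step]:
  fixes m :: "nat \<Rightarrow>\<^sub>0 nat"
  assumes "m \<in> exps {j..n}" "P 0"
    and step: "\<And>i m. i \<in> {j..n} \<Longrightarrow> m \<in> exps {i..n} \<Longrightarrow> P m \<Longrightarrow> P (sgl i 1 + m)"
  shows "P m"
  using assms(1)
proof (induction "\<Sum>k\<in>{j..n}. lkp m k" arbitrary: m)
  case 0
  have "lkp m k = 0" for k
  proof (cases "k \<in> {j..n}")
    case True
    then show ?thesis using 0(1) sum_eq_0_iff[of "{j..n}" "lkp m"] by simp
  next
    case False
    then show ?thesis using 0(2) by (auto simp: exps_def in_keys_iff)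
  qed
  then have "m = 0" by (intro poly_mapping_eqI) simp
  then show ?case using assms(2) by simp
next
  case (Suc N)
  then have "m \<noteq> 0" by auto
  then have ne: "kys m \<noteq> {}" by simp
  define i where "i = Min (kys m)"
  have ik: "i \<in> kys m" and le: "\<And>k. k \<in> kys m \<Longrightarrow> i \<le> k" unfolding i_def using ne by auto
  have ij: "i \<in> {j..n}" using ik Suc.prems by (auto simp: exps_def)
  define m' where "m' = m - sgl i 1"
  have pos: "lkp m i > 0" using ik by (simp add: in_keys_iff)
  have lm: "lkp m' k = (if k = i then lkp m i - 1 else lkp m k)" for k
    by (auto simp: m'_def lookup_minus lookup_single when_def)
  have m: "m = sgl i 1 + m'" using pos
    by (intro poly_mapping_eqI) (auto simp: lookup_add lm lookup_single when_def)
  have sub: "kys m' \<subseteq> kys m" by (auto simp: in_keys_iff lm split: if_splits)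
  have e: "m' \<in> exps {i..n}" using sub le Suc.prems by (fastforce simp: exps_def)
  have e': "m' \<in> exps {j..n}" using sub Suc.prems by (auto simp: exps_def)
  have "(\<Sum>k\<in>{j..n}. lkp m k) = (\<Sum>k\<in>{j..n}. lkp (sgl i (1::nat)) k) + (\<Sum>k\<in>{j..n}. lkp m' k)"
    by (subst m) (simp add: lookup_add sum.distrib)
  moreover have "(\<Sum>k\<in>{j..n}. lkp (sgl i (1::nat)) k) = 1"
    using ij by (simp add: lookup_single when_def sum.delta)
  ultimately have "N = (\<Sum>k\<in>{j..n}. lkp m' k)" using Suc.hyps(2) by simp
  then have "P m'" using Suc.hyps(1) e' by blast
  then show ?case unfolding m using step ij e by blast
qed

text \<open>Positions before \<open>i\<close> carry exponent 0 and act as the identity, later ones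
  are unchanged, and at \<open>i\<close> one factor comes out. The factors are abstract because both
  \<open>omon\<close> and the \<open>ordered_monomial\<close> of the given ring are such
  folds.\<close>

lemma foldr_step:
  assumes z: "z \<in> S" and cl: "\<And>i k y. i \<in> {1..n} \<Longrightarrow> y \<in> S \<Longrightarrow> F i k y \<in> S"
    and F0: "\<And>i y. i \<in> {1..n} \<Longrightarrow> y \<in> S \<Longrightarrow> F i 0 y = y"
    and FS: "\<And>i k y. i \<in> {1..n} \<Longrightarrow> y \<in> S \<Longrightarrow> F i (Suc k) y = G i (F i k y)"
    and i: "i \<in> {1..n}" and m: "m \<in> exps {i..n}"
  shows "foldr (\<lambda>i' y. F i' (lkp (sgl i 1 + m) i') y) [1..<Suc n] z = G i (foldr (\<lambda>i y. F i (lkp m i) y) [1..<Suc n] z)"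
proof -
  let ?f = "\<lambda>m i y. F i (lkp m i) y"
  have cl': "foldr (?f m') xs y \<in> S" if "set xs \<subseteq> {1..n}" "y \<in> S" for xs m' y
    using that by (induction xs) (auto intro: cl)
  have id: "foldr (?f m') xs y = y" if "set xs \<subseteq> {1..n}" "y \<in> S" "\<And>k. k \<in> set xs \<Longrightarrow> lkp m' k = 0" for xs m' y
    using that by (induction xs) (auto simp: F0)
  have sp: "[1..<Suc n] = [1..<i] @ i # [Suc i..<Suc n]"
    using i upt_add_eq_append[of 1 i "Suc n - i"] by (simp add: upt_conv_Cons del: upt_Suc)
  let ?z = "foldr (?f m) [Suc i..<Suc n] z"
  have zS: "?z \<in> S" using i z by (intro cl') auto
  have eq: "foldr (?f (sgl i 1 + m)) [Suc i..<Suc n] z = ?z"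
    by (rule foldr_cong) (auto simp: lookup_add lookup_single when_def)
  have lo: "lkp m k = 0" if "k < i" for k using m that by (force simp: exps_def in_keys_iff)
  have "foldr (?f m) [1..<Suc n] z = foldr (?f m) [1..<i] (F i (lkp m i) ?z)"
    unfolding sp by (simp del: upt_Suc)
  also have "\<dots> = F i (lkp m i) ?z" by (rule id) (use i zS lo in \<open>auto intro: cl\<close>)
  finally have 1: "foldr (?f m) [1..<Suc n] z = F i (lkp m i) ?z" .
  have "foldr (?f (sgl i 1 + m)) [1..<Suc n] z = foldr (?f (sgl i 1 + m)) [1..<i] (F i (Suc (lkp m i)) ?z)"
    unfolding sp using eq by (simp add: lookup_add del: upt_Suc)
  also have "\<dots> = F i (Suc (lkp m i)) ?z"
    by (rule id) (use i zS lo in \<open>auto intro: cl simp: lookup_add lookup_single when_def\<close>)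
  also have "\<dots> = G i (F i (lkp m i) ?z)" by (rule FS[OF i zS])
  finally show ?thesis unfolding 1 .
qed

context balg
begin

lemma omon_zero [simp]: "omon n x 0 = bone"
proof -
  have "foldr (\<lambda>i y. pw (x i) (lkp 0 i) \<diamondop> y) xs bone = bone" for xs
    by (induction xs) (simp_all only: foldr.simps lookup_zero pw.simps mul_one o_apply id_apply)
  then show ?thesis unfolding omon_def .
qed

lemma omon_step:
  assumes "i \<in> {1..n}" "m \<in> exps {i..n}" shows "omon n x (sgl i 1 + m) = x i \<diamondop> omon n x m"
proof -
  have "foldr (\<lambda>i' y. pw (x i') (lkp (sgl i 1 + m) i') \<diamondop> y) [1..<Suc n] bone =
      x i \<diamondop> foldr (\<lambda>i' y. pw (x i') (lkp m i') \<diamondop> y) [1..<Suc n] bone"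
    by (rule foldr_step[where S = UNIV and F = "\<lambda>i k y. pw (x i) k \<diamondop> y" and G = "\<lambda>i y. x i \<diamondop> y"])
      (use assms in \<open>simp_all only: UNIV_I mul_assoc pw.simps mul_one\<close>)
  then show ?thesis unfolding omon_def .
qed

end

definition map_coeff :: "('a::zero \<Rightarrow> 'b::zero) \<Rightarrow> ('e \<Rightarrow>\<^sub>0 'a) \<Rightarrow> ('e \<Rightarrow>\<^sub>0 'b)" where
  "map_coeff \<rho> = Poly_Mapping.mapp (\<lambda>_. \<rho>)"

lemma lookup_map_coeff: "\<rho> 0 = 0 \<Longrightarrow> lkp (map_coeff \<rho> v) k = \<rho> (lkp v k)"
  by (auto simp: map_coeff_def lookup_mapp when_def in_keys_iff)

section \<open>Twisted Laurent polynomials\<close>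

declare single_one [simp del]

text \<open>Exponents range over all natural indices; \<open>Q_out\<close> makes the variables
  outside \<open>{1..n}\<close> central, so the cocycle is defined on all exponents without a
  support condition.\<close>

locale torus =
  fixes n :: nat and Q :: "nat \<Rightarrow> nat \<Rightarrow> 'a::field"
  assumes Q_inv: "Q i j * Q j i = 1" and Q_diag: "Q i i = 1"
    and Q_out: "i \<notin> {1..n} \<Longrightarrow> Q i j = 1"
begin

lemma Q_nz [simp]: "Q i j \<noteq> 0"
  using Q_inv[of i j] by auto

text \<open>The monomials are ordered, so \<open>y^a y^b = eps a b y^(a+b)\<close>.\<close>

definition eps :: "(nat \<Rightarrow>\<^sub>0 int) \<Rightarrow> (nat \<Rightarrow>\<^sub>0 int) \<Rightarrow> 'a" where
  "eps a b = (\<Prod>i\<in>{..n}. \<Prod>j\<in>{..<i}. Q i j powi (lkp a i * lkp b j))"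

lemma eps_add_left: "eps (a + b) c = eps a c * eps b c"
  by (simp add: eps_def lookup_add algebra_simps power_int_add prod.distrib)

lemma eps_add_right: "eps a (b + c) = eps a b * eps a c"
  by (simp add: eps_def lookup_add algebra_simps power_int_add prod.distrib)

lemma eps_nz [simp]: "eps a b \<noteq> 0"
  by (simp add: eps_def)

lemma eps_zero [simp]: "eps 0 b = 1" "eps a 0 = 1"
  by (simp_all add: eps_def)

lemma eps_uminus: "eps (- a) b = inverse (eps a b)" "eps a (- b) = inverse (eps a b)"
  using eps_add_left[of a "- a" b] eps_add_right[of a b "- b"] by (auto simp: field_simps inverse_eq_divide)

text \<open>Only pairs with the larger index on the left contribute to \<open>eps\<close>, and here
  there are none.\<close>

lemma eps_ordered:
  assumes "a \<in> exps S" "b \<in> exps T'" "\<And>i j. i \<in> S \<Longrightarrow> j \<in> T' \<Longrightarrow> i \<le> j" shows "eps a b = 1"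
  unfolding eps_def
proof (intro prod.neutral ballI)
  fix i j :: nat assume "j \<in> {..<i}"
  then have "lkp a i = 0 \<or> lkp b j = 0" using assms by (force simp: exps_def in_keys_iff)
  then show "Q i j powi (lkp a i * lkp b j) = 1" by auto
qed

lemma eps_single: "eps (sgl i 1) (sgl j 1) = (if j < i then Q i j else 1)"
proof (cases "j < i")
  case True
  have "eps (sgl i 1) (sgl j 1) = (\<Prod>i'\<in>{..n}. \<Prod>j'\<in>{..<i'}. if i' = i \<and> j' = j then Q i j else 1)"
    unfolding eps_def by (intro prod.cong refl) (auto simp: lookup_single when_def)
  also have "\<dots> = (\<Prod>i'\<in>{..n}. if i' = i then Q i j else 1)"
    by (intro prod.cong refl) (auto simp: True)
  also have "\<dots> = Q i j" using Q_out[of i j] by auto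
  finally show ?thesis using True by simp
next
  case False
  then have "eps (sgl i 1) (sgl j 1) = 1"
    by (intro eps_ordered[of _ "{i}" _ "{j}"]) (auto intro: exps_single)
  then show ?thesis using False by simp
qed

definition tB :: "(nat \<Rightarrow>\<^sub>0 int) \<Rightarrow> (nat \<Rightarrow>\<^sub>0 int) \<Rightarrow> ((nat \<Rightarrow>\<^sub>0 int) \<Rightarrow>\<^sub>0 'a)" where
  "tB a b = sgl (a + b) (eps a b)"

text \<open>Associativity is the cocycle identity, a consequence of \<open>eps\<close> being
  multiplicative in each argument.\<close>

sublocale T: balg tB 0
  by unfold_locales (simp_all add: tB_def bil_single eps_add_left eps_add_right algebra_simps)

abbreviation tm (infixl "\<star>" 70) where "f \<star> g \<equiv> bil tB f g"
abbreviation tone ("\<one>t") where "\<one>t \<equiv> (sgl 0 1 :: (nat \<Rightarrow>\<^sub>0 int) \<Rightarrow>\<^sub>0 'a)"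

lemma tm_single: "sgl a c \<star> sgl b d = sgl (a + b) (c * d * eps a b)"
  by (simp add: bil_single tB_def)

lemma tm_scalar: "sgl 0 c \<star> v = smul c v" "v \<star> sgl 0 c = smul c v"
proof -
  have s: "sgl 0 c = smul c \<one>t" by simp
  show "sgl 0 c \<star> v = smul c v" unfolding s bil_distribs by simp
  show "v \<star> sgl 0 c = smul c v" unfolding s bil_distribs by simp
qed

text \<open>The commutation factor of monomials: \<open>y^a y^b = beta a b y^b y^a\<close>. It is an
  alternating bicharacter with values \<open>Q i j\<close> on the unit vectors.\<close>

definition beta :: "(nat \<Rightarrow>\<^sub>0 int) \<Rightarrow> (nat \<Rightarrow>\<^sub>0 int) \<Rightarrow> 'a" where
  "beta a b = eps a b / eps b a"

lemma beta_add_left: "beta (a + b) c = beta a c * beta b c"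
  by (simp add: beta_def eps_add_left eps_add_right)

lemma beta_add_right: "beta a (b + c) = beta a b * beta a c"
  by (simp add: beta_def eps_add_left eps_add_right)

lemma beta_nz [simp]: "beta a b \<noteq> 0" by (simp add: beta_def)
lemma beta_zero [simp]: "beta 0 b = 1" "beta a 0 = 1" by (simp_all add: beta_def)
lemma beta_flip: "beta a b * beta b a = 1" by (simp add: beta_def)
lemma beta_self [simp]: "beta a a = 1" by (simp add: beta_def)

lemma beta_uminus: "beta (- a) b = beta b a" "beta a (- b) = beta b a"
  using beta_add_left[of a "- a" b] beta_add_right[of a b "- b"] beta_flip[of a b] beta_nz[of a b]
  by (simp_all add: beta_def eps_uminus field_simps)

lemma beta_diff_right: "beta a (b - c) = beta a b * beta c a"
  using beta_add_right[of a b "- c"] by (simp add: beta_uminus)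

lemma beta_single: "beta (sgl i 1) (sgl j 1) = Q i j"
  using Q_inv[of i j] Q_diag[of i] by (auto simp: beta_def eps_single not_less field_simps)

text \<open>The conjugation that takes \<open>v\<close> to \<open>y^(-t) v y^t\<close>, written
  diagonally; see \<open>commute_monomial\<close>.\<close>

definition aut :: "(nat \<Rightarrow>\<^sub>0 int) \<Rightarrow> ((nat \<Rightarrow>\<^sub>0 int) \<Rightarrow>\<^sub>0 'a) \<Rightarrow> ((nat \<Rightarrow>\<^sub>0 int) \<Rightarrow>\<^sub>0 'a)" where
  "aut t = scl (\<lambda>b. beta b t)"

lemma lookup_aut: "lkp (aut t v) k = beta k t * lkp v k" by (simp add: aut_def)
lemma aut_single [simp]: "aut t (sgl a c) = sgl a (beta a t * c)" by (simp add: aut_def)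
lemma aut_add: "aut t (v + w) = aut t v + aut t w" by (simp add: aut_def scl_add)
lemma aut_diff: "aut t (v - w) = aut t v - aut t w" by (simp add: aut_def scl_diff)
lemma aut_smul: "aut t (smul c v) = smul c (aut t v)" by (simp add: aut_def scl_commute)
lemma aut_scl: "aut t (scl g v) = scl g (aut t v)" by (simp add: aut_def scl_commute)
lemma aut_aut: "aut s (aut t v) = aut (s + t) v" by (simp add: aut_def scl_scl beta_add_right)
lemma aut_0 [simp]: "aut t 0 = 0" by (simp add: aut_def)
lemma aut_sum: "aut t (sum f A) = (\<Sum>a\<in>A. aut t (f a))" by (simp add: aut_def scl_sum)
lemma aut_zero [simp]: "aut 0 v = v" by (rule poly_mapping_eqI) (simp add: lookup_aut)
lemma keys_aut: "kys (aut t v) \<subseteq> kys v" unfolding aut_def by (rule keys_scl)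

lemma aut_mult: "aut t (v \<star> w) = aut t v \<star> aut t w"
proof -
  have 1: "aut t (sgl a c \<star> w) = aut t (sgl a c) \<star> aut t w" for a c
    using subset_UNIV[of "kys w"]
    by (induction w rule: pm_induct_keys) (auto simp: bil_distribs aut_add tm_single beta_add_left algebra_simps)
  show ?thesis using subset_UNIV[of "kys v"]
    by (induction v rule: pm_induct_keys) (auto simp: bil_distribs aut_add 1 simp del: aut_single)
qed

lemma commute_monomial: "v \<star> sgl t c = sgl t c \<star> aut t v"
  using subset_UNIV[of "kys v"]
proof (induction v rule: pm_induct_keys)
  case (single m d)
  then show ?case by (simp add: tm_single beta_def ac_simps)
qed (auto simp: bil_distribs aut_add)

definition Y :: "nat \<Rightarrow> (nat \<Rightarrow>\<^sub>0 int) \<Rightarrow>\<^sub>0 'a" where "Y i = sgl (sgl i 1) 1"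

lemma Y_commute: "v \<star> Y i = Y i \<star> aut (sgl i 1) v"
  unfolding Y_def by (rule commute_monomial)

lemma Y_left_inverse: "sgl (sgl i (- 1)) 1 \<star> Y i = \<one>t" and Y_right_inverse: "Y i \<star> sgl (sgl i (- 1)) 1 = \<one>t"
proof -
  have "eps (sgl i (-1)) (sgl i 1) = 1" "eps (sgl i 1) (sgl i (-1)) = 1"
    by (intro eps_ordered[of _ "{i}" _ "{i}"]; auto intro: exps_single)+
  then show "sgl (sgl i (- 1)) 1 \<star> Y i = \<one>t" "Y i \<star> sgl (sgl i (- 1)) 1 = \<one>t"
    by (simp_all add: Y_def tm_single single_add[symmetric])
qed

lemma Y_cancel: "Y i \<star> v = Y i \<star> w \<Longrightarrow> v = w"
  by (metis T.mul_assoc T.mul_one(1) Y_left_inverse)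

lemma lookup_mul:
  assumes "finite A" "kys v \<subseteq> A"
  shows "lkp (v \<star> w) k = (\<Sum>a\<in>A. lkp v a * lkp w (k - a) * eps a (k - a))"
proof -
  have 1: "lkp (sgl a c \<star> w) k = c * lkp w (k - a) * eps a (k - a)" for a c
    using subset_UNIV[of "kys w"]
  proof (induction w rule: pm_induct_keys)
    case (single m d)
    have "a + m = k \<longleftrightarrow> m = k - a" by (auto simp: algebra_simps)
    then show ?case by (auto simp: tm_single lookup_single when_def)
  qed (auto simp: bil_distribs lookup_add algebra_simps)
  have "v \<star> w = (\<Sum>a\<in>kys v. sgl a (lkp v a)) \<star> w" using pm_sum_single[of v] by simp
  then have "lkp (v \<star> w) k = (\<Sum>a\<in>kys v. lkp v a * lkp w (k - a) * eps a (k - a))"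
    by (simp add: bil_sum_left lookup_sum 1)
  also have "\<dots> = (\<Sum>a\<in>A. lkp v a * lkp w (k - a) * eps a (k - a))"
    by (rule sum.mono_neutral_left) (use assms in \<open>auto simp: in_keys_iff\<close>)
  finally show ?thesis .
qed

lemma keys_mul_subset: "kys v \<subseteq> exps S \<Longrightarrow> kys w \<subseteq> exps S \<Longrightarrow> kys (v \<star> w) \<subseteq> exps S"
  by (rule keys_bil) (auto simp: tB_def dest: subsetD intro!: exps_add split: if_splits)

definition below :: "(nat \<Rightarrow>\<^sub>0 int) \<Rightarrow> ((nat \<Rightarrow>\<^sub>0 int) \<Rightarrow>\<^sub>0 'a) \<Rightarrow> bool" where
  "below m v \<longleftrightarrow> (\<forall>k\<in>kys v. k \<le> m)"

lemma below_mul: "below m v \<Longrightarrow> below p w \<Longrightarrow> below (m + p) (v \<star> w)"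
proof -
  assume a: "below m v" "below p w"
  have "kys (v \<star> w) \<subseteq> {k. k \<le> m + p}"
    by (rule keys_bil) (use a in \<open>auto simp: tB_def below_def add_mono\<close>)
  then show ?thesis by (auto simp: below_def)
qed

text \<open>An exponent \<open>a < m\<close> of \<open>v\<close> would need the partner
  \<open>m + p - a > p\<close> in \<open>w\<close>. The order is compatible with addition, so
  leading terms multiply up to a unit, and the torus is a domain.\<close>

lemma lookup_mul_top:
  assumes "below m v" "below p w" shows "lkp (v \<star> w) (m + p) = lkp v m * lkp w p * eps m p"
proof -
  have "lkp (v \<star> w) (m + p) = (\<Sum>a\<in>insert m (kys v). lkp v a * lkp w (m + p - a) * eps a (m + p - a))"
    by (rule lookup_mul) auto
  also have "\<dots> = (\<Sum>a\<in>{m}. lkp v a * lkp w (m + p - a) * eps a (m + p - a))"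
  proof (rule sum.mono_neutral_right)
    show "\<forall>a\<in>insert m (kys v) - {m}. lkp v a * lkp w (m + p - a) * eps a (m + p - a) = 0"
    proof
      fix a assume a: "a \<in> insert m (kys v) - {m}"
      then have "a < m" using assms(1) by (auto simp: below_def order.strict_iff_order)
      then have "p < m + p - a" by (simp add: algebra_simps)
      then have "lkp w (m + p - a) = 0" using assms(2) by (metis below_def in_keys_iff not_le)
      then show "lkp v a * lkp w (m + p - a) * eps a (m + p - a) = 0" by simp
    qed
  qed auto
  finally show ?thesis by simp
qed

lemma below_Max: "v \<noteq> 0 \<Longrightarrow> below (Max (kys v)) v \<and> lkp v (Max (kys v)) \<noteq> 0"
  using Max_in[of "kys v"] by (auto simp: below_def in_keys_iff)

lemma tm_domain: "v \<star> w = 0 \<Longrightarrow> v = 0 \<or> w = 0"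
proof (rule ccontr)
  assume a: "v \<star> w = 0" and "\<not> (v = 0 \<or> w = 0)"
  then have "lkp (v \<star> w) (Max (kys v) + Max (kys w)) \<noteq> 0"
    using below_Max[of v] below_Max[of w] by (subst lookup_mul_top) auto
  then show False using a by simp
qed

lemma mul_single_ordered:
  assumes "a \<in> exps S" "b \<in> exps T'" "\<And>i j. i \<in> S \<Longrightarrow> j \<in> T' \<Longrightarrow> i \<le> j"
  shows "sgl a c \<star> sgl b d = sgl (a + b) (c * d)"
  using eps_ordered[OF assms] by (simp add: tm_single)

text \<open>
  Generation of the Laurent polynomials in \<open>Y j, \<dots>, Y n\<close> by the elements \<open>Y l + W l\<close>, where \<open>W l\<close>
  involves only later variables, and by the inverses of the \<open>Y l\<close>.
\<close>

lemma laurent_closure: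
  assumes D: "0 \<in> D" "1 \<in> D" "\<And>c. c \<in> D \<Longrightarrow> - c \<in> D"
    and add: "\<And>v w. Pr v \<Longrightarrow> Pr w \<Longrightarrow> Pr (v + w)" and mult: "\<And>v w. Pr v \<Longrightarrow> Pr w \<Longrightarrow> Pr (v \<star> w)"
    and scal: "\<And>c. c \<in> D \<Longrightarrow> Pr (sgl 0 c)"
    and W: "\<And>l. l \<in> {j..n} \<Longrightarrow> kys (W l) \<subseteq> exps {Suc l..n} \<and> coeff_in D (W l)"
    and gen: "\<And>l. l \<in> {j..n} \<Longrightarrow> Pr (Y l + W l)"
    and inv: "\<And>l. l \<in> {j..n} \<Longrightarrow> (\<And>v. kys v \<subseteq> exps {Suc l..n} \<Longrightarrow> coeff_in D v \<Longrightarrow> Pr v) \<Longrightarrow> Pr (Y l) \<Longrightarrow> Pr (sgl (sgl l (- 1)) 1)"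
    and j: "j \<le> Suc n" and v: "kys v \<subseteq> exps {j..n}" "coeff_in D v"
  shows "Pr v"
  using W gen inv j v
proof (induction "Suc n - j" arbitrary: j v rule: less_induct)
  case (less j)
  show ?case
  proof (cases "j = Suc n")
    case True
    then have "kys v \<subseteq> {0}" using less.prems(5) by (auto simp: exps_def)
    then have "v = sgl 0 (lkp v 0)" by (intro poly_mapping_eqI) (auto simp: lookup_single when_def in_keys_iff subset_iff)
    then show ?thesis using scal[of "lkp v 0"] less.prems(6) by (simp add: coeff_in_def)
  next
    case False
    then have j: "j \<in> {j..n}" using less.prems(4) by auto
    have IH: "Pr v" if "kys v \<subseteq> exps {Suc j..n}" "coeff_in D v" for v
      by (rule less.hyps[of "Suc j"]) (use less.prems j that in auto)
    have neg: "Pr (- v)" if "Pr v" for v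
    proof -
      have "Pr (sgl 0 (- 1) \<star> v)" using that D scal mult by auto
      then show ?thesis by (simp add: tm_scalar smul_uminus)
    qed
    \<comment> \<open>\<open>W j\<close> lies in the later variables, so it can be subtracted from
      the generator to isolate \<open>Y j\<close>.\<close>
    have "Pr (W j)" using IH less.prems(1)[OF j] by auto
    then have "Pr (Y j + W j + - W j)" using add neg less.prems(2)[OF j] by blast
    then have Yj: "Pr (Y j)" by simp
    have Yi: "Pr (sgl (sgl j (- 1)) 1)" by (rule less.prems(3)[of j]) (use less.prems j IH Yj in auto)
    have pos: "Pr (sgl (sgl j (int k)) 1)" "Pr (sgl (sgl j (- int k)) 1)" for k
    proof (induction k)
      case 0
      show "Pr (sgl (sgl j (int 0)) 1)" "Pr (sgl (sgl j (- int 0)) 1)" using scal D by auto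
    next
      case (Suc k)
      have "sgl (sgl j (int (Suc k))) 1 = Y j \<star> sgl (sgl j (int k)) 1"
        unfolding Y_def by (subst mul_single_ordered[of _ "{j}" _ "{j}"])
          (auto simp: single_add[symmetric] intro: exps_single)
      moreover have "sgl (sgl j (- int (Suc k))) 1 = sgl (sgl j (- 1)) 1 \<star> sgl (sgl j (- int k)) 1"
        by (subst mul_single_ordered[of _ "{j}" _ "{j}"])
          (auto simp: single_add[symmetric] intro: exps_single)
      ultimately show "Pr (sgl (sgl j (int (Suc k))) 1)" "Pr (sgl (sgl j (- int (Suc k))) 1)"
        using Suc Yj Yi mult by auto
    qed
    have pw: "Pr (sgl (sgl j k) 1)" for k
      by (cases k rule: int_cases2) (use pos in auto)
    have mono: "Pr (sgl m c)" if m: "m \<in> exps {j..n}" and c: "c \<in> D" for m c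
    proof -
      define m' where "m' = m - sgl j (lkp m j)"
      have m': "m' \<in> exps {Suc j..n}"
        using m by (auto simp: exps_def m'_def in_keys_iff lookup_minus lookup_single when_def subset_iff
            Suc_le_eq le_less split: if_splits)
      have "sgl m c = sgl (sgl j (lkp m j)) 1 \<star> sgl m' c"
        by (subst mul_single_ordered[of _ "{j}" _ "{Suc j..n}"])
          (use m' in \<open>auto simp: m'_def intro: exps_single\<close>)
      moreover have "Pr (sgl m' c)"
        by (rule IH) (use m' c D in \<open>auto simp: coeff_in_def lookup_single when_def\<close>)
      ultimately show ?thesis using pw mult by auto
    qed
    have "Pr (\<Sum>a\<in>A. sgl a (lkp v a))" if "finite A" "A \<subseteq> exps {j..n}" for A
      using that
    proof (induction A rule: finite_induct)
      case empty
      show ?case using scal[OF D(1)] by simp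
    next
      case (insert a A)
      then show ?case using mono[of a "lkp v a"] less.prems(6) add by (auto simp: coeff_in_def)
    qed
    then have "Pr (\<Sum>a\<in>kys v. sgl a (lkp v a))" using less.prems by simp
    then show ?thesis by (simp only: pm_sum_single[symmetric])
  qed
qed

end

text \<open>\<open>C\<close> takes the place of k[Q] inside the field. It is only a ring, but
  \<open>Q j i\<close> inverts \<open>Q i j\<close>, hence all values of \<open>eps\<close> and
  \<open>beta\<close> are units of it.\<close>

locale scalar_torus = torus n Q for n and Q :: "nat \<Rightarrow> nat \<Rightarrow> 'a::field" +
  fixes C :: "'a set"
  assumes C_one: "1 \<in> C" and C_uminus: "c \<in> C \<Longrightarrow> - c \<in> C"
    and C_add: "c \<in> C \<Longrightarrow> d \<in> C \<Longrightarrow> c + d \<in> C" and C_mult: "c \<in> C \<Longrightarrow> d \<in> C \<Longrightarrow> c * d \<in> C"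
    and Q_C: "Q i j \<in> C"
begin

lemma C_zero: "0 \<in> C" using C_add[OF C_one C_uminus[OF C_one]] by simp

lemma Q_pow_C: "Q i j powi k \<in> C"
proof -
  have p: "x ^ k \<in> C" if "x \<in> C" for x k using that by (induction k) (auto simp: C_one intro: C_mult)
  have "inverse (Q i j) = Q j i" using Q_inv[of i j] by (simp add: field_simps inverse_eq_divide)
  then show ?thesis using p[OF Q_C] by (auto simp: power_int_def)
qed

lemma C_prod: "(\<And>a. a \<in> A \<Longrightarrow> f a \<in> C) \<Longrightarrow> prod f A \<in> C"
  by (induction A rule: infinite_finite_induct) (auto simp: C_one intro: C_mult)

lemma eps_C: "eps a b \<in> C" unfolding eps_def by (intro C_prod Q_pow_C)

lemma beta_C: "beta a b \<in> C"
proof -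
  have "beta a b = eps a b * eps (- b) a" by (simp add: beta_def eps_uminus field_simps)
  then show ?thesis using eps_C C_mult by metis
qed

end

section \<open>Solvable algebras in coordinates\<close>

declare One_nat_def [simp del]

definition toi :: "(nat \<Rightarrow>\<^sub>0 nat) \<Rightarrow> (nat \<Rightarrow>\<^sub>0 int)" where "toi = map_coeff int"

lemma lookup_toi [simp]: "lkp (toi m) k = int (lkp m k)" by (simp add: toi_def lookup_map_coeff)
lemma toi_add: "toi (a + b) = toi a + toi b" by (rule poly_mapping_eqI) (simp add: lookup_add)
lemma toi_zero [simp]: "toi 0 = 0" by (rule poly_mapping_eqI) simp
lemma toi_single [simp]: "toi (sgl i k) = sgl i (int k)"
  by (rule poly_mapping_eqI) (simp add: lookup_single when_def)
lemma keys_toi [simp]: "kys (toi m) = kys m" by (auto simp: in_keys_iff)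
lemma toi_inj: "toi a = toi b \<longleftrightarrow> a = b"
  by (metis lookup_toi of_nat_eq_iff poly_mapping_eqI)
lemma toi_less: "toi a < toi b \<longleftrightarrow> a < b"
  by (simp add: less_poly_mapping.rep_eq less_fun_def)
lemma toi_le: "toi a \<le> toi b \<longleftrightarrow> a \<le> b"
  using toi_less[of a b] toi_inj[of a b] by (auto simp: le_less)
lemma toi_exps [simp]: "toi m \<in> exps S \<longleftrightarrow> m \<in> exps S" by (simp add: exps_def)

text \<open>The algebra R in its basis of ordered monomials. In \<open>rB_rel\<close> the subalgebra
  generated by the later generators appears as the intersection of all sets \<open>S\<close> with
  the listed closure properties; taking a span of monomials for \<open>S\<close> gives the form that
  the inductions use.\<close>

locale solvable_coords = scalar_torus n Q C + R: balg rB 0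
  for n and Q :: "nat \<Rightarrow> nat \<Rightarrow> 'a::field" and rB :: "(nat \<Rightarrow>\<^sub>0 nat) \<Rightarrow> (nat \<Rightarrow>\<^sub>0 nat) \<Rightarrow> ((nat \<Rightarrow>\<^sub>0 nat) \<Rightarrow>\<^sub>0 'a)"
    and C :: "'a set" +
  assumes rB_C: "coeff_in C (rB a b)"
    and rB_gen: "\<lbrakk>i \<in> {1..n}; m \<in> exps {i..n}\<rbrakk> \<Longrightarrow> rB (sgl i 1) m = sgl (sgl i 1 + m) 1"
    and rB_rel: "\<lbrakk>i \<in> {1..n}; j \<in> {1..n}; i < j; \<And>c. c \<in> C \<Longrightarrow> sgl 0 c \<in> S;
        \<And>l. l \<in> {Suc i..n} \<Longrightarrow> sgl (sgl l 1) 1 \<in> S; \<And>v. v \<in> S \<Longrightarrow> - v \<in> S;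
        \<And>v w. v \<in> S \<Longrightarrow> w \<in> S \<Longrightarrow> v + w \<in> S; \<And>v w. v \<in> S \<Longrightarrow> w \<in> S \<Longrightarrow> bil rB v w \<in> S\<rbrakk> \<Longrightarrow>
      bil rB (sgl (sgl i 1) 1) (sgl (sgl j 1) 1) - smul (Q i j) (bil rB (sgl (sgl j 1) 1) (sgl (sgl i 1) 1)) \<in> S"
begin

abbreviation rm (infixl "\<ast>" 70) where "f \<ast> g \<equiv> bil rB f g"

definition gen :: "nat \<Rightarrow> (nat \<Rightarrow>\<^sub>0 nat) \<Rightarrow>\<^sub>0 'a" where "gen i = sgl (sgl i 1) 1"
text \<open>A span of monomials over the whole field. That it is closed under products is a theorem,
  \<open>rclosed\<close>, and not part of the data.\<close>

definition Rs :: "nat \<Rightarrow> ((nat \<Rightarrow>\<^sub>0 nat) \<Rightarrow>\<^sub>0 'a) set" where "Rs i = {v. kys v \<subseteq> exps {i..n}}"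
text \<open>Diagonal on ordered monomials and at first only linear; \<open>sig i\<close> turns out
  to be multiplicative on \<open>Rs (Suc i)\<close> in \<open>sig_der_mult\<close>.\<close>

definition raut :: "(nat \<Rightarrow>\<^sub>0 int) \<Rightarrow> ((nat \<Rightarrow>\<^sub>0 nat) \<Rightarrow>\<^sub>0 'a) \<Rightarrow> ((nat \<Rightarrow>\<^sub>0 nat) \<Rightarrow>\<^sub>0 'a)" where
  "raut t = scl (\<lambda>m. beta (toi m) t)"

abbreviation sig where "sig i \<equiv> raut (sgl i 1)"

text \<open>\<open>v \<ast> gen i = gen i \<ast> sig i v + der i v\<close> with \<open>sig i v\<close> and \<open>der i v\<close> in \<open>Rs (i+1)\<close> if \<open>v\<close> is.\<close>

definition der :: "nat \<Rightarrow> ((nat \<Rightarrow>\<^sub>0 nat) \<Rightarrow>\<^sub>0 'a) \<Rightarrow> ((nat \<Rightarrow>\<^sub>0 nat) \<Rightarrow>\<^sub>0 'a)" where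
  "der i v = v \<ast> gen i - gen i \<ast> sig i v"

lemma raut_single [simp]: "raut t (sgl m c) = sgl m (beta (toi m) t * c)" by (simp add: raut_def)
lemma raut_add: "raut t (v + w) = raut t v + raut t w" by (simp add: raut_def scl_add)
lemma raut_diff: "raut t (v - w) = raut t v - raut t w" by (simp add: raut_def scl_diff)
lemma raut_smul: "raut t (smul c v) = smul c (raut t v)" by (simp add: raut_def scl_commute)
lemma raut_raut: "raut s (raut t v) = raut (s + t) v"
  by (simp add: raut_def scl_scl beta_add_right)
lemma raut_0 [simp]: "raut t 0 = 0" by (simp add: raut_def)
lemma raut_zero [simp]: "raut 0 v = v" by (rule poly_mapping_eqI) (simp add: raut_def)
lemma raut_Rs [intro]: "v \<in> Rs i \<Longrightarrow> raut t v \<in> Rs i"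
  unfolding raut_def Rs_def mem_Collect_eq by (rule subset_trans[OF keys_scl])
lemma raut_gen: "raut t (gen l) = smul (beta (sgl l 1) t) (gen l)" by (simp add: gen_def)
lemma sig_gen: "sig i (gen l) = smul (Q l i) (gen l)" by (simp add: raut_gen beta_single)

lemma der_add: "der i (v + w) = der i v + der i w" by (simp add: der_def bil_distribs raut_add)
lemma der_smul: "der i (smul c v) = smul c (der i v)"
  by (simp add: der_def bil_distribs raut_smul scl_diff)
lemma der_zero [simp]: "der i 0 = 0" by (simp add: der_def)

lemma Rs_zero [simp, intro]: "0 \<in> Rs i" by (simp add: Rs_def)
lemma Rs_add [intro]: "v \<in> Rs i \<Longrightarrow> w \<in> Rs i \<Longrightarrow> v + w \<in> Rs i"
  using keys_add[of v w] by (auto simp: Rs_def)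
lemma Rs_uminus [intro]: "v \<in> Rs i \<Longrightarrow> - v \<in> Rs i" by (auto simp: Rs_def in_keys_iff)
lemma Rs_diff [intro]: "v \<in> Rs i \<Longrightarrow> w \<in> Rs i \<Longrightarrow> v - w \<in> Rs i"
  using Rs_add[of v i "- w"] by auto
lemma Rs_smul [intro]: "v \<in> Rs i \<Longrightarrow> smul c v \<in> Rs i" using keys_scl[of "\<lambda>_. c" v] by (auto simp: Rs_def)
lemma Rs_sum: "(\<And>a. a \<in> A \<Longrightarrow> f a \<in> Rs i) \<Longrightarrow> sum f A \<in> Rs i"
  by (induction A rule: infinite_finite_induct) auto
lemma Rs_scalar [simp, intro]: "sgl 0 c \<in> Rs i" by (simp add: Rs_def)
lemma Rs_mono: "i \<le> j \<Longrightarrow> Rs j \<subseteq> Rs i"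
  unfolding Rs_def exps_def by fastforce
lemma Rs_Suc: "v \<in> Rs (Suc i) \<Longrightarrow> v \<in> Rs i" using Rs_mono[of i "Suc i"] by auto
lemma gen_Rs: "l \<in> {i..n} \<Longrightarrow> gen l \<in> Rs i" by (auto simp: gen_def Rs_def exps_def)
lemma Rs_single: "m \<in> exps {i..n} \<Longrightarrow> sgl m c \<in> Rs i" by (auto simp: Rs_def)

lemma Rs_induct [consumes 1, case_names zero single add]:
  assumes "v \<in> Rs i" "P 0" "\<And>m c. m \<in> exps {i..n} \<Longrightarrow> P (sgl m c)" "\<And>v w. P v \<Longrightarrow> P w \<Longrightarrow> P (v + w)"
  shows "P v"
  using assms(1) unfolding Rs_def mem_Collect_eq by (rule pm_induct_keys) (use assms in auto)

lemma r_scalar: "sgl 0 c \<ast> v = smul c v" "v \<ast> sgl 0 c = smul c v"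
proof -
  have s: "sgl 0 c = smul c (sgl 0 1)" by simp
  show "sgl 0 c \<ast> v = smul c v" unfolding s bil_distribs by simp
  show "v \<ast> sgl 0 c = smul c v" unfolding s bil_distribs by simp
qed

lemma gen_single: "i \<in> {1..n} \<Longrightarrow> m \<in> exps {i..n} \<Longrightarrow> gen i \<ast> sgl m c = sgl (sgl i 1 + m) c"
  by (simp add: gen_def bil_single rB_gen)

lemma Rs_Suc_exps: "m \<in> exps {Suc i..n} \<Longrightarrow> m \<in> exps {i..n}"
  by (auto simp: exps_def)

lemma gen_mul_Rs: assumes "i \<in> {1..n}" "v \<in> Rs i" shows "gen i \<ast> v \<in> Rs i"
  using assms(2)
proof (induction v rule: Rs_induct)
  case (single m c)
  then show ?case using assms by (simp add: gen_single) (intro Rs_single exps_add exps_single; simp)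
qed (auto simp: bil_distribs)

lemma Rs_gen_induct [consumes 2, case_names scalar gen add]:
  assumes "v \<in> Rs i" "1 \<le> i"
    and "\<And>c. P (sgl 0 c)" "\<And>l v. l \<in> {i..n} \<Longrightarrow> v \<in> Rs l \<Longrightarrow> P v \<Longrightarrow> P (gen l \<ast> v)"
    and "\<And>v w. P v \<Longrightarrow> P w \<Longrightarrow> P (v + w)"
  shows "P v"
  using assms(1)
proof (induction v rule: Rs_induct)
  case zero
  then show ?case using assms(3)[of 0] by simp
next
  case (single m c)
  then show ?case
  proof (induction m rule: exponent_induct)
    case (step l m)
    then have "P (gen l \<ast> sgl m c)" using assms(4)[of l "sgl m c"] by (auto intro: Rs_single)
    then show ?case using step assms(2) by (simp add: gen_single)
  qed (rule assms)
qed (rule assms)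

lemma raut_gen_mul:
  assumes "l \<in> {1..n}" "v \<in> Rs l"
  shows "raut t (gen l \<ast> v) = smul (beta (sgl l 1) t) (gen l \<ast> raut t v)"
  using assms(2)
proof (induction v rule: Rs_induct)
  case (single m c)
  then show ?case using assms(1)
    by (simp add: gen_single toi_add beta_add_left algebra_simps)
qed (auto simp: bil_distribs raut_add scl_add)

definition rclosed :: "nat \<Rightarrow> bool" where "rclosed i \<longleftrightarrow> (\<forall>v\<in>Rs i. \<forall>w\<in>Rs i. v \<ast> w \<in> Rs i)"

text \<open>\<open>rB_rel\<close> is applied with \<open>S = Rs (Suc i)\<close>, which is a
  subalgebra by assumption; multiplication by \<open>- Q j i\<close> then exchanges the roles of the
  two products.\<close>

lemma relation_aux:
  assumes "rclosed (Suc i)" "i \<in> {1..n}" "j \<in> {Suc i..n}"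
  shows "gen j \<ast> gen i - smul (Q j i) (gen i \<ast> gen j) \<in> Rs (Suc i)"
proof -
  have "gen i \<ast> gen j - smul (Q i j) (gen j \<ast> gen i) \<in> Rs (Suc i)"
    unfolding gen_def by (rule rB_rel) (use assms gen_Rs in \<open>auto simp: rclosed_def gen_def\<close>)
  then have "smul (- Q j i) (gen i \<ast> gen j - smul (Q i j) (gen j \<ast> gen i)) \<in> Rs (Suc i)" by auto
  moreover have "smul (- Q j i) (gen i \<ast> gen j - smul (Q i j) (gen j \<ast> gen i)) =
      gen j \<ast> gen i - smul (Q j i) (gen i \<ast> gen j)"
    using Q_inv[of j i] by (simp add: scl_diff scl_scl) (simp add: smul_uminus)
  ultimately show ?thesis by simp
qed

text \<open>Moving \<open>gen l\<close> past \<open>gen i\<close> contributes the relation term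
  \<open>?r\<close>, and the rest is handled by induction. Closure at \<open>Suc i\<close> is a
  hypothesis because the lemma is used inside the induction that proves closure.\<close>

lemma der_Rs_aux:
  assumes "rclosed (Suc i)" "i \<in> {1..n}" "v \<in> Rs (Suc i)" shows "der i v \<in> Rs (Suc i)"
proof -
  have "1 \<le> Suc i" by simp
  with assms(3) show ?thesis
  proof (induction v rule: Rs_gen_induct)
    case (scalar c)
    then show ?case by (simp add: der_def r_scalar)
  next
    case (gen l v)
    let ?r = "gen l \<ast> gen i - smul (Q l i) (gen i \<ast> gen l)"
    have r: "?r \<in> Rs (Suc i)" using relation_aux assms gen by blast
    have v: "v \<in> Rs (Suc i)" using gen Rs_mono[of "Suc i" l] by auto
    have lv: "sig i (gen l \<ast> v) = smul (Q l i) (gen l \<ast> sig i v)"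
      using raut_gen_mul[of l v "sgl i 1"] gen by (simp add: beta_single)
    have "der i (gen l \<ast> v) = gen l \<ast> der i v + ?r \<ast> sig i v"
      unfolding der_def lv by (simp add: bil_distribs R.mul_assoc)
    then show ?case using assms(1) r v gen gen_Rs unfolding rclosed_def by auto
  qed (auto simp: der_add)
qed

text \<open>Downward induction. In the product of \<open>v\<close> with \<open>gen i\<close> a
  leading \<open>gen i\<close> of \<open>v\<close> is split off; if there is none, \<open>v\<close>
  lies in \<open>Rs (Suc i)\<close> and
  \<open>v \<ast> gen i = gen i \<ast> sig i v + der i v\<close> stays in the span. Later generators
  on the right are treated with the closure of the later span.\<close>

lemma rclosed: "1 \<le> i \<Longrightarrow> i \<le> Suc n \<Longrightarrow> rclosed i"
proof (induction "Suc n - i" arbitrary: i)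
  case 0
  then have i: "i = Suc n" by simp
  have "v \<ast> w \<in> Rs i" if v: "v \<in> Rs i" "w \<in> Rs i" for v w
  proof -
    have "kys v \<subseteq> {0}" using v by (auto simp: i Rs_def exps_def)
    then have "v = sgl 0 (lkp v 0)" by (intro poly_mapping_eqI) (auto simp: lookup_single when_def in_keys_iff subset_iff)
    then have "v \<ast> w = smul (lkp v 0) w" using r_scalar(1)[of "lkp v 0" w] by simp
    then show ?thesis using v by auto
  qed
  then show ?case by (auto simp: rclosed_def)
next
  case (Suc k)
  then have i: "i \<in> {1..n}" by auto
  have IH: "rclosed (Suc i)" by (rule Suc.hyps) (use Suc in auto)
  have gi: "v \<ast> gen i \<in> Rs i" if "v \<in> Rs i" for v
  proof -
    have "1 \<le> i" using i by simp
    with that show ?thesis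
    proof (induction v rule: Rs_gen_induct)
      case (scalar c)
      then show ?case using gen_Rs[of i i] i by (auto simp: r_scalar)
    next
      case (gen l v)
      show ?case
      proof (cases "l = i")
        case True
        then show ?thesis using gen gen_mul_Rs[OF i] by (simp add: R.mul_assoc)
      next
        case False
        have lv: "gen l \<ast> v \<in> Rs l" by (rule gen_mul_Rs) (use gen i in auto)
        then have lv: "gen l \<ast> v \<in> Rs (Suc i)" using Rs_mono[of "Suc i" l] gen False by auto
        have "gen l \<ast> v \<ast> gen i = gen i \<ast> sig i (gen l \<ast> v) + der i (gen l \<ast> v)" by (simp add: der_def)
        then show ?thesis
          using Rs_Suc[OF der_Rs_aux[OF IH i lv]] gen_mul_Rs[OF i Rs_Suc[OF raut_Rs[OF lv]]] by auto
      qed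
    qed (auto simp: bil_distribs)
  qed
  have gb: "v \<ast> b \<in> Rs i" if "v \<in> Rs i" "b \<in> Rs (Suc i)" for v b
  proof -
    have "1 \<le> i" using i by simp
    with that(1) show ?thesis
    proof (induction v rule: Rs_gen_induct)
      case (scalar c)
      then show ?case using Rs_Suc[OF that(2)] by (auto simp: r_scalar)
    next
      case (gen l v)
      show ?case
      proof (cases "l = i")
        case True
        then show ?thesis using gen gen_mul_Rs[OF i] by (simp add: R.mul_assoc)
      next
        case False
        have lv: "gen l \<ast> v \<in> Rs l" by (rule gen_mul_Rs) (use gen i in auto)
        then have lv: "gen l \<ast> v \<in> Rs (Suc i)" using Rs_mono[of "Suc i" l] gen False by auto
        then show ?thesis using IH that(2) Rs_Suc[of _ i] by (auto simp: rclosed_def)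
      qed
    qed (auto simp: bil_distribs)
  qed
  have "v \<ast> w \<in> Rs i" if "v \<in> Rs i" "w \<in> Rs i" for v w
  proof -
    have "1 \<le> i" using i by simp
    with that(2) show ?thesis using that(1)
    proof (induction w arbitrary: v rule: Rs_gen_induct)
      case (scalar c)
      then show ?case by (auto simp: r_scalar)
    next
      case (gen l w)
      have "v \<ast> gen l \<in> Rs i"
        using gi[OF gen.prems] gb[OF gen.prems] gen_Rs[of l "Suc i"] gen.hyps by (cases "l = i") auto
      then show ?case using gen.IH by (simp add: R.mul_assoc[symmetric])
    qed (auto simp: bil_distribs)
  qed
  then show ?case by (auto simp: rclosed_def)
qed

lemma Rs_mult: "\<lbrakk>1 \<le> i; v \<in> Rs i; w \<in> Rs i\<rbrakk> \<Longrightarrow> v \<ast> w \<in> Rs i"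
proof (cases "i \<le> Suc n")
  case True
  assume "1 \<le> i" "v \<in> Rs i" "w \<in> Rs i"
  then show ?thesis using rclosed True by (auto simp: rclosed_def)
next
  case False
  assume a: "1 \<le> i" "v \<in> Rs i" "w \<in> Rs i"
  have "Rs i = Rs (Suc n)" using False by (simp add: Rs_def)
  then show ?thesis using a rclosed[of "Suc n"] by (auto simp: rclosed_def)
qed

lemma der_Rs: "i \<in> {1..n} \<Longrightarrow> v \<in> Rs (Suc i) \<Longrightarrow> der i v \<in> Rs (Suc i)"
  using der_Rs_aux[of i v] rclosed[of "Suc i"] by auto

lemma mul_gen: "v \<ast> gen i = gen i \<ast> sig i v + der i v" by (simp add: der_def)

lemma gen_mul_inj: assumes "i \<in> {1..n}" "v \<in> Rs i" shows "lkp (gen i \<ast> v) (sgl i 1 + m) = lkp v m"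
  using assms(2)
proof (induction v rule: Rs_induct)
  case (single m' c)
  then show ?case using assms(1) by (simp add: gen_single lookup_single)
qed (auto simp: bil_distribs lookup_add)

text \<open>Left multiplication by \<open>gen i\<close> shifts exponents and so puts
  \<open>i\<close> into the support. This directness separates the two terms of
  \<open>mul_gen\<close>.\<close>

lemma gen_mul_Rs_Suc: assumes "i \<in> {1..n}" "v \<in> Rs i" "gen i \<ast> v \<in> Rs (Suc i)" shows "v = 0"
proof (rule poly_mapping_eqI)
  fix m :: "nat \<Rightarrow>\<^sub>0 nat"
  have "sgl i 1 + m \<notin> exps {Suc i..n}"
  proof
    assume "sgl i 1 + m \<in> exps {Suc i..n}"
    moreover have "i \<in> kys (sgl i 1 + m)" by (simp add: in_keys_iff lookup_add)
    ultimately show False by (auto simp: exps_def)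
  qed
  then have "lkp (gen i \<ast> v) (sgl i 1 + m) = 0" using assms(3) by (auto simp: Rs_def in_keys_iff)
  then show "lkp v m = lkp 0 m" using gen_mul_inj[OF assms(1,2), of m] by simp
qed

text \<open>Expand \<open>v \<ast> w \<ast> gen i\<close> as a whole and factor by factor. The
  difference is \<open>gen i\<close> times an element of \<open>Rs (Suc i)\<close> and also lies in
  \<open>Rs (Suc i)\<close>, so it vanishes by \<open>gen_mul_Rs_Suc\<close>.\<close>

lemma sig_der_mult:
  assumes i: "i \<in> {1..n}" and v: "v \<in> Rs (Suc i)" and w: "w \<in> Rs (Suc i)"
  shows "sig i (v \<ast> w) = sig i v \<ast> sig i w" "der i (v \<ast> w) = v \<ast> der i w + der i v \<ast> sig i w"
proof -
  have vw: "v \<ast> w \<in> Rs (Suc i)" using v w by (auto intro: Rs_mult)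
  have 1: "v \<ast> w \<ast> gen i = gen i \<ast> sig i (v \<ast> w) + der i (v \<ast> w)" by (rule mul_gen)
  have "v \<ast> w \<ast> gen i = v \<ast> gen i \<ast> sig i w + v \<ast> der i w"
    by (simp add: R.mul_assoc mul_gen[of w] bil_distribs)
  also have "\<dots> = gen i \<ast> (sig i v \<ast> sig i w) + der i v \<ast> sig i w + v \<ast> der i w"
    by (simp add: mul_gen[of v] bil_distribs R.mul_assoc)
  finally have 2: "gen i \<ast> (sig i (v \<ast> w) - sig i v \<ast> sig i w) = v \<ast> der i w + der i v \<ast> sig i w - der i (v \<ast> w)"
    using 1 by (simp add: bil_distribs algebra_simps)
  have "v \<ast> der i w + der i v \<ast> sig i w - der i (v \<ast> w) \<in> Rs (Suc i)"
    using v w vw der_Rs[OF i] by (intro Rs_diff Rs_add Rs_mult) auto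
  moreover have "sig i (v \<ast> w) - sig i v \<ast> sig i w \<in> Rs (Suc i)"
    using v w vw by (auto intro!: Rs_mult)
  ultimately have "sig i (v \<ast> w) - sig i v \<ast> sig i w = 0"
    using 2 by (intro gen_mul_Rs_Suc[OF i Rs_Suc]) auto
  then show "sig i (v \<ast> w) = sig i v \<ast> sig i w" by simp
  then show "der i (v \<ast> w) = v \<ast> der i w + der i v \<ast> sig i w" using 2 by simp
qed

text \<open>\<open>sig h\<close> is multiplicative on \<open>Rs (Suc h)\<close>, which contains
  \<open>gen i\<close> and \<open>gen l\<close>, so the correction term has the weight of the
  product of these two. This is the origin of the condition \<open>homog\<close> on
  \<open>W\<close>.\<close>

lemma der_gen_homogeneous:
  assumes h: "h \<in> {1..<i}" and i: "i \<in> {1..n}" and l: "l \<in> {Suc i..n}"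
  shows "sig h (der i (gen l)) = smul (Q l h * Q i h) (der i (gen l))"
proof -
  have hn: "h \<in> {1..n}" using h i by auto
  have g: "gen i \<in> Rs (Suc h)" "gen l \<in> Rs (Suc h)" using h i l by (auto intro!: gen_Rs)
  show ?thesis unfolding der_def sig_gen
    by (simp add: bil_distribs raut_diff raut_smul sig_der_mult(1)[OF hn] g sig_gen scl_diff scl_scl algebra_simps)
qed

lemma coeff_C_mult: "coeff_in C v \<Longrightarrow> coeff_in C w \<Longrightarrow> coeff_in C (v \<ast> w)"
  by (rule coeff_in_bil[where I = C and J = C]) (use C_add C_mult C_zero rB_C in \<open>auto simp: coeff_in_def\<close>)

end

section \<open>Triangular embeddings into the Laurent polynomials\<close>

context torus
begin

lemma beta_ext:
  assumes "t \<in> exps S" "\<And>h. h \<in> S \<Longrightarrow> beta m (sgl h 1) = beta p (sgl h 1)"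
  shows "beta m t = beta p t"
proof -
  have nat: "beta a (sgl h (int k)) = beta a (sgl h 1) ^ k" for a h k
  proof (induction k)
    case (Suc k)
    have "sgl h (int (Suc k)) = sgl h 1 + sgl h (int k)" by (simp add: single_add[symmetric])
    then show ?case using Suc by (simp add: beta_add_right)
  qed simp
  have int: "beta m (sgl h k) = beta p (sgl h k)" if "h \<in> S" for h k
  proof (cases k rule: int_cases2)
    case (nonpos j)
    have "sgl h k = - sgl h (int j)" using nonpos by (simp add: single_uminus)
    then have "beta a (sgl h k) = inverse (beta a (sgl h (int j)))" for a
      using beta_flip[of a "sgl h (int j)"] by (simp add: beta_uminus field_simps)
    then show ?thesis using nat assms(2)[OF that] by simp
  qed (use nat assms(2)[OF that] in auto)
  have "kys t \<subseteq> S" using assms(1) by (simp add: exps_def)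
  then show ?thesis by (induction t rule: pm_induct_keys) (auto simp: int beta_add_right)
qed

lemma beta_ext_left:
  assumes "t \<in> exps S" "\<And>h. h \<in> S \<Longrightarrow> beta (sgl h 1) m = beta (sgl h 1) p"
  shows "beta t m = beta t p"
proof -
  have f: "beta a b = inverse (beta b a)" for a b
    using beta_flip[of a b] by (simp add: field_simps inverse_eq_divide)
  have "beta m t = beta p t" by (rule beta_ext[OF assms(1)]) (use assms(2) f in metis)
  then show ?thesis using f by metis
qed

text \<open>\<open>v\<close> has the weight of \<open>Y l\<close> under conjugation by the earlier
  \<open>Y h\<close>; then \<open>Y l + v\<close> is still an eigenvector of these
  automorphisms.\<close>

definition homog :: "nat \<Rightarrow> nat \<Rightarrow> ((nat \<Rightarrow>\<^sub>0 int) \<Rightarrow>\<^sub>0 'a) \<Rightarrow> bool" where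
  "homog k l v \<longleftrightarrow> (\<forall>h\<in>{1..<k}. aut (sgl h 1) v = smul (Q l h) v)"

lemma homog_aut:
  assumes "homog l l w" "t \<in> exps {1..<l}"
  shows "aut t w = smul (beta (sgl l 1) t) w"
proof (rule poly_mapping_eqI)
  fix m
  show "lkp (aut t w) m = lkp (smul (beta (sgl l 1) t) w) m"
  proof (cases "lkp w m = 0")
    case False
    have "beta m (sgl h 1) = beta (sgl l 1) (sgl h 1)" if "h \<in> {1..<l}" for h
    proof -
      have "lkp (aut (sgl h 1) w) m = lkp (smul (Q l h) w) m" using assms(1) that by (auto simp: homog_def)
      then show ?thesis using False by (simp add: lookup_aut beta_single)
    qed
    then have "beta m t = beta (sgl l 1) t" by (rule beta_ext[OF assms(2)])
    then show ?thesis by (simp add: lookup_aut)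
  qed (simp add: lookup_aut)
qed

text \<open>Euler derivations, and the derivations \<open>v \<mapsto> \<Sum>l. (\<partial>l v) S l\<close>.\<close>

definition euler :: "nat \<Rightarrow> ((nat \<Rightarrow>\<^sub>0 int) \<Rightarrow>\<^sub>0 'a) \<Rightarrow> ((nat \<Rightarrow>\<^sub>0 int) \<Rightarrow>\<^sub>0 'a)" where
  "euler l = scl (\<lambda>a. of_int (lkp a l))"

definition res :: "(nat \<Rightarrow> ((nat \<Rightarrow>\<^sub>0 int) \<Rightarrow>\<^sub>0 'a)) \<Rightarrow> ((nat \<Rightarrow>\<^sub>0 int) \<Rightarrow>\<^sub>0 'a) \<Rightarrow> ((nat \<Rightarrow>\<^sub>0 int) \<Rightarrow>\<^sub>0 'a)" where
  "res S v = (\<Sum>l\<in>{1..n}. euler l v \<star> S l)"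

lemma euler_mult: "euler l (v \<star> w) = euler l v \<star> w + v \<star> euler l w"
proof -
  have 1: "euler l (sgl a c \<star> w) = euler l (sgl a c) \<star> w + sgl a c \<star> euler l w" for a c
    using subset_UNIV[of "kys w"]
    by (induction w rule: pm_induct_keys)
      (auto simp: bil_distribs tm_single euler_def scl_add lookup_add single_add[symmetric] algebra_simps)
  show ?thesis using subset_UNIV[of "kys v"]
    by (induction v rule: pm_induct_keys) (auto simp: bil_distribs euler_def scl_add 1[unfolded euler_def] algebra_simps simp del: scl_single)
qed

lemma euler_add: "euler l (v + w) = euler l v + euler l w" by (simp add: euler_def scl_add)
lemma euler_smul: "euler l (smul c v) = smul c (euler l v)" by (simp add: euler_def scl_commute)
lemma keys_euler: "kys (euler l v) \<subseteq> kys v" unfolding euler_def by (rule keys_scl)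
lemma euler_aut: "euler l (aut t v) = aut t (euler l v)" by (simp add: euler_def aut_scl)
lemma euler_Y: "euler l (Y j) = (if l = j then Y j else 0)"
  by (simp add: euler_def Y_def lookup_single when_def)
lemma euler_outside: "kys v \<subseteq> exps T' \<Longrightarrow> l \<notin> T' \<Longrightarrow> euler l v = 0"
proof (rule poly_mapping_eqI)
  fix k assume a: "kys v \<subseteq> exps T'" "l \<notin> T'"
  have "lkp k l = 0" if "k \<in> kys v" using a that by (fastforce simp: exps_def in_keys_iff)
  then show "lkp (euler l v) k = lkp 0 k" by (cases "k \<in> kys v") (auto simp: euler_def in_keys_iff)
qed

lemma res_add: "res S (v + w) = res S v + res S w"
  by (simp add: res_def euler_add bil_distribs sum.distrib)
lemma res_smul: "res S (smul c v) = smul c (res S v)"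
  by (simp add: res_def euler_smul bil_distribs scl_sum)
lemma res_diff: "res S (v - w) = res S v - res S w"
  using res_add[of S v "- w"] res_smul[of S "- 1" w] by (simp add: smul_uminus)
lemma res_scalar: "res S (sgl 0 c) = 0" by (simp add: res_def euler_def)
lemma res_Y: "j \<in> {1..n} \<Longrightarrow> res S (Y j) = Y j \<star> S j"
proof -
  assume j: "j \<in> {1..n}"
  have "res S (Y j) = (\<Sum>l\<in>{1..n}. if l = j then Y j \<star> S j else 0)"
    unfolding res_def by (intro sum.cong) (auto simp: euler_Y)
  then show ?thesis using j by simp
qed
lemma res_zero [simp]: "res S 0 = 0" using res_scalar[of S 0] by simp

lemma keys_res: "(\<And>l. l \<in> {1..n} \<Longrightarrow> kys (S l) \<subseteq> exps T') \<Longrightarrow> kys v \<subseteq> exps T' \<Longrightarrow> kys (res S v) \<subseteq> exps T'"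
proof -
  assume a: "\<And>l. l \<in> {1..n} \<Longrightarrow> kys (S l) \<subseteq> exps T'" "kys v \<subseteq> exps T'"
  have "kys (res S v) \<subseteq> (\<Union>l\<in>{1..n}. kys (euler l v \<star> S l))" unfolding res_def by (rule keys_sum)
  also have "\<dots> \<subseteq> exps T'"
    using a by (intro UN_least keys_mul_subset subset_trans[OF keys_euler]) auto
  finally show ?thesis .
qed

text \<open>The exponents \<open>m\<close> with \<open>w Y^m = Y^m aut i w\<close> for all \<open>w\<close> in the variables \<open>Y j, \<dots>, Y n\<close>.\<close>

definition resonant :: "nat \<Rightarrow> nat \<Rightarrow> ((nat \<Rightarrow>\<^sub>0 int) \<Rightarrow>\<^sub>0 'a) \<Rightarrow> bool" where
  "resonant i j u \<longleftrightarrow> (\<forall>m\<in>kys u. \<forall>l\<in>{j..n}. beta (sgl l 1) (sgl i 1 - m) = 1)"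

lemma resonant_commute:
  assumes "resonant i j u" "kys w \<subseteq> exps {j..n}" shows "w \<star> u = u \<star> aut (sgl i 1) w"
proof -
  have "w \<star> sgl m c = sgl m c \<star> aut (sgl i 1) w" if "m \<in> kys u" for m c
  proof -
    have "beta (sgl h 1) m = beta (sgl h 1) (sgl i 1)" if "h \<in> {j..n}" for h
    proof -
      have "beta m (sgl h 1) * beta (sgl h 1) (sgl i 1) = 1"
        using assms(1) \<open>m \<in> kys u\<close> that by (auto simp: resonant_def beta_diff_right mult.commute)
      then have "beta m (sgl h 1) * beta (sgl h 1) (sgl i 1) = beta m (sgl h 1) * beta (sgl h 1) m"
        by (simp add: beta_flip)
      then show ?thesis using mult_left_cancel[OF beta_nz] by metis
    qed
    then have "beta b m = beta b (sgl i 1)" if "b \<in> exps {j..n}" for b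
      using beta_ext_left[OF that] by blast
    then have "aut m w = aut (sgl i 1) w" unfolding aut_def
      using assms(2) by (intro scl_cong) auto
    then show ?thesis by (simp add: commute_monomial)
  qed
  then have "w \<star> (\<Sum>m\<in>kys u. sgl m (lkp u m)) = (\<Sum>m\<in>kys u. sgl m (lkp u m)) \<star> aut (sgl i 1) w"
    by (simp add: bil_sum_left bil_sum_right)
  then show ?thesis by (simp only: pm_sum_single[symmetric])
qed

text \<open>The Euler operators are derivations, and a resonant \<open>S l\<close> passes
  \<open>w\<close> at the cost of the automorphism. Hence \<open>res S\<close> obeys the same
  twisted Leibniz rule as \<open>der i\<close>.\<close>

lemma res_mult:
  assumes "\<And>l. l \<in> {1..n} \<Longrightarrow> resonant i j (S l)" "kys w \<subseteq> exps {j..n}"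
  shows "res S (v \<star> w) = v \<star> res S w + res S v \<star> aut (sgl i 1) w"
proof -
  have "res S (v \<star> w) = (\<Sum>l\<in>{1..n}. v \<star> (euler l w \<star> S l) + euler l v \<star> S l \<star> aut (sgl i 1) w)"
    unfolding res_def
  proof (rule sum.cong[OF refl])
    fix l assume "l \<in> {1..n}"
    then show "euler l (v \<star> w) \<star> S l = v \<star> (euler l w \<star> S l) + euler l v \<star> S l \<star> aut (sgl i 1) w"
      using resonant_commute[OF assms(1) assms(2)] by (simp add: euler_mult bil_distribs T.mul_assoc)
  qed
  then show ?thesis by (simp add: res_def sum.distrib bil_sum_left bil_sum_right)
qed

lemma aut_res:
  assumes "\<And>l. l \<in> {1..n} \<Longrightarrow> aut t (S l) = smul k (S l)"
  shows "aut t (res S v) = smul k (res S (aut t v))"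
  unfolding res_def aut_sum scl_sum
  by (intro sum.cong) (auto simp: aut_mult assms euler_aut bil_distribs)

end

section \<open>The candidate embedding and its multiplicativity\<close>

context solvable_coords
begin

text \<open>Ordered monomials go to ordered products, so \<open>phi W\<close> is a linear map for
  any \<open>W\<close>; it respects products once the \<open>W l\<close> are
  \<open>good\<close>.\<close>

definition phi :: "(nat \<Rightarrow> ((nat \<Rightarrow>\<^sub>0 int) \<Rightarrow>\<^sub>0 'a)) \<Rightarrow> ((nat \<Rightarrow>\<^sub>0 nat) \<Rightarrow>\<^sub>0 'a) \<Rightarrow> ((nat \<Rightarrow>\<^sub>0 int) \<Rightarrow>\<^sub>0 'a)" where
  "phi W = lin (T.omon n (\<lambda>l. Y l + W l))"

lemma phi_add: "phi W (v + w) = phi W v + phi W w" by (simp add: phi_def lin_add)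
lemma phi_diff: "phi W (v - w) = phi W v - phi W w" by (simp add: phi_def lin_diff)
lemma phi_smul: "phi W (smul c v) = smul c (phi W v)" by (simp add: phi_def lin_smul)
lemma phi_zero [simp]: "phi W 0 = 0" by (simp add: phi_def)
lemma phi_scalar [simp]: "phi W (sgl 0 c) = sgl 0 c" by (simp add: phi_def)

lemma phi_gen_mul: assumes "l \<in> {1..n}" "v \<in> Rs l" shows "phi W (gen l \<ast> v) = (Y l + W l) \<star> phi W v"
  using assms(2)
proof (induction v rule: Rs_induct)
  case (single m c)
  have "phi W (sgl (sgl l 1 + m) c) = (Y l + W l) \<star> phi W (sgl m c)"
    using T.omon_step[OF assms(1) single, of "\<lambda>l. Y l + W l"] by (simp add: phi_def bil_smul_right)
  then show ?case by (simp only: gen_single[OF assms(1) single])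
next
  case (add v w)
  then show ?case by (simp add: bil_add_right phi_add)
qed simp

lemma phi_gen [simp]: "l \<in> {1..n} \<Longrightarrow> phi W (gen l) = Y l + W l"
  using phi_gen_mul[of l "sgl 0 1" W] by simp

definition tri :: "nat \<Rightarrow> ((nat \<Rightarrow>\<^sub>0 int) \<Rightarrow>\<^sub>0 'a) \<Rightarrow> bool" where "tri l w \<longleftrightarrow> kys w \<subseteq> exps {Suc l..n}"

text \<open>The last condition is what \<open>mul_gen\<close> demands of the image
  \<open>Y l + W l\<close>: conjugation by \<open>Y l\<close> already realizes the automorphism, so
  \<open>W l\<close> alone has to produce \<open>der l\<close> as an inner skew derivation.\<close>

definition good :: "(nat \<Rightarrow> ((nat \<Rightarrow>\<^sub>0 int) \<Rightarrow>\<^sub>0 'a)) \<Rightarrow> nat \<Rightarrow> bool" where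
  "good W l \<longleftrightarrow> tri l (W l) \<and> homog l l (W l) \<and>
     (\<forall>v\<in>Rs (Suc l). phi W v \<star> W l - W l \<star> aut (sgl l 1) (phi W v) = phi W (der l v))"

lemma keys_Y: "l \<in> {i..n} \<Longrightarrow> kys (Y l) \<subseteq> exps {i..n}" by (auto simp: Y_def exps_def)

lemma keys_gen_image: "l \<in> {i..n} \<Longrightarrow> tri l w \<Longrightarrow> kys (Y l + w) \<subseteq> exps {i..n}"
proof -
  assume a: "l \<in> {i..n}" "tri l w"
  have "exps {Suc l..n} \<subseteq> (exps {i..n} :: (nat \<Rightarrow>\<^sub>0 int) set)" using a by (intro exps_mono) auto
  then show ?thesis using a keys_Y[of l i] keys_add[of "Y l" w] by (auto simp: tri_def)
qed

lemma keys_phi: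
  assumes "\<And>l. l \<in> {i..n} \<Longrightarrow> tri l (W l)" "1 \<le> i" "v \<in> Rs i" shows "kys (phi W v) \<subseteq> exps {i..n}"
  using assms(3,2)
proof (induction v rule: Rs_gen_induct)
  case (scalar c)
  then show ?case by auto
next
  case (gen l v)
  then have "phi W (gen l \<ast> v) = (Y l + W l) \<star> phi W v" using assms(2) by (intro phi_gen_mul) auto
  then show ?case using keys_mul_subset[OF keys_gen_image[OF gen(1) assms(1)[OF gen(1)]] gen(3)] by simp
next
  case (add v w)
  then show ?case using keys_add[of "phi W v" "phi W w"] by (auto simp: phi_add)
qed

lemma phi_cong:
  assumes "\<And>l. l \<in> {i..n} \<Longrightarrow> W l = W' l" "1 \<le> i" "v \<in> Rs i" shows "phi W v = phi W' v"
  using assms(3,2)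
proof (induction v rule: Rs_gen_induct)
  case (gen l v)
  then have "l \<in> {1..n}" using assms(2) by auto
  then show ?case using gen assms(1)[of l] by (simp add: phi_gen_mul)
qed (auto simp: phi_add)

lemma aut_gen_image:
  assumes "homog l l w" "t \<in> exps {1..<l}" shows "aut t (Y l + w) = smul (beta (sgl l 1) t) (Y l + w)"
  using homog_aut[OF assms] by (simp add: aut_add scl_add Y_def)

text \<open>By \<open>homog\<close> each image \<open>Y l + W l\<close> is an eigenvector of
  \<open>aut t\<close> for \<open>t\<close> in the earlier variables, with the eigenvalue that
  \<open>gen l\<close> has under \<open>raut t\<close>.\<close>

lemma aut_phi:
  assumes "\<And>l. l \<in> {i..n} \<Longrightarrow> homog l l (W l)" "1 \<le> i" "v \<in> Rs i" "t \<in> exps {1..<i}"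
  shows "aut t (phi W v) = phi W (raut t v)"
  using assms(3,2)
proof (induction v rule: Rs_gen_induct)
  case (gen l v)
  have l: "l \<in> {1..n}" using gen(1) assms(2) by auto
  have t: "t \<in> exps {1..<l}" using assms(4) exps_mono[of "{1..<i}" "{1..<l}"] gen(1) by auto
  show ?case using gen
    by (simp add: phi_gen_mul[OF l] raut_gen_mul[OF l] phi_smul aut_mult raut_Rs
      aut_gen_image[OF assms(1)[OF gen(1)] t] bil_smul_left)
qed (auto simp: phi_add aut_add raut_add)

text \<open>The induction runs as for \<open>rclosed\<close>. The case with content is
  \<open>b \<ast> gen i\<close> with \<open>b \<in> Rs (Suc i)\<close>, where
  \<open>good W i\<close> is the required identity.\<close>

lemma phi_mult:
  assumes "\<And>l. l \<in> {i..n} \<Longrightarrow> good W l" "1 \<le> i" "i \<le> Suc n" "v \<in> Rs i" "w \<in> Rs i"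
  shows "phi W (v \<ast> w) = phi W v \<star> phi W w"
  using assms
proof (induction "Suc n - i" arbitrary: i v w)
  case 0
  have "kys v \<subseteq> {0}" using 0 by (auto simp: Rs_def exps_def)
  then have v: "v = sgl 0 (lkp v 0)" by (intro poly_mapping_eqI) (auto simp: lookup_single when_def in_keys_iff subset_iff)
  show ?case by (subst (1 2) v) (simp add: r_scalar phi_smul tm_scalar)
next
  case (Suc k)
  have i: "i \<in> {1..n}" using Suc by auto
  have IH: "phi W (v \<ast> w) = phi W v \<star> phi W w" if "v \<in> Rs (Suc i)" "w \<in> Rs (Suc i)" for v w
    by (rule Suc.hyps(1)[of "Suc i"]) (use Suc that in auto)
  let ?X = "Y i + W i"
  have gi: "good W i" using Suc i by auto
  have ho: "\<And>l. l \<in> {Suc i..n} \<Longrightarrow> homog l l (W l)" using Suc.prems(1) by (auto simp: good_def)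
  have g0: "phi W (b \<ast> gen i) = phi W b \<star> ?X" if b: "b \<in> Rs (Suc i)" for b
  proof -
    have t: "sgl i 1 \<in> exps {1..<Suc i}" using i by (auto intro: exps_single)
    have a: "aut (sgl i 1) (phi W b) = phi W (sig i b)" by (rule aut_phi[OF ho _ b t]) auto
    have "phi W (b \<ast> gen i) = ?X \<star> phi W (sig i b) + phi W (der i b)"
      using phi_gen_mul[OF i Rs_Suc[OF raut_Rs[OF b]]] by (simp add: mul_gen phi_add)
    also have "\<dots> = Y i \<star> aut (sgl i 1) (phi W b) + phi W b \<star> W i"
      using gi b by (simp add: good_def a[symmetric] bil_distribs algebra_simps)
    also have "\<dots> = phi W b \<star> ?X" by (simp add: bil_distribs Y_commute)
    finally show ?thesis .
  qed
  have g1: "phi W (v \<ast> gen i) = phi W v \<star> ?X \<and> v \<ast> gen i \<in> Rs i" if "v \<in> Rs i" for v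
  proof
    show "v \<ast> gen i \<in> Rs i" using that i by (auto intro!: Rs_mult gen_Rs)
    have "1 \<le> i" using i by simp
    with that show "phi W (v \<ast> gen i) = phi W v \<star> ?X"
    proof (induction v rule: Rs_gen_induct)
      case (scalar c)
      then show ?case using i by (simp add: r_scalar phi_smul tm_scalar)
    next
      case (gen l v)
      show ?case
      proof (cases "l = i")
        case True
        have "v \<ast> gen i \<in> Rs i" using gen True i by (auto intro!: Rs_mult gen_Rs)
        then show ?thesis using gen True i by (simp add: R.mul_assoc T.mul_assoc phi_gen_mul)
      next
        case False
        have "gen l \<ast> v \<in> Rs l" by (rule gen_mul_Rs) (use gen i in auto)
        then have "gen l \<ast> v \<in> Rs (Suc i)" using Rs_mono[of "Suc i" l] gen False by auto
        then show ?thesis by (rule g0)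
      qed
    qed (auto simp: bil_distribs phi_add)
  qed
  have g2: "phi W (v \<ast> b) = phi W v \<star> phi W b" if "v \<in> Rs i" and b: "b \<in> Rs (Suc i)" for v b
  proof -
    have "1 \<le> i" using i by simp
    with that(1) show "phi W (v \<ast> b) = phi W v \<star> phi W b"
    proof (induction v rule: Rs_gen_induct)
      case (scalar c)
      then show ?case using i by (simp add: r_scalar phi_smul tm_scalar)
    next
      case (gen l v)
      show ?case
      proof (cases "l = i")
        case True
        have "v \<ast> b \<in> Rs i" using gen True i Rs_Suc[OF b] by (auto intro!: Rs_mult)
        then show ?thesis using gen True i by (simp add: R.mul_assoc T.mul_assoc phi_gen_mul)
      next
        case False
        have "gen l \<ast> v \<in> Rs l" by (rule gen_mul_Rs) (use gen i in auto)
        then have "gen l \<ast> v \<in> Rs (Suc i)" using Rs_mono[of "Suc i" l] gen False by auto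
        then show ?thesis using b by (rule IH)
      qed
    qed (auto simp: bil_distribs phi_add)
  qed
  have "1 \<le> i" using i by simp
  with Suc.prems(5) show ?case using Suc.prems(4)
  proof (induction w arbitrary: v rule: Rs_gen_induct)
    case (scalar c)
    then show ?case by (simp add: r_scalar phi_smul tm_scalar)
  next
    case (gen l w)
    have l: "l \<in> {1..n}" using gen i by auto
    have s: "v \<ast> gen l \<in> Rs i" using gen l i by (auto intro!: Rs_mult gen_Rs)
    have e: "phi W (v \<ast> gen l) = phi W v \<star> (Y l + W l)"
    proof (cases "l = i")
      case True
      then show ?thesis using g1 gen by simp
    next
      case False
      then show ?thesis using g2[OF gen.prems gen_Rs[of l "Suc i"]] gen(1) l by simp
    qed
    have "phi W (v \<ast> (gen l \<ast> w)) = phi W (v \<ast> gen l) \<star> phi W w"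
      using gen.IH[OF s] by (simp add: R.mul_assoc)
    then show ?case using gen l by (simp add: e phi_gen_mul T.mul_assoc)
  qed (auto simp: bil_distribs phi_add)
qed

definition F :: "'a set" where "F = {a / b | a b. a \<in> C \<and> b \<in> C \<and> b \<noteq> 0}"

lemma C_F: "C \<subseteq> F" using C_one unfolding F_def by force
lemma F_zero: "0 \<in> F" and F_one: "1 \<in> F" using C_F C_zero C_one by auto
lemma F_add: "x \<in> F \<Longrightarrow> y \<in> F \<Longrightarrow> x + y \<in> F"
proof -
  assume "x \<in> F" "y \<in> F"
  then obtain a b c d where h: "x = a / b" "y = c / d" "a \<in> C" "b \<in> C" "c \<in> C" "d \<in> C" "b \<noteq> 0" "d \<noteq> 0"
    unfolding F_def by auto
  then have "x + y = (a * d + c * b) / (b * d)" by (simp add: field_simps)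
  moreover have "a * d + c * b \<in> C" "b * d \<in> C" "b * d \<noteq> 0" using h by (auto intro!: C_add C_mult)
  ultimately show ?thesis unfolding F_def by blast
qed
lemma F_mult: "x \<in> F \<Longrightarrow> y \<in> F \<Longrightarrow> x * y \<in> F"
proof -
  assume "x \<in> F" "y \<in> F"
  then obtain a b c d where h: "x = a / b" "y = c / d" "a \<in> C" "b \<in> C" "c \<in> C" "d \<in> C" "b \<noteq> 0" "d \<noteq> 0"
    unfolding F_def by auto
  then have "x * y = (a * c) / (b * d)" by simp
  moreover have "a * c \<in> C" "b * d \<in> C" "b * d \<noteq> 0" using h by (auto intro!: C_mult)
  ultimately show ?thesis unfolding F_def by blast
qed
lemma F_inverse: "x \<in> F \<Longrightarrow> inverse x \<in> F"
proof -
  assume "x \<in> F"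
  then obtain a b where h: "x = a / b" "a \<in> C" "b \<in> C" "b \<noteq> 0" unfolding F_def by auto
  show ?thesis
  proof (cases "a = 0")
    case True
    then show ?thesis using h F_zero by simp
  next
    case False
    have "inverse x = b / a" using h by simp
    then show ?thesis using h False unfolding F_def by blast
  qed
qed
lemma F_uminus: "x \<in> F \<Longrightarrow> - x \<in> F" using F_mult[of "- 1" x] C_F C_uminus C_one by auto
lemma F_diff: "x \<in> F \<Longrightarrow> y \<in> F \<Longrightarrow> x - y \<in> F" using F_add[of x "- y"] F_uminus by simp

text \<open>A set of scalars that contains \<open>C\<close> and the values of the cocycle.\<close>

definition scalars :: "'a set \<Rightarrow> bool" where
  "scalars D \<longleftrightarrow> C \<subseteq> D \<and> (\<forall>x\<in>D. \<forall>y\<in>D. x + y \<in> D \<and> x * y \<in> D)"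

context
  fixes D assumes D: "scalars D"
begin

lemma D_zero: "0 \<in> D" and D_one: "1 \<in> D" and D_C: "c \<in> C \<Longrightarrow> c \<in> D"
  and D_add: "x \<in> D \<Longrightarrow> y \<in> D \<Longrightarrow> x + y \<in> D" and D_mult: "x \<in> D \<Longrightarrow> y \<in> D \<Longrightarrow> x * y \<in> D"
  using D C_zero C_one by (auto simp: scalars_def)
lemma D_uminus: "x \<in> D \<Longrightarrow> - x \<in> D" using D_mult[of "- 1" x] D_C[OF C_uminus[OF C_one]] by simp
lemma D_of_nat: "of_nat k \<in> D" by (induction k) (auto simp: D_zero D_one intro: D_add)
lemma D_of_int: "of_int k \<in> D" by (cases k rule: int_cases2) (auto simp: D_of_nat D_uminus)

lemma coeff_tm: "coeff_in D v \<Longrightarrow> coeff_in D w \<Longrightarrow> coeff_in D (v \<star> w)"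
  by (rule coeff_in_bil[where I = D and J = D])
    (auto simp: D_zero tB_def lookup_single when_def intro!: D_add D_mult D_C[OF eps_C])
lemma coeff_add: "coeff_in D v \<Longrightarrow> coeff_in D w \<Longrightarrow> coeff_in D (v + w)"
  by (auto simp: coeff_in_def lookup_add D_add)
lemma coeff_scl: "coeff_in D v \<Longrightarrow> (\<And>k. g k \<in> D) \<Longrightarrow> coeff_in D (scl g v)"
  by (auto simp: coeff_in_def D_mult)
lemma coeff_uminus: "coeff_in D v \<Longrightarrow> coeff_in D (- v)" by (auto simp: coeff_in_def D_uminus)
lemma coeff_diff: "coeff_in D v \<Longrightarrow> coeff_in D w \<Longrightarrow> coeff_in D (v - w)"
  using coeff_add[of v "- w"] coeff_uminus by auto
lemma coeff_single: "c \<in> D \<Longrightarrow> coeff_in D (sgl m c)" by (auto simp: coeff_in_def lookup_single when_def D_zero)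
lemma coeff_Y: "coeff_in D (Y l)" unfolding Y_def by (rule coeff_single[OF D_one])
lemma coeff_aut: "coeff_in D v \<Longrightarrow> coeff_in D (aut t v)"
  unfolding aut_def by (rule coeff_scl) (auto intro: D_C beta_C)
lemma coeff_sum: "(\<And>a. a \<in> A \<Longrightarrow> coeff_in D (f a)) \<Longrightarrow> coeff_in D (sum f A)"
  by (rule coeff_in_sum) (auto simp: D_zero D_add)
lemma coeff_res: "coeff_in D v \<Longrightarrow> (\<And>l. l \<in> {1..n} \<Longrightarrow> coeff_in D (S l)) \<Longrightarrow> coeff_in D (res S v)"
  unfolding res_def euler_def by (intro coeff_sum coeff_tm coeff_scl) (auto simp: D_of_int)
lemma coeff_phi:
  assumes "\<And>l. l \<in> {1..n} \<Longrightarrow> coeff_in D (W l)" "coeff_in D v" "v \<in> Rs 1" shows "coeff_in D (phi W v)"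
proof -
  have "coeff_in D (T.omon n (\<lambda>l. Y l + W l) m)" if "m \<in> exps {1..n}" for m
    using that
  proof (induction m rule: exponent_induct)
    case zero
    then show ?case by (simp add: coeff_single D_one)
  next
    case (step l m)
    then show ?case using assms(1) by (simp add: T.omon_step coeff_tm coeff_add coeff_Y)
  qed
  then show ?thesis unfolding phi_def using assms(2,3)
    by (intro coeff_in_lin[where I = D and J = D]) (auto simp: D_zero D_add D_mult Rs_def)
qed

end

lemma scalars_F: "scalars F" using C_F F_add F_mult by (auto simp: scalars_def)
lemma scalars_C: "scalars C" using C_add C_mult by (auto simp: scalars_def)

lemma coeff_gen: "coeff_in C (gen l)" by (auto simp: gen_def coeff_in_def lookup_single when_def C_zero C_one)
lemma coeff_raut: "coeff_in C v \<Longrightarrow> coeff_in C (raut t v)"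
  by (auto simp: raut_def coeff_in_def intro!: C_mult beta_C)
lemma coeff_der: "coeff_in C v \<Longrightarrow> coeff_in C (der i v)"
  unfolding der_def by (intro coeff_diff[OF scalars_C] coeff_C_mult coeff_gen coeff_raut)

end

lemma smul_eq_0_iff: "smul c v = 0 \<longleftrightarrow> c = 0 \<or> v = 0" for c :: "'a::field"
proof -
  have "smul (inverse c) (smul c v) = v" if "c \<noteq> 0" using that by (simp add: scl_scl)
  then show ?thesis by (metis scl_zero smul_zero_left)
qed

lemma (in torus) Y_nz [simp]: "Y l \<noteq> 0"
  unfolding Y_def by (metis lookup_single_eq lookup_zero zero_neq_one)

section \<open>Solving for the implementing element, one variable at a time\<close>

context solvable_coords
begin

text \<open>
  On the variables from \<open>j\<close> on, the derivation \<open>der i\<close> is the inner derivation given by \<open>V\<close> up to the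
  resonant part \<open>res S\<close>.
\<close>

definition inn where
  "inn W i j V S \<longleftrightarrow> kys V \<subseteq> exps {Suc i..n} \<and> coeff_in F V \<and> homog i i V \<and>
     (\<forall>l\<in>{1..n}. kys (S l) \<subseteq> exps {Suc i..n} \<and> coeff_in F (S l) \<and> homog i i (S l) \<and> resonant i j (S l)) \<and>
     (\<forall>l<j. S l = 0) \<and>
     (\<forall>l\<in>{j..n}. phi W (der i (gen l)) =
        (Y l + W l) \<star> V - V \<star> aut (sgl i 1) (Y l + W l) + res S (Y l + W l))"

context
  fixes W i
  assumes i: "i \<in> {1..n}" and gW: "\<And>l. l \<in> {Suc i..n} \<Longrightarrow> good W l" and cW: "\<And>l. l \<in> {1..n} \<Longrightarrow> coeff_in F (W l)"
begin

abbreviation "Ai \<equiv> aut (sgl i 1)"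

text \<open>The part of \<open>der i\<close> that the inner derivation by \<open>V\<close> misses.
  As a difference of skew derivations it is determined by its values on generators.\<close>

definition defect where "defect V v = phi W (der i v) - (phi W v \<star> V - V \<star> Ai (phi W v))"

lemma A_phi: "v \<in> Rs (Suc i) \<Longrightarrow> phi W (sig i v) = Ai (phi W v)"
  using aut_phi[of "Suc i" W v "sgl i 1"] gW i exps_single[of i "{1..<Suc i}" "1::int"] by (auto simp: good_def)

lemma phi_mult_i: "v \<in> Rs (Suc i) \<Longrightarrow> w \<in> Rs (Suc i) \<Longrightarrow> phi W (v \<ast> w) = phi W v \<star> phi W w"
  by (rule phi_mult[of "Suc i"]) (use gW i in auto)

lemma defect_mult:
  assumes "v \<in> Rs (Suc i)" "w \<in> Rs (Suc i)"
  shows "defect V (v \<ast> w) = phi W v \<star> defect V w + defect V v \<star> Ai (phi W w)"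
  unfolding defect_def
  using assms der_Rs[OF i]
  by (simp add: phi_mult_i sig_der_mult(2)[OF i] phi_add A_phi raut_Rs aut_mult bil_distribs T.mul_assoc algebra_simps)

lemma defect_add: "defect V (v + w) = defect V v + defect V w"
  by (simp add: defect_def der_add phi_add aut_add bil_distribs algebra_simps)
lemma defect_scalar: "defect V (sgl 0 c) = 0"
  by (simp add: defect_def der_def r_scalar tm_scalar)

text \<open>Both sides obey the same twisted Leibniz rule, and \<open>inn\<close> states that they
  agree on the generators from \<open>j\<close> on.\<close>

lemma defect_eq_res:
  assumes V: "inn W i j V S" and j: "Suc i \<le> j" and v: "v \<in> Rs j"
  shows "defect V v = res S (phi W v)"
proof -
  have "1 \<le> j" using j by simp
  with v show ?thesis
  proof (induction v rule: Rs_gen_induct)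
    case (scalar c)
    then show ?case by (simp add: defect_scalar res_scalar)
  next
    case (gen l v)
    have l: "l \<in> {1..n}" "l \<in> {Suc i..n}" using gen(1) j by auto
    have R: "gen l \<in> Rs (Suc i)" "v \<in> Rs (Suc i)" using gen j Rs_mono[of "Suc i" l] by (auto intro: gen_Rs)
    have k: "kys (phi W v) \<subseteq> exps {j..n}"
      using keys_phi[of l W v] gW gen j exps_mono[of "{l..n}" "{j..n}"] by (auto simp: good_def)
    have "defect V (gen l) = res S (Y l + W l)"
      using V gen(1) l by (simp add: inn_def defect_def algebra_simps)
    moreover have "res S ((Y l + W l) \<star> phi W v) = (Y l + W l) \<star> res S (phi W v) + res S (Y l + W l) \<star> Ai (phi W v)"
      by (rule res_mult[OF _ k]) (use V in \<open>auto simp: inn_def\<close>)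
    ultimately show ?case
      using gen l R by (simp add: defect_mult phi_gen_mul)
  qed (auto simp: defect_add phi_add res_add)
qed

text \<open>Adjoining the variable \<open>j\<close>. The unexplained part of the defect at
  \<open>gen j\<close> is written as \<open>Y j \<star> E'\<close>. Compatibility of
  \<open>der i\<close> with the relations between \<open>gen j\<close> and the later generators
  forces \<open>E'\<close> to be resonant in the later variables, so adding resonant terms of this
  kind to \<open>V\<close> changes nothing there. At \<open>j\<close> itself the number
  \<open>?r m j\<close> decides for each exponent \<open>m\<close> of \<open>E'\<close>: if it
  differs from 1, division by \<open>1 - ?r m j\<close> turns the term into an inner one; if it
  equals 1, the term is resonant and goes into \<open>S j\<close>.\<close>

lemma inner_step:
  assumes j: "j \<in> {Suc i..n}" and V: "inn W i (Suc j) V S"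
  shows "\<exists>V S. inn W i j V S"
proof -
  let ?X = "\<lambda>l. Y l + W l"
  let ?D = "res S"
  let ?s = "aut (sgl j 1)"
  have jn: "j \<in> {1..n}" and ij: "i \<noteq> j" using j i by auto
  have reS: "\<And>l. l \<in> {1..n} \<Longrightarrow> resonant i (Suc j) (S l)" using V by (auto simp: inn_def)
  have gj: "good W j" using gW j by auto
  have tW: "kys (W l) \<subseteq> exps {Suc l..n}" if "l \<in> {Suc i..n}" for l using gW[OF that] by (auto simp: good_def tri_def)
  have AX: "Ai (?X l) = smul (Q l i) (?X l)" and AW: "Ai (W l) = smul (Q l i) (W l)" if "l \<in> {Suc i..n}" for l
  proof -
    have h: "homog l l (W l)" "sgl i 1 \<in> exps {1..<l}" using gW[OF that] that i by (auto simp: good_def intro: exps_single)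
    show "Ai (?X l) = smul (Q l i) (?X l)" using aut_gen_image[OF h] by (simp add: beta_single)
    show "Ai (W l) = smul (Q l i) (W l)" using homog_aut[OF h] by (simp add: beta_single)
  qed
  have AY: "Ai (Y l) = smul (Q l i) (Y l)" for l by (simp add: Y_def beta_single)
  have sY: "?s (Y l) = smul (Q l j) (Y l)" for l by (simp add: Y_def beta_single)
  have rmul: "?D (v \<star> w) = v \<star> ?D w + ?D v \<star> Ai w" if "kys w \<subseteq> exps {Suc j..n}" for v w
    by (rule res_mult[OF _ that]) (use reS in auto)
  define E where "E = defect V (gen j) - ?D (W j)"
  \<comment> \<open>\<open>G\<close> compares the two ways of computing the defect of
    \<open>a \<ast> gen j\<close>, directly and after moving \<open>a\<close> past
    \<open>gen j\<close>, with the contributions of \<open>W j\<close> cancelled.\<close>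
  define G where "G = (\<lambda>b. b \<star> E + smul (Q j i) (?D b \<star> Y j) - Y j \<star> ?D (?s b) - E \<star> Ai (?s b))"
  have G_phi: "G (phi W a) = 0" if a: "a \<in> Rs (Suc j)" for a
  proof -
    have R: "a \<in> Rs (Suc i)" "gen j \<in> Rs (Suc i)" "sig j a \<in> Rs (Suc j)" "sig j a \<in> Rs (Suc i)" "der j a \<in> Rs (Suc j)"
        "der j a \<in> Rs (Suc i)"
      using a j Rs_mono[of "Suc i" "Suc j"] der_Rs[OF jn a] by (auto intro: gen_Rs)
    have ss: "phi W (sig j a) = ?s (phi W a)"
      using aut_phi[of "Suc j" W a "sgl j 1"] gW j a exps_single[of j "{1..<Suc j}" "1::int"] jn by (auto simp: good_def)
    have dd: "phi W (der j a) = phi W a \<star> W j - W j \<star> ?s (phi W a)" using gj a by (auto simp: good_def)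
    have k: "kys (W j) \<subseteq> exps {Suc j..n}" "kys (phi W a) \<subseteq> exps {Suc j..n}"
      using tW[OF j] keys_phi[of "Suc j" W a] gW j a by (auto simp: good_def)
    have k': "kys (?s (phi W a)) \<subseteq> exps {Suc j..n}" using keys_aut k(2) by (rule subset_trans)
    have D: "defect V v = ?D (phi W v)" if "v \<in> Rs (Suc j)" for v
      using defect_eq_res[OF V _ that] j by auto
    have "defect V (a \<ast> gen j) = phi W a \<star> defect V (gen j) + ?D (phi W a) \<star> Ai (?X j)"
      using R D[OF a] jn by (simp add: defect_mult)
    moreover have "defect V (a \<ast> gen j) = ?X j \<star> ?D (?s (phi W a)) + defect V (gen j) \<star> Ai (?s (phi W a)) +
        (phi W a \<star> ?D (W j) + ?D (phi W a) \<star> Ai (W j) - W j \<star> ?D (?s (phi W a)) - ?D (W j) \<star> Ai (?s (phi W a)))"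
      using R jn by (simp add: mul_gen defect_add defect_mult D ss dd res_diff rmul[OF k(1)] rmul[OF k'] algebra_simps)
    ultimately show ?thesis
      unfolding G_def E_def using j
      by (simp add: AX AW bil_distribs scl_add algebra_simps)
  qed
  have G_mult: "G (a \<star> b) = a \<star> G b + G a \<star> Ai (?s b)" if "kys b \<subseteq> exps {Suc j..n}" for a b
  proof -
    have k': "kys (?s b) \<subseteq> exps {Suc j..n}" using keys_aut that by (rule subset_trans)
    have yc: "b \<star> Y j = Y j \<star> ?s b" "a \<star> (Y j \<star> c) = Y j \<star> (?s a \<star> c)" "Ai b \<star> Y j = Y j \<star> Ai (?s b)" for c
    proof -
      show "b \<star> Y j = Y j \<star> ?s b" by (rule Y_commute)
      show "a \<star> (Y j \<star> c) = Y j \<star> (?s a \<star> c)" by (simp add: T.mul_assoc[symmetric] Y_commute)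
      show "Ai b \<star> Y j = Y j \<star> Ai (?s b)" by (simp add: Y_commute aut_aut add.commute)
    qed
    show ?thesis unfolding G_def
      by (simp add: rmul[OF that] rmul[OF k'] aut_mult bil_distribs scl_add scl_diff T.mul_assoc yc algebra_simps)
  qed
  have G_add: "G (a + b) = G a + G b" for a b
    unfolding G_def by (simp add: bil_distribs res_add aut_add scl_add algebra_simps)
  have G_scalar: "G (sgl 0 c) = 0" for c
    unfolding G_def by (simp add: res_scalar tm_scalar)
  \<comment> \<open>\<open>G\<close> obeys a twisted Leibniz rule, so its zeros are closed under
    products and, since \<open>Y l\<close> can be cancelled, contain inverses. From the images of
    the generators they therefore reach all Laurent polynomials in the later variables.\<close>
  have G0: "kys v \<subseteq> exps {Suc j..n} \<and> G v = 0" if "kys v \<subseteq> exps {Suc j..n}" for v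
  proof (rule laurent_closure[where D = UNIV and W = W and j = "Suc j" and Pr = "\<lambda>v. kys v \<subseteq> exps {Suc j..n} \<and> G v = 0"])
    fix v w assume a: "kys v \<subseteq> exps {Suc j..n} \<and> G v = 0" "kys w \<subseteq> exps {Suc j..n} \<and> G w = 0"
    show "kys (v + w) \<subseteq> exps {Suc j..n} \<and> G (v + w) = 0" using a keys_add[of v w] by (auto simp: G_add)
    show "kys (v \<star> w) \<subseteq> exps {Suc j..n} \<and> G (v \<star> w) = 0" using a keys_mul_subset by (auto simp: G_mult)
  next
    fix l assume l: "l \<in> {Suc j..n}"
    have l': "l \<in> {1..n}" "l \<in> {Suc i..n}" using l j by auto
    show "kys (W l) \<subseteq> exps {Suc l..n} \<and> coeff_in UNIV (W l)" using tW[OF l'(2)] by (auto simp: coeff_in_def)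
    have "G (phi W (gen l)) = 0" using G_phi[OF gen_Rs] l by auto
    then show "kys (?X l) \<subseteq> exps {Suc j..n} \<and> G (?X l) = 0"
      using l l' keys_gen_image[of l "Suc j" "W l"] gW[OF l'(2)] by (auto simp: good_def)
    assume Yl: "kys (Y l) \<subseteq> exps {Suc j..n} \<and> G (Y l) = 0"
    let ?Yi = "sgl (sgl l (- 1)) 1"
    have "G (?Yi \<star> Y l) = 0" using G_scalar by (simp add: Y_left_inverse)
    then have "G ?Yi \<star> Ai (?s (Y l)) = 0" using Yl by (simp add: G_mult)
    then have "smul (Q l j * Q l i) (G ?Yi \<star> Y l) = 0" by (simp add: AY sY aut_smul scl_scl bil_distribs)
    then have "G ?Yi \<star> Y l = 0" by (simp add: smul_eq_0_iff)
    then have "G ?Yi = 0" using tm_domain[of "G ?Yi" "Y l"] by simp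
    then show "kys ?Yi \<subseteq> exps {Suc j..n} \<and> G ?Yi = 0" using l by (auto simp: exps_def)
  qed (use that j in \<open>auto simp: G_scalar coeff_in_def\<close>)
  define E' where "E' = sgl (sgl j (- 1)) 1 \<star> E"
  have E: "E = Y j \<star> E'" unfolding E'_def by (simp add: T.mul_assoc[symmetric] Y_right_inverse)
  let ?r = "\<lambda>m l. beta (sgl l 1) (sgl i 1 - m)"
  \<comment> \<open>The equation \<open>G (Y l) = 0\<close>, read at exponent \<open>m\<close> after
    cancelling \<open>Y j\<close> and \<open>Y l\<close>.\<close>
  have rel: "lkp (S l) m * (1 - ?r m j) = lkp E' m * (1 - ?r m l)" if l: "l \<in> {Suc j..n}" for l m
  proof -
    have ln: "l \<in> {1..n}" using l j by auto
    have "kys (Y l) \<subseteq> exps {Suc j..n}" by (rule keys_Y[OF l])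
    then have "G (Y l) = 0" using G0 by blast
    then have "Y l \<star> (Y j \<star> E') + smul (Q j i) (Y l \<star> S l \<star> Y j) - smul (Q l j) (Y j \<star> (Y l \<star> S l)) -
        smul (Q l i * Q l j) (Y j \<star> (E' \<star> Y l)) = 0"
      unfolding G_def using ln by (simp add: E res_Y sY AY aut_smul res_smul scl_scl bil_distribs T.mul_assoc mult.commute)
    moreover have "Y l \<star> (Y j \<star> E') = smul (Q l j) (Y j \<star> (Y l \<star> E'))"
      by (simp add: T.mul_assoc[symmetric] Y_commute[of "Y l" j] sY bil_distribs)
    moreover have "Y l \<star> S l \<star> Y j = smul (Q l j) (Y j \<star> (Y l \<star> ?s (S l)))"
      by (simp add: Y_commute aut_mult sY bil_distribs T.mul_assoc)
    moreover have "E' \<star> Y l = Y l \<star> aut (sgl l 1) E'" by (rule Y_commute)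
    ultimately have "smul (Q l j) (Y j \<star> (Y l \<star> (E' + smul (Q j i) (?s (S l)) - S l - smul (Q l i) (aut (sgl l 1) E')))) = 0"
      by (simp add: bil_distribs scl_add scl_diff scl_scl mult.commute)
    then have "Y j \<star> (Y l \<star> (E' + smul (Q j i) (?s (S l)) - S l - smul (Q l i) (aut (sgl l 1) E'))) = 0"
      by (simp add: smul_eq_0_iff)
    then have "E' + smul (Q j i) (?s (S l)) - S l - smul (Q l i) (aut (sgl l 1) E') = 0"
      using tm_domain[of "Y j"] tm_domain[of "Y l"] Y_nz by metis
    then have "lkp (E' + smul (Q j i) (?s (S l)) - S l - smul (Q l i) (aut (sgl l 1) E')) m = 0" by simp
    then show ?thesis
      by (simp add: lookup_add lookup_minus lookup_aut beta_diff_right beta_single algebra_simps)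
  qed
  \<comment> \<open>The equation to be solved is \<open>E' = U - smul (Q j i) (?s U) + E1\<close>,
    and the operator on \<open>U\<close> multiplies the coefficient at \<open>m\<close> by
    \<open>1 - ?r m j\<close>.\<close>
  define U where "U = scl (\<lambda>m. if ?r m j = 1 then 0 else inverse (1 - ?r m j)) E'"
  define E1 where "E1 = scl (\<lambda>m. if ?r m j = 1 then 1 else 0) E'"
  \<comment> \<open>If \<open>m\<close> occurs in \<open>S l\<close>, its resonance is known. If
    not, the left side of \<open>rel\<close> is 0 while \<open>E'\<close> has a nonzero coefficient
    on the right.\<close>
  have resE: "resonant i (Suc j) E'"
    unfolding resonant_def
  proof (intro ballI)
    fix m l assume m: "m \<in> kys E'" and l: "l \<in> {Suc j..n}"
    have ln: "l \<in> {1..n}" using l j by auto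
    show "?r m l = 1"
    proof (cases "m \<in> kys (S l)")
      case True
      then show ?thesis using reS[OF ln] l by (auto simp: resonant_def)
    next
      case False
      then show ?thesis using rel[OF l, of m] m by (auto simp: in_keys_iff)
    qed
  qed
  have resU: "resonant i (Suc j) U" using resE keys_scl[of "\<lambda>m. if ?r m j = 1 then 0 else inverse (1 - ?r m j)" E']
    unfolding U_def resonant_def by (meson subsetD)
  have keys_sclE: "kys (scl g E') \<subseteq> exps {Suc i..n}" if "kys E' \<subseteq> exps {Suc i..n}" for g
    using keys_scl that by (rule subset_trans)
  have split_le: "l = j \<or> l \<in> {Suc j..n}" if "l \<in> {j..n}" for l using that by auto
  have resE1: "resonant i j E1" unfolding resonant_def
  proof (intro ballI)
    fix m l assume m: "m \<in> kys E1" and l: "l \<in> {j..n}"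
    then have "?r m j = 1" "m \<in> kys E'" by (auto simp: E1_def in_keys_iff split: if_splits)
    then show "?r m l = 1" using split_le[OF l] resE by (auto simp: resonant_def)
  qed
  have resS: "resonant i j (S l)" if "l \<in> {1..n}" for l unfolding resonant_def
  proof (intro ballI)
    fix m k assume m: "m \<in> kys (S l)" and k: "k \<in> {j..n}"
    show "?r m k = 1"
    proof (cases "k = j")
      case False
      then show ?thesis using reS[OF that] m k by (auto simp: resonant_def)
    next
      case True
      have "l \<in> {Suc j..n}"
      proof (rule ccontr)
        assume "l \<notin> {Suc j..n}"
        then have "l < Suc j" using that by auto
        then have "S l = 0" using V by (auto simp: inn_def)
        then show False using m by simp
      qed
      then show ?thesis using rel[of l m] m reS[OF that] True by (auto simp: resonant_def in_keys_iff)
    qed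
  qed
  have coefE: "coeff_in F E"
  proof -
    note cl = coeff_diff[OF scalars_F] coeff_tm[OF scalars_F] coeff_aut[OF scalars_F] coeff_res[OF scalars_F]
      coeff_phi[OF scalars_F]
    have CF: "coeff_in C v \<Longrightarrow> coeff_in F v" for v :: "(nat \<Rightarrow>\<^sub>0 nat) \<Rightarrow>\<^sub>0 'a" using C_F by (auto simp: coeff_in_def)
    have g1: "gen j \<in> Rs 1" using jn by (auto intro: gen_Rs)
    have g2: "der i (gen j) \<in> Rs 1"
      using der_Rs[OF i gen_Rs[OF j]] Rs_mono[of 1 "Suc i"] by auto
    show ?thesis unfolding E_def defect_def using V jn g1 g2
      by (intro cl CF cW coeff_der coeff_gen) (auto simp: inn_def)
  qed
  have coefE': "coeff_in F E'" unfolding E'_def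
    by (intro coeff_tm[OF scalars_F] coeff_single[OF scalars_F] F_one coefE)
  have rF: "?r m l \<in> F" for m l using beta_C C_F by blast
  have keysE: "kys E \<subseteq> exps {Suc i..n}"
  proof -
    have g: "der i (gen j) \<in> Rs (Suc i)" by (rule der_Rs[OF i gen_Rs[OF j]])
    have kp: "kys (phi W v) \<subseteq> exps {Suc i..n}" if "v \<in> Rs (Suc i)" for v
      using keys_phi[of "Suc i" W v] gW that by (auto simp: good_def)
    have kA: "kys (Ai v) \<subseteq> T'" if "kys v \<subseteq> T'" for v T' using keys_aut that by (rule subset_trans)
    have kd: "kys (v - w) \<subseteq> T'" if "kys v \<subseteq> T'" "kys w \<subseteq> T'" for v w :: "(nat \<Rightarrow>\<^sub>0 int) \<Rightarrow>\<^sub>0 'a" and T'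
      using that keys_diff[of v w] by blast
    have kW: "kys (W j) \<subseteq> exps {Suc i..n}" using tW[OF j] exps_mono[of "{Suc j..n}" "{Suc i..n}"] j by auto
    have kV: "kys V \<subseteq> exps {Suc i..n}" "\<And>l. l \<in> {1..n} \<Longrightarrow> kys (S l) \<subseteq> exps {Suc i..n}"
      using V by (auto simp: inn_def)
    show ?thesis unfolding E_def defect_def
      using gen_Rs[OF j] g kW kV by (intro kd keys_mul_subset kA kp keys_res) auto
  qed
  have keysE': "kys E' \<subseteq> exps {Suc i..n}" unfolding E'_def
    by (rule keys_mul_subset[OF _ keysE]) (use j in \<open>auto simp: exps_def\<close>)
  have homE': "homog i i E'" unfolding homog_def
  proof
    fix h assume h: "h \<in> {1..<i}"
    let ?t = "aut (sgl h 1)"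
    have hi: "h \<in> {1..<Suc i}" "sgl h 1 \<in> exps {1..<Suc i}" "sgl h 1 \<in> exps {1..<j}" using h j i by (auto intro: exps_single)
    have tW: "?t (W j) = smul (Q j h) (W j)" "?t (?X j) = smul (Q j h) (?X j)"
      using homog_aut[OF _ hi(3), of "W j"] aut_gen_image[OF _ hi(3), of "W j"] gj by (auto simp: good_def beta_single)
    have tV: "?t V = smul (Q i h) V" "\<And>l. l \<in> {1..n} \<Longrightarrow> ?t (S l) = smul (Q i h) (S l)"
      using V h by (auto simp: inn_def homog_def)
    have td: "?t (phi W (der i (gen j))) = smul (Q i h * Q j h) (phi W (der i (gen j)))"
    proof -
      have "?t (phi W (der i (gen j))) = phi W (raut (sgl h 1) (der i (gen j)))"
        by (rule aut_phi[OF _ _ der_Rs[OF i gen_Rs[OF j]] hi(2)]) (use gW in \<open>auto simp: good_def\<close>)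
      also have "\<dots> = smul (Q i h * Q j h) (phi W (der i (gen j)))"
        using der_gen_homogeneous[OF h i j] by (simp add: phi_smul mult.commute)
      finally show ?thesis .
    qed
    have tA: "?t (Ai (?X j)) = smul (Q j h) (Ai (?X j))"
      using tW(2) by (simp add: aut_aut add.commute aut_smul) (metis aut_aut aut_smul add.commute)
    have t1: "?t (?X j \<star> V) = smul (Q i h * Q j h) (?X j \<star> V)"
      unfolding aut_mult tW(2) tV(1) by (simp add: bil_smul_left bil_smul_right scl_scl mult.commute)
    have t2: "?t (V \<star> Ai (?X j)) = smul (Q i h * Q j h) (V \<star> Ai (?X j))"
      unfolding aut_mult tA tV(1) by (simp add: bil_smul_left bil_smul_right scl_scl mult.commute)
    have t3: "?t (?D (W j)) = smul (Q i h * Q j h) (?D (W j))"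
      by (subst aut_res[where k = "Q i h"]) (simp_all add: tV(2) tW(1) res_smul scl_scl mult.commute)
    have "?t E = smul (Q i h * Q j h) E"
      unfolding E_def defect_def phi_gen[OF jn] by (simp only: aut_diff t1 t2 t3 td scl_diff)
    moreover have "?t E = smul (Q j h) (Y j \<star> ?t E')"
      by (simp add: E aut_mult bil_distribs Y_def beta_single) (simp add: bil_smul_left[symmetric])
    ultimately have "smul (Q j h) (Y j \<star> ?t E') = smul (Q j h) (Y j \<star> smul (Q i h) E')"
      by (simp add: E bil_distribs scl_scl mult.commute)
    then have "smul (Q h j) (smul (Q j h) (Y j \<star> ?t E')) = smul (Q h j) (smul (Q j h) (Y j \<star> smul (Q i h) E'))" by simp
    then have "Y j \<star> ?t E' = Y j \<star> smul (Q i h) E'" by (simp add: scl_scl Q_inv)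
    then show "?t E' = smul (Q i h) E'" by (rule Y_cancel)
  qed
  have homscl: "homog i i (scl g E')" for g using homE' by (simp add: homog_def aut_scl scl_commute)
  define V' where "V' = V + U"
  define S' where "S' = S(j := E1)"
  \<comment> \<open>\<open>U\<close> is resonant in the later variables, and \<open>S\<close>
    changes only at \<open>j\<close>, whose Euler operator vanishes there. So the equations already
    solved are kept.\<close>
  have comm: "b \<star> V' - V' \<star> Ai b + res S' b = b \<star> V - V \<star> Ai b + res S b" if b: "kys b \<subseteq> exps {Suc j..n}" for b
  proof -
    have "b \<star> U = U \<star> Ai b" by (rule resonant_commute[OF resU b])
    moreover have "res S' b = res S b" unfolding res_def
      by (intro sum.cong refl) (auto simp: S'_def euler_outside[OF b])
    ultimately show ?thesis by (simp add: V'_def bil_distribs)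
  qed
  have "inn W i j V' S'"
    unfolding inn_def
  proof (intro conjI ballI allI impI)
    show "kys V' \<subseteq> exps {Suc i..n}"
      using V keys_sclE[OF keysE'] keys_add[of V U] unfolding V'_def U_def inn_def by (meson Un_least subset_trans)
    show "coeff_in F V'" unfolding V'_def U_def using V
      by (intro coeff_add[OF scalars_F] coeff_scl[OF scalars_F] coefE')
        (auto simp: inn_def F_zero intro!: F_inverse F_diff F_one rF)
    show "homog i i V'" using homscl V unfolding V'_def U_def by (auto simp: homog_def aut_add scl_add inn_def)
    show "kys (S' l) \<subseteq> exps {Suc i..n}" if "l \<in> {1..n}" for l
      using V that keys_sclE[OF keysE'] unfolding S'_def E1_def inn_def by auto
    show "coeff_in F (S' l)" if "l \<in> {1..n}" for l
      using V that coeff_scl[OF scalars_F coefE'] F_zero F_one unfolding S'_def E1_def inn_def by auto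
    show "homog i i (S' l)" if "l \<in> {1..n}" for l
      using V that homscl unfolding S'_def E1_def inn_def by auto
    show "resonant i j (S' l)" if "l \<in> {1..n}" for l using resS[OF that] resE1 by (auto simp: S'_def)
    show "S' l = 0" if "l < j" for l using that V by (auto simp: S'_def inn_def)
    fix l assume l: "l \<in> {j..n}"
    show "phi W (der i (gen l)) = ?X l \<star> V' - V' \<star> Ai (?X l) + res S' (?X l)"
    proof (cases "l = j")
      case False
      then have l: "l \<in> {Suc j..n}" using l by auto
      have "kys (?X l) \<subseteq> exps {Suc j..n}"
        using keys_gen_image[of l "Suc j" "W l"] gW[of l] l j by (auto simp: good_def)
      then show ?thesis using comm V l by (auto simp: inn_def)
    next
      case True
      have "E' = U - smul (Q j i) (?s U) + E1"
        by (rule poly_mapping_eqI)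
          (simp add: U_def E1_def lookup_add lookup_minus lookup_aut beta_diff_right beta_single field_simps)
      then have e1: "E = Y j \<star> U - U \<star> Ai (Y j) + Y j \<star> E1"
        using E by (simp add: AY bil_distribs Y_commute[of U])
      have e2: "phi W (der i (gen j)) = E + res S (W j) + (?X j \<star> V - V \<star> Ai (?X j))"
        unfolding E_def defect_def using jn by simp
      have e3: "res S' (Y j) = Y j \<star> E1" using res_Y[OF jn, of S'] by (simp add: S'_def)
      have "W j \<star> V' - V' \<star> Ai (W j) + res S' (W j) = W j \<star> V - V \<star> Ai (W j) + res S (W j)"
        by (rule comm[OF tW[OF j]])
      then show ?thesis unfolding True e2 e1
        by (simp add: V'_def aut_add bil_distribs res_add e3 algebra_simps)
    qed
  qed
  then show ?thesis by blast
qed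

text \<open>The descent starts at \<open>Suc n\<close>, where no generator is left to be served and
  \<open>V\<close> and \<open>S\<close> are 0.\<close>

lemma inner_exists: "\<exists>V S. inn W i (Suc i) V S"
proof -
  have base: "inn W i (Suc n) 0 (\<lambda>_. 0)"
    by (auto simp: inn_def homog_def resonant_def coeff_in_def F_zero)
  have "\<exists>V S. inn W i j V S" if "Suc i \<le> j" "j \<le> Suc n" for j
    using that(2,1)
  proof (induction rule: inc_induct)
    case base
    then show ?case using \<open>inn W i (Suc n) 0 (\<lambda>_. 0)\<close> by blast
  next
    case (step j)
    then obtain V S where "inn W i (Suc j) V S" by auto
    then show ?case using inner_step[of j] step by auto
  qed
  then show ?thesis using i by auto
qed

end
end

section \<open>Leading coefficients in one generator, and relations modulo a prime\<close>

context solvable_coords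
begin

text \<open>The expansion \<open>v = \<Sum>s. gp i s \<ast> part i s v\<close> of \<open>v \<in> Rs i\<close> in powers of \<open>gen i\<close>.\<close>

definition gp :: "nat \<Rightarrow> nat \<Rightarrow> (nat \<Rightarrow>\<^sub>0 nat) \<Rightarrow>\<^sub>0 'a" where "gp i s = sgl (sgl i s) 1"

definition part :: "nat \<Rightarrow> nat \<Rightarrow> ((nat \<Rightarrow>\<^sub>0 nat) \<Rightarrow>\<^sub>0 'a) \<Rightarrow> ((nat \<Rightarrow>\<^sub>0 nat) \<Rightarrow>\<^sub>0 'a)" where
  "part i s = lin (\<lambda>m. if lkp m i = s then sgl (m - sgl i s) 1 else 0)"

lemma part_add: "part i s (v + w) = part i s v + part i s w" by (simp add: part_def lin_add)
lemma part_diff: "part i s (v - w) = part i s v - part i s w" by (simp add: part_def lin_diff)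
lemma part_smul: "part i s (smul c v) = smul c (part i s v)" by (simp add: part_def lin_smul)
lemma part_sum: "part i s (sum f A) = (\<Sum>a\<in>A. part i s (f a))" by (simp add: part_def lin_sum)
lemma part_zero [simp]: "part i s 0 = 0" by (simp add: part_def)
lemma part_single: "part i s (sgl m c) = (if lkp m i = s then sgl (m - sgl i s) c else 0)"
  by (simp add: part_def)

lemma gp_0 [simp]: "gp i 0 = sgl 0 1" by (simp add: gp_def)
lemma gp_Suc: "i \<in> {1..n} \<Longrightarrow> gp i (Suc s) = gen i \<ast> gp i s"
proof -
  assume i: "i \<in> {1..n}"
  have "sgl i s \<in> exps {i..n}" using i by (auto intro: exps_single)
  then show ?thesis using i by (simp add: gp_def gen_single single_add[symmetric] One_nat_def)
qed
lemma gp_Rs: "i \<in> {1..n} \<Longrightarrow> gp i s \<in> Rs i" by (auto simp: gp_def intro!: Rs_single exps_single)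

lemma exps_Suc_lookup: "m \<in> exps {Suc i..n} \<Longrightarrow> lkp m i = 0"
  by (auto simp: exps_def in_keys_iff)

lemma gp_single:
  assumes "i \<in> {1..n}" "m \<in> exps {i..n}" shows "gp i s \<ast> sgl m c = sgl (sgl i s + m) c"
proof (induction s)
  case (Suc s)
  have "sgl i s + m \<in> exps {i..n}" using assms by (auto intro!: exps_add exps_single)
  then have "gen i \<ast> sgl (sgl i s + m) c = sgl (sgl i 1 + (sgl i s + m)) c" using assms by (simp add: gen_single)
  also have "sgl i 1 + (sgl i s + m) = sgl i (Suc s) + m" by (simp add: add.assoc[symmetric] single_add[symmetric] One_nat_def)
  finally show ?case using Suc assms by (simp add: gp_Suc R.mul_assoc)
qed simp

lemma part_gp:
  assumes "i \<in> {1..n}" "w \<in> Rs (Suc i)" shows "part i s (gp i t \<ast> w) = (if s = t then w else 0)"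
  using assms(2)
proof (induction w rule: Rs_induct)
  case (single m c)
  have m: "lkp m i = 0" by (rule exps_Suc_lookup[OF single])
  have "gp i t \<ast> sgl m c = sgl (sgl i t + m) c" using assms(1) Rs_Suc_exps[OF single] by (simp add: gp_single)
  then show ?case by (auto simp: part_single lookup_add m)
qed (auto simp: bil_distribs part_add)

lemma part_Rs: assumes "v \<in> Rs i" shows "part i s v \<in> Rs (Suc i)"
  using assms
proof (induction v rule: Rs_induct)
  case (single m c)
  show ?case
  proof (cases "lkp m i = s")
    case True
    have "k \<in> {Suc i..n}" if "k \<in> kys (m - sgl i s)" for k
    proof -
      have "k \<noteq> i" using that True by (auto simp: in_keys_iff lookup_minus)
      moreover have "k \<in> kys m" using that by (auto simp: in_keys_iff lookup_minus)
      ultimately show ?thesis using single by (force simp: exps_def)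
    qed
    then have "m - sgl i s \<in> exps {Suc i..n}" by (auto simp: exps_def)
    then show ?thesis using True by (simp add: part_single Rs_single)
  qed (simp add: part_single)
qed (auto simp: part_add)

lemma part_expand:
  assumes i: "i \<in> {1..n}" and v: "v \<in> Rs i"
  obtains d where "v = (\<Sum>s\<le>d. gp i s \<ast> part i s v)" "\<And>s. s > d \<Longrightarrow> part i s v = 0"
proof -
  have "\<exists>d. (\<forall>s>d. part i s v = 0) \<and> (\<forall>d'\<ge>d. v = (\<Sum>s\<le>d'. gp i s \<ast> part i s v))"
    using v
  proof (induction v rule: Rs_induct)
    case zero
    then show ?case by auto
  next
    case (single m c)
    have m: "m - sgl i (lkp m i) \<in> exps {i..n}"
      using single by (auto simp: exps_def in_keys_iff lookup_minus)
    have e: "sgl i (lkp m i) + (m - sgl i (lkp m i)) = m"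
      by (rule poly_mapping_eqI) (auto simp: lookup_add lookup_minus lookup_single when_def)
    have "sgl m c = (\<Sum>s\<le>d'. gp i s \<ast> part i s (sgl m c))" if "d' \<ge> lkp m i" for d'
    proof -
      have "(\<Sum>s\<le>d'. gp i s \<ast> part i s (sgl m c)) = (\<Sum>s\<le>d'. if s = lkp m i then sgl m c else 0)"
        by (rule sum.cong) (auto simp: part_single gp_single[OF i m] e)
      then show ?thesis using that by simp
    qed
    then have "\<forall>d'\<ge>lkp m i. sgl m c = (\<Sum>s\<le>d'. gp i s \<ast> part i s (sgl m c))" by blast
    moreover have "\<forall>s>lkp m i. part i s (sgl m c) = 0" by (simp add: part_single)
    ultimately show ?case by blast
  next
    case (add v w)
    then obtain d1 d2 where "\<forall>s>d1. part i s v = 0" "\<forall>d'\<ge>d1. v = (\<Sum>s\<le>d'. gp i s \<ast> part i s v)"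
      "\<forall>s>d2. part i s w = 0" "\<forall>d'\<ge>d2. w = (\<Sum>s\<le>d'. gp i s \<ast> part i s w)" by auto
    then have "(\<forall>s>max d1 d2. part i s (v + w) = 0) \<and> (\<forall>d'\<ge>max d1 d2. v + w = (\<Sum>s\<le>d'. gp i s \<ast> part i s (v + w)))"
      by (auto simp: part_add bil_add_right sum.distrib)
    then show ?case by blast
  qed
  then show thesis using that by blast
qed

lemma part_mult:
  assumes i: "i \<in> {1..n}" and v: "v \<in> Rs i" and w: "w \<in> Rs (Suc i)"
  shows "part i s (v \<ast> w) = part i s v \<ast> w"
proof -
  obtain d where d: "v = (\<Sum>s\<le>d. gp i s \<ast> part i s v)" "\<And>s. s > d \<Longrightarrow> part i s v = 0"
    using part_expand[OF i v] by blast
  have "v \<ast> w = (\<Sum>t\<le>d. gp i t \<ast> (part i t v \<ast> w))"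
    by (subst d(1)) (simp add: bil_sum_left R.mul_assoc)
  then have "part i s (v \<ast> w) = (\<Sum>t\<le>d. part i s (gp i t \<ast> (part i t v \<ast> w)))" by (simp add: part_sum)
  also have "\<dots> = (\<Sum>t\<le>d. if t = s then part i s v \<ast> w else 0)"
    by (rule sum.cong) (use part_gp[OF i Rs_mult[OF _ part_Rs[OF v] w]] in auto)
  also have "\<dots> = part i s v \<ast> w" using d(2)[of s] by auto
  finally show ?thesis .
qed

lemma part_gen:
  assumes i: "i \<in> {1..n}" and v: "v \<in> Rs i"
  shows "part i (Suc s) (gen i \<ast> v) = part i s v" "part i 0 (gen i \<ast> v) = 0"
proof -
  obtain d where d: "v = (\<Sum>s\<le>d. gp i s \<ast> part i s v)" "\<And>s. s > d \<Longrightarrow> part i s v = 0"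
    using part_expand[OF i v] by blast
  have e: "gen i \<ast> v = (\<Sum>t\<le>d. gp i (Suc t) \<ast> part i t v)"
    by (subst d(1)) (simp add: bil_sum_right R.mul_assoc gp_Suc[OF i])
  have "part i (Suc s) (gen i \<ast> v) = (\<Sum>t\<le>d. if t = s then part i s v else 0)"
    unfolding e part_sum by (rule sum.cong) (auto simp: part_gp[OF i part_Rs[OF v]])
  then show "part i (Suc s) (gen i \<ast> v) = part i s v" using d(2)[of s] by auto
  show "part i 0 (gen i \<ast> v) = 0" unfolding e part_sum
    by (intro sum.neutral ballI) (simp add: part_gp[OF i part_Rs[OF v]])
qed

text \<open>The coefficient of \<open>gp i (s - 1)\<close> in \<open>b \<ast> gp i s\<close>, next
  to the leading coefficient, which is \<open>b\<close> under the \<open>s\<close>-th power of the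
  automorphism. One more factor \<open>gen i\<close> contributes through \<open>sig i b\<close> and
  through \<open>der i b\<close>.\<close>

fun dd :: "nat \<Rightarrow> nat \<Rightarrow> ((nat \<Rightarrow>\<^sub>0 nat) \<Rightarrow>\<^sub>0 'a) \<Rightarrow> ((nat \<Rightarrow>\<^sub>0 nat) \<Rightarrow>\<^sub>0 'a)" where
  "dd i 0 b = 0"
| "dd i (Suc s) b = dd i s (sig i b) + raut (sgl i (int s)) (der i b)"

lemma dd_smul: "dd i s (smul c b) = smul c (dd i s b)"
  by (induction s arbitrary: b) (auto simp: raut_smul der_smul scl_add)

lemma dd_Rs: "i \<in> {1..n} \<Longrightarrow> b \<in> Rs (Suc i) \<Longrightarrow> dd i s b \<in> Rs (Suc i)"
proof (induction s arbitrary: b)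
  case (Suc s)
  then show ?case using Rs_add[OF Suc.IH[OF Suc.prems(1) raut_Rs[OF Suc.prems(2)]] raut_Rs[OF der_Rs[OF Suc.prems]]] by simp
qed simp

lemma part_expansion:
  assumes i: "i \<in> {1..n}" and b: "b \<in> Rs (Suc i)"
  shows "(\<forall>t>s. part i t (b \<ast> gp i s) = 0) \<and> part i s (b \<ast> gp i s) = raut (sgl i (int s)) b \<and>
    (s \<ge> 1 \<longrightarrow> part i (s - 1) (b \<ast> gp i s) = dd i s b)"
  using b
proof (induction s arbitrary: b)
  case 0
  then have "part i t b = (if t = 0 then b else 0)" for t using part_gp[OF i, of b t 0] by simp
  then show ?case by simp
next
  case (Suc s)
  have R: "sig i b \<in> Rs (Suc i)" "der i b \<in> Rs (Suc i)" using Suc.prems der_Rs[OF i] by auto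
  have R': "sig i b \<ast> gp i s \<in> Rs i" by (rule Rs_mult[OF _ Rs_Suc[OF R(1)] gp_Rs[OF i]]) (use i in auto)
  have e: "b \<ast> gp i (Suc s) = gen i \<ast> (sig i b \<ast> gp i s) + der i b \<ast> gp i s"
    using i by (simp add: gp_Suc R.mul_assoc[symmetric] mul_gen bil_distribs)
  note IH1 = Suc.IH[OF R(1)] and IH2 = Suc.IH[OF R(2)]
  have "part i t (b \<ast> gp i (Suc s)) = 0" if t: "t > Suc s" for t
  proof -
    obtain t' where "t = Suc t'" using t by (cases t) auto
    then show ?thesis using t IH1 IH2 by (simp add: e part_add part_gen[OF i R'])
  qed
  moreover have "part i (Suc s) (b \<ast> gp i (Suc s)) = raut (sgl i (int (Suc s))) b"
    using IH1 IH2 by (simp add: e part_add part_gen[OF i R'] raut_raut single_add[symmetric] add.commute[of 1])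
  moreover have "part i s (b \<ast> gp i (Suc s)) = dd i (Suc s) b"
  proof -
    have "part i s (b \<ast> gp i (Suc s)) = part i s (gen i \<ast> (sig i b \<ast> gp i s)) + part i s (der i b \<ast> gp i s)"
      unfolding e by (rule part_add)
    also have "part i s (gen i \<ast> (sig i b \<ast> gp i s)) = dd i s (sig i b)"
    proof (cases s)
      case 0
      then show ?thesis using part_gen(2)[OF i R'] by simp
    next
      case (Suc s')
      have "part i (Suc s') (gen i \<ast> (sig i b \<ast> gp i s)) = part i s' (sig i b \<ast> gp i s)"
        by (rule part_gen(1)[OF i R'])
      then show ?thesis using IH1 Suc by (simp add: One_nat_def)
    qed
    finally show ?thesis using IH2 by simp
  qed
  ultimately show ?case by simp
qed

lemma beta_single_power: "beta (sgl l 1) (sgl i (int s)) = Q l i ^ s"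
proof (induction s)
  case (Suc s)
  have "sgl i (int (Suc s)) = sgl i 1 + sgl i (int s)" by (simp add: single_add[symmetric])
  then show ?case using Suc by (simp add: beta_add_right beta_single)
qed simp

definition prime_in :: "'a set \<Rightarrow> bool" where
  "prime_in E \<longleftrightarrow> E \<subseteq> C \<and> 0 \<in> E \<and> 1 \<notin> E \<and> (\<forall>x\<in>E. \<forall>y\<in>E. x + y \<in> E) \<and> (\<forall>c\<in>C. \<forall>x\<in>E. c * x \<in> E) \<and>
     (\<forall>x\<in>C. \<forall>y\<in>C. x * y \<in> E \<longrightarrow> x \<in> E \<or> y \<in> E)"

text \<open>
  The trace of finiteness over the centre on \<open>Rs i\<close>: any \<open>N + 1\<close> elements are dependent modulo
  \<open>E\<close> over elements that commute with the generators up to the scalars \<open>beta (e_l) \<theta>\<close>.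
\<close>

definition central_rel :: "'a set \<Rightarrow> nat \<Rightarrow> bool" where
  "central_rel E i \<longleftrightarrow> (\<exists>N::nat. \<forall>r. (\<forall>k\<le>N. r k \<in> Rs i \<and> coeff_in C (r k)) \<longrightarrow>
     (\<exists>z \<theta>. \<theta> \<in> exps {1..<i} \<and> (\<forall>k\<le>N. z k \<in> Rs i \<and> coeff_in C (z k)) \<and> (\<exists>k\<le>N. \<not> coeff_in E (z k)) \<and>
       (\<forall>k\<le>N. \<forall>l\<in>{i..n}. coeff_in E (z k \<ast> gen l - smul (beta (sgl l 1) \<theta>) (gen l \<ast> z k))) \<and>
       coeff_in E (\<Sum>k\<le>N. z k \<ast> r k)))"

lemma coeff_part: "0 \<in> I \<Longrightarrow> (\<And>x y. x \<in> I \<Longrightarrow> y \<in> I \<Longrightarrow> x + y \<in> I) \<Longrightarrow> coeff_in I v \<Longrightarrow> coeff_in I (part i s v)"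
  unfolding part_def
  by (rule coeff_in_lin[where I = I and J = "{0, 1}"]) (auto simp: coeff_in_def lookup_single when_def)

context
  fixes E assumes E: "prime_in E"
begin

lemma E_facts: "E \<subseteq> C" "0 \<in> E" "1 \<notin> E" "x \<in> E \<Longrightarrow> y \<in> E \<Longrightarrow> x + y \<in> E" "c \<in> C \<Longrightarrow> x \<in> E \<Longrightarrow> c * x \<in> E"
    "x \<in> C \<Longrightarrow> y \<in> C \<Longrightarrow> x * y \<in> E \<Longrightarrow> x \<in> E \<or> y \<in> E"
  using E unfolding prime_in_def by blast+

lemma coeffE_add: "coeff_in E v \<Longrightarrow> coeff_in E w \<Longrightarrow> coeff_in E (v + w)"
  by (auto simp: coeff_in_def lookup_add E_facts)
lemma coeffE_smul: "coeff_in E v \<Longrightarrow> c \<in> C \<Longrightarrow> coeff_in E (smul c v)"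
  by (auto simp: coeff_in_def E_facts)
lemma coeffE_uminus: "coeff_in E v \<Longrightarrow> coeff_in E (- v)"
  using coeffE_smul[of v "- 1"] C_uminus[OF C_one] by (simp add: smul_uminus)
lemma coeffE_diff: "coeff_in E v \<Longrightarrow> coeff_in E w \<Longrightarrow> coeff_in E (v - w)"
  using coeffE_add[of v "- w"] coeffE_uminus by auto
lemma coeffE_sum: "(\<And>a. a \<in> A \<Longrightarrow> coeff_in E (f a)) \<Longrightarrow> coeff_in E (sum f A)"
  by (rule coeff_in_sum) (auto simp: E_facts)
lemma coeffE_mult1: "coeff_in E v \<Longrightarrow> coeff_in C w \<Longrightarrow> coeff_in E (v \<ast> w)"
  by (rule coeff_in_bil[where I = E and J = C])
    (use rB_C in \<open>auto simp: E_facts coeff_in_def mult.commute[of _ "_ * _"] C_mult intro!: E_facts(5)\<close>)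
lemma coeffE_mult2: "coeff_in C v \<Longrightarrow> coeff_in E w \<Longrightarrow> coeff_in E (v \<ast> w)"
  by (rule coeff_in_bil[where I = C and J = E])
    (use rB_C in \<open>auto simp: E_facts coeff_in_def mult.left_commute[of _ "_ :: 'a"] mult.commute[of _ "lkp _ _"] intro!: E_facts(5)\<close>)
lemma coeffE_part: "coeff_in E v \<Longrightarrow> coeff_in E (part i s v)"
  by (rule coeff_part) (auto simp: E_facts)
lemma coeffC_part: "coeff_in C v \<Longrightarrow> coeff_in C (part i s v)"
  by (rule coeff_part) (auto simp: C_zero C_add)
lemma coeffE_zero [simp]: "coeff_in E 0" by (simp add: coeff_in_def E_facts)
lemma coeffC_gp: "coeff_in C (gp i s)" unfolding gp_def by (rule coeff_single[OF scalars_C C_one])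
lemma coeffE_raut: "coeff_in E (raut t v) \<longleftrightarrow> coeff_in E v"
proof -
  have 1: "coeff_in E (raut t v)" if "coeff_in E v" for t v
    using that by (auto simp: raut_def coeff_in_def intro!: E_facts(5) beta_C)
  then show ?thesis using 1[of "raut t v" "- t"] by (auto simp: raut_raut)
qed

lemma coeffE_expand:
  assumes i: "i \<in> {1..n}" and v: "v \<in> Rs i" and p: "\<And>s. coeff_in E (part i s v)" shows "coeff_in E v"
proof -
  obtain d where d: "v = (\<Sum>s\<le>d. gp i s \<ast> part i s v)" using part_expand[OF i v] by blast
  show ?thesis by (subst d) (intro coeffE_sum coeffE_mult2 coeffC_gp p)
qed

text \<open>Comparison of coefficients at the two highest powers of \<open>gen i\<close> that count
  modulo \<open>E\<close>. The second congruence is the one in which the derivation becomes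
  visible.\<close>

lemma part_commutation:
  assumes i: "i \<in> {1..n}" and z: "z \<in> Rs i" "coeff_in C z" and m: "\<And>s. s > m \<Longrightarrow> coeff_in E (part i s z)"
    and l: "l \<in> {Suc i..n}" and lam: "lam \<in> C" and e: "coeff_in E (z \<ast> gen l - smul lam (gen l \<ast> z))"
  shows "coeff_in E (part i m z \<ast> gen l - smul (lam * Q l i ^ m) (gen l \<ast> part i m z))"
    and "m \<ge> 1 \<Longrightarrow> coeff_in E (part i (m - 1) z \<ast> gen l -
        smul lam (dd i m (gen l) \<ast> part i m z + smul (Q l i ^ (m - 1)) (gen l \<ast> part i (m - 1) z)))"
proof -
  have gl: "gen l \<in> Rs (Suc i)" by (rule gen_Rs[OF l])
  obtain d where d: "z = (\<Sum>s\<le>d. gp i s \<ast> part i s z)" "\<And>s. s > d \<Longrightarrow> part i s z = 0"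
    using part_expand[OF i z(1)] by blast
  have ri: "gen l \<ast> gp i s \<in> Rs i" for s using gp_Rs[OF i] Rs_Suc[OF gl] i by (auto intro!: Rs_mult)
  have rg: "raut (sgl i (int s)) (gen l) = smul (Q l i ^ s) (gen l)" for s
  proof (induction s)
    case (Suc s)
    have "raut (sgl i (int (Suc s))) (gen l) = sig i (raut (sgl i (int s)) (gen l))"
      by (simp add: raut_raut single_add[symmetric])
    then show ?case using Suc by (simp add: raut_smul sig_gen scl_scl mult.commute)
  qed simp
  have p: "part i t (gen l \<ast> z) = (\<Sum>s\<le>d. part i t (gen l \<ast> gp i s) \<ast> part i s z)" for t
  proof -
    have "gen l \<ast> z = (\<Sum>s\<le>d. gen l \<ast> gp i s \<ast> part i s z)" by (subst d(1)) (simp add: bil_sum_right R.mul_assoc)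
    then show ?thesis by (simp add: part_sum part_mult[OF i ri part_Rs[OF z(1)]])
  qed
  have hi: "coeff_in E (part i t (gen l \<ast> gp i s) \<ast> part i s z)" if "s > m" for s t
    by (intro coeffE_mult2 coeffC_part coeff_C_mult coeff_gen coeffC_gp m that)
  have pz: "part i s z = 0 \<or> s \<le> d" for s using d(2)[of s] by force
  \<comment> \<open>Terms with \<open>s > m\<close> lie in \<open>E\<close>, and those with
    \<open>s \<le> m\<close> outside \<open>T'\<close> vanish, so modulo \<open>E\<close> only
    \<open>T'\<close> counts. The uses are \<open>{m}\<close> and \<open>{m - 1, m}\<close>.\<close>
  have split: "coeff_in E (part i t (gen l \<ast> z) - (\<Sum>s\<in>T'. part i t (gen l \<ast> gp i s) \<ast> part i s z))"
    if T': "finite T'" "\<And>s. s \<le> m \<Longrightarrow> s \<notin> T' \<Longrightarrow> part i t (gen l \<ast> gp i s) = 0" for t T'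
  proof -
    let ?f = "\<lambda>s. part i t (gen l \<ast> gp i s) \<ast> part i s z"
    have 1: "part i t (gen l \<ast> z) = sum ?f ({..d} \<union> T')"
      unfolding p by (rule sum.mono_neutral_left) (use T' d(2) in \<open>auto simp: not_le\<close>)
    have "sum ?f ({..d} \<union> T') = sum ?f T' + sum ?f ({..d} - T')"
      using sum.union_disjoint[of T' "{..d} - T'" ?f] T' by (simp add: Un_Diff_cancel Un_commute)
    moreover have "coeff_in E (sum ?f ({..d} - T'))"
    proof (rule coeffE_sum)
      fix s assume "s \<in> {..d} - T'"
      then show "coeff_in E (?f s)" using hi[of s t] T'(2)[of s] by (cases "s > m") auto
    qed
    ultimately show ?thesis using 1 by simp
  qed
  have pe: "coeff_in E (part i t z \<ast> gen l - smul lam (part i t (gen l \<ast> z)))" for t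
    using coeffE_part[OF e, of i t] part_mult[OF i z(1) gl] by (simp add: part_diff part_smul)
  have comb: "coeff_in E (part i t z \<ast> gen l - smul lam v)" if "coeff_in E (part i t (gen l \<ast> z) - v)" for t v
  proof -
    have eq: "part i t z \<ast> gen l - smul lam v = (part i t z \<ast> gen l - smul lam (part i t (gen l \<ast> z))) + smul lam (part i t (gen l \<ast> z) - v)"
      by (simp add: scl_diff)
    show ?thesis unfolding eq by (rule coeffE_add[OF pe coeffE_smul[OF that lam]])
  qed
  note px = part_expansion[OF i gl]
  have "coeff_in E (part i m (gen l \<ast> z) - (\<Sum>s\<in>{m}. part i m (gen l \<ast> gp i s) \<ast> part i s z))"
    by (rule split) (use px in auto)
  then have "coeff_in E (part i m (gen l \<ast> z) - smul (Q l i ^ m) (gen l \<ast> part i m z))"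
    using px[of m] by (simp add: rg bil_distribs)
  from comb[OF this] show "coeff_in E (part i m z \<ast> gen l - smul (lam * Q l i ^ m) (gen l \<ast> part i m z))"
    by (simp add: scl_scl)
  assume m1: "m \<ge> 1"
  have "coeff_in E (part i (m - 1) (gen l \<ast> z) - (\<Sum>s\<in>{m - 1, m}. part i (m - 1) (gen l \<ast> gp i s) \<ast> part i s z))"
  proof (rule split)
    fix s assume "s \<le> m" "s \<notin> {m - 1, m}"
    then show "part i (m - 1) (gen l \<ast> gp i s) = 0" using px[of s] by auto
  qed simp
  moreover have "(\<Sum>s\<in>{m - 1, m}. part i (m - 1) (gen l \<ast> gp i s) \<ast> part i s z) =
      dd i m (gen l) \<ast> part i m z + smul (Q l i ^ (m - 1)) (gen l \<ast> part i (m - 1) z)"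
  proof -
    obtain m' where m': "m = Suc m'" using m1 by (cases m) auto
    show ?thesis using px[of m] px[of m'] rg[of m'] by (simp add: m' bil_distribs add.commute)
  qed
  ultimately show "coeff_in E (part i (m - 1) z \<ast> gen l -
        smul lam (dd i m (gen l) \<ast> part i m z + smul (Q l i ^ (m - 1)) (gen l \<ast> part i (m - 1) z)))"
    using comb by simp
qed

lemma exists_top:
  assumes i: "i \<in> {1..n}" and v: "v \<in> Rs i" and s0: "\<not> coeff_in E (part i s0 v)"
  obtains s where "s \<ge> s0" "\<not> coeff_in E (part i s v)" "\<And>t. t > s \<Longrightarrow> coeff_in E (part i t v)"
proof -
  obtain d where d: "\<And>s. s > d \<Longrightarrow> part i s v = 0" using part_expand[OF i v] by blast
  let ?A = "{s. \<not> coeff_in E (part i s v)}"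
  have A: "?A \<subseteq> {..d}" using d by (force simp: not_less[symmetric])
  then have fin: "finite ?A" using finite_subset by blast
  show thesis
  proof (rule that[of "Max ?A"])
    show "s0 \<le> Max ?A" using fin s0 by auto
    show "\<not> coeff_in E (part i (Max ?A) v)" using Max_in[OF fin] s0 by auto
    show "coeff_in E (part i t v)" if "Max ?A < t" for t using Max_ge[OF fin, of t] that by force
  qed
qed

text \<open>Let \<open>m\<close> be the highest power of \<open>gen i\<close> that survives modulo
  \<open>E\<close> in any \<open>z k\<close>. As the \<open>r k\<close> do not involve
  \<open>gen i\<close>, the coefficients at \<open>m\<close> inherit the dependence. They commute
  with \<open>gen l\<close> only up to a further factor \<open>Q l i ^ m\<close>, which is why the
  twist \<open>\<theta>\<close> is carried along.\<close>

lemma central_rel_Suc: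
  assumes i: "i \<in> {1..n}" and c: "central_rel E i" shows "central_rel E (Suc i)"
proof -
  obtain N :: nat where N: "\<And>r. (\<forall>k\<le>N. r k \<in> Rs i \<and> coeff_in C (r k)) \<Longrightarrow>
     (\<exists>z \<theta>. \<theta> \<in> exps {1..<i} \<and> (\<forall>k\<le>N. z k \<in> Rs i \<and> coeff_in C (z k)) \<and> (\<exists>k\<le>N. \<not> coeff_in E (z k)) \<and>
       (\<forall>k\<le>N. \<forall>l\<in>{i..n}. coeff_in E (z k \<ast> gen l - smul (beta (sgl l 1) \<theta>) (gen l \<ast> z k))) \<and>
       coeff_in E (\<Sum>k\<le>N. z k \<ast> r k))" using c unfolding central_rel_def by blast
  show ?thesis unfolding central_rel_def
  proof (intro exI[of _ N] allI impI)
    fix r assume r: "\<forall>k\<le>N. r k \<in> Rs (Suc i) \<and> coeff_in C (r k)"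
    then obtain z \<theta> where z: "\<theta> \<in> exps {1..<i}" "\<And>k. k \<le> N \<Longrightarrow> z k \<in> Rs i \<and> coeff_in C (z k)"
      "\<exists>k\<le>N. \<not> coeff_in E (z k)"
      "\<And>k l. k \<le> N \<Longrightarrow> l \<in> {i..n} \<Longrightarrow> coeff_in E (z k \<ast> gen l - smul (beta (sgl l 1) \<theta>) (gen l \<ast> z k))"
      "coeff_in E (\<Sum>k\<le>N. z k \<ast> r k)" 
    proof -
      have "\<forall>k\<le>N. r k \<in> Rs i \<and> coeff_in C (r k)" using r Rs_Suc[of _ i] by blast
      from N[OF this] show thesis using that by blast
    qed
    let ?A = "{s. \<exists>k\<le>N. \<not> coeff_in E (part i s (z k))}"
    have "\<exists>d. \<forall>s>d. part i s (z k) = 0" if "k \<le> N" for k using part_expand[OF i, of "z k"] z(2)[OF that] by blast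
    then have "\<forall>k\<in>{..N}. \<exists>d. \<forall>s>d. part i s (z k) = 0" by simp
    then obtain d where d: "\<forall>k\<in>{..N}. \<forall>s>d k. part i s (z k) = 0" by (rule bchoice[THEN exE])
    have "?A \<subseteq> (\<Union>k\<le>N. {..d k})"
    proof
      fix s assume "s \<in> ?A"
      then obtain k where "k \<le> N" "\<not> coeff_in E (part i s (z k))" by blast
      then have "s \<le> d k" using d coeffE_zero by (metis atMost_iff not_le)
      then show "s \<in> (\<Union>k\<le>N. {..d k})" using \<open>k \<le> N\<close> by auto
    qed
    then have fin: "finite ?A" using finite_subset by blast
    have ne: "?A \<noteq> {}" using z(2,3) coeffE_expand[OF i] by blast
    define m where "m = Max ?A"
    have m: "m \<in> ?A" unfolding m_def using Max_in[OF fin ne] .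
    have hi: "coeff_in E (part i s (z k))" if "k \<le> N" "s > m" for s k
      
    proof (rule ccontr)
      assume "\<not> coeff_in E (part i s (z k))"
      then have "s \<le> m" unfolding m_def using that by (intro Max_ge[OF fin]) blast
      then show False using that by simp
    qed
    show "\<exists>z \<theta>. \<theta> \<in> exps {1..<Suc i} \<and> (\<forall>k\<le>N. z k \<in> Rs (Suc i) \<and> coeff_in C (z k)) \<and> (\<exists>k\<le>N. \<not> coeff_in E (z k)) \<and>
       (\<forall>k\<le>N. \<forall>l\<in>{Suc i..n}. coeff_in E (z k \<ast> gen l - smul (beta (sgl l 1) \<theta>) (gen l \<ast> z k))) \<and>
       coeff_in E (\<Sum>k\<le>N. z k \<ast> r k)"
    proof (intro exI[of _ "\<lambda>k. part i m (z k)"] exI[of _ "\<theta> + sgl i (int m)"] conjI allI impI ballI)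
      have "\<theta> \<in> exps {1..<Suc i}" using z(1) exps_mono[of "{1..<i}" "{1..<Suc i}"] by auto
      then show "\<theta> + sgl i (int m) \<in> exps {1..<Suc i}" using i by (intro exps_add exps_single) auto
      show "part i m (z k) \<in> Rs (Suc i)" if "k \<le> N" for k using part_Rs z(2)[OF that] by auto
      show "coeff_in C (part i m (z k))" if "k \<le> N" for k using coeffC_part z(2)[OF that] by auto
      show "\<exists>k\<le>N. \<not> coeff_in E (part i m (z k))" using m by auto
      show "coeff_in E (part i m (z k) \<ast> gen l - smul (beta (sgl l 1) (\<theta> + sgl i (int m))) (gen l \<ast> part i m (z k)))"
        if k: "k \<le> N" and l: "l \<in> {Suc i..n}" for k l
        using part_commutation(1)[OF i _ _ hi[OF k] l beta_C z(4)[OF k]] z(2)[OF k] l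
        by (simp add: beta_add_right beta_single_power)
      have "part i m (\<Sum>k\<le>N. z k \<ast> r k) = (\<Sum>k\<le>N. part i m (z k) \<ast> r k)"
        unfolding part_sum by (rule sum.cong) (use z(2) r part_mult[OF i] in auto)
      then show "coeff_in E (\<Sum>k\<le>N. part i m (z k) \<ast> r k)" using coeffE_part[OF z(5), of i m] by simp
    qed
  qed
qed

lemma central_rel_le: "central_rel E 1 \<Longrightarrow> 1 \<le> i \<Longrightarrow> i \<le> Suc n \<Longrightarrow> central_rel E i"
proof (induction i)
  case (Suc k)
  then show ?case using central_rel_Suc[of k] by (cases "k = 0") (auto simp: One_nat_def)
qed auto

text \<open>Applied to the powers of \<open>gen i\<close>: a dependence needs a coefficient of positive degree in \<open>gen i\<close>.\<close>

lemma exists_twisted_central: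
  assumes i: "i \<in> {1..n}" and c: "central_rel E i"
  obtains z \<theta> m where "\<theta> \<in> exps {1..<i}" "z \<in> Rs i" "coeff_in C z" "m \<ge> 1" "\<not> coeff_in E (part i m z)"
    "\<And>s. s > m \<Longrightarrow> coeff_in E (part i s z)"
    "\<And>l. l \<in> {i..n} \<Longrightarrow> coeff_in E (z \<ast> gen l - smul (beta (sgl l 1) \<theta>) (gen l \<ast> z))"
proof -
  obtain N :: nat where N: "\<And>r. (\<forall>k\<le>N. r k \<in> Rs i \<and> coeff_in C (r k)) \<Longrightarrow>
     (\<exists>z \<theta>. \<theta> \<in> exps {1..<i} \<and> (\<forall>k\<le>N. z k \<in> Rs i \<and> coeff_in C (z k)) \<and> (\<exists>k\<le>N. \<not> coeff_in E (z k)) \<and>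
       (\<forall>k\<le>N. \<forall>l\<in>{i..n}. coeff_in E (z k \<ast> gen l - smul (beta (sgl l 1) \<theta>) (gen l \<ast> z k))) \<and>
       coeff_in E (\<Sum>k\<le>N. z k \<ast> r k))" using c unfolding central_rel_def by blast
  have "\<forall>k\<le>N. gp i k \<in> Rs i \<and> coeff_in C (gp i k)" using gp_Rs[OF i] coeffC_gp by auto
  from N[OF this] obtain z \<theta> where z: "\<theta> \<in> exps {1..<i}" "\<And>k. k \<le> N \<Longrightarrow> z k \<in> Rs i \<and> coeff_in C (z k)"
      "\<exists>k\<le>N. \<not> coeff_in E (z k)"
      "\<And>k l. k \<le> N \<Longrightarrow> l \<in> {i..n} \<Longrightarrow> coeff_in E (z k \<ast> gen l - smul (beta (sgl l 1) \<theta>) (gen l \<ast> z k))"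
      "coeff_in E (\<Sum>k\<le>N. z k \<ast> gp i k)" by blast
  \<comment> \<open>Otherwise every \<open>z k\<close> is congruent to its part \<open>?b k\<close>
    free of \<open>gen i\<close>. With \<open>K\<close> the last index where \<open>z K\<close> is
    nonzero modulo \<open>E\<close>, the dependence has at \<open>gp i K\<close> the coefficient
    \<open>raut (sgl i (int K)) (?b K)\<close>, which cannot vanish modulo \<open>E\<close>.\<close>
  have "\<exists>k\<le>N. \<exists>s\<ge>1. \<not> coeff_in E (part i s (z k))"
  proof (rule ccontr)
    assume no: "\<not> (\<exists>k\<le>N. \<exists>s\<ge>1. \<not> coeff_in E (part i s (z k)))"
    let ?b = "\<lambda>k. part i 0 (z k)"
    have b: "?b k \<in> Rs (Suc i)" if "k \<le> N" for k using part_Rs z(2)[OF that] by auto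
    have pb: "part i s (?b k) = (if s = 0 then ?b k else 0)" if "k \<le> N" for k s
      using part_gp[OF i b[OF that], of s 0] by simp
    have zb: "coeff_in E (z k - ?b k)" if k: "k \<le> N" for k
    proof (rule coeffE_expand[OF i])
      show "z k - ?b k \<in> Rs i" using z(2)[OF k] Rs_Suc[OF b[OF k]] by auto
      show "coeff_in E (part i s (z k - ?b k))" for s
      proof (cases "s \<ge> 1")
        case True
        then have "coeff_in E (part i s (z k))" using no k by blast
        then show ?thesis using True k by (simp add: part_diff pb)
      next
        case False
        then have "s = 0" by (simp add: One_nat_def)
        then show ?thesis using k by (simp add: part_diff pb)
      qed
    qed
    let ?K = "{k. k \<le> N \<and> \<not> coeff_in E (z k)}"
    have fin: "finite ?K" by simp
    have ne: "?K \<noteq> {}" using z(3) by auto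
    define K where "K = Max ?K"
    have K: "K \<le> N" "\<not> coeff_in E (z K)" using Max_in[OF fin ne] by (auto simp: K_def)
    have hi: "coeff_in E (z k)" if "k \<le> N" "k > K" for k 
    proof (rule ccontr)
      assume "\<not> coeff_in E (z k)"
      then have "k \<le> K" unfolding K_def using that by (intro Max_ge[OF fin]) simp
      then show False using that by simp
    qed
    have t: "coeff_in E (part i K (z k \<ast> gp i k))" if k: "k \<le> N" "k \<noteq> K" for k
    proof (cases "k > K")
      case True
      then show ?thesis using hi k by (intro coeffE_part coeffE_mult1 coeffC_gp) auto
    next
      case False
      then have "part i K (?b k \<ast> gp i k) = 0" using part_expansion[OF i b[OF k(1)]] k by auto
      moreover have "coeff_in E (part i K ((z k - ?b k) \<ast> gp i k))" by (intro coeffE_part coeffE_mult1 coeffC_gp zb k)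
      ultimately show ?thesis by (simp add: bil_distribs part_diff)
    qed
    let ?rest = "\<Sum>k\<in>{..N} - {K}. part i K (z k \<ast> gp i k)"
    have 1: "(\<Sum>k\<le>N. part i K (z k \<ast> gp i k)) = part i K (z K \<ast> gp i K) + ?rest"
      by (rule sum.remove) (use K in auto)
    have 2: "coeff_in E ?rest" by (rule coeffE_sum) (use t in auto)
    have 3: "coeff_in E (\<Sum>k\<le>N. part i K (z k \<ast> gp i k))" using coeffE_part[OF z(5), of i K] by (simp add: part_sum)
    have "coeff_in E (part i K (z K \<ast> gp i K))" using coeffE_diff[OF 3 2] unfolding 1 by simp
    moreover have "coeff_in E (part i K ((z K - ?b K) \<ast> gp i K))" by (intro coeffE_part coeffE_mult1 coeffC_gp zb K)
    ultimately have "coeff_in E (part i K (z K \<ast> gp i K) - part i K ((z K - ?b K) \<ast> gp i K))" by (rule coeffE_diff)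
    then have "coeff_in E (part i K (?b K \<ast> gp i K))" by (simp add: bil_distribs part_diff)
    then have "coeff_in E (?b K)" using part_expansion[OF i b[OF K(1)], of K] by (simp add: coeffE_raut)
    then have "coeff_in E (z K - ?b K + ?b K)" by (rule coeffE_add[OF zb[OF K(1)]])
    then show False using K by simp
  qed
  then obtain k s where k: "k \<le> N" "s \<ge> 1" "\<not> coeff_in E (part i s (z k))" by blast
  obtain m where m: "m \<ge> s" "\<not> coeff_in E (part i m (z k))" "\<And>t. t > m \<Longrightarrow> coeff_in E (part i t (z k))"
    using exists_top[OF i _ k(3)] z(2)[OF k(1)] by blast
  show thesis by (rule that[of \<theta> "z k" m]) (use z k m in auto)
qed

end
end

context torus
begin

lemma exps_less_single: "m \<in> exps {Suc l..n} \<Longrightarrow> m < sgl l (1 :: int)"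
proof -
  assume m: "m \<in> exps {Suc l..n}"
  have "lkp m k = 0" if "k \<le> l" for k using m that by (force simp: exps_def in_keys_iff)
  then show ?thesis
    unfolding less_poly_mapping.rep_eq less_fun_def by (intro exI[of _ l]) (auto simp: lookup_single when_def)
qed

end

section \<open>Triangularity of the embedding, localization at a prime, and the resonant
  part\<close>

context solvable_coords
begin

text \<open>\<open>W l\<close> involves later variables only, and any monomial in these is smaller
  than \<open>Y l\<close> in the lexicographic order, whatever its exponents.\<close>

lemma omon_leading:
  assumes "m \<in> exps {j..n}" "1 \<le> j" "\<And>l. l \<in> {j..n} \<Longrightarrow> tri l (W l)"
  shows "below (toi m) (T.omon n (\<lambda>l. Y l + W l) m) \<and> lkp (T.omon n (\<lambda>l. Y l + W l) m) (toi m) = 1"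
  using assms(1)
proof (induction m rule: exponent_induct)
  case zero
  then show ?case by (auto simp: below_def)
next
  case (step l m)
  let ?X = "Y l + W l"
  have l: "l \<in> {1..n}" using step(1) assms(2) by auto
  have small: "k < sgl l 1" if "k \<in> kys (W l)" for k
    using assms(3)[OF step(1)] that by (auto simp: tri_def intro!: exps_less_single)
  then have b: "below (sgl l 1) ?X"
    using keys_add[of "Y l" "W l"] by (fastforce simp: below_def Y_def)
  have "sgl l 1 \<notin> kys (W l)" using small by blast
  then have t: "lkp ?X (sgl l 1) = 1" by (simp add: lookup_add Y_def in_keys_iff)
  have e: "eps (sgl l 1) (toi m) = 1"
    by (rule eps_ordered[of _ "{l}" _ "{l..n}"]) (use step(2) in \<open>auto intro: exps_single\<close>)
  have o: "T.omon n (\<lambda>l. Y l + W l) (sgl l 1 + m) = ?X \<star> T.omon n (\<lambda>l. Y l + W l) m"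
    by (rule T.omon_step[OF l step(2)])
  have s: "toi (sgl l 1 + m) = sgl l 1 + toi m" by (simp add: toi_add)
  show ?case unfolding o s
    using below_mul[OF b conjunct1[OF step(3)]] lookup_mul_top[OF b conjunct1[OF step(3)]] t e step(3) by simp
qed

lemma coeff_omon:
  assumes "scalars D" "\<And>l. l \<in> {1..n} \<Longrightarrow> coeff_in D (W l)" "m \<in> exps {1..n}"
  shows "coeff_in D (T.omon n (\<lambda>l. Y l + W l) m)"
  using assms(3)
proof (induction m rule: exponent_induct)
  case zero
  then show ?case by (simp add: coeff_single[OF assms(1)] D_one[OF assms(1)])
next
  case (step l m)
  then show ?case using assms(2) by (simp add: T.omon_step coeff_tm[OF assms(1)] coeff_add[OF assms(1)] coeff_Y[OF assms(1)])
qed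

text \<open>\<open>phi W\<close> is unitriangular. At the largest exponent whose coefficient is not
  in \<open>I\<close>, larger exponents contribute elements of \<open>I\<close> and smaller ones
  contribute nothing. Injectivity is the case \<open>I = {0}\<close>; the case
  \<open>I = ME E\<close> shows that nonzero elements modulo \<open>E\<close> have nonzero
  images.\<close>

lemma phi_reflect:
  assumes D: "scalars D" "\<And>l. l \<in> {1..n} \<Longrightarrow> coeff_in D (W l)"
    and I: "0 \<in> I" "\<And>x y. x \<in> I \<Longrightarrow> y \<in> I \<Longrightarrow> x + y \<in> I" "\<And>d x. d \<in> D \<Longrightarrow> x \<in> I \<Longrightarrow> d * x \<in> I"
    and j: "1 \<le> j" "\<And>l. l \<in> {j..n} \<Longrightarrow> tri l (W l)"
    and v: "v \<in> Rs j" "coeff_in I (phi W v)"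
  shows "coeff_in I v"
proof (rule ccontr)
  assume no: "\<not> coeff_in I v"
  let ?o = "T.omon n (\<lambda>l. Y l + W l)"
  define m where "m = Max {m \<in> kys v. lkp v m \<notin> I}"
  have ne: "{m \<in> kys v. lkp v m \<notin> I} \<noteq> {}" 
  proof -
    obtain k where "lkp v k \<notin> I" using no by (auto simp: coeff_in_def)
    then show ?thesis using I(1) by (auto simp: in_keys_iff intro!: exI[of _ k])
  qed
  have fin: "finite {m \<in> kys v. lkp v m \<notin> I}" by simp
  have m: "m \<in> kys v" "lkp v m \<notin> I" using Max_in[OF fin ne] by (auto simp: m_def)
  have hi: "lkp v a \<in> I" if "a > m" for a
  proof (rule ccontr)
    assume h: "lkp v a \<notin> I"
    then have "a \<in> kys v" using I(1) by (auto simp: in_keys_iff)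
    then have "a \<le> m" using h unfolding m_def by (intro Max_ge[OF fin]) auto
    then show False using that by simp
  qed
  have ex: "a \<in> exps {j..n}" if "a \<in> kys v" for a using v(1) that by (auto simp: Rs_def)
  have "lkp (phi W v) (toi m) = (\<Sum>a\<in>kys v. lkp v a * lkp (?o a) (toi m))"
    by (simp add: phi_def lin_def lookup_sum)
  also have "\<dots> = lkp v m * lkp (?o m) (toi m) + (\<Sum>a\<in>kys v - {m}. lkp v a * lkp (?o a) (toi m))"
    by (rule sum.remove) (use m in auto)
  also have "lkp (?o m) (toi m) = 1" using omon_leading[OF ex[OF m(1)] j(1), of W] j(2) by blast
  finally have e: "lkp v m = lkp (phi W v) (toi m) + - (\<Sum>a\<in>kys v - {m}. lkp v a * lkp (?o a) (toi m))" by simp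
  have "lkp v a * lkp (?o a) (toi m) \<in> I" if a: "a \<in> kys v - {m}" for a
  proof (cases "a > m")
    case True
    have "a \<in> exps {1..n}" using ex[of a] a j(1) exps_mono[of "{j..n}" "{1..n}"] by auto
    then have "lkp (?o a) (toi m) \<in> D" using coeff_omon[OF D] by (auto simp: coeff_in_def)
    from I(3)[OF this hi[OF True]] show ?thesis by (simp add: mult.commute)
  next
    case False
    then have "toi a < toi m" using a by (auto simp: toi_less)
    moreover have "below (toi a) (?o a)" using omon_leading[OF ex[of a] j(1), of W] j(2) a by blast
    ultimately have "lkp (?o a) (toi m) = 0" by (metis below_def in_keys_iff not_le)
    then show ?thesis using I(1) by simp
  qed
  then have "(\<Sum>a\<in>A. lkp v a * lkp (?o a) (toi m)) \<in> I" if "A \<subseteq> kys v - {m}" for A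
    using finite_subset[OF that] that by (induction A rule: infinite_finite_induct) (auto simp: I)
  then have "(\<Sum>a\<in>kys v - {m}. lkp v a * lkp (?o a) (toi m)) \<in> I" by blast
  then have "- 1 * (\<Sum>a\<in>kys v - {m}. lkp v a * lkp (?o a) (toi m)) \<in> I"
    using I(3)[OF D_uminus[OF D(1) D_one[OF D(1)]]] by blast
  moreover have "lkp (phi W v) (toi m) \<in> I" using v(2) by (simp add: coeff_in_def)
  ultimately have "lkp (phi W v) (toi m) + - 1 * (\<Sum>a\<in>kys v - {m}. lkp v a * lkp (?o a) (toi m)) \<in> I" using I(2) by blast
  then have "lkp v m \<in> I" using e by simp
  then show False using m by simp
qed

text \<open>The local ring of \<open>C\<close> at \<open>E\<close>, followed by its maximal ideal.
  The \<open>W l\<close> have denominators, so congruences make sense for them where these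
  denominators become units.\<close>

definition OE :: "'a set \<Rightarrow> 'a set" where "OE E = {a / b | a b. a \<in> C \<and> b \<in> C \<and> b \<notin> E}"
definition ME :: "'a set \<Rightarrow> 'a set" where "ME E = {a / b | a b. a \<in> E \<and> b \<in> C \<and> b \<notin> E}"

context
  fixes E assumes E: "prime_in E"
begin

lemma OE_den: "b \<in> C \<Longrightarrow> b \<notin> E \<Longrightarrow> d \<in> C \<Longrightarrow> d \<notin> E \<Longrightarrow> b * d \<in> C \<and> b * d \<notin> E \<and> b \<noteq> 0 \<and> d \<noteq> 0"
  using E_facts[OF E] C_mult by metis

lemma OE_E:
  assumes "x \<in> OE E" obtains a b where "x = a / b" "a \<in> C" "b \<in> C" "b \<notin> E" "b \<noteq> 0"
  using assms OE_den unfolding OE_def by blast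
lemma ME_E:
  assumes "x \<in> ME E" obtains a b where "x = a / b" "a \<in> E" "a \<in> C" "b \<in> C" "b \<notin> E" "b \<noteq> 0"
  using assms OE_den E_facts(1)[OF E] unfolding ME_def by blast
lemma OE_I: "a \<in> C \<Longrightarrow> b \<in> C \<Longrightarrow> b \<notin> E \<Longrightarrow> a / b \<in> OE E" by (auto simp: OE_def)
lemma ME_I: "a \<in> E \<Longrightarrow> b \<in> C \<Longrightarrow> b \<notin> E \<Longrightarrow> a / b \<in> ME E" by (auto simp: ME_def)

lemma C_OE: "C \<subseteq> OE E"
proof
  fix c assume "c \<in> C"
  then show "c \<in> OE E" using OE_I[of c 1] C_one E_facts(3)[OF E] by simp
qed

lemma scalars_OE: "scalars (OE E)"
  unfolding scalars_def
proof (intro conjI ballI C_OE)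
  fix x y assume "x \<in> OE E" "y \<in> OE E"
  obtain a b where x: "x = a / b" "a \<in> C" "b \<in> C" "b \<notin> E" "b \<noteq> 0" using OE_E[OF \<open>x \<in> OE E\<close>] .
  obtain c d where y: "y = c / d" "c \<in> C" "d \<in> C" "d \<notin> E" "d \<noteq> 0" using OE_E[OF \<open>y \<in> OE E\<close>] .
  have bd: "b * d \<in> C" "b * d \<notin> E" using OE_den x y by auto
  have "x + y = (a * d + c * b) / (b * d)" "x * y = (a * c) / (b * d)" using x y by (simp_all add: field_simps)
  then show "x + y \<in> OE E" "x * y \<in> OE E" using x y bd by (auto intro!: OE_I C_add C_mult)
qed

lemma ME_zero: "0 \<in> ME E" using ME_I[of 0 1] C_one E_facts[OF E] by simp

lemma ME_add: "x \<in> ME E \<Longrightarrow> y \<in> ME E \<Longrightarrow> x + y \<in> ME E"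
proof -
  assume "x \<in> ME E" "y \<in> ME E"
  obtain a b where x: "x = a / b" "a \<in> E" "a \<in> C" "b \<in> C" "b \<notin> E" "b \<noteq> 0" using ME_E[OF \<open>x \<in> ME E\<close>] .
  obtain c d where y: "y = c / d" "c \<in> E" "c \<in> C" "d \<in> C" "d \<notin> E" "d \<noteq> 0" using ME_E[OF \<open>y \<in> ME E\<close>] .
  have "x + y = (d * a + b * c) / (b * d)" using x y by (simp add: field_simps)
  then show "x + y \<in> ME E" using x y OE_den[of b d] E_facts[OF E] by (auto intro!: ME_I)
qed

lemma ME_mult: "x \<in> OE E \<Longrightarrow> y \<in> ME E \<Longrightarrow> x * y \<in> ME E"
proof -
  assume "x \<in> OE E" "y \<in> ME E"
  obtain a b where x: "x = a / b" "a \<in> C" "b \<in> C" "b \<notin> E" "b \<noteq> 0" using OE_E[OF \<open>x \<in> OE E\<close>] .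
  obtain c d where y: "y = c / d" "c \<in> E" "c \<in> C" "d \<in> C" "d \<notin> E" "d \<noteq> 0" using ME_E[OF \<open>y \<in> ME E\<close>] .
  have "x * y = (a * c) / (b * d)" using x y by simp
  then show "x * y \<in> ME E" using x y OE_den[of b d] E_facts[OF E] by (auto intro!: ME_I)
qed

lemma ME_frac: "a \<in> C \<Longrightarrow> b \<in> C \<Longrightarrow> b \<notin> E \<Longrightarrow> a / b \<in> ME E \<Longrightarrow> a \<in> E"
proof -
  assume h: "a \<in> C" "b \<in> C" "b \<notin> E" "a / b \<in> ME E"
  obtain c d where y: "a / b = c / d" "c \<in> E" "c \<in> C" "d \<in> C" "d \<notin> E" "d \<noteq> 0" using ME_E[OF h(4)] .
  have "b \<noteq> 0" using h E_facts[OF E] by auto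
  then have "a * d = b * c" using y by (simp add: field_simps)
  then have "a * d \<in> E" using E_facts(5)[OF E h(2) y(2)] by simp
  then show ?thesis using E_facts(6)[OF E h(1) y(4)] y(5) by blast
qed

lemma ME_C: "a \<in> C \<Longrightarrow> a \<in> ME E \<Longrightarrow> a \<in> E"
  using ME_frac[of a 1] C_one E_facts(3)[OF E] by simp

lemma E_ME: "E \<subseteq> ME E" 
proof
  fix c assume "c \<in> E"
  then show "c \<in> ME E" using ME_I[of c 1] C_one E_facts(3)[OF E] by simp
qed

lemma ME_prime: "x \<in> OE E \<Longrightarrow> y \<in> OE E \<Longrightarrow> x * y \<in> ME E \<Longrightarrow> x \<in> ME E \<or> y \<in> ME E"
proof -
  assume h: "x \<in> OE E" "y \<in> OE E" "x * y \<in> ME E"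
  obtain a b where x: "x = a / b" "a \<in> C" "b \<in> C" "b \<notin> E" "b \<noteq> 0" using OE_E[OF h(1)] .
  obtain c d where y: "y = c / d" "c \<in> C" "d \<in> C" "d \<notin> E" "d \<noteq> 0" using OE_E[OF h(2)] .
  have "(a * c) / (b * d) \<in> ME E" using h(3) x y by simp
  then have "a * c \<in> E" using ME_frac[of "a * c" "b * d"] OE_den[of b d] x y C_mult by auto
  then show ?thesis using E_facts(6)[OF E x(2) y(2)] x y ME_I by auto
qed

lemma ME_unit: "x \<in> OE E \<Longrightarrow> x * y = 1 \<Longrightarrow> y \<in> OE E \<Longrightarrow> x \<notin> ME E"
proof
  assume h: "x \<in> OE E" "x * y = 1" "y \<in> OE E" "x \<in> ME E"
  then have "1 \<in> ME E" using ME_mult[of y x] by (simp add: mult.commute)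
  then show False using ME_C[OF C_one] E_facts(3)[OF E] by blast
qed

lemma beta_OE: "beta a b \<in> OE E" using beta_C C_OE by blast
lemma eps_unit: "eps a b \<in> OE E" "eps a b \<notin> ME E"
proof -
  show 1: "eps a b \<in> OE E" using eps_C C_OE by blast
  have "eps a b * eps (- a) b = 1" by (simp add: eps_uminus)
  moreover have "eps (- a) b \<in> OE E" using eps_C C_OE by blast
  ultimately show "eps a b \<notin> ME E" using ME_unit 1 by blast
qed
lemma beta_unit: "beta a b \<notin> ME E"
  using ME_unit[OF beta_OE beta_flip beta_OE] .

lemma coeffM_add: "coeff_in (ME E) v \<Longrightarrow> coeff_in (ME E) w \<Longrightarrow> coeff_in (ME E) (v + w)"
  by (auto simp: coeff_in_def lookup_add ME_add)
lemma coeffM_smul: "coeff_in (ME E) v \<Longrightarrow> c \<in> OE E \<Longrightarrow> coeff_in (ME E) (smul c v)"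
  by (auto simp: coeff_in_def ME_mult)
lemma coeffM_uminus: "coeff_in (ME E) v \<Longrightarrow> coeff_in (ME E) (- v)"
  using coeffM_smul[of v "- 1"] C_uminus[OF C_one] C_OE by (auto simp: smul_uminus)
lemma coeffM_diff: "coeff_in (ME E) v \<Longrightarrow> coeff_in (ME E) w \<Longrightarrow> coeff_in (ME E) (v - w)"
  using coeffM_add[of v "- w"] coeffM_uminus by auto
lemma OE_mult: "x \<in> OE E \<Longrightarrow> y \<in> OE E \<Longrightarrow> x * y \<in> OE E" using scalars_OE by (auto simp: scalars_def)
lemma coeffM_mult1: "coeff_in (ME E) v \<Longrightarrow> coeff_in (OE E) w \<Longrightarrow> coeff_in (ME E) (v \<star> w)"
proof (rule coeff_in_bil[where I = "ME E" and J = "OE E"])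
  fix a b x y k assume "x \<in> ME E" "y \<in> OE E"
  then show "x * (y * lkp (tB a b) k) \<in> ME E"
    using ME_mult[of "y * lkp (tB a b) k" x] OE_mult[of y "lkp (tB a b) k"] eps_unit(1) ME_zero
    by (auto simp: tB_def lookup_single when_def mult.commute)
qed (auto simp: ME_zero ME_add)
lemma coeffM_mult2: "coeff_in (OE E) v \<Longrightarrow> coeff_in (ME E) w \<Longrightarrow> coeff_in (ME E) (v \<star> w)"
proof (rule coeff_in_bil[where I = "OE E" and J = "ME E"])
  fix a b x y k assume h: "x \<in> OE E" "y \<in> ME E"
  have "lkp (tB a b) k \<in> OE E" using eps_unit(1) D_zero[OF scalars_OE] by (auto simp: tB_def lookup_single when_def)
  then have "(x * lkp (tB a b) k) * y \<in> ME E" using h ME_mult OE_mult by blast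
  then show "x * (y * lkp (tB a b) k) \<in> ME E" by (simp add: mult.left_commute mult.commute)
qed (auto simp: ME_zero ME_add)
lemma coeffM_zero [simp]: "coeff_in (ME E) 0" by (simp add: coeff_in_def ME_zero)

end

lemma common_denominator:
  assumes "finite A" "A \<subseteq> F" shows "\<exists>f\<in>C. f \<noteq> 0 \<and> (\<forall>x\<in>A. f * x \<in> C)"
  using assms
proof (induction A rule: finite_induct)
  case empty
  then show ?case using C_one by (intro bexI[of _ 1]) auto
next
  case (insert x A)
  then obtain f where f: "f \<in> C" "f \<noteq> 0" "\<forall>x\<in>A. f * x \<in> C" by auto
  obtain a b where x: "x = a / b" "a \<in> C" "b \<in> C" "b \<noteq> 0" using insert.prems unfolding F_def by auto
  have "b * f * y \<in> C" if "y \<in> insert x A" for y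
  proof (cases "y = x")
    case True
    then have eq: "b * f * y = f * a" using x by simp
    show ?thesis unfolding eq by (rule C_mult[OF f(1) x(2)])
  next
    case False
    then show ?thesis using that f x C_mult[of b "f * y"] by (simp add: mult.assoc)
  qed
  then show ?case using f x by (intro bexI[of _ "b * f"]) (auto intro: C_mult)
qed

text \<open>Resonance against all variables of \<open>m\<close> gives
  \<open>beta m (sgl i 1 - m) = 1\<close>. Since \<open>beta m m = 1\<close>, the monomial with
  exponent \<open>m\<close> commutes with \<open>Y i\<close>.\<close>

lemma resonant_aut:
  assumes "resonant i (Suc i) u" "kys u \<subseteq> exps {Suc i..n}" shows "aut (sgl i k) u = u"
proof (rule poly_mapping_eqI)
  fix m
  show "lkp (aut (sgl i k) u) m = lkp u m"
  proof (cases "m \<in> kys u")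
    case True
    have "beta m (sgl i 1 - m) = beta m 0"
      by (rule beta_ext_left[of _ "{Suc i..n}"]) (use assms True in \<open>auto simp: resonant_def\<close>)
    then have "beta m (sgl i 1) = 1" by (simp add: beta_diff_right)
    have "beta m (sgl i k) = beta 0 (sgl i k)"
      by (rule beta_ext[of _ "{i}"]) (use \<open>beta m (sgl i 1) = 1\<close> in \<open>auto intro: exps_single\<close>)
    then show ?thesis by (simp add: lookup_aut)
  qed (simp add: lookup_aut in_keys_iff)
qed

text \<open>The steps of \<open>dd\<close> transport \<open>der i\<close> by powers of the
  automorphism. The inner parts add up to the twisted commutator with a sum of translates of
  \<open>V\<close>; the coefficients \<open>S l\<close> are fixed by the automorphism, so the
  resonant part is repeated \<open>s\<close> times. Writing \<open>Q l i ^ s / Q l i\<close> avoids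
  a truncated difference in the exponent.\<close>

lemma phi_dd:
  assumes i: "i \<in> {1..n}" and gW: "\<And>l. l \<in> {Suc i..n} \<Longrightarrow> good W l" and inn: "inn W i (Suc i) V S"
    and l: "l \<in> {Suc i..n}"
  shows "phi W (dd i s (gen l)) = smul (Q l i ^ s / Q l i)
     ((Y l + W l) \<star> (\<Sum>t<s. aut (sgl i (int t)) V) - smul (Q l i) ((\<Sum>t<s. aut (sgl i (int t)) V) \<star> (Y l + W l))
        + smul (of_nat s) (res S (Y l + W l)))"
proof (induction s)
  case (Suc s)
  let ?X = "Y l + W l" and ?a = "aut (sgl i (int s))" and ?S = "\<lambda>s. \<Sum>t<s. aut (sgl i (int t)) V"
  have h: "homog l l (W l)" using gW[OF l] by (simp add: good_def)
  have aX: "aut (sgl i (int s)) ?X = smul (Q l i ^ s) ?X" for s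
    using aut_gen_image[OF h, of "sgl i (int s)"] l i exps_single[of i "{1..<l}" "int s"] by (auto simp: beta_single_power)
  have aS: "?a (res S ?X) = smul (Q l i ^ s) (res S ?X)"
  proof -
    have "?a (S k) = smul 1 (S k)" if "k \<in> {1..n}" for k
      using resonant_aut[of i "S k"] inn that by (simp add: inn_def)
    from aut_res[of "sgl i (int s)" S 1, OF this] show ?thesis by (simp only: aX res_smul smul_one)
  qed
  have d: "phi W (der i (gen l)) = ?X \<star> V - V \<star> smul (Q l i) ?X + res S ?X"
    using inn l aX[of 1] by (simp add: inn_def)
  have "phi W (raut (sgl i (int s)) (der i (gen l))) = ?a (phi W (der i (gen l)))"
    using aut_phi[of "Suc i" W "der i (gen l)" "sgl i (int s)"] gW der_Rs[OF i gen_Rs[OF l]] i exps_single[of i "{1..<Suc i}" "int s"]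
    by (auto simp: good_def)
  also have "\<dots> = smul (Q l i ^ s) (?X \<star> ?a V - smul (Q l i) (?a V \<star> ?X) + res S ?X)"
  proof -
    have 1: "?a (?X \<star> V) = smul (Q l i ^ s) (?X \<star> ?a V)" by (simp only: aut_mult aX bil_smul_left)
    have 2: "?a (V \<star> smul (Q l i) ?X) = smul (Q l i ^ s) (smul (Q l i) (?a V \<star> ?X))"
      by (simp only: aut_mult aut_smul aX bil_smul_right scl_scl mult.commute)
    show ?thesis
      unfolding d aut_add[of _ "?X \<star> V - V \<star> smul (Q l i) ?X"] aut_diff[of _ "?X \<star> V"] 1 2 aS
      by (simp only: scl_add[symmetric] scl_diff[symmetric])
  qed
  finally have p: "phi W (raut (sgl i (int s)) (der i (gen l))) = smul (Q l i ^ s) (?X \<star> ?a V - smul (Q l i) (?a V \<star> ?X) + res S ?X)" .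
  have "phi W (dd i (Suc s) (gen l)) = smul (Q l i) (phi W (dd i s (gen l))) + phi W (raut (sgl i (int s)) (der i (gen l)))"
    by (simp add: sig_gen dd_smul phi_add phi_smul)
  also have "\<dots> = smul (Q l i ^ s) (?X \<star> ?S (Suc s) - smul (Q l i) (?S (Suc s) \<star> ?X) + smul (of_nat (Suc s)) (res S ?X))"
  proof -
    have "smul (Q l i) (phi W (dd i s (gen l))) = smul (Q l i ^ s) (?X \<star> ?S s - smul (Q l i) (?S s \<star> ?X) + smul (of_nat s) (res S ?X))"
      unfolding Suc.IH by (simp only: scl_scl) simp
    then show ?thesis unfolding p
      by (simp only: sum.lessThan_Suc bil_add_left bil_add_right of_nat_Suc smul_plus smul_one scl_add scl_diff) (simp add: algebra_simps)
  qed
  finally show ?case by simp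
qed simp

text \<open>A nonzero coefficient of \<open>S l0\<close> is kept alive modulo a prime
  \<open>E\<close> supplied by density. Let \<open>\<zeta>\<close> and \<open>\<zeta>1\<close> be
  the images of the two highest coefficients of a twisted central element of degree
  \<open>m \<ge> 1\<close> in \<open>gen i\<close>. After the inner part is absorbed into
  \<open>\<zeta>'\<close>, their relations modulo \<open>E\<close> read
  \<open>\<zeta> b = aut t1 b \<zeta>\<close> and
  \<open>\<zeta>' b = aut t0 b \<zeta>' + m res S (aut t0 b) \<zeta>\<close>. For
  \<open>b = Y l0\<close>, at the sum of the leading exponents of \<open>S l0\<close> and
  \<open>\<zeta>\<close>, resonance makes the terms with \<open>\<zeta>'\<close> cancel, while the
  last term is a product of elements outside the maximal ideal.\<close>

lemma resonant_part_vanishes: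
  assumes i: "i \<in> {1..n}" and gW: "\<And>l. l \<in> {Suc i..n} \<Longrightarrow> good W l" and cW: "\<And>l. l \<in> {1..n} \<Longrightarrow> coeff_in F (W l)"
    and inn: "inn W i (Suc i) V S"
    and char: "\<And>m::nat. m > 0 \<Longrightarrow> \<exists>c\<in>C. of_nat m * c = 1"
    and dens: "\<And>f. f \<in> C \<Longrightarrow> f \<noteq> 0 \<Longrightarrow> \<exists>E. prime_in E \<and> f \<notin> E \<and> central_rel E i"
    and l0: "l0 \<in> {1..n}"
  shows "S l0 = 0"
proof (rule ccontr)
  assume nz: "S l0 \<noteq> 0"
  have l0: "l0 \<in> {Suc i..n}"
    using inn nz l0 by (auto simp: inn_def not_less_eq_eq[symmetric])
  define \<mu> where "\<mu> = Max (kys (S l0))"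
  have \<mu>: "below \<mu> (S l0)" "lkp (S l0) \<mu> \<noteq> 0" using below_Max[OF nz] by (auto simp: \<mu>_def)
  let ?vals = "\<lambda>v. lkp v ` kys v"
  define AA where "AA = (\<Union>l\<in>{1..n}. ?vals (W l)) \<union> (\<Union>l\<in>{1..n}. ?vals (S l)) \<union> ?vals V"
  have AA: "?vals V \<subseteq> AA" "\<And>l. l \<in> {1..n} \<Longrightarrow> ?vals (W l) \<subseteq> AA" "\<And>l. l \<in> {1..n} \<Longrightarrow> ?vals (S l) \<subseteq> AA"
    unfolding AA_def by blast+
  have vF: "?vals v \<subseteq> F" if "coeff_in F v" for v :: "(nat \<Rightarrow>\<^sub>0 int) \<Rightarrow>\<^sub>0 'a" using that by (auto simp: coeff_in_def)
  have "AA \<subseteq> F" unfolding AA_def using cW inn by (intro Un_least UN_least vF) (auto simp: inn_def)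
  moreover have "finite AA" unfolding AA_def by simp
  ultimately have "\<exists>f\<in>C. f \<noteq> 0 \<and> (\<forall>x\<in>AA. f * x \<in> C)" by (intro common_denominator)
  then obtain f where f: "f \<in> C" "f \<noteq> 0" "\<And>x. x \<in> AA \<Longrightarrow> f * x \<in> C" by blast
  have l0n: "l0 \<in> {1..n}" using l0 by auto
  have "lkp (S l0) \<mu> \<in> ?vals (S l0)" using \<mu> by (auto simp: in_keys_iff)
  then have c0: "f * lkp (S l0) \<mu> \<in> C" using f(3) AA(3)[OF l0n] by blast
  \<comment> \<open>One factor \<open>f\<close> makes the common denominator a unit at
    \<open>E\<close>; the other turns the coefficient of \<open>S l0\<close> into an element of
    \<open>C\<close> that \<open>E\<close> can avoid.\<close>
  obtain E where E: "prime_in E" "f * (f * lkp (S l0) \<mu>) \<notin> E" "central_rel E i"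
    using dens[of "f * (f * lkp (S l0) \<mu>)"] C_mult[OF f(1) c0] f \<mu> by auto
  note EF = E_facts[OF E(1)]
  have fE: "f \<notin> E" using EF(5)[OF c0, of f] E(2) by (auto simp: mult.commute)
  have f0E: "f * lkp (S l0) \<mu> \<notin> E" using EF(5)[OF f(1)] E(2) by blast
  let ?D = "OE E" and ?M = "ME E"
  note D = scalars_OE[OF E(1)]
  have cD: "coeff_in ?D v" if "?vals v \<subseteq> AA" for v :: "(nat \<Rightarrow>\<^sub>0 int) \<Rightarrow>\<^sub>0 'a"
    unfolding coeff_in_def
  proof
    fix k
    show "lkp v k \<in> ?D"
    proof (cases "k \<in> kys v")
      case True
      then have "f * lkp v k \<in> C" using f(3) that by blast
      from OE_I[OF E(1) this f(1) fE] show ?thesis using f(2) by simp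
    qed (use D_zero[OF D] in \<open>simp add: in_keys_iff\<close>)
  qed
  have DW: "coeff_in ?D (W l)" and DS: "coeff_in ?D (S l)" if "l \<in> {1..n}" for l using cD AA(2,3) that by blast+
  have DV: "coeff_in ?D V" by (rule cD[OF AA(1)])
  have S0M: "lkp (S l0) \<mu> \<notin> ?M"
  proof
    assume "lkp (S l0) \<mu> \<in> ?M"
    then have "(f * lkp (S l0) \<mu>) / f \<in> ?M" using f(2) by simp
    then show False using ME_frac[OF E(1) c0 f(1) fE] f0E by blast
  qed
  obtain z \<theta> m where z: "\<theta> \<in> exps {1..<i}" "z \<in> Rs i" "coeff_in C z" "m \<ge> 1" "\<not> coeff_in E (part i m z)"
    "\<And>s. s > m \<Longrightarrow> coeff_in E (part i s z)"
    "\<And>l. l \<in> {i..n} \<Longrightarrow> coeff_in E (z \<ast> gen l - smul (beta (sgl l 1) \<theta>) (gen l \<ast> z))"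
    by (rule exists_twisted_central[OF E(1) i E(3)]) (rule that)
  define zm where "zm = part i m z"
  define z1 where "z1 = part i (m - 1) z"
  have zR: "zm \<in> Rs (Suc i)" "z1 \<in> Rs (Suc i)" using part_Rs[OF z(2)] by (auto simp: zm_def z1_def)
  have zC: "coeff_in C zm" "coeff_in C z1" using coeffC_part[OF E(1) z(3)] by (auto simp: zm_def z1_def)
  have tri: "tri l (W l)" "homog l l (W l)" if "l \<in> {Suc i..n}" for l using gW[OF that] by (auto simp: good_def)
  have R1: "v \<in> Rs 1" if "v \<in> Rs (Suc i)" for v using that Rs_mono[of 1 "Suc i"] by auto
  have phiC: "coeff_in ?D (phi W v)" if "coeff_in C v" "v \<in> Rs (Suc i)" for v
    using that C_OE[OF E(1)] DW by (intro coeff_phi[where W = W, OF D] R1) (auto simp: coeff_in_def)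
  have phiE: "coeff_in ?M (phi W v)" if v: "coeff_in E v" "v \<in> Rs (Suc i)" for v
    unfolding phi_def
  proof (rule coeff_in_lin[where I = E and J = ?D])
    fix a assume "a \<in> kys v"
    then have "a \<in> exps {1..n}" using R1[OF v(2)] by (auto simp: Rs_def)
    then show "coeff_in ?D (T.omon n (\<lambda>l. Y l + W l) a)"
      by (intro coeff_omon[where W = W, OF D]) (use DW in auto)
  next
    fix x y assume "x \<in> E" "y \<in> ?D"
    then show "x * y \<in> ?M" using E_ME[OF E(1)] ME_mult[OF E(1), of y x] by (auto simp: mult.commute)
  qed (use v ME_zero[OF E(1)] ME_add[OF E(1)] in auto)
  define \<zeta> where "\<zeta> = phi W zm"
  define \<zeta>1 where "\<zeta>1 = phi W z1"
  have D\<zeta>: "coeff_in ?D \<zeta>" "coeff_in ?D \<zeta>1" using phiC zC zR by (auto simp: \<zeta>_def \<zeta>1_def)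
  have \<zeta>M: "\<not> coeff_in ?M \<zeta>"
  proof
    assume "coeff_in ?M \<zeta>"
    then have "coeff_in ?M (phi W zm)" by (simp add: \<zeta>_def)
    have "coeff_in ?M zm"
      by (rule phi_reflect[where D = ?D and W = W and j = "Suc i"])
        (fact D DW ME_zero[OF E(1)] ME_add[OF E(1)] ME_mult[OF E(1)] tri(1) zR(1) \<open>coeff_in ?M (phi W zm)\<close> | simp)+
    then have "coeff_in E zm" using ME_C[OF E(1)] zC(1) by (auto simp: coeff_in_def)
    then show False using z(5) by (simp add: zm_def)
  qed
  let ?SV = "\<Sum>t<m. aut (sgl i (int t)) V"
  have DSV: "coeff_in ?D ?SV" by (intro coeff_sum[OF D] coeff_aut[OF D] DV)
  \<comment> \<open>Adding \<open>?SV\<close> times the relation for \<open>\<zeta>\<close> to that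
    for \<open>\<zeta>1\<close> removes the terms with \<open>V\<close>.\<close>
  define \<zeta>' where "\<zeta>' = \<zeta>1 + ?SV \<star> \<zeta>"
  have D\<zeta>': "coeff_in ?D \<zeta>'" unfolding \<zeta>'_def by (intro coeff_add[OF D] coeff_tm[OF D] DSV D\<zeta>)
  \<comment> \<open>The twists belonging to the coefficients at \<open>m - 1\<close> and
    \<open>m\<close>; the subtraction takes place in the integers.\<close>
  define t0 where "t0 = \<theta> + sgl i (int m - 1)"
  define t1 where "t1 = \<theta> + sgl i (int m)"
  have t01: "sgl i 1 + t0 = t1" by (simp add: t0_def t1_def single_add[symmetric] ac_simps)
  define B1 where "B1 = (\<lambda>b. \<zeta> \<star> b - aut t1 b \<star> \<zeta>)"
  define B2 where "B2 = (\<lambda>b. \<zeta>' \<star> b - aut t0 b \<star> \<zeta>' - smul (of_nat m) (res S (aut t0 b) \<star> \<zeta>))"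
  have t_exps: "t0 \<in> exps {1..<Suc i}" "t1 \<in> exps {1..<Suc i}"
    unfolding t0_def t1_def using z(1) exps_mono[of "{1..<i}" "{1..<Suc i}"] i by (auto intro!: exps_add exps_single)
  have XB: "coeff_in ?M (B1 (Y l + W l)) \<and> coeff_in ?M (B2 (Y l + W l))" if l: "l \<in> {Suc i..n}" for l
  proof -
    let ?X = "Y l + W l" and ?q = "Q l i" and ?lam = "beta (sgl l 1) \<theta>"
    have ln: "l \<in> {1..n}" "l \<in> {i..n}" using l by auto
    have gl: "gen l \<in> Rs (Suc i)" by (rule gen_Rs[OF l])
    have te: "t0 \<in> exps {1..<l}" "t1 \<in> exps {1..<l}" using t_exps exps_mono[of "{1..<Suc i}" "{1..<l}"] l by auto
    obtain m' where m': "m = Suc m'" using z(4) by (cases m) auto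
    have b1: "beta (sgl l 1) t1 = ?lam * ?q ^ m" by (simp add: t1_def beta_add_right beta_single_power)
    have b0: "beta (sgl l 1) t0 = ?lam * ?q ^ (m - 1)"
      using beta_single_power[of l i m'] by (simp add: t0_def beta_add_right m')
    have a1: "aut t1 ?X = smul (?lam * ?q ^ m) ?X" and a0: "aut t0 ?X = smul (?lam * ?q ^ (m - 1)) ?X"
      using aut_gen_image[OF tri(2)[OF l]] te by (auto simp: b0 b1)
    have pc1: "coeff_in E (zm \<ast> gen l - smul (?lam * ?q ^ m) (gen l \<ast> zm))"
      unfolding zm_def by (rule part_commutation(1)[OF E(1) i z(2,3) _ l beta_C z(7)[OF ln(2)]]) (rule z(6))
    have pc2: "coeff_in E (z1 \<ast> gen l - smul ?lam (dd i m (gen l) \<ast> zm + smul (?q ^ (m - 1)) (gen l \<ast> z1)))"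
      unfolding zm_def z1_def
      by (rule part_commutation(2)[OF E(1) i z(2,3) _ l beta_C z(7)[OF ln(2)] z(4)]) (rule z(6))
    have "coeff_in ?M (phi W (zm \<ast> gen l - smul (?lam * ?q ^ m) (gen l \<ast> zm)))"
      using zR gl by (intro phiE[OF pc1]) (auto intro!: Rs_diff Rs_smul Rs_mult)
    then have M1: "coeff_in ?M (B1 ?X)"
      using phi_mult[of "Suc i" W] gW i zR gl ln
      by (simp add: B1_def a1 phi_diff phi_smul \<zeta>_def bil_smul_left)
    have "coeff_in ?M (phi W (z1 \<ast> gen l - smul ?lam (dd i m (gen l) \<ast> zm + smul (?q ^ (m - 1)) (gen l \<ast> z1))))"
      using zR gl dd_Rs[OF i gl]
      by (intro phiE[OF pc2]) (auto intro!: Rs_diff Rs_add Rs_smul Rs_mult)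
    then have "coeff_in ?M (\<zeta>1 \<star> ?X - smul ?lam (phi W (dd i m (gen l)) \<star> \<zeta> + smul (?q ^ (m - 1)) (?X \<star> \<zeta>1)))"
      using phi_mult[of "Suc i" W] gW i zR gl ln dd_Rs[OF i gl]
      by (simp add: phi_diff phi_smul phi_add \<zeta>_def \<zeta>1_def)
    then have M2: "coeff_in ?M (\<zeta>1 \<star> ?X - smul ?lam (phi W (dd i m (gen l)) \<star> \<zeta> + smul (?q ^ (m - 1)) (?X \<star> \<zeta>1)) + ?SV \<star> B1 ?X)"
      by (intro coeffM_add[OF E(1)] coeffM_mult2[OF E(1) DSV M1])
    have qq: "?q ^ m / ?q = ?q ^ (m - 1)" by (simp add: m')
    have qm: "?q ^ m = ?q ^ (m - 1) * ?q" by (simp add: m')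
    have pd: "phi W (dd i m (gen l)) = smul (?q ^ (m - 1)) (?X \<star> ?SV - smul ?q (?SV \<star> ?X) + smul (of_nat m) (res S ?X))"
      unfolding qq[symmetric] by (rule phi_dd[OF i _ inn l]) (rule gW)
    have id: "a1 \<star> x - smul lam (smul r (x \<star> s - smul q (s \<star> x) + smul k t) \<star> a + smul r (x \<star> a1)) +
        s \<star> (a \<star> x - smul (lam * (r * q)) x \<star> a) =
        (a1 + s \<star> a) \<star> x - smul (lam * r) x \<star> (a1 + s \<star> a) - smul k (smul (lam * r) t \<star> a)" for a1 x lam r s q k t a
      by (simp add: bil_distribs scl_add scl_diff scl_scl T.mul_assoc algebra_simps)
    have "\<zeta>1 \<star> ?X - smul ?lam (phi W (dd i m (gen l)) \<star> \<zeta> + smul (?q ^ (m - 1)) (?X \<star> \<zeta>1)) + ?SV \<star> B1 ?X = B2 ?X"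
      unfolding pd B1_def B2_def a0 a1 \<zeta>'_def qm res_smul by (rule id)
    then show ?thesis using M1 M2 by simp
  qed
  have reS: "\<And>l. l \<in> {1..n} \<Longrightarrow> resonant i (Suc i) (S l)" using inn by (auto simp: inn_def)
  have B1m: "B1 (a \<star> b) = B1 a \<star> b + aut t1 a \<star> B1 b" for a b
    unfolding B1_def by (simp add: aut_mult bil_distribs T.mul_assoc)
  have B2m: "B2 (a \<star> b) = B2 a \<star> b + aut t0 a \<star> B2 b + smul (of_nat m) (res S (aut t0 a) \<star> B1 b)"
    if b: "kys b \<subseteq> exps {Suc i..n}" for a b
  proof -
    have k: "kys (aut t0 b) \<subseteq> exps {Suc i..n}" using keys_aut b by (rule subset_trans)
    have r: "res S (aut t0 (a \<star> b)) = aut t0 a \<star> res S (aut t0 b) + res S (aut t0 a) \<star> aut t1 b"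
      unfolding aut_mult by (subst res_mult[OF reS k]) (auto simp: aut_aut t01)
    show ?thesis unfolding B1_def B2_def r
      by (simp add: aut_mult bil_distribs T.mul_assoc scl_add scl_diff)
  qed
  let ?Pr = "\<lambda>b. kys b \<subseteq> exps {Suc i..n} \<and> coeff_in ?D b \<and> coeff_in ?M (B1 b) \<and> coeff_in ?M (B2 b)"
  have Dres: "coeff_in ?D (res S (aut t0 b))" if "coeff_in ?D b" for b
    by (intro coeff_res[OF D] coeff_aut[OF D] that DS)
  have Dm: "of_nat m \<in> ?D" by (rule D_of_nat[OF D])
  note ad = coeffM_add[OF E(1)] and di = coeffM_diff[OF E(1)] and sm = coeffM_smul[OF E(1) _ Dm]
    and n1 = coeffM_mult1[OF E(1)] and n2 = coeffM_mult2[OF E(1)]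
  \<comment> \<open>The congruences are known for the elements \<open>Y l + W l\<close>.
    \<open>B1\<close> and \<open>B2\<close> obey twisted Leibniz rules, that for \<open>B2\<close>
    with a term in \<open>B1\<close>, so both congruences together extend to products and inverses
    and hence to \<open>Y l0\<close>.\<close>
  have BY: "?Pr (Y l0)"
  proof (rule laurent_closure[where D = ?D and W = W and j = "Suc i" and Pr = ?Pr])
    show "0 \<in> ?D" "1 \<in> ?D" "\<And>c. c \<in> ?D \<Longrightarrow> - c \<in> ?D" using D_zero[OF D] D_one[OF D] D_uminus[OF D] by auto
    show "Suc i \<le> Suc n" using i by auto
    show "kys (Y l0) \<subseteq> exps {Suc i..n}" by (rule keys_Y[OF l0])
    show "coeff_in ?D (Y l0)" by (rule coeff_Y[OF D])
    show "?Pr (sgl 0 c)" if "c \<in> ?D" for c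
    proof -
      have "B1 (sgl 0 c) = 0" "B2 (sgl 0 c) = 0" by (simp_all add: B1_def B2_def tm_scalar res_scalar)
      moreover have "kys (sgl 0 c :: (nat \<Rightarrow>\<^sub>0 int) \<Rightarrow>\<^sub>0 'a) \<subseteq> exps {Suc i..n}" by auto
      ultimately show ?thesis by (simp add: coeff_single[OF D that] coeffM_zero[OF E(1)])
    qed
    show "?Pr (v + w)" if "?Pr v" "?Pr w" for v w
    proof -
      have "B1 (v + w) = B1 v + B1 w" "B2 (v + w) = B2 v + B2 w"
        unfolding B1_def B2_def by (simp_all add: bil_distribs aut_add res_add scl_add algebra_simps)
      then show ?thesis using that keys_add[of v w] by (auto intro!: ad coeff_add[OF D])
    qed
    show "?Pr (v \<star> w)" if "?Pr v" "?Pr w" for v w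
    proof -
      have vw: "coeff_in ?D v" "coeff_in ?D w" "coeff_in ?M (B1 v)" "coeff_in ?M (B1 w)"
        "coeff_in ?M (B2 v)" "coeff_in ?M (B2 w)" "kys w \<subseteq> exps {Suc i..n}" using that by auto
      have "coeff_in ?M (B2 (v \<star> w))" unfolding B2m[OF vw(7)]
        by (rule ad[OF ad[OF n1[OF vw(5,2)] n2[OF coeff_aut[OF D vw(1)] vw(6)]] sm[OF n2[OF Dres[OF vw(1)] vw(4)]]])
      moreover have "coeff_in ?M (B1 (v \<star> w))" unfolding B1m
        by (rule ad[OF n1[OF vw(3,2)] n2[OF coeff_aut[OF D vw(1)] vw(4)]])
      ultimately show ?thesis using that keys_mul_subset[of v _ w] by (auto intro!: coeff_tm[OF D])
    qed
    fix l assume l: "l \<in> {Suc i..n}"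
    have ln: "l \<in> {1..n}" using l by auto
    show "kys (W l) \<subseteq> exps {Suc l..n} \<and> coeff_in ?D (W l)" using tri(1)[OF l] DW[OF ln] by (simp add: tri_def)
    show "?Pr (Y l + W l)"
      using XB[OF l] keys_gen_image[OF l tri(1)[OF l]] coeff_add[OF D coeff_Y[OF D] DW[OF ln]] by blast
    assume YP: "?Pr (Y l)"
    let ?Yi = "sgl (sgl l (- 1)) 1"
    have kYi: "kys ?Yi \<subseteq> exps {Suc i..n}" using l by (auto simp: exps_def)
    have DYi: "coeff_in ?D ?Yi" by (rule coeff_single[OF D D_one[OF D]])
    have unit: "coeff_in ?M v" if "coeff_in ?M (aut t (Y l) \<star> v)" for t v
    proof -
      have "smul (beta t (sgl l 1)) (?Yi \<star> (aut t (Y l) \<star> v)) = v"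
      proof -
        have "aut t (Y l) = smul (beta (sgl l 1) t) (Y l)" by (simp add: Y_def)
        then show ?thesis
          by (simp add: bil_smul_left bil_smul_right scl_scl T.mul_assoc[symmetric] Y_left_inverse beta_flip)
      qed
      moreover have "coeff_in ?M (smul (beta t (sgl l 1)) (?Yi \<star> (aut t (Y l) \<star> v)))"
        by (intro coeffM_smul[OF E(1)] coeffM_mult2[OF E(1) DYi that] beta_OE[OF E(1)])
      ultimately show ?thesis by simp
    qed
    have B10: "B1 (sgl 0 1) = 0" "B2 (sgl 0 1) = 0" by (simp_all add: B1_def B2_def res_scalar)
    have "B1 (Y l) \<star> ?Yi + aut t1 (Y l) \<star> B1 ?Yi = 0" using B1m[of "Y l" ?Yi] B10 by (simp add: Y_right_inverse)
    then have "aut t1 (Y l) \<star> B1 ?Yi = 0 - B1 (Y l) \<star> ?Yi" by (simp add: eq_neg_iff_add_eq_0 add.commute)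
    moreover have "coeff_in ?M (0 - B1 (Y l) \<star> ?Yi)" using YP by (intro di n1 DYi coeffM_zero[OF E(1)]) auto
    ultimately have M1: "coeff_in ?M (B1 ?Yi)" using unit by metis
    have "B2 (Y l) \<star> ?Yi + aut t0 (Y l) \<star> B2 ?Yi + smul (of_nat m) (res S (aut t0 (Y l)) \<star> B1 ?Yi) = 0"
      using B2m[OF kYi, of "Y l"] B10 by (simp add: Y_right_inverse)
    then have "aut t0 (Y l) \<star> B2 ?Yi = 0 - B2 (Y l) \<star> ?Yi - smul (of_nat m) (res S (aut t0 (Y l)) \<star> B1 ?Yi)"
      by (simp add: algebra_simps eq_neg_iff_add_eq_0)
    moreover have "coeff_in ?M (0 - B2 (Y l) \<star> ?Yi - smul (of_nat m) (res S (aut t0 (Y l)) \<star> B1 ?Yi))"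
      using YP by (intro di sm n1[of _ ?Yi] n2[OF Dres M1] DYi coeffM_zero[OF E(1)]) auto
    ultimately have "coeff_in ?M (B2 ?Yi)" using unit by metis
    then show "?Pr ?Yi" using kYi DYi M1 by blast
  qed
  let ?e = "sgl l0 1" and ?Yi = "sgl (sgl l0 (- 1)) 1"
  have DYi: "coeff_in ?D ?Yi" by (rule coeff_single[OF D D_one[OF D]])
  have autY: "aut t (Y l0) = smul (beta ?e t) (Y l0)" for t by (simp add: Y_def)
  have M1: "coeff_in ?M (aut ?e \<zeta> - smul (beta ?e t1) \<zeta>)"
  proof -
    have "?Yi \<star> B1 (Y l0) = aut ?e \<zeta> - smul (beta ?e t1) \<zeta>"
      unfolding B1_def bil_diff_right Y_commute[of \<zeta>] autY
      by (simp add: bil_distribs T.mul_assoc[symmetric] Y_left_inverse)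
    then show ?thesis using coeffM_mult2[OF E(1) DYi, of "B1 (Y l0)"] BY by simp
  qed
  let ?p = "beta ?e t0"
  have M2: "coeff_in ?M (aut ?e \<zeta>' - smul ?p \<zeta>' - smul (of_nat m * ?p) (S l0 \<star> \<zeta>))"
  proof -
    have "?Yi \<star> B2 (Y l0) = aut ?e \<zeta>' - smul ?p \<zeta>' - smul (of_nat m * ?p) (S l0 \<star> \<zeta>)"
      unfolding B2_def bil_diff_right Y_commute[of \<zeta>'] autY res_smul res_Y[OF l0n]
      by (simp add: bil_distribs T.mul_assoc[symmetric] Y_left_inverse scl_scl)
    then show ?thesis using coeffM_mult2[OF E(1) DYi, of "B2 (Y l0)"] BY by simp
  qed
  \<comment> \<open>The leading exponent of \<open>\<zeta>\<close> modulo the maximal ideal; larger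
    exponents may occur in \<open>\<zeta>\<close>, but their coefficients lie in the maximal
    ideal.\<close>
  define \<nu> where "\<nu> = Max {k \<in> kys \<zeta>. lkp \<zeta> k \<notin> ?M}"
  have fin: "finite {k \<in> kys \<zeta>. lkp \<zeta> k \<notin> ?M}" by simp
  have ne: "{k \<in> kys \<zeta>. lkp \<zeta> k \<notin> ?M} \<noteq> {}"
  proof -
    obtain k where "lkp \<zeta> k \<notin> ?M" using \<zeta>M by (auto simp: coeff_in_def)
    then show ?thesis using ME_zero[OF E(1)] by (auto simp: in_keys_iff intro!: exI[of _ k])
  qed
  have \<nu>: "lkp \<zeta> \<nu> \<notin> ?M" using Max_in[OF fin ne] by (auto simp: \<nu>_def)
  have \<zeta>hi: "lkp \<zeta> k \<in> ?M" if "k > \<nu>" for k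
  proof (rule ccontr)
    assume h: "lkp \<zeta> k \<notin> ?M"
    then have "k \<in> kys \<zeta>" using ME_zero[OF E(1)] by (auto simp: in_keys_iff)
    then have "k \<le> \<nu>" unfolding \<nu>_def using h by (intro Max_ge[OF fin]) auto
    then show False using that by simp
  qed
  note bO = beta_OE[OF E(1)]
  have Ddiff: "x - y \<in> ?D" if "x \<in> ?D" "y \<in> ?D" for x y
    using D_add[OF D that(1) D_uminus[OF D that(2)]] by simp
  have \<zeta>D: "lkp \<zeta> k \<in> ?D" "lkp \<zeta>' k \<in> ?D" "lkp (S l0) k \<in> ?D" for k
    using D\<zeta> D\<zeta>' DS[OF l0n] by (auto simp: coeff_in_def)
  have "lkp (aut ?e \<zeta> - smul (beta ?e t1) \<zeta>) \<nu> \<in> ?M" using M1 by (simp add: coeff_in_def)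
  then have "lkp \<zeta> \<nu> * (beta \<nu> ?e - beta ?e t1) \<in> ?M" by (simp add: lookup_minus lookup_aut algebra_simps)
  then have dM: "beta \<nu> ?e - beta ?e t1 \<in> ?M" using ME_prime[OF E(1) \<zeta>D(1) Ddiff[OF bO bO]] \<nu> by blast
  have rs: "beta ?e (sgl i 1) * beta \<mu> ?e = 1"
  proof -
    have "\<mu> \<in> kys (S l0)" using \<mu> by (simp add: in_keys_iff)
    then have "beta ?e (sgl i 1 - \<mu>) = 1" using reS[OF l0n] l0 by (auto simp: resonant_def)
    then show ?thesis by (simp add: beta_diff_right)
  qed
  have "beta ?e t1 = beta ?e (sgl i 1) * ?p" using t01 beta_add_right by metis
  then have "beta \<mu> ?e * beta ?e t1 = (beta ?e (sgl i 1) * beta \<mu> ?e) * ?p" by simp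
  then have bp: "beta \<mu> ?e * beta ?e t1 = ?p" using rs by simp
  let ?k = "\<mu> + \<nu>"
  have "lkp (aut ?e \<zeta>' - smul ?p \<zeta>' - smul (of_nat m * ?p) (S l0 \<star> \<zeta>)) ?k \<in> ?M" using M2 by (simp add: coeff_in_def)
  then have "lkp \<zeta>' ?k * (beta \<mu> ?e * beta \<nu> ?e - ?p) - of_nat m * ?p * lkp (S l0 \<star> \<zeta>) ?k \<in> ?M"
    by (simp add: lookup_minus lookup_add lookup_aut beta_add_left algebra_simps)
  \<comment> \<open>Resonance of \<open>\<mu>\<close> and the congruence \<open>dM\<close> at
    \<open>\<nu>\<close> make the eigenvalue difference at \<open>?k\<close> vanish modulo the
    maximal ideal, so the unknown coefficient of \<open>\<zeta>'\<close> drops out.\<close>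
  moreover have "beta \<mu> ?e * beta \<nu> ?e - ?p = beta \<mu> ?e * (beta \<nu> ?e - beta ?e t1)" using bp by (simp add: algebra_simps)
  moreover have "lkp \<zeta>' ?k * (beta \<mu> ?e * (beta \<nu> ?e - beta ?e t1)) \<in> ?M"
    by (intro ME_mult[OF E(1)] \<zeta>D bO dM)
  moreover have subM: "y \<in> ?M" if "x \<in> ?M" "x - y \<in> ?M" for x y
  proof -
    have "x + - 1 * (x - y) \<in> ?M"
      by (intro ME_add[OF E(1)] that ME_mult[OF E(1) D_uminus[OF D D_one[OF D]]])
    then show ?thesis by simp
  qed
  ultimately have "of_nat m * ?p * lkp (S l0 \<star> \<zeta>) ?k \<in> ?M" by metis
  then have M3: "of_nat m * (?p * lkp (S l0 \<star> \<zeta>) ?k) \<in> ?M" by (simp add: mult.assoc)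
  have SzD: "lkp (S l0 \<star> \<zeta>) k \<in> ?D" for k using coeff_tm[OF D DS[OF l0n] D\<zeta>(1)] by (simp add: coeff_in_def)
  have mM: "of_nat m \<notin> ?M"
  proof -
    obtain c where "c \<in> C" "of_nat m * c = 1" using char[of m] z(4) by auto
    then show ?thesis using ME_unit[OF E(1) Dm, of c] C_OE[OF E(1)] by blast
  qed
  have M4: "lkp (S l0 \<star> \<zeta>) ?k \<in> ?M"
    using ME_prime[OF E(1) Dm OE_mult[OF E(1) bO SzD] M3] mM ME_prime[OF E(1) bO SzD] beta_unit[OF E(1)] by blast
  let ?g = "\<lambda>a. lkp (S l0) a * lkp \<zeta> (?k - a) * eps a (?k - a)"
  have "lkp (S l0 \<star> \<zeta>) ?k = sum ?g (kys (S l0))" by (rule lookup_mul) auto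
  also have "\<dots> = ?g \<mu> + sum ?g (kys (S l0) - {\<mu>})" by (rule sum.remove) (use \<mu> in \<open>auto simp: in_keys_iff\<close>)
  finally have e: "?g \<mu> = lkp (S l0 \<star> \<zeta>) ?k + - 1 * sum ?g (kys (S l0) - {\<mu>})" by simp
  have small: "?g a \<in> ?M" if a: "a \<in> kys (S l0) - {\<mu>}" for a
  proof -
    have "a < \<mu>" using a \<mu>(1) by (auto simp: below_def order.strict_iff_order)
    then have "\<nu> < ?k - a" by (simp add: algebra_simps)
    then have "(lkp (S l0) a * eps a (?k - a)) * lkp \<zeta> (?k - a) \<in> ?M"
      by (intro ME_mult[OF E(1)] OE_mult[OF E(1)] \<zeta>D eps_unit[OF E(1)] \<zeta>hi)
    then show ?thesis by (simp add: ac_simps)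
  qed
  have "sum ?g A \<in> ?M" if "A \<subseteq> kys (S l0) - {\<mu>}" for A
    using finite_subset[OF that] that small
    by (induction A rule: infinite_finite_induct) (auto simp: ME_zero[OF E(1)] intro!: ME_add[OF E(1)])
  then have "sum ?g (kys (S l0) - {\<mu>}) \<in> ?M" by blast
  then have "?g \<mu> \<in> ?M" unfolding e
    by (intro ME_add[OF E(1)] M4 ME_mult[OF E(1) D_uminus[OF D D_one[OF D]]])
  then have "lkp (S l0) \<mu> * lkp \<zeta> \<nu> * eps \<mu> \<nu> \<in> ?M" by simp
  then have "lkp (S l0) \<mu> * lkp \<zeta> \<nu> \<in> ?M"
    using ME_prime[OF E(1) OE_mult[OF E(1) \<zeta>D(3) \<zeta>D(1)] eps_unit(1)[OF E(1)]] eps_unit(2)[OF E(1)] by blast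
  then show False using ME_prime[OF E(1) \<zeta>D(3) \<zeta>D(1)] S0M \<nu> by blast
qed

end

section \<open>Rings carried by an algebra with a basis\<close>

context balg
begin

lemma ring_ring_of:
  assumes "e \<in> T'" "1 \<in> C" "\<And>c. c \<in> C \<Longrightarrow> - c \<in> C" "\<And>c d. c \<in> C \<Longrightarrow> d \<in> C \<Longrightarrow> c + d \<in> C"
    and "\<And>f g. f \<in> carrier (ring_of C T') \<Longrightarrow> g \<in> carrier (ring_of C T') \<Longrightarrow> f \<diamondop> g \<in> carrier (ring_of C T')"
  shows "ring (ring_of C T')"
proof -
  have z: "0 \<in> C" using assms(4)[OF assms(2) assms(3)[OF assms(2)]] by simp
  have u: "kys (- f) = kys f" for f :: "'e \<Rightarrow>\<^sub>0 'a" by (auto simp: in_keys_iff)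
  have a: "kys (f + g) \<subseteq> T'" if "kys f \<subseteq> T'" "kys g \<subseteq> T'" for f g :: "'e \<Rightarrow>\<^sub>0 'a"
    using that keys_add[of f g] by blast
  show ?thesis
  proof (intro ringI abelian_groupI monoidI)
    show "\<exists>y\<in>carrier (ring_of C T'). y \<oplus>\<^bsub>ring_of C T'\<^esub> x = \<zero>\<^bsub>ring_of C T'\<^esub>" if "x \<in> carrier (ring_of C T')" for x
      using that assms(3) by (intro bexI[of _ "- x"]) (auto simp: ring_of_def coeff_in_def u)
  qed (use assms a z in \<open>auto simp: ring_of_def coeff_in_def lookup_add lookup_single when_def mul_assoc bil_distribs algebra_simps\<close>)
qed

lemma ring_of_simps [simp]:
  "\<one>\<^bsub>ring_of C T'\<^esub> = bone" "\<zero>\<^bsub>ring_of C T'\<^esub> = 0" "f \<otimes>\<^bsub>ring_of C T'\<^esub> g = f \<diamondop> g" "f \<oplus>\<^bsub>ring_of C T'\<^esub> g = f + g"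
  "f \<in> carrier (ring_of C T') \<longleftrightarrow> kys f \<subseteq> T' \<and> coeff_in C f"
  by (auto simp: ring_of_def)

lemma ring_of_a_inv:
  assumes "ring (ring_of C T')" "f \<in> carrier (ring_of C T')" shows "\<ominus>\<^bsub>ring_of C T'\<^esub> f = - f"
proof -
  interpret ring "ring_of C T'" by fact
  have "f \<oplus>\<^bsub>ring_of C T'\<^esub> (\<ominus>\<^bsub>ring_of C T'\<^esub> f) = \<zero>\<^bsub>ring_of C T'\<^esub>" using assms(2) by (rule r_neg)
  then have "f + (\<ominus>\<^bsub>ring_of C T'\<^esub> f) = 0" by (simp only: ring_of_simps)
  then show ?thesis by (simp add: eq_neg_iff_add_eq_0 add.commute)
qed

lemma ring_of_finsum:
  assumes "ring (ring_of C T')" "finite A" "\<And>a. a \<in> A \<Longrightarrow> f a \<in> carrier (ring_of C T')"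
  shows "(\<Oplus>\<^bsub>ring_of C T'\<^esub>a\<in>A. f a) = sum f A"
proof -
  interpret ring "ring_of C T'" by fact
  show ?thesis using assms(2,3)
  proof (induction A rule: finite_induct)
    case (insert a A)
    then have "(\<Oplus>\<^bsub>ring_of C T'\<^esub>a\<in>insert a A. f a) = f a \<oplus>\<^bsub>ring_of C T'\<^esub> (\<Oplus>\<^bsub>ring_of C T'\<^esub>a\<in>A. f a)"
      by (intro finsum_insert) (auto simp del: ring_of_simps)
    then show ?case using insert by simp
  qed simp
qed

end

section \<open>Existence of the embedding, Ore property and denominators\<close>

context solvable_coords
begin

lemma good_cong:
  assumes "\<And>k. k \<in> {l..n} \<Longrightarrow> W k = W' k" "l \<in> {1..n}" "good W l" shows "good W' l"
proof -
  have "phi W' v = phi W v" if "v \<in> Rs (Suc l)" for v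
    by (rule phi_cong[of "Suc l", OF _ _ that]) (use assms(1) in auto)
  moreover have "W' l = W l" using assms by auto
  ultimately show ?thesis using assms(2,3) der_Rs[OF assms(2)] by (auto simp: good_def)
qed

text \<open>Downward induction on \<open>i\<close>. \<open>good W l\<close> sees only the values of
  \<open>W\<close> from \<open>l\<close> on, so overwriting the value at \<open>i\<close> does not
  disturb what has been constructed for the later variables.\<close>

theorem exists_embedding:
  assumes char: "\<And>m::nat. m > 0 \<Longrightarrow> \<exists>c\<in>C. of_nat m * c = 1"
    and dens: "\<And>f. f \<in> C \<Longrightarrow> f \<noteq> 0 \<Longrightarrow> \<exists>E. prime_in E \<and> f \<notin> E \<and> central_rel E 1"
  obtains W where "\<And>l. l \<in> {1..n} \<Longrightarrow> good W l" "\<And>l. l \<in> {1..n} \<Longrightarrow> coeff_in F (W l)"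
proof -
  have "\<exists>W. (\<forall>l\<in>{i..n}. good W l) \<and> (\<forall>l\<in>{1..n}. coeff_in F (W l))" if "1 \<le> i" "i \<le> Suc n" for i
    using that(2,1)
  proof (induction rule: inc_induct)
    case base
    then show ?case by (intro exI[of _ "\<lambda>_. 0"]) (auto simp: coeff_in_def F_zero)
  next
    case (step i)
    then have i: "i \<in> {1..n}" by auto
    obtain W where W: "\<And>l. l \<in> {Suc i..n} \<Longrightarrow> good W l" "\<And>l. l \<in> {1..n} \<Longrightarrow> coeff_in F (W l)"
    proof -
      have "\<exists>W. (\<forall>l\<in>{Suc i..n}. good W l) \<and> (\<forall>l\<in>{1..n}. coeff_in F (W l))" using step by auto
      then show thesis using that by blast
    qed
    have "\<exists>V S. inn W i (Suc i) V S" by (rule inner_exists[OF i]) (use W in auto)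
    then obtain V S where inn: "inn W i (Suc i) V S" by blast
    have di: "\<exists>E. prime_in E \<and> f \<notin> E \<and> central_rel E i" if f: "f \<in> C" "f \<noteq> 0" for f
      using dens[OF f] central_rel_le[of _ i] i by auto
    have S0: "S l = 0" if "l \<in> {1..n}" for l
      by (rule resonant_part_vanishes[OF i _ _ inn _ _ that]) (use W char di in auto)
    define W' where "W' = W(i := V)"
    have ph: "phi W' v = phi W v" if "v \<in> Rs (Suc i)" for v
      by (rule phi_cong[OF _ _ that]) (auto simp: W'_def)
    have "good W' i" unfolding good_def
    proof (intro conjI ballI)
      show "tri i (W' i)" "homog i i (W' i)" using inn by (auto simp: W'_def inn_def tri_def)
      fix v assume v: "v \<in> Rs (Suc i)"
      have "defect W i V v = res S (phi W v)"
        by (rule defect_eq_res[OF i _ _ inn _ v]) (use W in auto)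
      also have "\<dots> = 0" using S0 by (simp add: res_def)
      finally have "defect W i V v = 0" .
      then show "phi W' v \<star> W' i - W' i \<star> aut (sgl i 1) (phi W' v) = phi W' (der i v)"
      proof -
        have "defect W i V v = phi W (der i v) - (phi W v \<star> V - V \<star> aut (sgl i 1) (phi W v))"
          by (subst defect_def[OF i]) (use W in auto)
        then show ?thesis using \<open>defect W i V v = 0\<close> ph[OF v] ph[OF der_Rs[OF i v]] by (simp add: W'_def)
      qed
    qed
    moreover have "good W' l" if "l \<in> {Suc i..n}" for l
      by (rule good_cong[of l W]) (use that W(1) in \<open>auto simp: W'_def\<close>)
    ultimately have "good W' l" if "l \<in> {i..n}" for l using that by (cases "l = i") auto
    moreover have "coeff_in F (W' l)" if "l \<in> {1..n}" for l using W(2)[OF that] inn by (auto simp: W'_def inn_def)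
    ultimately show ?case by blast
  qed
  from this[of 1] have "\<exists>W. (\<forall>l\<in>{1..n}. good W l) \<and> (\<forall>l\<in>{1..n}. coeff_in F (W l))" by simp
  then show thesis using that by blast
qed

abbreviation "Rring \<equiv> R.ring_of C (exps {1..n})"
abbreviation "Lring \<equiv> T.ring_of F (exps {1..n})"

lemma Rring_carrier: "v \<in> carrier Rring \<longleftrightarrow> v \<in> Rs 1 \<and> coeff_in C v" by (simp add: Rs_def)

lemma ring_Rring: "ring Rring"
  by (rule R.ring_ring_of) (use Rs_mult[of 1] coeff_C_mult C_one C_uminus C_add in \<open>auto simp: Rs_def\<close>)

lemma ring_Lring: "ring Lring"
  by (rule T.ring_ring_of) (use coeff_tm[OF scalars_F] keys_mul_subset F_one F_uminus F_add in auto)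

lemma nc_domain_Lring: "nc_domain Lring"
  using ring_Lring tm_domain by (auto simp: nc_domain_def nc_domain_axioms_def) (metis lookup_single_eq lookup_zero zero_neq_one)

lemma part_gp_mul:
  assumes i: "i \<in> {1..n}" and v: "v \<in> Rs i"
  shows "part i t (gp i s \<ast> v) = (if s \<le> t then part i (t - s) v else 0)"
proof (induction s arbitrary: t)
  case (Suc s)
  have R: "gp i s \<ast> v \<in> Rs i" using i v gp_Rs[OF i] by (auto intro: Rs_mult)
  show ?case using Suc part_gen[OF i R] by (cases t) (auto simp: gp_Suc[OF i] R.mul_assoc)
qed simp

text \<open>Neither \<open>sig i\<close> nor \<open>der i\<close> introduces \<open>gen i\<close>,
  so each factor \<open>gen i\<close> on the right raises the degree by at most one. This bounds the
  number of equations in the Ore argument.\<close>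

lemma part_mul_gp:
  assumes i: "i \<in> {1..n}" and v: "v \<in> Rs i" and d: "\<And>s. s > d \<Longrightarrow> part i s v = 0" and t: "t > d + k"
  shows "part i t (v \<ast> gp i k) = 0"
proof -
  obtain d' where d': "v = (\<Sum>s\<le>d'. gp i s \<ast> part i s v)" using part_expand[OF i v] by blast
  have "v \<ast> gp i k = (\<Sum>s\<le>d'. gp i s \<ast> (part i s v \<ast> gp i k))"
    by (subst d') (simp add: bil_sum_left R.mul_assoc)
  also have "part i t \<dots> = (\<Sum>s\<le>d'. part i t (gp i s \<ast> (part i s v \<ast> gp i k)))" by (rule part_sum)
  also have "\<dots> = 0"
  proof (intro sum.neutral ballI)
    fix s
    have R: "part i s v \<in> Rs (Suc i)" by (rule part_Rs[OF v])
    have R': "part i s v \<ast> gp i k \<in> Rs i" using Rs_Suc[OF R] gp_Rs[OF i] i by (auto intro: Rs_mult)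
    show "part i t (gp i s \<ast> (part i s v \<ast> gp i k)) = 0"
    proof (cases "s > d")
      case True
      then show ?thesis using d by simp
    next
      case False
      then have "t - s > k" using t by simp
      then show ?thesis using part_expansion[OF i R, of k] by (simp add: part_gp_mul[OF i R'])
    qed
  qed
  finally show ?thesis .
qed

lemma parts_zero: "i \<in> {1..n} \<Longrightarrow> v \<in> Rs i \<Longrightarrow> (\<And>s. part i s v = 0) \<Longrightarrow> v = 0"
  using part_expand[of i v] by (metis (no_types, lifting) bil_zero(2) sum.neutral)

context
  fixes W assumes gW: "\<And>l. l \<in> {1..n} \<Longrightarrow> good W l" and cW: "\<And>l. l \<in> {1..n} \<Longrightarrow> coeff_in F (W l)"
begin

lemma phi_hom: "phi W \<in> ring_hom Rring Lring"
proof (rule ring_hom_memI)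
  have tri: "tri l (W l)" if "l \<in> {1..n}" for l using gW[OF that] by (simp add: good_def)
  show "phi W v \<in> carrier Lring" if "v \<in> carrier Rring" for v
  proof -
    have v: "v \<in> Rs 1" "coeff_in F v" using that C_F unfolding Rring_carrier by (auto simp: coeff_in_def)
    have "kys (phi W v) \<subseteq> exps {1..n}" by (rule keys_phi[OF _ _ v(1)]) (use tri in auto)
    moreover have "coeff_in F (phi W v)" by (rule coeff_phi[OF scalars_F _ v(2,1)]) (rule cW)
    ultimately show ?thesis by simp
  qed
  show "phi W (v \<otimes>\<^bsub>Rring\<^esub> w) = phi W v \<otimes>\<^bsub>Lring\<^esub> phi W w" if "v \<in> carrier Rring" "w \<in> carrier Rring" for v w
    using that phi_mult[of 1 W v w] gW unfolding Rring_carrier by simp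
  show "phi W (v \<oplus>\<^bsub>Rring\<^esub> w) = phi W v \<oplus>\<^bsub>Lring\<^esub> phi W w" for v w by (simp add: phi_add)
  show "phi W \<one>\<^bsub>Rring\<^esub> = \<one>\<^bsub>Lring\<^esub>" by simp
qed

lemma phi_eq_0: assumes "v \<in> Rs 1" "phi W v = 0" shows "v = 0"
proof -
  have "coeff_in {0} v"
    by (rule phi_reflect[where D = UNIV and W = W and j = 1 and I = "{0}"])
      (use assms gW in \<open>auto simp: scalars_def good_def coeff_in_def\<close>)
  then show ?thesis by (intro poly_mapping_eqI) (auto simp: coeff_in_def)
qed

lemma phi_inj: "inj_on (phi W) (Rs 1)"
proof (rule inj_onI)
  fix v w assume "v \<in> Rs 1" "w \<in> Rs 1" "phi W v = phi W w"
  then show "v = w" using phi_eq_0[of "v - w"] by (auto simp: phi_diff)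
qed

lemma Rs_domain: "v \<in> Rs 1 \<Longrightarrow> w \<in> Rs 1 \<Longrightarrow> v \<ast> w = 0 \<Longrightarrow> v = 0 \<or> w = 0"
proof -
  assume h: "v \<in> Rs 1" "w \<in> Rs 1" "v \<ast> w = 0"
  have "phi W v \<star> phi W w = 0" using phi_mult[of 1 W v w] gW h by auto
  then show ?thesis using tm_domain phi_eq_0 h by blast
qed

lemma nc_domain_Rring: "nc_domain Rring"
  using ring_Rring Rs_domain
  by (auto simp: nc_domain_def nc_domain_axioms_def Rs_def) (metis lookup_single_eq lookup_zero zero_neq_one)

definition Rc where "Rc i = {v \<in> Rs i. coeff_in C v}"

lemma Rc_carrier: "1 \<le> i \<Longrightarrow> v \<in> Rc i \<Longrightarrow> v \<in> carrier Rring"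
  using Rs_mono[of 1 i] unfolding Rring_carrier Rc_def by auto

lemma subring_Rc: "1 \<le> i \<Longrightarrow> subring (Rc i) Rring"
proof (rule ring.subringI[OF ring_Rring])
  assume i: "1 \<le> i"
  show "Rc i \<subseteq> carrier Rring" using Rc_carrier[OF i] by blast
  show "\<one>\<^bsub>Rring\<^esub> \<in> Rc i" by (simp add: Rc_def coeff_single[OF scalars_C C_one])
  show "\<ominus>\<^bsub>Rring\<^esub> v \<in> Rc i" if "v \<in> Rc i" for v
    using that R.ring_of_a_inv[OF ring_Rring Rc_carrier[OF i that]] coeff_uminus[OF scalars_C] by (auto simp: Rc_def)
  show "v \<otimes>\<^bsub>Rring\<^esub> w \<in> Rc i" "v \<oplus>\<^bsub>Rring\<^esub> w \<in> Rc i" if "v \<in> Rc i" "w \<in> Rc i" for v w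
    using that i by (auto simp: Rc_def intro!: Rs_mult coeff_C_mult coeff_add[OF scalars_C])
qed

text \<open>
  Counting in powers of \<open>gen i\<close>: the common multiple is found from a linear system over \<open>Rc (i+1)\<close>
  with \<open>2 d + 2\<close> unknowns and \<open>2 d + 1\<close> equations.
\<close>

lemma right_ore_Rc: "1 \<le> i \<Longrightarrow> i \<le> Suc n \<Longrightarrow> right_ore Rring (Rc i)"
proof (induction "Suc n - i" arbitrary: i)
  case 0
  then have i: "i = Suc n" by simp
  have const: "v = sgl 0 (lkp v 0)" if "v \<in> Rc i" for v
  proof -
    have "kys v \<subseteq> {0}" using that by (auto simp: i Rc_def Rs_def exps_def)
    then show ?thesis by (intro poly_mapping_eqI) (auto simp: lookup_single when_def in_keys_iff subset_iff)
  qed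
  have comm: "v \<ast> w = w \<ast> v" if "v \<in> Rc i" "w \<in> Rc i" for v w
    by (subst (1 2) const[OF that(1)]) (simp add: r_scalar)
  show ?case unfolding right_ore_def
  proof (intro ballI impI)
    fix a b assume "a \<in> Rc i" "b \<in> Rc i" "b \<noteq> \<zero>\<^bsub>Rring\<^esub>"
    then show "\<exists>u\<in>Rc i. \<exists>v\<in>Rc i. v \<noteq> \<zero>\<^bsub>Rring\<^esub> \<and> a \<otimes>\<^bsub>Rring\<^esub> v = b \<otimes>\<^bsub>Rring\<^esub> u"
      using comm by (intro bexI[of _ a] bexI[of _ b]) auto
  qed
next
  case (Suc N)
  then have i: "i \<in> {1..n}" by auto
  have IH: "right_ore Rring (Rc (Suc i))" by (rule Suc.hyps) (use Suc in auto)
  interpret dom: nc_domain Rring by (rule nc_domain_Rring)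
  have S: "subring (Rc (Suc i)) Rring" by (rule subring_Rc) simp
  show ?case unfolding right_ore_def
  proof (intro ballI impI)
    fix a b assume a: "a \<in> Rc i" and b: "b \<in> Rc i" and bnz: "b \<noteq> \<zero>\<^bsub>Rring\<^esub>"
    have aR: "a \<in> Rs i" "coeff_in C a" and bR: "b \<in> Rs i" "coeff_in C b" using a b by (auto simp: Rc_def)
    have R1: "v \<in> Rs 1" if "v \<in> Rs i" for v using that Rs_mono[of 1 i] i by auto
    obtain d1 where d1: "\<And>s. s > d1 \<Longrightarrow> part i s a = 0" using part_expand[OF i aR(1)] by blast
    obtain d2 where d2: "\<And>s. s > d2 \<Longrightarrow> part i s b = 0" using part_expand[OF i bR(1)] by blast
    define d where "d = max d1 d2"
    have d: "\<And>s. s > d \<Longrightarrow> part i s a = 0" "\<And>s. s > d \<Longrightarrow> part i s b = 0" using d1 d2 by (auto simp: d_def)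
    \<comment> \<open>The columns of the system: \<open>a \<ast> gp i k\<close> and
      \<open>- b \<ast> gp i k\<close>. For \<open>k \<le> d\<close> their degree in
      \<open>gen i\<close> is at most \<open>2 * d\<close>.\<close>
    define y where "y = (\<lambda>p :: nat \<times> bool. (if snd p then a else - b) \<ast> gp i (fst p))"
    have gpC: "coeff_in C (gp i k)" for k unfolding gp_def by (rule coeff_single[OF scalars_C C_one])
    have yR: "y p \<in> Rs i" "coeff_in C (y p)" for p
    proof -
      have "(if snd p then a else - b) \<in> Rs i" "coeff_in C (if snd p then a else - b)"
        using aR bR coeff_uminus[OF scalars_C] by auto
      then show "y p \<in> Rs i" "coeff_in C (y p)"
        unfolding y_def using Rs_mult[OF _ _ gp_Rs[OF i]] coeff_C_mult[OF _ gpC] i by auto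
    qed
    let ?J = "{..d} \<times> (UNIV :: bool set)"
    have cardJ: "card {..2 * d} < card ?J" by (simp add: card_cartesian_product)
    have "\<exists>u. (\<forall>j\<in>?J. u j \<in> Rc (Suc i)) \<and> (\<exists>j\<in>?J. u j \<noteq> \<zero>\<^bsub>Rring\<^esub>) \<and>
        (\<forall>s\<in>{..2 * d}. (\<Oplus>\<^bsub>Rring\<^esub>j\<in>?J. part i s (y j) \<otimes>\<^bsub>Rring\<^esub> u j) = \<zero>\<^bsub>Rring\<^esub>)"
      by (rule dom.ore_linear_system[OF S IH _ _ cardJ])
        (use yR part_Rs coeff_part[OF C_zero C_add] in \<open>auto simp: Rc_def\<close>)
    then obtain u where u: "\<And>j. j \<in> ?J \<Longrightarrow> u j \<in> Rc (Suc i)" "\<exists>j\<in>?J. u j \<noteq> 0"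
      "\<And>s. s \<le> 2 * d \<Longrightarrow> (\<Oplus>\<^bsub>Rring\<^esub>j\<in>?J. part i s (y j) \<otimes>\<^bsub>Rring\<^esub> u j) = 0" by auto
    have uR: "u j \<in> Rs (Suc i)" "coeff_in C (u j)" if "j \<in> ?J" for j using u(1)[OF that] by (auto simp: Rc_def)
    have pu: "part i s (y j) \<ast> u j \<in> carrier Rring" if "j \<in> ?J" for s j
    proof -
      have "part i s (y j) \<ast> u j \<in> Rs (Suc i)" by (rule Rs_mult[OF _ part_Rs[OF yR(1)] uR(1)[OF that]]) simp
      moreover have "coeff_in C (part i s (y j) \<ast> u j)"
        by (rule coeff_C_mult[OF coeff_part[OF C_zero C_add yR(2)] uR(2)[OF that]])
      ultimately show ?thesis unfolding Rring_carrier using R1 Rs_Suc by blast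
    qed
    have sys: "(\<Sum>j\<in>?J. part i s (y j) \<ast> u j) = 0" if "s \<le> 2 * d" for s
    proof -
      have "(\<Oplus>\<^bsub>Rring\<^esub>j\<in>?J. part i s (y j) \<otimes>\<^bsub>Rring\<^esub> u j) = (\<Sum>j\<in>?J. part i s (y j) \<otimes>\<^bsub>Rring\<^esub> u j)"
        by (rule R.ring_of_finsum[OF ring_Rring]) (simp, simp only: R.ring_of_simps(3) pu)
      then show ?thesis using u(3)[OF that] by simp
    qed
    have hi: "part i s (y j) = 0" if "j \<in> ?J" "s > 2 * d" for s j
      unfolding y_def
    proof (rule part_mul_gp[OF i])
      show "(if snd j then a else - b) \<in> Rs i" using aR bR by auto
      show "part i t (if snd j then a else - b) = 0" if "t > d" for t
        using d[OF that] part_smul[of i t "- 1" b] by (simp add: smul_uminus)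
      show "d + fst j < s" using that by auto
    qed
    have tot: "(\<Sum>j\<in>?J. y j \<ast> u j) = 0"
    proof (rule parts_zero[OF i])
      show "(\<Sum>j\<in>?J. y j \<ast> u j) \<in> Rs i"
        by (rule Rs_sum, rule Rs_mult[OF _ yR(1) Rs_Suc[OF uR(1)]]) (use i in auto)
      fix s
      have "part i s (\<Sum>j\<in>?J. y j \<ast> u j) = (\<Sum>j\<in>?J. part i s (y j) \<ast> u j)"
        unfolding part_sum by (rule sum.cong[OF refl], rule part_mult[OF i yR(1) uR(1)])
      also have "\<dots> = 0"
      proof (cases "s \<le> 2 * d")
        case False
        then show ?thesis using hi by (intro sum.neutral ballI) simp
      qed (rule sys)
      finally show "part i s (\<Sum>j\<in>?J. y j \<ast> u j) = 0" .
    qed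
    \<comment> \<open>Regrouping the unknowns by their second index gives the two cofactors of the
      common multiple.\<close>
    define U where "U = (\<lambda>c. \<Sum>k\<le>d. gp i k \<ast> u (k, c))"
    have UR: "U c \<in> Rc i" for c
    proof -
      have "gp i k \<ast> u (k, c) \<in> Rs i" "coeff_in C (gp i k \<ast> u (k, c))" if "k \<le> d" for k
        using Rs_mult[OF _ gp_Rs[OF i] Rs_Suc[OF uR(1)[of "(k, c)"]]] coeff_C_mult[OF gpC uR(2)[of "(k, c)"]] that i by auto
      then show ?thesis unfolding Rc_def U_def by (auto intro!: Rs_sum coeff_sum[OF scalars_C])
    qed
    have "(\<Sum>j\<in>?J. y j \<ast> u j) = (\<Sum>k\<le>d. \<Sum>c\<in>UNIV. y (k, c) \<ast> u (k, c))" by (simp add: sum.cartesian_product)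
    also have "\<dots> = a \<ast> U True - b \<ast> U False"
      by (simp add: UNIV_bool y_def U_def bil_sum_right bil_distribs R.mul_assoc sum.distrib sum_negf sum_subtractf)
    finally have ab: "a \<ast> U True = b \<ast> U False" using tot by simp
    obtain k c where kc: "k \<le> d" "u (k, c) \<noteq> 0" using u(2) by auto
    have "part i k (U c) = (\<Sum>k'\<le>d. part i k (gp i k' \<ast> u (k', c)))" by (simp add: U_def part_sum)
    also have "\<dots> = (\<Sum>k'\<le>d. if k' = k then u (k, c) else 0)"
      by (rule sum.cong[OF refl]) (use part_gp[OF i uR(1)] in auto)
    also have "\<dots> = u (k, c)" using kc by simp
    finally have Uc: "U c \<noteq> 0" using kc by auto
    have R1': "U c \<in> Rs 1" "a \<in> Rs 1" "b \<in> Rs 1" for c using UR aR bR R1 by (auto simp: Rc_def)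
    have "U True \<noteq> 0"
    proof
      assume t: "U True = 0"
      then have "U False \<noteq> 0" using Uc by (cases c) auto
      moreover have "b \<ast> U False = 0" using ab t by simp
      ultimately show False using Rs_domain[OF R1'(3) R1'(1)] bnz by auto
    qed
    then show "\<exists>u\<in>Rc i. \<exists>v\<in>Rc i. v \<noteq> \<zero>\<^bsub>Rring\<^esub> \<and> a \<otimes>\<^bsub>Rring\<^esub> v = b \<otimes>\<^bsub>Rring\<^esub> u"
      using UR ab by (intro bexI[of _ "U False"] bexI[of _ "U True"]) auto
  qed
qed

lemma Rc_1: "Rc 1 = carrier Rring" using Rring_carrier by (auto simp: Rc_def simp del: R.ring_of_simps)

lemma subring_image: "subring (phi W ` carrier Rring) Lring"
proof -
  interpret ring_hom_ring Rring Lring "phi W" by (rule ring_hom_ringI2[OF ring_Rring ring_Lring phi_hom])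
  show ?thesis by (rule img_is_subring[OF ring.carrier_is_subring[OF ring_Rring]])
qed

lemma right_ore_image: "right_ore Lring (phi W ` carrier Rring)"
  unfolding right_ore_def
proof (intro ballI impI)
  fix x y assume "x \<in> phi W ` carrier Rring" "y \<in> phi W ` carrier Rring" and nz: "y \<noteq> \<zero>\<^bsub>Lring\<^esub>"
  then obtain a b where a: "a \<in> carrier Rring" "x = phi W a" and b: "b \<in> carrier Rring" "y = phi W b" by blast
  have "b \<noteq> \<zero>\<^bsub>Rring\<^esub>" using nz b by auto
  then obtain u v where uv: "u \<in> carrier Rring" "v \<in> carrier Rring" "v \<noteq> \<zero>\<^bsub>Rring\<^esub>" "a \<otimes>\<^bsub>Rring\<^esub> v = b \<otimes>\<^bsub>Rring\<^esub> u"
  proof -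
    have "right_ore Rring (carrier Rring)" using right_ore_Rc[of 1] unfolding Rc_1 by simp
    then show thesis using a(1) b(1) \<open>b \<noteq> \<zero>\<^bsub>Rring\<^esub>\<close> that unfolding right_ore_def by blast
  qed
  have "phi W v \<noteq> 0" using uv phi_eq_0 by (auto simp: Rs_def)
  moreover have "x \<otimes>\<^bsub>Lring\<^esub> phi W v = y \<otimes>\<^bsub>Lring\<^esub> phi W u"
    using ring_hom_mult[OF phi_hom a(1) uv(2)] ring_hom_mult[OF phi_hom b(1) uv(1)] uv(4) a b by simp
  ultimately show "\<exists>u\<in>phi W ` carrier Rring. \<exists>v\<in>phi W ` carrier Rring. v \<noteq> \<zero>\<^bsub>Lring\<^esub> \<and> x \<otimes>\<^bsub>Lring\<^esub> v = y \<otimes>\<^bsub>Lring\<^esub> u"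
    using uv by (intro bexI[of _ "phi W u"] bexI[of _ "phi W v"]) (auto simp del: R.ring_of_simps(3,5))
qed

text \<open>The denominated elements form a ring, so \<open>laurent_closure\<close> reduces the
  claim to scalars, where \<open>p / q\<close> has the denominator \<open>q\<close>, to generators,
  which lie in the image, and to the inverses of the \<open>Y l\<close>, which
  \<open>denominated_inverse\<close> provides.\<close>

theorem denominated_image: "denominated Lring (phi W ` carrier Rring) = carrier Lring"
proof
  interpret dom: nc_domain Lring by (rule nc_domain_Lring)
  let ?S = "phi W ` carrier Rring"
  note ds = subring_image right_ore_image
  show "denominated Lring ?S \<subseteq> carrier Lring" by (auto simp: denominated_def)
  show "carrier Lring \<subseteq> denominated Lring ?S"
  proof
    fix v assume "v \<in> carrier Lring"
    then have v: "kys v \<subseteq> exps {1..n}" "coeff_in F v" by auto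
    show "v \<in> denominated Lring ?S"
    proof (rule laurent_closure[where D = F and W = W and j = 1 and Pr = "\<lambda>v. v \<in> denominated Lring ?S"])
      show "0 \<in> F" "1 \<in> F" "\<And>c. c \<in> F \<Longrightarrow> - c \<in> F" using F_zero F_one F_uminus by auto
      show "v + w \<in> denominated Lring ?S" "v \<star> w \<in> denominated Lring ?S"
        if "v \<in> denominated Lring ?S" "w \<in> denominated Lring ?S" for v w
        using dom.denominated_add[OF ds that] dom.denominated_mult[OF ds that] by simp_all
      show "sgl 0 c \<in> denominated Lring ?S" if c: "c \<in> F" for c
      proof -
        obtain p q where pq: "c = p / q" "p \<in> C" "q \<in> C" "q \<noteq> 0" using c unfolding F_def by auto
        have S: "sgl 0 d \<in> ?S" if "d \<in> C" for d
          by (rule image_eqI[of _ _ "sgl 0 d"]) (use coeff_single[OF scalars_C that] in auto)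
        have "(sgl 0 q :: (nat \<Rightarrow>\<^sub>0 int) \<Rightarrow>\<^sub>0 'a) \<noteq> 0" using pq by (metis lookup_single_eq lookup_zero)
        moreover have "sgl 0 c \<otimes>\<^bsub>Lring\<^esub> sgl 0 q \<in> ?S" using S[OF pq(2)] pq by (simp add: tm_scalar)
        moreover have "sgl 0 c \<in> carrier Lring" by (simp add: coeff_single[OF scalars_F c])
        ultimately show ?thesis unfolding denominated_def using S[OF pq(3)]
          by (intro CollectI conjI bexI[of _ "sgl 0 q"]) (auto simp del: T.ring_of_simps(3,5))
      qed
      show "kys v \<subseteq> exps {1..n}" "coeff_in F v" by fact+
      fix l assume l: "l \<in> {1..n}"
      show "kys (W l) \<subseteq> exps {Suc l..n} \<and> coeff_in F (W l)" using gW[OF l] cW[OF l] by (auto simp: good_def tri_def)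
      have "gen l \<in> carrier Rring" unfolding Rring_carrier using l coeff_gen by (auto intro: gen_Rs)
      then have "phi W (gen l) \<in> ?S" by (rule imageI)
      then show "Y l + W l \<in> denominated Lring ?S" using dom.denominated_base[OF ds] l by auto
      assume "Y l \<in> denominated Lring ?S"
      moreover have "sgl (sgl l (- 1)) 1 \<in> carrier Lring"
        using l coeff_single[OF scalars_F F_one] by (auto simp: exps_def)
      ultimately show "sgl (sgl l (- 1)) 1 \<in> denominated Lring ?S"
        using dom.denominated_inverse[OF ds] Y_left_inverse[of l] by auto
    qed simp
  qed
qed

end
end

context scalar_torus
begin

text \<open>Twisted polynomials are a solvable algebra without correction terms.\<close>

definition pB :: "(nat \<Rightarrow>\<^sub>0 nat) \<Rightarrow> (nat \<Rightarrow>\<^sub>0 nat) \<Rightarrow> ((nat \<Rightarrow>\<^sub>0 nat) \<Rightarrow>\<^sub>0 'a)" where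
  "pB a b = sgl (a + b) (eps (toi a) (toi b))"

lemma pB_single: "bil pB (sgl a c) (sgl b d) = sgl (a + b) (c * d * eps (toi a) (toi b))"
  by (simp add: bil_single pB_def)

text \<open>The relation term is 0, which as a scalar lies in every admissible
  \<open>S\<close>.\<close>

sublocale P: solvable_coords n Q pB C
proof unfold_locales
  show "bil pB (pB a b) (sgl c 1) = bil pB (sgl a 1) (pB b c)" for a b c
    by (simp add: pB_def bil_single toi_add eps_add_left eps_add_right algebra_simps)
  show "pB 0 a = sgl a 1" "pB a 0 = sgl a 1" for a by (simp_all add: pB_def)
  show "coeff_in C (pB a b)" for a b
    by (auto simp: pB_def coeff_in_def lookup_single when_def eps_C C_zero)
  show "pB (sgl i 1) m = sgl (sgl i 1 + m) 1" if "i \<in> {1..n}" "m \<in> exps {i..n}" for i m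
  proof -
    have "eps (sgl i 1) (toi m) = 1"
      by (rule eps_ordered[of _ "{i}" _ "{i..n}"]) (use that in \<open>auto intro: exps_single\<close>)
    then show ?thesis by (simp add: pB_def)
  qed
  show "bil pB (sgl (sgl i 1) 1) (sgl (sgl j 1) 1) - smul (Q i j) (bil pB (sgl (sgl j 1) 1) (sgl (sgl i 1) 1)) \<in> S"
    if "i < j" "\<And>c. c \<in> C \<Longrightarrow> sgl 0 c \<in> S" for i j S
  proof -
    have "bil pB (sgl (sgl i 1) 1) (sgl (sgl j 1) 1) - smul (Q i j) (bil pB (sgl (sgl j 1) 1) (sgl (sgl i 1) 1)) = sgl 0 0"
      using that(1) Q_inv[of i j] by (simp add: pB_single eps_single add.commute)
    then show ?thesis using that(2)[OF C_zero] by simp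
  qed
qed

lemma P_phi_single: assumes "m \<in> exps {1..n}" shows "P.phi (\<lambda>_. 0) (sgl m c) = sgl (toi m) c"
proof -
  have "T.omon n (\<lambda>l. Y l + 0) m = sgl (toi m) 1" using assms
  proof (induction m rule: exponent_induct)
    case (step l m)
    then have "T.omon n (\<lambda>l. Y l + 0) (sgl l 1 + m) = Y l \<star> sgl (toi m) 1"
      using T.omon_step[of l n m "\<lambda>l. Y l + 0"] by auto
    also have "\<dots> = sgl (sgl l 1 + toi m) (1 * 1)" unfolding Y_def
      by (rule mul_single_ordered[of _ "{l}" _ "{l..n}"]) (use step in \<open>auto intro: exps_single\<close>)
    finally show ?case by (simp add: toi_add)
  qed simp
  then show ?thesis by (simp add: P.phi_def)
qed

lemma P_phi: assumes "v \<in> P.Rs 1"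
  shows "lkp (P.phi (\<lambda>_. 0) v) (toi m) = lkp v m" "k \<in> kys (P.phi (\<lambda>_. 0) v) \<Longrightarrow> \<exists>m\<in>exps {1..n}. k = toi m"
proof -
  have "lkp (P.phi (\<lambda>_. 0) v) (toi m) = lkp v m \<and> (\<forall>k\<in>kys (P.phi (\<lambda>_. 0) v). \<exists>m\<in>exps {1..n}. k = toi m)"
    using assms
  proof (induction v rule: P.Rs_induct)
    case (single p c)
    then show ?case by (auto simp: P_phi_single lookup_single when_def toi_inj)
  next
    case (add v w)
    then show ?case using keys_add[of "P.phi (\<lambda>_. 0) v" "P.phi (\<lambda>_. 0) w"] by (auto simp: P.phi_add lookup_add)
  qed simp
  then show "lkp (P.phi (\<lambda>_. 0) v) (toi m) = lkp v m"
    "k \<in> kys (P.phi (\<lambda>_. 0) v) \<Longrightarrow> \<exists>m\<in>exps {1..n}. k = toi m" by blast+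
qed

text \<open>Without correction terms every \<open>der l\<close> vanishes, and 0 implements
  it.\<close>

lemma P_good: "P.good (\<lambda>_. 0) l"
proof -
  have "P.der l v = 0" for v
    using subset_UNIV[of "kys v"]
  proof (induction v rule: pm_induct_keys)
    case (single m c)
    then show ?case by (simp add: P.der_def P.gen_def pB_single beta_def ac_simps)
  qed (auto simp: P.der_add)
  then show ?thesis by (simp add: P.good_def P.tri_def homog_def)
qed

abbreviation "Pimage \<equiv> P.phi (\<lambda>_. 0) ` carrier P.Rring"

lemma Pimage_iff: "w \<in> Pimage \<longleftrightarrow> coeff_in C w \<and> (\<forall>k\<in>kys w. \<exists>m\<in>exps {1..n}. k = toi m)"
proof
  let ?p = "P.phi (\<lambda>_. 0)"
  assume "w \<in> Pimage"
  then obtain v where v: "v \<in> carrier P.Rring" and wv: "w = ?p v" by (rule imageE)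
  have vR: "v \<in> P.Rs 1" and vc: "coeff_in C v" using v unfolding P.Rring_carrier by simp_all
  have sup: "\<exists>m\<in>exps {1..n}. k = toi m" if "k \<in> kys w" for k
    using P_phi(2)[OF vR] that unfolding wv .
  have "lkp w k \<in> C" for k
  proof (cases "k \<in> kys w")
    case True
    then obtain m where "k = toi m" using sup by blast
    then have "lkp w k = lkp v m" unfolding wv using P_phi(1)[OF vR] by simp
    then show ?thesis using vc by (simp add: coeff_in_def)
  next
    case False
    then have "lkp w k = 0" by (simp only: in_keys_iff not_not)
    then show ?thesis using C_zero by simp
  qed
  then show "coeff_in C w \<and> (\<forall>k\<in>kys w. \<exists>m\<in>exps {1..n}. k = toi m)"
    unfolding coeff_in_def using sup by simp
next
  let ?p = "P.phi (\<lambda>_. 0)"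
  assume w: "coeff_in C w \<and> (\<forall>k\<in>kys w. \<exists>m\<in>exps {1..n}. k = toi m)"
  let ?M = "{m \<in> exps {1..n}. toi m \<in> kys w}"
  have "finite (toi -` kys w)" by (rule finite_vimageI) (auto simp: inj_def toi_inj)
  then have fin: "finite ?M" by (rule finite_subset[rotated]) auto
  define v where "v = (\<Sum>m\<in>?M. sgl m (lkp w (toi m)))"
  have lv: "lkp v m = (if m \<in> ?M then lkp w (toi m) else 0)" for m
    using fin by (simp add: v_def lookup_sum lookup_single when_def)
  have vR: "v \<in> P.Rs 1" unfolding v_def by (intro P.Rs_sum P.Rs_single) auto
  have "coeff_in C v" using w C_zero by (auto simp: coeff_in_def lv)
  then have vc: "v \<in> carrier P.Rring" using vR unfolding P.Rring_carrier by simp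
  have "?p v = w"
  proof (rule poly_mapping_eqI)
    fix k
    show "lkp (?p v) k = lkp w k"
    proof (cases "\<exists>m\<in>exps {1..n}. k = toi m")
      case True
      then obtain m where "m \<in> exps {1..n}" "k = toi m" by blast
      then show ?thesis using P_phi(1)[OF vR, of m] by (auto simp: lv in_keys_iff)
    next
      case False
      then have "k \<notin> kys (?p v)" "k \<notin> kys w" using P_phi(2)[OF vR] w by blast+
      then show ?thesis by (simp add: in_keys_iff)
    qed
  qed
  then show "w \<in> Pimage" using vc by (metis image_eqI)
qed

lemma Pimage_ore: "subring Pimage P.Lring" "right_ore P.Lring Pimage" "denominated P.Lring Pimage = carrier P.Lring"
proof -
  have c: "coeff_in P.F (0 :: (nat \<Rightarrow>\<^sub>0 int) \<Rightarrow>\<^sub>0 'a)" by (simp add: coeff_in_def P.F_zero)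
  show "subring Pimage P.Lring" by (rule P.subring_image) (rule P_good c)+
  show "right_ore P.Lring Pimage" by (rule P.right_ore_image) (rule P_good c)+
  show "denominated P.Lring Pimage = carrier P.Lring" by (rule P.denominated_image) (rule P_good c)+
qed

end

section \<open>Coordinates of a solvable algebra\<close>

locale q_matrix =
  fixes n :: nat and q :: "nat \<Rightarrow> nat \<Rightarrow> 'k::field_char_0 laurent"
  assumes Q_matrix: "Q_matrix n q"
begin

abbreviation "K \<equiv> carrier (kQ n q)"
abbreviation "Laurent \<equiv> (ring_of_type_algebra :: 'k laurent ring)"

lemma Laurent_simps [simp]: "carrier Laurent = UNIV" "a \<otimes>\<^bsub>Laurent\<^esub> b = a * b" "a \<oplus>\<^bsub>Laurent\<^esub> b = a + b"
    "\<one>\<^bsub>Laurent\<^esub> = 1" "\<zero>\<^bsub>Laurent\<^esub> = 0"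
  by (simp_all add: ring_of_type_algebra_def)

lemma Laurent_uminus: "\<ominus>\<^bsub>Laurent\<^esub> a = - a"
proof -
  interpret L: ring Laurent by (rule ring_from_type_algebra)
  have "a \<oplus>\<^bsub>Laurent\<^esub> (\<ominus>\<^bsub>Laurent\<^esub> a) = \<zero>\<^bsub>Laurent\<^esub>" by (rule L.r_neg) simp
  then show ?thesis by (simp add: eq_neg_iff_add_eq_0 add.commute)
qed

lemma K_eq: "K = generate_ring Laurent (range const \<union> {q i j | i j. i \<in> {1..n} \<and> j \<in> {1..n}})"
  by (simp add: kQ_def)

lemma kQ_simps [simp]: "a \<otimes>\<^bsub>kQ n q\<^esub> b = a * b" "a \<oplus>\<^bsub>kQ n q\<^esub> b = a + b" "\<one>\<^bsub>kQ n q\<^esub> = 1" "\<zero>\<^bsub>kQ n q\<^esub> = 0"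
  by (simp_all add: kQ_def ring_of_type_algebra_def)

lemma K_one: "1 \<in> K" using generate_ring.one[of Laurent] unfolding K_eq by simp
lemma K_uminus: "a \<in> K \<Longrightarrow> - a \<in> K" using generate_ring.a_inv[of a Laurent] unfolding K_eq by (simp add: Laurent_uminus)
lemma K_add: "a \<in> K \<Longrightarrow> b \<in> K \<Longrightarrow> a + b \<in> K" using generate_ring.eng_add[of a Laurent _ b] unfolding K_eq by simp
lemma K_mult: "a \<in> K \<Longrightarrow> b \<in> K \<Longrightarrow> a * b \<in> K" using generate_ring.eng_mult[of a Laurent _ b] unfolding K_eq by simp
lemma K_zero: "0 \<in> K" using K_add[OF K_one K_uminus[OF K_one]] by simp
lemma K_const: "const c \<in> K" unfolding K_eq by (rule generate_ring.incl) simp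
lemma K_q: "i \<in> {1..n} \<Longrightarrow> j \<in> {1..n} \<Longrightarrow> q i j \<in> K" unfolding K_eq by (rule generate_ring.incl) auto

lemma cring_kQ: "cring (kQ n q)"
proof (intro cringI abelian_groupI comm_monoidI)
  show "\<exists>b\<in>K. b \<oplus>\<^bsub>kQ n q\<^esub> a = \<zero>\<^bsub>kQ n q\<^esub>" if "a \<in> K" for a
    using K_uminus[OF that] by (intro bexI[of _ "- a"]) auto
qed (auto intro: K_one K_zero K_add K_mult simp: algebra_simps)

definition emb :: "'k laurent \<Rightarrow> 'k laurent fract" where "emb c = Fract c 1"

lemma emb_simps [simp]: "emb 0 = 0" "emb 1 = 1" "emb (a + b) = emb a + emb b" "emb (a * b) = emb a * emb b"
  "emb (- a) = - emb a" "emb a = emb b \<longleftrightarrow> a = b"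
  by (simp_all add: emb_def Zero_fract_def One_fract_def eq_fract)

lemma emb_eq_0 [simp]: "emb a = 0 \<longleftrightarrow> a = 0" using emb_simps(6)[of a 0] by (simp only: emb_simps(1))

definition Qm :: "nat \<Rightarrow> nat \<Rightarrow> 'k laurent fract" where
  "Qm i j = (if i \<in> {1..n} \<and> j \<in> {1..n} then emb (q i j) else 1)"

definition C :: "'k laurent fract set" where "C = emb ` K"

lemma scalar_torus: "scalar_torus n Qm C"
proof unfold_locales
  show "Qm i j * Qm j i = 1" for i j
  proof (cases "i \<in> {1..n} \<and> j \<in> {1..n}")
    case True
    then have "q i j * q j i = 1" using Q_matrix unfolding Q_matrix_def by blast
    then show ?thesis using True by (simp add: Qm_def flip: emb_simps)
  qed (auto simp: Qm_def)
  show "Qm i i = 1" for i using Q_matrix by (auto simp: Qm_def Q_matrix_def)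
  show "Qm i j = 1" if "i \<notin> {1..n}" for i j unfolding Qm_def using that by (simp only: simp_thms if_False)
  show "1 \<in> C" unfolding C_def using K_one by (metis emb_simps(2) imageI)
  show "- c \<in> C" if "c \<in> C" for c using that K_uminus by (auto simp: C_def simp flip: emb_simps)
  show "c + d \<in> C" "c * d \<in> C" if "c \<in> C" "d \<in> C" for c d
    using that K_add K_mult by (auto simp: C_def simp flip: emb_simps)
  show "Qm i j \<in> C" for i j using K_q \<open>1 \<in> C\<close> by (auto simp: Qm_def C_def)
qed

sublocale S: scalar_torus n Qm C by (rule scalar_torus)

end

definition ext :: "nat set \<Rightarrow> (nat \<Rightarrow>\<^sub>0 nat) \<Rightarrow> (nat \<Rightarrow>\<^sub>0 nat)" where
  "ext S m = Poly_Mapping.mapp (\<lambda>k c. if k \<in> S then c else 0) m"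

lemma lookup_ext: "lkp (ext S m) k = (if k \<in> S then lkp m k else 0)"
  by (auto simp: ext_def lookup_mapp when_def in_keys_iff)

lemma ext_exps: "ext S m \<in> exps S" by (auto simp: exps_def in_keys_iff lookup_ext split: if_splits)
lemma ext_split: "ext (- S) m + ext S m = m" by (rule poly_mapping_eqI) (simp add: lookup_add lookup_ext)

lemma ext_sum:
  assumes "m \<in> exps S" "t \<in> exps (- S)" shows "ext S (t + m) = m" "ext (- S) (t + m) = t"
proof -
  have "lkp m k = 0" if "k \<notin> S" for k using assms(1) that by (auto simp: exps_def in_keys_iff subset_iff)
  moreover have "lkp t k = 0" if "k \<in> S" for k using assms(2) that by (auto simp: exps_def in_keys_iff subset_iff)
  ultimately show "ext S (t + m) = m" "ext (- S) (t + m) = t"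
    by (auto intro!: poly_mapping_eqI simp: lookup_add lookup_ext)
qed

locale solvable_data = q_matrix n q for n and q :: "nat \<Rightarrow> nat \<Rightarrow> 'k::field_char_0 laurent" +
  fixes R :: "('r, 'm) ring_scheme" (structure) and \<eta> :: "'k laurent \<Rightarrow> 'r" and x :: "nat \<Rightarrow> 'r"
  assumes Q_solvable: "Q_solvable n q R \<eta> x"
begin

lemma Q_algebra: "Q_algebra n q R \<eta>" using Q_solvable by (simp add: Q_solvable_def)

sublocale ring R using Q_algebra by (simp add: Q_algebra_def)

sublocale eta: ring_hom_ring "kQ n q" R \<eta>
  by (rule ring_hom_ringI2) (use Q_algebra cring_kQ in \<open>auto simp: Q_algebra_def cring_def\<close>)

lemma eta_closed: "a \<in> K \<Longrightarrow> \<eta> a \<in> carrier R" by simp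
lemma eta_central: "a \<in> K \<Longrightarrow> r \<in> carrier R \<Longrightarrow> \<eta> a \<otimes> r = r \<otimes> \<eta> a"
  using Q_algebra by (auto simp: Q_algebra_def ring_center_def)
lemma eta_add: "a \<in> K \<Longrightarrow> b \<in> K \<Longrightarrow> \<eta> (a + b) = \<eta> a \<oplus> \<eta> b" using eta.hom_add[of a b] by simp
lemma eta_mult: "a \<in> K \<Longrightarrow> b \<in> K \<Longrightarrow> \<eta> (a * b) = \<eta> a \<otimes> \<eta> b" using eta.hom_mult[of a b] by simp
lemma eta_zero: "\<eta> 0 = \<zero>" using eta.hom_zero by simp
lemma eta_one: "\<eta> 1 = \<one>" using eta.hom_one by simp

lemma x_closed: "i \<in> {1..n} \<Longrightarrow> x i \<in> carrier R" using Q_solvable by (simp add: Q_solvable_def)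

abbreviation "xm \<equiv> ordered_monomial n R x"
abbreviation "M \<equiv> (exps {1..n} :: (nat \<Rightarrow>\<^sub>0 nat) set)"
abbreviation "KC \<equiv> kQ_coeffs n q M"
abbreviation "lc \<equiv> lin_comb R \<eta> xm"

lemma multi_exponents_exps: "multi_exponents n = M" by (simp add: multi_exponents_def exps_def)

lemma KC_iff: "c \<in> KC \<longleftrightarrow> kys c \<subseteq> M \<and> coeff_in K c" by (auto simp: kQ_coeffs_def coeff_in_def)

lemma xm_closed: "xm m \<in> carrier R"
proof -
  have "foldr (\<lambda>i y. x i [^] lkp m i \<otimes> y) xs \<one> \<in> carrier R" if "set xs \<subseteq> {1..n}" for xs
    using that by (induction xs) (auto intro!: m_closed nat_pow_closed x_closed)
  moreover have "set [1..<Suc n] \<subseteq> {1..n}" by auto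
  ultimately show ?thesis unfolding ordered_monomial_def by blast
qed

lemma mon_zero: "xm 0 = \<one>"
proof -
  have "foldr (\<lambda>i y. x i [^] lkp (0 :: nat \<Rightarrow>\<^sub>0 nat) i \<otimes> y) xs \<one> = \<one>" for xs by (induction xs) auto
  then show ?thesis unfolding ordered_monomial_def .
qed

lemma mon_step: assumes "i \<in> {1..n}" "m \<in> exps {i..n}" shows "xm (sgl i 1 + m) = x i \<otimes> xm m"
  unfolding ordered_monomial_def
  by (rule foldr_step[where S = "carrier R" and F = "\<lambda>i k y. x i [^] k \<otimes> y" and G = "\<lambda>i y. x i \<otimes> y"])
    (use assms x_closed in \<open>auto simp: m_assoc[symmetric] simp flip: nat_pow_Suc2\<close>)

lemma mon_gen: "i \<in> {1..n} \<Longrightarrow> xm (sgl i 1) = x i" using mon_step[of i 0] x_closed by (simp add: mon_zero)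

lemma lc_superset:
  assumes "finite A" "kys c \<subseteq> A" "coeff_in K c"
  shows "lc c = (\<Oplus>m\<in>A. \<eta> (lkp c m) \<otimes> xm m)"
  unfolding lin_comb_def
proof (rule add.finprod_mono_neutral_cong_left)
  show "\<eta> (lkp c i) \<otimes> xm i = \<zero>" if "i \<in> A - kys c" for i
    using that by (simp add: in_keys_iff eta_zero xm_closed)
qed (use assms in \<open>auto simp: coeff_in_def xm_closed\<close>)

lemma lc_closed: "coeff_in K c \<Longrightarrow> lc c \<in> carrier R"
  unfolding lin_comb_def by (rule finsum_closed) (auto simp: coeff_in_def xm_closed)

lemma lc_add: assumes "coeff_in K c" "coeff_in K d" shows "lc (c + d) = lc c \<oplus> lc d"
proof -
  let ?A = "kys c \<union> kys d"
  have "coeff_in K (c + d)" using assms by (auto simp: coeff_in_def lookup_add intro: K_add)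
  then have "lc (c + d) = (\<Oplus>m\<in>?A. \<eta> (lkp c m) \<otimes> xm m \<oplus> \<eta> (lkp d m) \<otimes> xm m)"
    using assms by (subst lc_superset[of ?A])
      (auto intro!: finsum_cong' simp: keys_add coeff_in_def xm_closed lookup_add eta_add l_distr)
  also have "\<dots> = lc c \<oplus> lc d"
    using assms by (subst finsum_addf) (auto simp: coeff_in_def xm_closed lc_superset[of ?A])
  finally show ?thesis .
qed

lemma lc_smul: assumes "a \<in> K" "coeff_in K c" shows "lc (smul a c) = \<eta> a \<otimes> lc c"
proof -
  have "lc (smul a c) = (\<Oplus>m\<in>kys c. \<eta> a \<otimes> (\<eta> (lkp c m) \<otimes> xm m))"
    using assms keys_scl[of "\<lambda>_. a" c] by (subst lc_superset[of "kys c"])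
      (auto intro!: finsum_cong' simp: coeff_in_def xm_closed eta_mult m_assoc K_mult)
  also have "\<dots> = \<eta> a \<otimes> lc c" unfolding lin_comb_def
    using assms by (intro finsum_rdistr[symmetric]) (auto simp: coeff_in_def xm_closed)
  finally show ?thesis .
qed

lemma lc_single: "a \<in> K \<Longrightarrow> lc (sgl m a) = \<eta> a \<otimes> xm m"
  by (subst lc_superset[of "{m}"]) (auto simp: coeff_in_def lookup_single when_def K_zero xm_closed)

definition cd :: "'r \<Rightarrow> (nat \<Rightarrow>\<^sub>0 nat) \<Rightarrow>\<^sub>0 'k laurent" where "cd = the_inv_into KC lc"

lemma bij_lc: "bij_betw lc KC (carrier R)"
  using Q_solvable by (simp add: Q_solvable_def multi_exponents_exps)

lemma lc_KC: "c \<in> KC \<Longrightarrow> lc c \<in> carrier R" using lc_closed by (simp add: KC_iff)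
lemma cd_KC: "r \<in> carrier R \<Longrightarrow> cd r \<in> KC" unfolding cd_def
  by (metis bij_betw_def bij_betw_the_inv_into bij_lc image_eqI)
lemma lc_cd: "r \<in> carrier R \<Longrightarrow> lc (cd r) = r" unfolding cd_def
  using f_the_inv_into_f_bij_betw[OF bij_lc] by blast
lemma cd_lc: "c \<in> KC \<Longrightarrow> cd (lc c) = c" unfolding cd_def
  using the_inv_into_f_f bij_lc by (metis bij_betw_def)

lemma cd_coeff: "r \<in> carrier R \<Longrightarrow> coeff_in K (cd r)" and cd_keys: "r \<in> carrier R \<Longrightarrow> kys (cd r) \<subseteq> M"
  using cd_KC by (auto simp: KC_iff)

lemma cd_add: assumes "r \<in> carrier R" "s \<in> carrier R" shows "cd (r \<oplus> s) = cd r + cd s"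
proof -
  have "cd r + cd s \<in> KC" using assms[THEN cd_KC] keys_add[of "cd r" "cd s"]
    by (auto simp: KC_iff coeff_in_def lookup_add intro: K_add)
  then have "cd (lc (cd r + cd s)) = cd r + cd s" by (rule cd_lc)
  then show ?thesis using assms by (simp add: lc_add cd_coeff lc_cd)
qed

lemma cd_eta: assumes "a \<in> K" "r \<in> carrier R" shows "cd (\<eta> a \<otimes> r) = smul a (cd r)"
proof -
  have "smul a (cd r) \<in> KC" using assms(1) cd_KC[OF assms(2)] keys_scl[of "\<lambda>_. a" "cd r"]
    by (auto simp: KC_iff coeff_in_def intro: K_mult)
  then have "cd (lc (smul a (cd r))) = smul a (cd r)" by (rule cd_lc)
  then show ?thesis using assms by (simp add: lc_smul cd_coeff lc_cd)
qed

lemma cd_mon: assumes "m \<in> M" shows "cd (xm m) = sgl m 1"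
proof -
  have "sgl m 1 \<in> KC" using assms by (auto simp: KC_iff coeff_in_def lookup_single when_def K_zero K_one)
  then have "cd (lc (sgl m 1)) = sgl m 1" by (rule cd_lc)
  then show ?thesis by (simp add: lc_single K_one eta_one xm_closed)
qed

lemma carrier_induct [consumes 1, case_names single add]:
  assumes r: "r \<in> carrier R" and 1: "\<And>a m. a \<in> K \<Longrightarrow> m \<in> M \<Longrightarrow> P (\<eta> a \<otimes> xm m)"
    and 2: "\<And>r s. r \<in> carrier R \<Longrightarrow> s \<in> carrier R \<Longrightarrow> P r \<Longrightarrow> P s \<Longrightarrow> P (r \<oplus> s)"
  shows "P r"
proof -
  let ?c = "cd r"
  have c: "kys ?c \<subseteq> M" "\<And>m. lkp ?c m \<in> K" using cd_coeff[OF r] cd_keys[OF r] by (auto simp: coeff_in_def)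
  have "P (\<Oplus>m\<in>A. \<eta> (lkp ?c m) \<otimes> xm m)" if "finite A" "A \<subseteq> M" for A
    using that
  proof (induction A rule: finite_induct)
    case empty
    show ?case using 1[OF K_zero exps_zero] by (simp add: eta_zero xm_closed)
  next
    case (insert m A)
    then show ?case using c by (subst finsum_insert) (auto intro!: 1 2 finsum_closed simp: xm_closed)
  qed
  then have "P (lc ?c)" unfolding lin_comb_def using c(1) by simp
  then show ?thesis using lc_cd[OF r] by simp
qed

definition crd :: "'r \<Rightarrow> (nat \<Rightarrow>\<^sub>0 nat) \<Rightarrow>\<^sub>0 'k laurent fract" where "crd r = map_coeff emb (cd r)"

lemma lookup_crd [simp]: "lkp (crd r) m = emb (lkp (cd r) m)" by (simp add: crd_def lookup_map_coeff)
lemma keys_crd: "kys (crd r) = kys (cd r)" by (auto simp: in_keys_iff)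
lemma crd_add: "r \<in> carrier R \<Longrightarrow> s \<in> carrier R \<Longrightarrow> crd (r \<oplus> s) = crd r + crd s"
  by (rule poly_mapping_eqI) (simp add: cd_add lookup_add)
lemma crd_eta: "a \<in> K \<Longrightarrow> r \<in> carrier R \<Longrightarrow> crd (\<eta> a \<otimes> r) = smul (emb a) (crd r)"
  by (rule poly_mapping_eqI) (simp add: cd_eta)
lemma crd_mon: "m \<in> M \<Longrightarrow> crd (xm m) = sgl m 1"
  by (rule poly_mapping_eqI) (simp add: cd_mon lookup_single when_def)
lemma crd_one: "crd \<one> = sgl 0 1" using crd_mon[of 0] by (simp add: mon_zero)
lemma crd_scalar: "a \<in> K \<Longrightarrow> crd (\<eta> a) = sgl 0 (emb a)" using crd_eta[of a \<one>] by (simp add: crd_one)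
lemma crd_coeff: "r \<in> carrier R \<Longrightarrow> coeff_in C (crd r)" using cd_coeff[of r] by (auto simp: coeff_in_def C_def)
lemma crd_inj: "inj_on crd (carrier R)"
proof (rule inj_onI)
  fix r s assume rs: "r \<in> carrier R" "s \<in> carrier R" "crd r = crd s"
  have "lkp (cd r) m = lkp (cd s) m" for m using arg_cong[OF rs(3), of "\<lambda>v. lkp v m"] by simp
  then have "cd r = cd s" by (rule poly_mapping_eqI)
  then show "r = s" using lc_cd rs by metis
qed
lemma crd_zero: "crd \<zero> = 0" using crd_scalar[OF K_zero] by (simp add: eta_zero)
lemma crd_uminus: "r \<in> carrier R \<Longrightarrow> crd (\<ominus> r) = - crd r"
  using crd_add[of r "\<ominus> r"] by (simp add: r_neg crd_zero eq_neg_iff_add_eq_0 add.commute)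
lemma crd_diff: "r \<in> carrier R \<Longrightarrow> s \<in> carrier R \<Longrightarrow> crd (r \<ominus> s) = crd r - crd s"
  by (simp add: a_minus_def crd_add crd_uminus)

text \<open>
  The basis of the coordinate algebra is indexed by all exponents; those outside \<open>{1..n}\<close> are
  treated as additional central variables.
\<close>

definition sh :: "(nat \<Rightarrow>\<^sub>0 nat) \<Rightarrow> ((nat \<Rightarrow>\<^sub>0 nat) \<Rightarrow>\<^sub>0 'k laurent fract) \<Rightarrow> ((nat \<Rightarrow>\<^sub>0 nat) \<Rightarrow>\<^sub>0 'k laurent fract)" where
  "sh t = lin (\<lambda>m. sgl (t + m) 1)"

lemma sh_zero [simp]: "sh 0 v = v"
  using subset_UNIV[of "kys v"] by (induction v rule: pm_induct_keys) (simp_all add: sh_def lin_add)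
lemma sh_single [simp]: "sh t (sgl m c) = sgl (t + m) c" by (simp add: sh_def)
lemma sh_add: "sh t (v + w) = sh t v + sh t w" by (simp add: sh_def lin_add)
lemma sh_smul: "sh t (smul c v) = smul c (sh t v)" by (simp add: sh_def lin_smul)

definition rB :: "(nat \<Rightarrow>\<^sub>0 nat) \<Rightarrow> (nat \<Rightarrow>\<^sub>0 nat) \<Rightarrow> (nat \<Rightarrow>\<^sub>0 nat) \<Rightarrow>\<^sub>0 'k laurent fract" where
  "rB a b = sh (ext (- {1..n}) a + ext (- {1..n}) b) (crd (xm (ext {1..n} a) \<otimes> xm (ext {1..n} b)))"

lemma bil_sh:
  assumes s: "s \<in> exps (- {1..n})" and t: "t \<in> exps (- {1..n})" and r: "r1 \<in> carrier R" "r2 \<in> carrier R"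
  shows "bil rB (sh s (crd r1)) (sh t (crd r2)) = sh (s + t) (crd (r1 \<otimes> r2))"
proof -
  have 1: "bil rB (sh s (crd (\<eta> a \<otimes> xm m))) (sh t (crd (\<eta> b \<otimes> xm p))) =
      sh (s + t) (crd (\<eta> a \<otimes> xm m \<otimes> (\<eta> b \<otimes> xm p)))"
    if "a \<in> K" "b \<in> K" "m \<in> M" "p \<in> M" for a b m p
  proof -
    have "\<eta> a \<otimes> xm m \<otimes> (\<eta> b \<otimes> xm p) = \<eta> a \<otimes> (xm m \<otimes> \<eta> b) \<otimes> xm p"
      using that by (simp add: m_assoc xm_closed)
    also have "\<dots> = \<eta> (a * b) \<otimes> (xm m \<otimes> xm p)"
      using that by (simp add: eta_central[of b "xm m", symmetric] xm_closed eta_mult m_assoc)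
    finally show ?thesis
      using that s t by (simp add: crd_eta crd_mon xm_closed K_mult sh_smul bil_single rB_def ext_sum)
  qed
  have 2: "bil rB (sh s (crd (\<eta> a \<otimes> xm m))) (sh t (crd r2)) = sh (s + t) (crd (\<eta> a \<otimes> xm m \<otimes> r2))"
    if "a \<in> K" "m \<in> M" for a m
    using r(2) by (induction r2 rule: carrier_induct)
      (use that 1 in \<open>auto simp: crd_add sh_add bil_distribs r_distr xm_closed\<close>)
  show ?thesis using r(1) by (induction r1 rule: carrier_induct)
      (use r(2) 2 in \<open>auto simp: crd_add sh_add bil_distribs l_distr xm_closed\<close>)
qed

lemma crd_mult: "r \<in> carrier R \<Longrightarrow> s \<in> carrier R \<Longrightarrow> crd (r \<otimes> s) = bil rB (crd r) (crd s)"
  using bil_sh[of 0 0 r s] by simp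

lemma solvable_coords: "solvable_coords n Qm rB C"
proof unfold_locales
  let ?o = "ext (- {1..n})" and ?i = "ext {1..n}"
  \<comment> \<open>Every basis element is a shifted coordinate vector of a monomial, which reduces
    associativity of \<open>rB\<close> to that of R.\<close>
  have sg: "sgl a 1 = sh (?o a) (crd (xm (?i a)))" for a by (simp add: crd_mon ext_exps ext_split)
  have ex: "?o a + ?o b \<in> exps (- {1..n})" for a b by (intro exps_add ext_exps)
  show "bil rB (rB a b) (sgl c 1) = bil rB (sgl a 1) (rB b c)" for a b c
    unfolding sg rB_def[of a b] rB_def[of b c]
    by (subst (1 2) bil_sh) (auto intro!: exps_add ext_exps simp: xm_closed m_assoc add.assoc)
  show "rB 0 a = sgl a 1" "rB a 0 = sgl a 1" for a
  proof -
    have "?o 0 = 0" "?i 0 = 0" by (auto intro: poly_mapping_eqI simp: lookup_ext)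
    then show "rB 0 a = sgl a 1" "rB a 0 = sgl a 1" by (simp_all add: rB_def mon_zero xm_closed sg)
  qed
  show "coeff_in C (rB a b)" for a b
    unfolding rB_def sh_def
    by (rule coeff_in_lin[where I = C and J = C])
      (auto intro: S.C_add S.C_mult crd_coeff m_closed xm_closed simp: S.C_zero S.C_one coeff_in_def[of _ "sgl _ _"] lookup_single when_def)
  show gen: "rB (sgl i 1) m = sgl (sgl i 1 + m) 1" if "i \<in> {1..n}" "m \<in> exps {i..n}" for i m
  proof -
    have m: "m \<in> M" using that exps_mono[of "{i..n}" "{1..n}"] by auto
    then have m': "sgl i 1 + m \<in> M" using that(1) by (intro exps_add exps_single)
    have "rB (sgl i 1) m = bil rB (crd (x i)) (crd (xm m))"
      using that(1) m by (simp add: mon_gen[symmetric] crd_mon exps_single bil_single)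
    also have "\<dots> = crd (xm (sgl i 1 + m))" using that by (simp add: mon_step crd_mult x_closed xm_closed)
    finally show ?thesis using m' by (simp add: crd_mon)
  qed
  fix i j S
  assume ij: "i \<in> {1..n}" "j \<in> {1..n}" "i < j" and S0: "\<And>c. c \<in> C \<Longrightarrow> sgl 0 c \<in> S"
    and Sx: "\<And>l. l \<in> {Suc i..n} \<Longrightarrow> sgl (sgl l 1) 1 \<in> S" and Su: "\<And>v. v \<in> S \<Longrightarrow> - v \<in> S"
    and Sa: "\<And>v w. v \<in> S \<Longrightarrow> w \<in> S \<Longrightarrow> v + w \<in> S" and Sm: "\<And>v w. v \<in> S \<Longrightarrow> w \<in> S \<Longrightarrow> bil rB v w \<in> S"
  have x1: "sgl (sgl l 1) 1 = crd (x l)" if "l \<in> {1..n}" for l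
    using crd_mon[of "sgl l 1"] that by (simp add: mon_gen exps_single)
  let ?H = "\<eta> ` K \<union> x ` {i + 1..n}"
  have H: "?H \<subseteq> carrier R" using ij by (auto intro: x_closed)
  \<comment> \<open>Each way of building elements of the generated subring is matched by a closure
    property of \<open>S\<close>.\<close>
  have *: "r \<in> carrier R \<and> crd r \<in> S" if "r \<in> generate_ring R ?H" for r
    using that
  proof (induction r)
    case one
    show ?case using S0[OF S.C_one] by (simp add: crd_one)
  next
    case (incl h)
    then show ?case using S0 Sx x1 ij H by (auto simp: crd_scalar C_def x_closed)
  qed (auto simp: crd_uminus crd_add crd_mult Su Sa Sm)
  let ?r = "(x i \<otimes> x j) \<ominus> (\<eta> (q i j) \<otimes> (x j \<otimes> x i))"
  have "?r \<in> generate_ring R ?H" using Q_solvable ij unfolding Q_solvable_def by blast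
  then have "crd ?r \<in> S" using * by blast
  then show "bil rB (sgl (sgl i 1) 1) (sgl (sgl j 1) 1) - smul (Qm i j) (bil rB (sgl (sgl j 1) 1) (sgl (sgl i 1) 1)) \<in> S"
    using ij crd_eta[OF K_q[OF ij(1,2)], of "x j \<otimes> x i"]
    by (simp add: crd_diff crd_mult[of "x i"] crd_mult[of "x j"] K_q x_closed x1 Qm_def)
qed

sublocale V: solvable_coords n Qm rB C by (rule solvable_coords)

lemma crd_carrier: "crd ` carrier R = carrier V.Rring"
proof
  show "crd ` carrier R \<subseteq> carrier V.Rring"
    using cd_keys crd_coeff by (fastforce simp: V.Rs_def keys_crd simp del: One_nat_def)
  show "carrier V.Rring \<subseteq> crd ` carrier R"
  proof
    fix v assume "v \<in> carrier V.Rring"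
    then have v: "kys v \<subseteq> M" "coeff_in C v" by simp_all
    define c where "c = map_coeff (the_inv emb) v"
    have ie: "the_inv emb (emb a) = a" for a by (rule the_inv_f_f) (simp add: inj_def)
    have l: "lkp c m = the_inv emb (lkp v m)" for m unfolding c_def by (rule lookup_map_coeff) (metis ie emb_simps(1))
    have e: "emb (lkp c m) = lkp v m" "lkp c m \<in> K" for m
    proof -
      obtain a where "a \<in> K" "lkp v m = emb a" using v(2) unfolding coeff_in_def C_def by blast
      then show "emb (lkp c m) = lkp v m" "lkp c m \<in> K" by (simp_all add: l ie)
    qed
    have "kys c \<subseteq> kys v"
    proof
      fix m assume "m \<in> kys c"
      then show "m \<in> kys v" using e(1)[of m] by (metis emb_eq_0 in_keys_iff)
    qed
    then have "c \<in> KC" using v(1) e(2) by (auto simp: KC_iff coeff_in_def)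
    moreover from this have "crd (lc c) = v" by (intro poly_mapping_eqI) (simp add: cd_lc e)
    ultimately show "v \<in> crd ` carrier R" using lc_KC by blast
  qed
qed

lemma crd_hom: "crd \<in> ring_hom R V.Rring"
  by (rule ring_hom_memI) (use crd_carrier in \<open>auto simp: crd_add crd_mult crd_one simp del: V.R.ring_of_simps(5)\<close>)

end

text \<open>With \<open>N\<close> generators over the centre, \<open>N + 1\<close> elements give
  more unknowns than equations. The centre is commutative and has no zero divisors, hence is Ore, so
  the system has a nonzero solution in the centre itself.\<close>

lemma (in nc_domain) central_dependence:
  assumes "finite_over_center G"
  shows "\<exists>N::nat. \<forall>r. (\<forall>k\<le>N. r k \<in> carrier G) \<longrightarrow>
    (\<exists>u. (\<forall>k\<le>N. u k \<in> ring_center G) \<and> (\<exists>k\<le>N. u k \<noteq> \<zero>) \<and> (\<Oplus>k\<in>{..N}. u k \<otimes> r k) = \<zero>)"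
proof -
  let ?Z = "ring_center G"
  have ZD: "z \<in> carrier G" "a \<in> carrier G \<Longrightarrow> z \<otimes> a = a \<otimes> z" if "z \<in> ?Z" for z a
    using that by (auto simp: ring_center_def)
  have ZI: "z \<in> ?Z" if "z \<in> carrier G" "\<And>a. a \<in> carrier G \<Longrightarrow> z \<otimes> a = a \<otimes> z" for z
    using that unfolding ring_center_def by blast
  have Z: "subring ?Z G"
  proof (rule subringI)
    show "\<ominus> z \<in> ?Z" if z: "z \<in> ?Z" for z
    proof (rule ZI)
      show "\<ominus> z \<otimes> a = a \<otimes> \<ominus> z" if a: "a \<in> carrier G" for a
        by (simp only: l_minus[OF ZD(1)[OF z] a] r_minus[OF a ZD(1)[OF z]] ZD(2)[OF z a])
    qed (use ZD(1)[OF z] in simp)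
    show "z \<otimes> w \<in> ?Z" if zw: "z \<in> ?Z" "w \<in> ?Z" for z w
    proof -
      have "z \<otimes> w \<otimes> a = a \<otimes> (z \<otimes> w)" if a: "a \<in> carrier G" for a
      proof -
        have c: "z \<in> carrier G" "w \<in> carrier G" using zw ZD(1) by blast+
        have "z \<otimes> w \<otimes> a = z \<otimes> (w \<otimes> a)" by (rule m_assoc) (use c a in auto)
        also have "\<dots> = z \<otimes> (a \<otimes> w)" unfolding ZD(2)[OF zw(2) a] by (rule refl)
        also have "\<dots> = z \<otimes> a \<otimes> w" by (rule m_assoc[symmetric]) (use c a in auto)
        also have "\<dots> = a \<otimes> z \<otimes> w" unfolding ZD(2)[OF zw(1) a] by (rule refl)
        also have "\<dots> = a \<otimes> (z \<otimes> w)" by (rule m_assoc) (use c a in auto)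
        finally show ?thesis .
      qed
      moreover have "z \<otimes> w \<in> carrier G" using zw ZD(1) by (intro m_closed)
      ultimately show ?thesis by (intro ZI)
    qed
    show "z \<oplus> w \<in> ?Z" if zw: "z \<in> ?Z" "w \<in> ?Z" for z w
    proof (rule ZI)
      have c: "z \<in> carrier G" "w \<in> carrier G" using zw ZD(1) by blast+
      then show "z \<oplus> w \<in> carrier G" by simp
      show "(z \<oplus> w) \<otimes> a = a \<otimes> (z \<oplus> w)" if a: "a \<in> carrier G" for a
        by (simp only: l_distr[OF c a] r_distr[OF c a] ZD(2)[OF zw(1) a] ZD(2)[OF zw(2) a])
    qed
    show "\<one> \<in> ?Z" by (rule ZI) auto
  qed (use ZD(1) in blast)
  have ore: "right_ore G ?Z" unfolding right_ore_def using ZD by metis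
  obtain F where F: "finite F" "F \<subseteq> carrier G"
    and gen: "\<forall>r\<in>carrier G. \<exists>z \<in> F \<rightarrow> ?Z. r = (\<Oplus>f\<in>F. z f \<otimes> f)"
    using assms unfolding finite_over_center_def by (elim exE conjE) (rule that)
  let ?N = "card F"
  have "\<exists>u. (\<forall>k\<le>?N. u k \<in> ?Z) \<and> (\<exists>k\<le>?N. u k \<noteq> \<zero>) \<and> (\<Oplus>k\<in>{..?N}. u k \<otimes> r k) = \<zero>"
    if r: "\<forall>k\<le>?N. r k \<in> carrier G" for r
  proof -
    define z where "z k = (SOME z. z \<in> F \<rightarrow> ?Z \<and> r k = (\<Oplus>f\<in>F. z f \<otimes> f))" for k
    have z: "z k \<in> F \<rightarrow> ?Z \<and> r k = (\<Oplus>f\<in>F. z k f \<otimes> f)" if k: "k \<le> ?N" for k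
    proof -
      have "r k \<in> carrier G" using r k by blast
      with gen have "\<exists>w \<in> F \<rightarrow> ?Z. r k = (\<Oplus>f\<in>F. w f \<otimes> f)" by (rule bspec)
      then have "\<exists>w. w \<in> F \<rightarrow> ?Z \<and> r k = (\<Oplus>f\<in>F. w f \<otimes> f)" by (simp only: Bex_def)
      from someI_ex[OF this] show ?thesis unfolding z_def .
    qed
    have zZ: "z k f \<in> ?Z" if "k \<le> ?N" "f \<in> F" for k f using z[OF that(1)] that(2) by (auto simp: Pi_iff)
    have "\<exists>u. (\<forall>k\<in>{..?N}. u k \<in> ?Z) \<and> (\<exists>k\<in>{..?N}. u k \<noteq> \<zero>) \<and> (\<forall>f\<in>F. (\<Oplus>k\<in>{..?N}. z k f \<otimes> u k) = \<zero>)"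
    proof (rule ore_linear_system[OF Z ore F(1)])
      show "z k f \<in> ?Z" if "f \<in> F" "k \<in> {..?N}" for f k by (rule zZ) (use that in auto)
    qed auto
    then obtain u where u: "\<forall>k\<in>{..?N}. u k \<in> ?Z" and nz: "\<exists>k\<in>{..?N}. u k \<noteq> \<zero>"
      and eq: "\<forall>f\<in>F. (\<Oplus>k\<in>{..?N}. z k f \<otimes> u k) = \<zero>" by (elim exE conjE) (rule that)
    have uc: "u k \<in> carrier G" if "k \<le> ?N" for k using u that ZD(1) by blast
    have zc: "z k f \<in> carrier G" "f \<in> carrier G" if "k \<le> ?N" "f \<in> F" for k f
      using zZ[OF that] that(2) F(2) ZD(1) by blast+
    have t: "u k \<otimes> (z k f \<otimes> f) = z k f \<otimes> u k \<otimes> f" if k: "k \<le> ?N" "f \<in> F" for k f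
    proof -
      have "u k \<otimes> (z k f \<otimes> f) = u k \<otimes> z k f \<otimes> f" by (rule m_assoc[symmetric]) (use uc zc k in auto)
      also have "u k \<otimes> z k f = z k f \<otimes> u k" by (rule ZD(2)[symmetric]) (use zZ uc k in auto)
      finally show ?thesis .
    qed
    have part: "(\<Oplus>k\<in>A. u k \<otimes> r k) = (\<Oplus>f\<in>F. (\<Oplus>k\<in>A. z k f \<otimes> u k) \<otimes> f)" if "finite A" "A \<subseteq> {..?N}" for A
      using that
    proof (induction A rule: finite_induct)
      case empty
      have "(\<Oplus>f\<in>F. \<zero> \<otimes> f) = (\<Oplus>f\<in>F. \<zero>)" by (rule finsum_cong') (use F in auto)
      then show ?case by simp
    next
      case (insert k A)
      then have k: "k \<le> ?N" "\<And>k. k \<in> A \<Longrightarrow> k \<le> ?N" by auto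
      have rk: "u k \<otimes> r k = (\<Oplus>f\<in>F. z k f \<otimes> u k \<otimes> f)"
      proof -
        have "r k = (\<Oplus>f\<in>F. z k f \<otimes> f)" using z[OF k(1)] by blast
        then have "u k \<otimes> r k = (\<Oplus>f\<in>F. u k \<otimes> (z k f \<otimes> f))"
          by (simp only:) (rule finsum_rdistr, use F(1) uc zc k in auto)
        also have "\<dots> = (\<Oplus>f\<in>F. z k f \<otimes> u k \<otimes> f)" by (rule finsum_cong') (use t uc zc k in auto)
        finally show ?thesis .
      qed
      have S: "(\<Oplus>k\<in>A. z k f \<otimes> u k) \<in> carrier G" if "f \<in> F" for f
        by (rule finsum_closed) (use uc zc k that in auto)
      have "(\<Oplus>k\<in>insert k A. u k \<otimes> r k) = u k \<otimes> r k \<oplus> (\<Oplus>k\<in>A. u k \<otimes> r k)"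
        by (rule finsum_insert) (use insert uc k r in auto)
      also have "\<dots> = (\<Oplus>f\<in>F. z k f \<otimes> u k \<otimes> f) \<oplus> (\<Oplus>f\<in>F. (\<Oplus>k\<in>A. z k f \<otimes> u k) \<otimes> f)"
        using insert by (simp only: rk) auto
      also have "\<dots> = (\<Oplus>f\<in>F. z k f \<otimes> u k \<otimes> f \<oplus> (\<Oplus>k\<in>A. z k f \<otimes> u k) \<otimes> f)"
        by (rule finsum_addf[symmetric]) (use uc zc k S in auto)
      also have "\<dots> = (\<Oplus>f\<in>F. (\<Oplus>k\<in>insert k A. z k f \<otimes> u k) \<otimes> f)"
      proof (rule finsum_cong')
        show "z k f \<otimes> u k \<otimes> f \<oplus> (\<Oplus>k\<in>A. z k f \<otimes> u k) \<otimes> f = (\<Oplus>k\<in>insert k A. z k f \<otimes> u k) \<otimes> f" if f: "f \<in> F" for f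
        proof -
          have "(\<Oplus>k\<in>insert k A. z k f \<otimes> u k) = z k f \<otimes> u k \<oplus> (\<Oplus>k\<in>A. z k f \<otimes> u k)"
            by (rule finsum_insert) (use insert(1,2) uc zc k f in auto)
          then show ?thesis by (simp only:) (rule l_distr[symmetric], use uc zc k f S in auto)
        qed
        show "(\<lambda>f. (\<Oplus>k\<in>insert k A. z k f \<otimes> u k) \<otimes> f) \<in> F \<rightarrow> carrier G"
          by (intro Pi_I m_closed finsum_closed) (use uc zc k in auto)
      qed simp
      finally show ?case .
    qed
    have "(\<Oplus>k\<in>{..?N}. u k \<otimes> r k) = (\<Oplus>f\<in>F. (\<Oplus>k\<in>{..?N}. z k f \<otimes> u k) \<otimes> f)" by (rule part) auto
    also have "\<dots> = (\<Oplus>f\<in>F. \<zero>)" by (rule finsum_cong') (use eq F in auto)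
    also have "\<dots> = \<zero>" by (rule finsum_zero)
    finally have "(\<Oplus>k\<in>{..?N}. u k \<otimes> r k) = \<zero>" .
    then show ?thesis using u nz by (intro exI[of _ u]) auto
  qed
  then show ?thesis by (intro exI[of _ ?N] allI impI)
qed

section \<open>Specialization at the primes of k[Q]\<close>

context solvable_data
begin

definition specialized :: "'k laurent set \<Rightarrow> 'r set" where "specialized E = {r \<in> carrier R. coeff_in E (cd r)}"

context
  fixes E assumes E: "primeideal E (kQ n q)"
begin

lemma E_K: "a \<in> E \<Longrightarrow> a \<in> K" and E_zero: "0 \<in> E" and E_add: "a \<in> E \<Longrightarrow> b \<in> E \<Longrightarrow> a + b \<in> E"
  and E_mult: "a \<in> K \<Longrightarrow> b \<in> E \<Longrightarrow> a * b \<in> E"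
proof -
  interpret primeideal E "kQ n q" by fact
  show "a \<in> E \<Longrightarrow> a \<in> K" using a_subset by blast
  show "0 \<in> E" "a \<in> E \<Longrightarrow> b \<in> E \<Longrightarrow> a + b \<in> E" "a \<in> K \<Longrightarrow> b \<in> E \<Longrightarrow> a * b \<in> E"
    using zero_closed a_closed[of a b] I_l_closed[of b a] by simp_all
qed

lemma specialized_crd: assumes "r \<in> carrier R" shows "r \<in> specialized E \<longleftrightarrow> coeff_in (emb ` E) (crd r)"
proof -
  have "emb a \<in> emb ` E \<longleftrightarrow> a \<in> E" for a by (rule inj_image_mem_iff) (simp add: inj_def)
  then show ?thesis using assms by (simp add: specialized_def coeff_in_def)
qed

lemma prime_in_emb: "V.prime_in (emb ` E)"
proof -
  interpret P: primeideal E "kQ n q" by (rule E)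
  have m: "emb a \<in> emb ` E \<longleftrightarrow> a \<in> E" for a by (rule inj_image_mem_iff) (simp add: inj_def)
  have o: "1 \<notin> E"
  proof
    assume o: "1 \<in> E"
    have "K \<subseteq> E"
    proof
      fix a assume "a \<in> K"
      then show "a \<in> E" using E_mult[OF _ o] by simp
    qed
    then show False using P.I_notcarr E_K by auto
  qed
  have "0 \<in> emb ` E" "1 \<notin> emb ` E" using m[of 0] m[of 1] E_zero o by simp_all
  moreover have "x \<in> emb ` E \<or> y \<in> emb ` E" if xy: "x \<in> C" "y \<in> C" "x * y \<in> emb ` E" for x y
  proof -
    obtain a b where ab: "a \<in> K" "b \<in> K" "x = emb a" "y = emb b" using xy(1,2) unfolding C_def by blast
    then have "a * b \<in> E" using xy(3) m[of "a * b"] by simp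
    then have "a \<in> E \<or> b \<in> E" using P.I_prime[OF ab(1,2)] by simp
    then show ?thesis using ab m by blast
  qed
  ultimately show ?thesis unfolding V.prime_in_def using E_K E_add E_mult
    by (auto simp: C_def m simp flip: emb_simps)
qed

text \<open>The ordered monomials form a basis over k[Q], so RE consists of the elements with all
  coordinates in \<open>E\<close>. This turns congruences in the quotient into conditions on
  coefficients.\<close>

lemma genideal_specialized: "genideal R (\<eta> ` E) = specialized E"
proof
  let ?E = "emb ` E"
  have pE: "0 \<in> ?E" "\<And>a b. a \<in> ?E \<Longrightarrow> b \<in> ?E \<Longrightarrow> a + b \<in> ?E" "\<And>c a. c \<in> C \<Longrightarrow> a \<in> ?E \<Longrightarrow> c * a \<in> ?E"
    using prime_in_emb unfolding V.prime_in_def by blast+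
  have eE: "\<eta> ` E \<subseteq> carrier R" using E_K by (auto intro: eta_closed)
  have "ideal (specialized E) R"
  proof (rule idealI)
    show "subgroup (specialized E) (add_monoid R)"
    proof (rule add.subgroupI)
      have "\<zero> \<in> specialized E" by (simp add: specialized_crd crd_zero coeff_in_def pE)
      then show "specialized E \<noteq> {}" by blast
      show "\<ominus> r \<in> specialized E" if "r \<in> specialized E" for r
      proof -
        have r: "r \<in> carrier R" using that by (simp add: specialized_def)
        have "- e \<in> ?E" if "e \<in> ?E" for e using pE(3)[OF S.C_uminus[OF S.C_one] that] by simp
        then show ?thesis using that r by (simp add: specialized_crd crd_uminus coeff_in_def)
      qed
      show "r \<oplus> s \<in> specialized E" if "r \<in> specialized E" "s \<in> specialized E" for r s
      proof -
        have r: "r \<in> carrier R" "s \<in> carrier R" using that by (simp_all add: specialized_def)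
        then show ?thesis using that by (simp add: specialized_crd crd_add coeff_in_def lookup_add pE)
      qed
    qed (auto simp: specialized_def)
    fix a r assume a: "a \<in> specialized E" and r: "r \<in> carrier R"
    then have ac: "a \<in> carrier R" by (simp add: specialized_def)
    have sp: "coeff_in ?E (crd a)" using a ac by (simp add: specialized_crd)
    have B: "lkp (rB k l) m \<in> C" for k l m using V.rB_C[of k l] by (simp add: coeff_in_def)
    have em: "e * (c * lkp (rB k l) m) \<in> ?E" "c * (e * lkp (rB k l) m) \<in> ?E" if "e \<in> ?E" "c \<in> C" for e c k l m
      using pE(3)[OF S.C_mult[OF that(2) B] that(1)] by (simp_all add: ac_simps)
    have "coeff_in ?E (bil rB (crd a) (crd r))"
      by (rule coeff_in_bil[where I = ?E and J = C]) (use sp crd_coeff[OF r] pE(1,2) em in auto)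
    then show "a \<otimes> r \<in> specialized E" using ac r by (simp add: specialized_crd crd_mult)
    have "coeff_in ?E (bil rB (crd r) (crd a))"
      by (rule coeff_in_bil[where I = C and J = ?E]) (use sp crd_coeff[OF r] pE(1,2) em in auto)
    then show "r \<otimes> a \<in> specialized E" using ac r by (simp add: specialized_crd crd_mult)
  qed (rule ring_axioms)
  moreover have "\<eta> ` E \<subseteq> specialized E"
  proof
    fix r assume "r \<in> \<eta> ` E"
    then obtain a where a: "a \<in> E" "r = \<eta> a" by blast
    then show "r \<in> specialized E" using E_K[OF a(1)] pE(1)
      by (simp add: specialized_crd crd_scalar coeff_in_def lookup_single when_def)
  qed
  ultimately show "genideal R (\<eta> ` E) \<subseteq> specialized E" by (rule genideal_minimal)
  show "specialized E \<subseteq> genideal R (\<eta> ` E)"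
  proof
    interpret I: ideal "genideal R (\<eta> ` E)" R by (rule genideal_ideal[OF eE])
    fix r assume r: "r \<in> specialized E"
    then have rc: "r \<in> carrier R" by (simp add: specialized_def)
    have t: "\<eta> (lkp (cd r) m) \<otimes> xm m \<in> genideal R (\<eta> ` E)" for m
      using r genideal_self[OF eE] by (intro I.I_r_closed) (auto simp: specialized_def coeff_in_def xm_closed)
    have "(\<Oplus>m\<in>A. \<eta> (lkp (cd r) m) \<otimes> xm m) \<in> genideal R (\<eta> ` E)" if "finite A" for A
      using that
    proof (induction A rule: finite_induct)
      case (insert m A)
      then show ?case by (subst finsum_insert) (auto intro: I.a_closed t I.a_Hcarr)
    qed simp
    then have "lc (cd r) \<in> genideal R (\<eta> ` E)" unfolding lin_comb_def by simp
    then show "r \<in> genideal R (\<eta> ` E)" using lc_cd[OF rc] by simp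
  qed
qed

text \<open>A central dependence in R/RE is lifted to representatives, for which commutation and the
  dependence hold up to elements of RE. No twist has arisen yet, so \<open>\<theta>\<close> is
  0.\<close>

lemma central_rel_of_finite:
  assumes d: "noncomm_domain (specialization R \<eta> E)" and f: "finite_over_center (specialization R \<eta> E)"
  shows "V.central_rel (emb ` E) 1"
proof -
  define I where "I = specialized E"
  have "ideal (genideal R (\<eta> ` E)) R" by (rule genideal_ideal) (use E_K in \<open>auto intro: eta_closed\<close>)
  then interpret I: ideal I R by (simp add: genideal_specialized I_def)
  let ?D = "R Quot I"
  have D: "specialization R \<eta> E = ?D" by (simp add: specialization_def genideal_specialized I_def)
  have "nc_domain ?D" using d unfolding D nc_domain_iff .
  then interpret D: nc_domain ?D .
  interpret pi: ring_hom_ring R ?D "(+>) I" by (rule I.rcos_ring_hom_ring)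
  have z: "I +> r = \<zero>\<^bsub>?D\<^esub> \<longleftrightarrow> r \<in> I" if "r \<in> carrier R" for r
  proof -
    have "I +> r = I +> \<zero> \<longleftrightarrow> r \<ominus> \<zero> \<in> I" using quotient_eq_iff_same_a_r_cos[OF I.is_ideal that zero_closed] by blast
    moreover have "r \<ominus> \<zero> = r" using that by (simp add: a_minus_def)
    ultimately show ?thesis using pi.hom_zero by simp
  qed
  have fz: "I +> (\<Oplus>k\<in>A. f k) = (\<Oplus>\<^bsub>?D\<^esub>k\<in>A. I +> f k)" if "\<And>k. k \<in> A \<Longrightarrow> f k \<in> carrier R" for A :: "nat set" and f
    using that by (subst pi.hom_finsum) (auto simp: o_def)
  have "\<exists>N::nat. \<forall>r. (\<forall>k\<le>N. r k \<in> carrier ?D) \<longrightarrow> (\<exists>u. (\<forall>k\<le>N. u k \<in> ring_center ?D) \<and>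
      (\<exists>k\<le>N. u k \<noteq> \<zero>\<^bsub>?D\<^esub>) \<and> (\<Oplus>\<^bsub>?D\<^esub>k\<in>{..N}. u k \<otimes>\<^bsub>?D\<^esub> r k) = \<zero>\<^bsub>?D\<^esub>)"
    by (rule D.central_dependence) (use f in \<open>simp only: D\<close>)
  then obtain N :: nat where N: "\<forall>r. (\<forall>k\<le>N. r k \<in> carrier ?D) \<longrightarrow> (\<exists>u. (\<forall>k\<le>N. u k \<in> ring_center ?D) \<and>
      (\<exists>k\<le>N. u k \<noteq> \<zero>\<^bsub>?D\<^esub>) \<and> (\<Oplus>\<^bsub>?D\<^esub>k\<in>{..N}. u k \<otimes>\<^bsub>?D\<^esub> r k) = \<zero>\<^bsub>?D\<^esub>)" by (elim exE) (rule that)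
  have cD: "carrier ?D = (+>) I ` carrier R"
    unfolding FactRing_def A_RCOSETS_def' by (simp only: partial_object.select_convs) blast
  show ?thesis unfolding V.central_rel_def
  proof (intro exI[of _ N] allI impI)
    fix r assume r: "\<forall>k\<le>N. r k \<in> V.Rs 1 \<and> coeff_in C (r k)"
    define s where "s k = inv_into (carrier R) crd (r k)" for k
    have "r k \<in> crd ` carrier R" if "k \<le> N" for k
      unfolding crd_carrier V.Rring_carrier using r that by blast
    then have s: "s k \<in> carrier R" "r k = crd (s k)" if "k \<le> N" for k
      unfolding s_def using that by (auto intro: inv_into_into simp: f_inv_into_f)
    have "\<forall>k\<le>N. I +> s k \<in> carrier ?D" using s(1) by simp
    from mp[OF spec[OF N] this] obtain u where u: "\<forall>k\<le>N. u k \<in> ring_center ?D" "\<exists>k\<le>N. u k \<noteq> \<zero>\<^bsub>?D\<^esub>"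
      "(\<Oplus>\<^bsub>?D\<^esub>k\<in>{..N}. u k \<otimes>\<^bsub>?D\<^esub> (I +> s k)) = \<zero>\<^bsub>?D\<^esub>" by (rule exE) (elim conjE, rule that)
    define y where "y k = inv_into (carrier R) ((+>) I) (u k)" for k
    have "u k \<in> (+>) I ` carrier R" if "k \<le> N" for k
      using u(1) that unfolding ring_center_def cD by blast
    then have y: "y k \<in> carrier R" "u k = I +> y k" if "k \<le> N" for k
      unfolding y_def using that by (auto intro: inv_into_into simp: f_inv_into_f)
    have com: "y k \<otimes> x l \<ominus> x l \<otimes> y k \<in> I" if kl: "k \<le> N" "l \<in> {1..n}" for k l
    proof -
      have c: "y k \<in> carrier R" "x l \<in> carrier R" using y(1)[OF kl(1)] x_closed[OF kl(2)] by auto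
      have "u k \<otimes>\<^bsub>?D\<^esub> (I +> x l) = (I +> x l) \<otimes>\<^bsub>?D\<^esub> u k"
        using u(1) kl(1) pi.hom_closed[OF c(2)] unfolding ring_center_def by blast
      then have "I +> (y k \<otimes> x l) = I +> (x l \<otimes> y k)"
        unfolding y(2)[OF kl(1)] pi.hom_mult[OF c] pi.hom_mult[OF c(2) c(1)] .
      then show ?thesis
        using quotient_eq_iff_same_a_r_cos[OF I.is_ideal m_closed[OF c] m_closed[OF c(2) c(1)]] by (rule iffD2[rotated])
    qed
    have sc: "(\<Oplus>k\<in>A. y k \<otimes> s k) \<in> carrier R" if "A \<subseteq> {..N}" for A
    proof (rule finsum_closed, rule Pi_I)
      fix k assume "k \<in> A"
      then have "k \<le> N" using that by auto
      then show "y k \<otimes> s k \<in> carrier R" using y(1) s(1) by (intro m_closed)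
    qed
    have mem: "(\<Oplus>k\<in>{..N}. y k \<otimes> s k) \<in> I"
    proof -
      have "I +> (\<Oplus>k\<in>{..N}. y k \<otimes> s k) = (\<Oplus>\<^bsub>?D\<^esub>k\<in>{..N}. I +> (y k \<otimes> s k))"
        by (rule fz) (use y(1) s(1) in auto)
      also have "\<dots> = (\<Oplus>\<^bsub>?D\<^esub>k\<in>{..N}. u k \<otimes>\<^bsub>?D\<^esub> (I +> s k))"
      proof (rule D.finsum_cong'[OF refl])
        fix k assume "k \<in> {..N}"
        then have k: "k \<le> N" by simp
        show "I +> (y k \<otimes> s k) = u k \<otimes>\<^bsub>?D\<^esub> (I +> s k)"
          unfolding y(2)[OF k] by (rule pi.hom_mult[OF y(1)[OF k] s(1)[OF k]])
      next
        show "(\<lambda>k. u k \<otimes>\<^bsub>?D\<^esub> (I +> s k)) \<in> {..N} \<rightarrow> carrier ?D"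
        proof (rule Pi_I)
          fix k assume "k \<in> {..N}"
          then have k: "k \<le> N" by simp
          show "u k \<otimes>\<^bsub>?D\<^esub> (I +> s k) \<in> carrier ?D"
            unfolding y(2)[OF k] by (rule D.m_closed[OF pi.hom_closed[OF y(1)[OF k]] pi.hom_closed[OF s(1)[OF k]]])
        qed
      qed
      finally show ?thesis using u(3) z[OF sc[OF subset_refl]] by simp
    qed
    have cs: "crd (\<Oplus>k\<in>A. y k \<otimes> s k) = (\<Sum>k\<in>A. bil rB (crd (y k)) (r k))" if "finite A" "A \<subseteq> {..N}" for A
      using that
    proof (induction A rule: finite_induct)
      case empty
      then show ?case by (simp add: crd_zero)
    next
      case (insert k A)
      then have k: "k \<le> N" "A \<subseteq> {..N}" by auto
      have "(\<Oplus>k\<in>insert k A. y k \<otimes> s k) = y k \<otimes> s k \<oplus> (\<Oplus>k\<in>A. y k \<otimes> s k)"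
      proof (rule finsum_insert[OF insert(1,2)])
        show "(\<lambda>k. y k \<otimes> s k) \<in> A \<rightarrow> carrier R"
        proof (rule Pi_I)
          fix k assume "k \<in> A"
          then have "k \<le> N" using k(2) by auto
          then show "y k \<otimes> s k \<in> carrier R" using y(1) s(1) by (intro m_closed)
        qed
        show "y k \<otimes> s k \<in> carrier R" by (rule m_closed[OF y(1)[OF k(1)] s(1)[OF k(1)]])
      qed
      then have "crd (\<Oplus>k\<in>insert k A. y k \<otimes> s k) = bil rB (crd (y k)) (crd (s k)) + crd (\<Oplus>k\<in>A. y k \<otimes> s k)"
        by (simp only: crd_add[OF m_closed[OF y(1)[OF k(1)] s(1)[OF k(1)]] sc[OF k(2)]] crd_mult[OF y(1)[OF k(1)] s(1)[OF k(1)]])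
      then show ?case using insert(3)[OF k(2)] insert(1,2) s(2)[OF k(1)] by simp
    qed
    have "coeff_in (emb ` E) (crd (\<Oplus>k\<in>{..N}. y k \<otimes> s k))"
      using mem unfolding I_def specialized_crd[OF sc[OF subset_refl]] .
    then have dep: "coeff_in (emb ` E) (\<Sum>k\<le>N. bil rB (crd (y k)) (r k))"
      unfolding cs[OF finite_atMost subset_refl] .
    have comm: "coeff_in (emb ` E) (bil rB (crd (y k)) (V.gen l) - smul (S.beta (sgl l 1) 0) (bil rB (V.gen l) (crd (y k))))"
      if "k \<le> N" "l \<in> {1..n}" for k l
    proof -
      have "V.gen l = crd (x l)" using crd_mon[of "sgl l 1"] that by (simp add: V.gen_def mon_gen exps_single)
      then show ?thesis using com[OF that] y(1)[OF that(1)] x_closed[OF that(2)]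
        unfolding I_def by (simp add: specialized_crd crd_diff crd_mult)
    qed
    obtain k where k: "k \<le> N" "u k \<noteq> \<zero>\<^bsub>?D\<^esub>" using u(2) by (elim exE conjE) (rule that)
    have "y k \<notin> I" using k(2) z[OF y(1)[OF k(1)]] y(2)[OF k(1)] by simp
    then have "\<not> coeff_in (emb ` E) (crd (y k))"
      using specialized_crd[OF y(1)[OF k(1)]] unfolding I_def by simp
    then have ne: "\<exists>k\<le>N. \<not> coeff_in (emb ` E) (crd (y k))" using k(1) by (intro exI conjI)
    have yR: "crd (y k) \<in> V.Rs 1 \<and> coeff_in C (crd (y k))" if "k \<le> N" for k
    proof -
      have "crd (y k) \<in> crd ` carrier R" using y(1)[OF that] by (rule imageI)
      then show ?thesis unfolding crd_carrier V.Rring_carrier .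
    qed
    show "\<exists>z \<theta>. \<theta> \<in> exps {1..<1} \<and> (\<forall>k\<le>N. z k \<in> V.Rs 1 \<and> coeff_in C (z k)) \<and> (\<exists>k\<le>N. \<not> coeff_in (emb ` E) (z k)) \<and>
       (\<forall>k\<le>N. \<forall>l\<in>{1..n}. coeff_in (emb ` E) (bil rB (z k) (V.gen l) - smul (S.beta (sgl l 1) \<theta>) (bil rB (V.gen l) (z k)))) \<and>
       coeff_in (emb ` E) (\<Sum>k\<le>N. bil rB (z k) (r k))"
      by (intro exI[of _ "\<lambda>k. crd (y k)"] exI[of _ 0] conjI allI impI ballI exps_zero yR[THEN conjunct1] yR[THEN conjunct2] ne comm dep)
  qed
qed

end

text \<open>Density is tested at the zero ideal, the generic point: it lies in the basic open set of
  any nonzero \<open>a\<close>, so that set contains a point where the specialization is a domain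
  and finite over its centre.\<close>

lemma dense_points:
  assumes pure: "pure_Q_algebra n q R \<eta>" and f: "f \<in> C" "f \<noteq> 0"
  shows "\<exists>E. V.prime_in E \<and> f \<notin> E \<and> V.central_rel E 1"
proof -
  obtain a where a: "a \<in> K" "f = emb a" using f(1) by (auto simp: C_def)
  have "primeideal {0} (kQ n q)"
  proof (rule primeidealI)
    show "ideal {0} (kQ n q)" using ring.zeroideal[OF cring.axioms(1)[OF cring_kQ]] by simp
    show "K \<noteq> {0}"
    proof
      assume "K = {0}"
      then have "1 \<in> {0 :: 'k laurent}" using K_one by (simp only:)
      then show False by simp
    qed
    show "a \<in> {0} \<or> b \<in> {0}" if "a \<otimes>\<^bsub>kQ n q\<^esub> b \<in> {0}" for a b using that by simp
  qed (rule cring_kQ)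
  note zero = this
  then have "{0} \<in> prime_spec (kQ n q)" by (simp add: prime_spec_def)
  then have cl: "{0} \<in> zariski (kQ n q) closure_of pure_points n q R \<eta>"
    using pure unfolding pure_Q_algebra_def by simp
  have ze: "{0} \<in> {E \<in> prime_spec (kQ n q). a \<notin> E}"
    using zero f(2) a(2) by (simp add: prime_spec_def)
  have op: "openin (zariski (kQ n q)) {E \<in> prime_spec (kQ n q). a \<notin> E}"
    unfolding zariski_def by (rule topology_generated_by_Basis) (rule imageI, rule a(1))
  have "\<forall>T. {0} \<in> T \<and> openin (zariski (kQ n q)) T \<longrightarrow> (\<exists>E. E \<in> pure_points n q R \<eta> \<and> E \<in> T)"
    using cl unfolding in_closure_of by (rule conjunct2)
  from mp[OF spec[OF this] conjI[OF ze op]]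
  obtain E where E: "E \<in> pure_points n q R \<eta>" "E \<in> {E \<in> prime_spec (kQ n q). a \<notin> E}" by (rule exE) (elim conjE, rule that)
  have pr: "primeideal E (kQ n q)" using E(2) by (simp add: prime_spec_def)
  have d: "noncomm_domain (specialization R \<eta> E)" "finite_over_center (specialization R \<eta> E)"
    using E(1) by (simp_all add: pure_points_def)
  have "f \<notin> emb ` E"
  proof
    assume "f \<in> emb ` E"
    then obtain b where "b \<in> E" "emb a = emb b" unfolding a(2) by (rule imageE)
    then show False using E(2) by simp
  qed
  then show ?thesis by (intro exI[of _ "emb ` E"] conjI prime_in_emb[OF pr] central_rel_of_finite[OF pr d])
qed

abbreviation "Lring \<equiv> V.Lring"

lemma exists_good:
  assumes pure: "pure_Q_algebra n q R \<eta>"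
  shows "\<exists>W. (\<forall>l\<in>{1..n}. V.good W l) \<and> (\<forall>l\<in>{1..n}. coeff_in V.F (W l))"
proof -
  \<comment> \<open>The constants of k lie in k[Q], so in characteristic 0 the inverse of
    \<open>m\<close> is available in \<open>C\<close>.\<close>
  have char: "\<exists>c\<in>C. of_nat m * c = 1" if "m > 0" for m :: nat
  proof -
    have p: "const (of_nat m) = (of_nat m :: 'k laurent)" by (simp add: const_def single_of_nat)
    have "const (of_nat m) * const (1 / of_nat m) = const (1 :: 'k)"
      unfolding const_def mult_single using that by simp
    then have "of_nat m * const (1 / of_nat m) = (1 :: 'k laurent)" unfolding p by (simp add: const_def single_one)
    then have "emb (of_nat m) * emb (const (1 / of_nat m)) = 1" by (simp only: emb_simps(4)[symmetric] emb_simps(2))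
    moreover have "emb (of_nat m) = of_nat m" by (simp add: emb_def Fract_of_nat_eq)
    ultimately have "of_nat m * emb (const (1 / of_nat m)) = 1" by (simp only:)
    moreover have "emb (const (1 / of_nat m)) \<in> C" unfolding C_def by (rule imageI[OF K_const])
    ultimately show ?thesis by (rule bexI)
  qed
  show ?thesis
  proof (rule V.exists_embedding[OF char dense_points[OF pure]])
    fix W assume W: "\<And>l. l \<in> {1..n} \<Longrightarrow> V.good W l" "\<And>l. l \<in> {1..n} \<Longrightarrow> coeff_in V.F (W l)"
    show ?thesis by (intro exI[of _ W] conjI ballI W)
  qed
qed

theorem torus_embedding:
  assumes W: "\<And>l. l \<in> {1..n} \<Longrightarrow> V.good W l" "\<And>l. l \<in> {1..n} \<Longrightarrow> coeff_in V.F (W l)"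
  obtains h where "h \<in> ring_hom R Lring" "inj_on h (carrier R)" "right_ore Lring (h ` carrier R)"
    "denominated Lring (h ` carrier R) = carrier Lring" "\<And>a. a \<in> K \<Longrightarrow> h (\<eta> a) = sgl 0 (emb a)"
proof -
  let ?h = "V.phi W \<circ> crd"
  have im: "?h ` carrier R = V.phi W ` carrier V.Rring" by (simp only: image_comp[symmetric] crd_carrier)
  show ?thesis
  proof (rule that[of ?h])
    have "V.phi W \<in> ring_hom V.Rring Lring" by (rule V.phi_hom) (erule W)+
    then show "?h \<in> ring_hom R Lring" by (rule ring_hom_trans[OF crd_hom])
    show "inj_on ?h (carrier R)"
    proof (rule comp_inj_on[OF crd_inj])
      show "inj_on (V.phi W) (crd ` carrier R)"
      proof (rule inj_on_subset)
        show "inj_on (V.phi W) (V.Rs 1)" by (rule V.phi_inj) (erule W)+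
        show "crd ` carrier R \<subseteq> V.Rs 1"
        proof
          fix v assume "v \<in> crd ` carrier R"
          then show "v \<in> V.Rs 1" unfolding crd_carrier V.Rring_carrier by (rule conjunct1)
        qed
      qed
    qed
    show "right_ore Lring (?h ` carrier R)" unfolding im by (rule V.right_ore_image) (erule W)+
    show "denominated Lring (?h ` carrier R) = carrier Lring" unfolding im by (rule V.denominated_image) (erule W)+
    show "?h (\<eta> a) = sgl 0 (emb a)" if "a \<in> K" for a using that by (simp add: crd_scalar)
  qed
qed

end

section \<open>The associated graded algebra\<close>

definition splits :: "(nat \<Rightarrow>\<^sub>0 nat) \<Rightarrow> ((nat \<Rightarrow>\<^sub>0 nat) \<times> (nat \<Rightarrow>\<^sub>0 nat)) set" where
  "splits m = {(p, s). p + s = m}"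

text \<open>Both summands are bounded by \<open>m\<close> in each coordinate. Finiteness matters
  because \<open>finprod\<close> is trivial on infinite index sets.\<close>

lemma finite_splits: "finite (splits m)"
proof (rule inj_on_finite)
  let ?B = "\<Union>k\<in>kys m. {..lkp m k}"
  let ?T = "{f. \<forall>x. (x \<in> kys m \<longrightarrow> f x \<in> ?B) \<and> (x \<notin> kys m \<longrightarrow> f x = 0)}"
  show "inj_on (\<lambda>(p, s). (lkp p, lkp s)) (splits m)" by (auto simp: inj_on_def lookup_inject)
  have "lkp p \<in> ?T \<and> lkp s \<in> ?T" if "p + s = m" for p s
  proof -
    have e: "lkp m k = lkp p k + lkp s k" for k using that by (simp add: lookup_add flip: that)
    have "lkp p k \<in> ?B \<and> lkp s k \<in> ?B" if "k \<in> kys m" for k using that e[of k] by (intro conjI UN_I[of k]) auto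
    moreover have "lkp p k = 0 \<and> lkp s k = 0" if "k \<notin> kys m" for k using that e[of k] by (simp add: in_keys_iff)
    ultimately show ?thesis by blast
  qed
  note * = this
  show "(\<lambda>(p, s). (lkp p, lkp s)) ` splits m \<subseteq> ?T \<times> ?T"
  proof
    fix z assume "z \<in> (\<lambda>(p, s). (lkp p, lkp s)) ` splits m"
    then obtain p s where "p + s = m" "z = (lkp p, lkp s)" by (auto simp: splits_def)
    then show "z \<in> ?T \<times> ?T" using * by (simp only: mem_Times_iff fst_conv snd_conv)
  qed
  have "finite ?T" by (rule finite_set_of_finite_funs) auto
  then show "finite (?T \<times> ?T)" by blast
qed

definition bnd :: "(nat \<Rightarrow>\<^sub>0 nat) \<Rightarrow> ((nat \<Rightarrow>\<^sub>0 nat) \<Rightarrow>\<^sub>0 'a::comm_ring_1) \<Rightarrow> bool" where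
  "bnd m v \<longleftrightarrow> (\<forall>k. lkp v k \<noteq> 0 \<longrightarrow> k \<le> m)"

lemma bnd_add: "bnd m v \<Longrightarrow> bnd m w \<Longrightarrow> bnd m (v + w)"
  unfolding bnd_def lookup_add by (metis add_0)
lemma bnd_diff: "bnd m v \<Longrightarrow> bnd m w \<Longrightarrow> bnd m (v - w)"
  unfolding bnd_def lookup_minus by (metis diff_zero)
lemma bnd_single: "bnd m (sgl m c)" by (simp add: bnd_def lookup_single when_def)

context scalar_torus
begin

lemma lookup_pB: "lkp (bil pB v w) m = (\<Sum>(p, s)\<in>splits m. lkp v p * lkp w s * eps (toi p) (toi s))"
proof -
  have 1: "lkp (bil pB (sgl a c) (sgl b d)) m =
      (\<Sum>(p, s)\<in>splits m. lkp (sgl a c) p * lkp (sgl b d) s * eps (toi p) (toi s))" for a b c d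
  proof -
    have "(\<Sum>(p, s)\<in>splits m. lkp (sgl a c) p * lkp (sgl b d) s * eps (toi p) (toi s)) =
        (\<Sum>z\<in>splits m. if z = (a, b) then c * d * eps (toi a) (toi b) else 0)"
      by (intro sum.cong) (auto simp: lookup_single when_def split: if_splits)
    also have "\<dots> = (if (a, b) \<in> splits m then c * d * eps (toi a) (toi b) else 0)"
      by (simp add: finite_splits)
    finally show ?thesis by (simp add: pB_single lookup_single when_def splits_def)
  qed
  have 2: "lkp (bil pB (sgl a c) w) m =
      (\<Sum>(p, s)\<in>splits m. lkp (sgl a c) p * lkp w s * eps (toi p) (toi s))" for a c
    using subset_UNIV[of "kys w"]
    by (induction w rule: pm_induct_keys)
      (simp_all add: 1 bil_distribs lookup_add case_prod_beta algebra_simps sum.distrib)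
  show ?thesis using subset_UNIV[of "kys v"]
    by (induction v rule: pm_induct_keys)
      (simp_all add: 2 bil_distribs lookup_add case_prod_beta algebra_simps sum.distrib)
qed

end

section \<open>The layers of the filtration and the product of symbols\<close>

context solvable_data
begin

abbreviation "fl \<equiv> filt n q R \<eta> x"
abbreviation "fb \<equiv> filt_below n q R \<eta> x"
abbreviation "G \<equiv> gr n q R \<eta> x"

lemma span_iff:
  assumes "S \<subseteq> M" shows "b \<in> monomial_span n q R \<eta> x S \<longleftrightarrow> b \<in> carrier R \<and> kys (crd b) \<subseteq> S"
proof
  assume "b \<in> monomial_span n q R \<eta> x S"
  then obtain c where c: "c \<in> kQ_coeffs n q S" "b = lc c" unfolding monomial_span_def by blast
  then have "c \<in> KC" using assms by (auto simp: kQ_coeffs_def)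
  then show "b \<in> carrier R \<and> kys (crd b) \<subseteq> S" using c lc_KC[of c] cd_lc[of c] by (auto simp: keys_crd kQ_coeffs_def)
next
  assume b: "b \<in> carrier R \<and> kys (crd b) \<subseteq> S"
  then have "cd b \<in> kQ_coeffs n q S" using cd_KC[of b] by (auto simp: kQ_coeffs_def keys_crd)
  then show "b \<in> monomial_span n q R \<eta> x S" unfolding monomial_span_def
    using b lc_cd[of b] by (intro image_eqI[of _ _ "cd b"]) auto
qed

text \<open>The element \<open>c X^m\<close> of layer \<open>m\<close>. A class in a layer is
  determined by its coefficient at \<open>m\<close>, so the cosets in \<open>gr\<close> are indexed
  by scalars, and \<open>fb m\<close> is the one with \<open>c = 0\<close>.\<close>

definition coset :: "(nat \<Rightarrow>\<^sub>0 nat) \<Rightarrow> 'k laurent fract \<Rightarrow> 'r set" where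
  "coset m c = {b \<in> carrier R. bnd m (crd b) \<and> lkp (crd b) m = c}"

lemma crd_M: "b \<in> carrier R \<Longrightarrow> lkp (crd b) k \<noteq> 0 \<Longrightarrow> k \<in> M"
  using cd_keys[of b] unfolding keys_crd[symmetric] by (auto simp: in_keys_iff simp del: lookup_crd)

lemma fl_iff: "b \<in> fl m \<longleftrightarrow> b \<in> carrier R \<and> bnd m (crd b)"
proof -
  have "b \<in> fl m \<longleftrightarrow> b \<in> carrier R \<and> kys (crd b) \<subseteq> {p \<in> M. p \<le> m}"
    unfolding filt_def multi_exponents_exps by (rule span_iff) blast
  then show ?thesis using crd_M[of b] by (auto simp: bnd_def in_keys_iff simp del: lookup_crd)
qed

lemma fb_eq: "fb m = coset m 0"
proof (rule Set.set_eqI)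
  fix b
  have "b \<in> fb m \<longleftrightarrow> b \<in> carrier R \<and> kys (crd b) \<subseteq> {p \<in> M. p < m}"
    unfolding filt_below_def multi_exponents_exps by (rule span_iff) blast
  also have "\<dots> \<longleftrightarrow> b \<in> coset m 0"
    using crd_M[of b] by (auto simp: coset_def bnd_def in_keys_iff order.strict_iff_order simp del: lookup_crd)
  finally show "b \<in> fb m \<longleftrightarrow> b \<in> coset m 0" .
qed

lemma coset_add_mem:
  assumes "a \<in> coset m c" "b \<in> coset m d" shows "a \<oplus> b \<in> coset m (c + d)"
  using assms by (simp add: coset_def crd_add bnd_add lookup_add del: lookup_crd)

lemma coset_diff_mem:
  assumes "a \<in> coset m c" "b \<in> coset m d" shows "a \<ominus> b \<in> coset m (c - d)"
  using assms by (simp add: coset_def crd_diff bnd_diff lookup_minus del: lookup_crd)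

lemma coset_ex: assumes "m \<in> M" "c \<in> C" shows "\<exists>a. a \<in> coset m c"
proof -
  obtain k where k: "k \<in> K" "c = emb k" using assms(2) unfolding C_def by blast
  have "crd (\<eta> k \<otimes> xm m) = sgl m c" using k assms(1) by (simp add: crd_eta crd_mon xm_closed)
  then show ?thesis using k xm_closed[of m]
    by (intro exI[of _ "\<eta> k \<otimes> xm m"]) (simp add: coset_def bnd_single del: lookup_crd)
qed

lemma coset_R: "a \<in> coset m c \<Longrightarrow> a \<in> carrier R" by (simp add: coset_def)

lemma set_add_coset:
  assumes "a \<in> coset m d" shows "fb m +> a = coset m d"
proof
  show "fb m +> a \<subseteq> coset m d"
    unfolding a_r_coset_def' fb_eq using coset_add_mem[OF _ assms, of _ 0] by auto
  show "coset m d \<subseteq> fb m +> a"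
  proof
    fix b assume b: "b \<in> coset m d"
    have "b \<ominus> a \<in> fb m" unfolding fb_eq using coset_diff_mem[OF b assms] by simp
    moreover have "b = b \<ominus> a \<oplus> a" using coset_R[OF b] coset_R[OF assms] by (simp add: a_minus_def a_assoc l_neg)
    ultimately show "b \<in> fb m +> a" unfolding a_r_coset_def' by blast
  qed
qed

lemma fl_coset: "a \<in> fl m \<Longrightarrow> a \<in> coset m (lkp (crd a) m)" by (simp add: fl_iff coset_def)
lemma coset_fl: "a \<in> coset m c \<Longrightarrow> a \<in> fl m" by (simp add: fl_iff coset_def)
lemma lookup_crd_C: "a \<in> carrier R \<Longrightarrow> lkp (crd a) m \<in> C" using crd_coeff[of a] by (simp add: coeff_in_def)

lemma coset_inj: "m \<in> M \<Longrightarrow> c \<in> C \<Longrightarrow> coset m c = coset m d \<Longrightarrow> c = d"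
  using coset_ex[of m c] by (auto simp: coset_def)

lemma coset_set_add:
  assumes "m \<in> M" "d \<in> C" shows "coset m c <+> coset m d = coset m (c + d)"
proof
  show "coset m c <+> coset m d \<subseteq> coset m (c + d)"
    unfolding set_add_def' using coset_add_mem by blast
  show "coset m (c + d) \<subseteq> coset m c <+> coset m d"
  proof
    fix b assume b: "b \<in> coset m (c + d)"
    obtain a where a: "a \<in> coset m d" using coset_ex[OF assms] by blast
    have "b \<ominus> a \<in> coset m c" using coset_diff_mem[OF b a] by simp
    moreover have "b = b \<ominus> a \<oplus> a" using coset_R[OF b] coset_R[OF a] by (simp add: a_minus_def a_assoc l_neg)
    ultimately show "b \<in> coset m c <+> coset m d" unfolding set_add_def' using a by blast
  qed
qed

lemma comm_group_layer: "comm_group (R A_Mod fb m)"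
proof -
  have "subgroup (fb m) (add_monoid R)"
  proof (rule add.subgroupI)
    have z: "\<zero> \<in> fb m" unfolding fb_eq by (simp add: coset_def crd_zero bnd_def del: lookup_crd)
    then show "fb m \<noteq> {}" by blast
    show "\<ominus> a \<in> fb m" if "a \<in> fb m" for a
      using coset_diff_mem[of \<zero> m 0 a 0] z that coset_R[of a m 0] unfolding fb_eq by (simp add: a_minus_def)
    show "a \<oplus> b \<in> fb m" if "a \<in> fb m" "b \<in> fb m" for a b
      using coset_add_mem[of a m 0 b 0] that unfolding fb_eq by simp
  qed (use coset_R in \<open>auto simp: fb_eq\<close>)
  then have "abelian_subgroup (fb m) R"
    by (intro abelian_subgroupI3 additive_subgroupI abelian_group_axioms)
  then show ?thesis by (rule abelian_subgroup.a_factorgroup_is_comm_group)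
qed

lemma coset_layer: "m \<in> M \<Longrightarrow> c \<in> C \<Longrightarrow> coset m c \<in> carrier (R A_Mod fb m)"
  using coset_ex[of m c] set_add_coset[of _ m c] coset_R[of _ m c]
  by (auto simp: A_FactGroup_def' A_RCOSETS_def')

lemma finprod_coset:
  assumes m: "m \<in> M" and "finite I" "\<And>i. i \<in> I \<Longrightarrow> f i \<in> C"
  shows "finprod (R A_Mod fb m) (\<lambda>i. coset m (f i)) I = coset m (\<Sum>i\<in>I. f i) \<and> (\<Sum>i\<in>I. f i) \<in> C"
proof -
  interpret L: comm_group "R A_Mod fb m" by (rule comm_group_layer)
  show ?thesis using assms(2,3)
  proof (induction I rule: finite_induct)
    case empty
    have "\<one>\<^bsub>R A_Mod fb m\<^esub> = coset m 0" by (simp add: A_FactGroup_def' fb_eq)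
    then show ?case by (simp only: L.finprod_empty sum.empty S.C_zero simp_thms)
  next
    case (insert i I)
    have "finprod (R A_Mod fb m) (\<lambda>i. coset m (f i)) (insert i I) =
        coset m (f i) \<otimes>\<^bsub>R A_Mod fb m\<^esub> finprod (R A_Mod fb m) (\<lambda>i. coset m (f i)) I"
      by (rule L.finprod_insert) (use insert coset_layer[OF m] in auto)
    also have "\<dots> = coset m (f i) <+> coset m (sum f I)" using insert by (simp add: A_FactGroup_def')
    also have "\<dots> = coset m (f i + sum f I)" by (rule coset_set_add[OF m]) (use insert in auto)
    finally show ?case using insert by (auto intro: S.C_add)
  qed
qed

lemma gr_simps:
  "f \<in> carrier G \<longleftrightarrow> f \<in> (\<Pi>\<^sub>E m\<in>M. (\<lambda>a. fb m +> a) ` fl m) \<and> finite {m \<in> M. f m \<noteq> fb m}"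
  "f \<otimes>\<^bsub>G\<^esub> g = (\<lambda>m\<in>M. finprod (R A_Mod fb m) (\<lambda>(p, s). \<Union>a\<in>f p. \<Union>b\<in>g s. fb m +> (a \<otimes> b)) (splits m))"
  "f \<oplus>\<^bsub>G\<^esub> g = (\<lambda>m\<in>M. f m <+> g m)"
  "\<one>\<^bsub>G\<^esub> = (\<lambda>m\<in>M. if m = 0 then fb m +> \<one> else fb m)" "\<zero>\<^bsub>G\<^esub> = (\<lambda>m\<in>M. fb m)"
  by (simp_all add: gr_def Let_def multi_exponents_exps splits_def)

text \<open>The comparison map from twisted polynomials to \<open>gr\<close>: the monomial with
  exponent \<open>m\<close> goes to the symbol \<open>X^m\<close>.\<close>

definition symbols :: "((nat \<Rightarrow>\<^sub>0 nat) \<Rightarrow>\<^sub>0 'k laurent fract) \<Rightarrow> ((nat \<Rightarrow>\<^sub>0 nat) \<Rightarrow> 'r set)" where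
  "symbols v = (\<lambda>m\<in>M. coset m (lkp v m))"

abbreviation "Prng \<equiv> S.P.Rring"

lemma Prng_iff: "v \<in> carrier Prng \<longleftrightarrow> kys v \<subseteq> M \<and> coeff_in C v" by simp

lemma symbols_image: "symbols ` carrier Prng = carrier G"
proof
  show "symbols ` carrier Prng \<subseteq> carrier G"
  proof
    fix f assume "f \<in> symbols ` carrier Prng"
    then obtain v where v: "v \<in> carrier Prng" and f: "f = symbols v" by (rule imageE)
    have c: "lkp v m \<in> C" for m using v unfolding Prng_iff by (simp add: coeff_in_def)
    have "coset m (lkp v m) \<in> (\<lambda>a. fb m +> a) ` fl m" if m: "m \<in> M" for m
    proof -
      obtain a where a: "a \<in> coset m (lkp v m)" using coset_ex[OF m c] by blast
      then show ?thesis using set_add_coset[OF a] coset_fl[OF a] by (intro image_eqI[of _ _ a]) auto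
    qed
    moreover have "{m \<in> M. coset m (lkp v m) \<noteq> fb m} \<subseteq> kys v" by (auto simp: fb_eq in_keys_iff)
    then have "finite {m \<in> M. coset m (lkp v m) \<noteq> fb m}" by (rule finite_subset) simp
    then have "finite {m \<in> M. symbols v m \<noteq> fb m}" by (rule rev_finite_subset) (auto simp: symbols_def)
    ultimately show "f \<in> carrier G" unfolding gr_simps(1) f by (auto simp: symbols_def)
  qed
  show "carrier G \<subseteq> symbols ` carrier Prng"
  proof
    fix f assume "f \<in> carrier G"
    then have f: "f \<in> (\<Pi>\<^sub>E m\<in>M. (\<lambda>a. fb m +> a) ` fl m)" and fin: "finite {m \<in> M. f m \<noteq> fb m}"
      unfolding gr_simps(1) by blast+
    have "\<forall>m\<in>M. \<exists>c. c \<in> C \<and> f m = coset m c"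
    proof
      fix m assume m: "m \<in> M"
      have "f m \<in> (\<lambda>a. fb m +> a) ` fl m" using f m by (rule PiE_mem)
      then obtain a where a: "a \<in> fl m" "f m = fb m +> a" by blast
      then have "f m = coset m (lkp (crd a) m)" using set_add_coset[OF fl_coset[OF a(1)]] by simp
      moreover have "lkp (crd a) m \<in> C" using a(1) by (intro lookup_crd_C) (simp add: fl_iff)
      ultimately show "\<exists>c. c \<in> C \<and> f m = coset m c" by blast
    qed
    then obtain c where c: "\<forall>m\<in>M. c m \<in> C \<and> f m = coset m (c m)" by (rule bchoice[THEN exE])
    let ?N = "{m \<in> M. f m \<noteq> fb m}"
    define v where "v = (\<Sum>m\<in>?N. sgl m (c m))"
    have v: "lkp v m = (if m \<in> ?N then c m else 0)" for m
      using fin by (simp add: v_def lookup_sum lookup_single when_def)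
    have "kys v \<subseteq> M" by (auto simp: in_keys_iff v split: if_splits)
    moreover have "coeff_in C v" using c S.C_zero by (auto simp: coeff_in_def v)
    ultimately have "v \<in> carrier Prng" unfolding Prng_iff by blast
    moreover have "f = symbols v"
    proof (rule extensionalityI[of _ M])
      show "f \<in> extensional M" using f by (simp add: PiE_def)
      show "f m = symbols v m" if m: "m \<in> M" for m
        using c m by (cases "f m = fb m") (simp_all add: symbols_def v fb_eq)
    qed (simp add: symbols_def)
    ultimately show "f \<in> symbols ` carrier Prng" by (rule image_eqI[rotated])
  qed
qed

lemma symbols_inj: "inj_on symbols (carrier Prng)"
proof (rule inj_onI)
  fix v w assume v: "v \<in> carrier Prng" and w: "w \<in> carrier Prng" and e: "symbols v = symbols w"
  have vw: "kys v \<subseteq> M" "coeff_in C v" "kys w \<subseteq> M" using v w unfolding Prng_iff by blast+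
  show "v = w"
  proof (rule poly_mapping_eqI)
    fix m
    show "lkp v m = lkp w m"
    proof (cases "m \<in> M")
      case True
      have "coset m (lkp v m) = coset m (lkp w m)" using fun_cong[OF e, of m] True by (simp add: symbols_def)
      then show ?thesis using vw(2) by (intro coset_inj[OF True]) (auto simp: coeff_in_def)
    next
      case False
      then have "m \<notin> kys v" "m \<notin> kys w" using vw by blast+
      then show ?thesis by (simp add: in_keys_iff)
    qed
  qed
qed

lemma symbols_scalar:
  assumes "c \<in> C" "a \<in> coset 0 c" shows "symbols (sgl 0 c) = (\<lambda>m\<in>M. if m = 0 then fb m +> a else fb m)"
proof (rule extensionalityI[of _ M])
  show "symbols (sgl 0 c) m = (\<lambda>m\<in>M. if m = 0 then fb m +> a else fb m) m" if "m \<in> M" for m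
    using that set_add_coset[OF assms(2)] by (auto simp: symbols_def fb_eq lookup_single when_def)
qed (auto simp: symbols_def)

context
  fixes W assumes gW: "\<And>l. l \<in> {1..n} \<Longrightarrow> V.good W l"
begin

text \<open>Unitriangularity again: a monomial below \<open>p\<close> has an image below
  \<open>toi p\<close>, and the monomial at \<open>p\<close> itself keeps its coefficient.\<close>

lemma phi_top:
  assumes "v \<in> V.Rs 1" "bnd p v"
  shows "S.below (toi p) (V.phi W v) \<and> lkp (V.phi W v) (toi p) = lkp v p"
proof -
  have "kys v \<subseteq> {m \<in> M. m \<le> p}" using assms by (auto simp: V.Rs_def bnd_def in_keys_iff)
  then show ?thesis
  proof (induction v rule: pm_induct_keys)
    case (single m c)
    let ?o = "S.T.omon n (\<lambda>l. S.Y l + W l) m"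
    have o: "S.below (toi m) ?o \<and> lkp ?o (toi m) = 1"
      by (rule V.omon_leading[of _ 1]) (use single gW in \<open>auto simp: V.good_def\<close>)
    have e: "V.phi W (sgl m c) = smul c ?o" by (simp add: V.phi_def)
    have "k \<le> toi p" if "k \<in> kys (smul c ?o)" for k
    proof -
      have "k \<in> kys ?o" using that keys_scl[of "\<lambda>_. c" ?o] by blast
      then have "k \<le> toi m" using o unfolding S.below_def by blast
      also have "toi m \<le> toi p" using single by (simp add: toi_le)
      finally show ?thesis .
    qed
    moreover have "lkp ?o (toi p) = 0" if "m \<noteq> p"
    proof -
      have "m \<le> p" using single by simp
      then have "m < p" using that by (rule le_neq_trans)
      then have "\<not> toi p \<le> toi m" by (simp add: toi_le)
      then have "toi p \<notin> kys ?o" using o unfolding S.below_def by (elim conjE) (rule notI, drule (1) bspec, erule notE, assumption)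
      then show ?thesis by (simp only: in_keys_iff not_not)
    qed
    ultimately show ?case unfolding e S.below_def using o by (auto simp: lookup_single when_def)
  next
    case (add v w)
    have "kys (V.phi W v + V.phi W w) \<subseteq> kys (V.phi W v) \<union> kys (V.phi W w)" by (rule keys_add)
    then have "k \<le> toi p" if "k \<in> kys (V.phi W v + V.phi W w)" for k
      using that add.IH unfolding S.below_def by (elim conjE) (drule (1) subsetD, erule UnE, erule (1) bspec, erule (1) bspec)
    then show ?case using add.IH unfolding S.below_def V.phi_add lookup_add by simp
  qed (simp add: S.below_def)
qed

text \<open>The largest exponent of \<open>v\<close> survives in the image by
  \<open>phi_top\<close>. So bounds on supports can be read off in the torus, where they are
  multiplicative.\<close>

lemma bnd_of_below:
  assumes v: "v \<in> V.Rs 1" and b: "S.below (toi m) (V.phi W v)" shows "bnd m v"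
  unfolding bnd_def
proof (intro allI impI)
  fix k assume k: "lkp v k \<noteq> 0"
  let ?t = "Max (kys v)"
  have kt: "k \<le> ?t" using k by (simp add: in_keys_iff)
  have t: "?t \<in> kys v" using k by (intro Max_in) (auto simp: in_keys_iff)
  have "bnd ?t v" unfolding bnd_def by (simp add: in_keys_iff)
  then have "lkp (V.phi W v) (toi ?t) = lkp v ?t" using phi_top[OF v] by blast
  then have "toi ?t \<in> kys (V.phi W v)" using t by (simp add: in_keys_iff)
  then have "toi ?t \<le> toi m" using b unfolding S.below_def by blast
  then show "k \<le> m" using kt by (simp add: toi_le)
qed

lemma crd_Rs: "a \<in> carrier R \<Longrightarrow> crd a \<in> V.Rs 1"
proof -
  assume "a \<in> carrier R"
  then have "crd a \<in> crd ` carrier R" by (rule imageI)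
  then show ?thesis unfolding crd_carrier V.Rring_carrier by (rule conjunct1)
qed

text \<open>The embedding into the quantum torus preserves leading terms, so it computes them for products.\<close>

lemma coset_mult:
  assumes a: "a \<in> coset p c" and b: "b \<in> coset s d"
  shows "a \<otimes> b \<in> coset (p + s) (c * d * S.eps (toi p) (toi s))"
proof -
  have R: "a \<in> carrier R" "b \<in> carrier R" using a b by (auto intro: coset_R)
  have "bnd p (crd a)" "bnd s (crd b)" using a b by (auto simp: coset_def)
  note A = phi_top[OF crd_Rs[OF R(1)] this(1)] and B = phi_top[OF crd_Rs[OF R(2)] this(2)]
  have e: "V.phi W (crd (a \<otimes> b)) = bil S.tB (V.phi W (crd a)) (V.phi W (crd b))"
    unfolding crd_mult[OF R] by (rule V.phi_mult[of 1]) (use gW crd_Rs R in auto)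
  have ab: "crd (a \<otimes> b) \<in> V.Rs 1" by (rule crd_Rs[OF m_closed[OF R]])
  have bel: "S.below (toi (p + s)) (V.phi W (crd (a \<otimes> b)))"
    unfolding e toi_add by (rule S.below_mul) (use A B in blast)+
  have bn: "bnd (p + s) (crd (a \<otimes> b))" by (rule bnd_of_below[OF ab bel])
  have "lkp (crd (a \<otimes> b)) (p + s) = lkp (V.phi W (crd (a \<otimes> b))) (toi p + toi s)"
    using phi_top[OF ab bn] by (simp add: toi_add)
  also have "\<dots> = lkp (V.phi W (crd a)) (toi p) * lkp (V.phi W (crd b)) (toi s) * S.eps (toi p) (toi s)"
    unfolding e by (rule S.lookup_mul_top) (use A B in blast)+
  also have "\<dots> = c * d * S.eps (toi p) (toi s)" using A B a b by (simp add: coset_def)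
  finally show ?thesis using bn m_closed[OF R] by (simp add: coset_def)
qed

lemma symbols_mult:
  assumes v: "v \<in> carrier Prng" and w: "w \<in> carrier Prng"
  shows "symbols (bil S.pB v w) = symbols v \<otimes>\<^bsub>G\<^esub> symbols w"
proof (rule extensionalityI[of _ M])
  have C: "lkp v p * lkp w s * S.eps (toi p) (toi s) \<in> C" for p s
    using v w unfolding Prng_iff by (auto simp: coeff_in_def intro!: S.C_mult S.eps_C)
  show "symbols (bil S.pB v w) m = (symbols v \<otimes>\<^bsub>G\<^esub> symbols w) m" if m: "m \<in> M" for m
  proof -
    interpret L: comm_group "R A_Mod fb m" by (rule comm_group_layer)
    let ?c = "\<lambda>z. lkp v (fst z) * lkp w (snd z) * S.eps (toi (fst z)) (toi (snd z))"
    \<comment> \<open>The product in \<open>gr\<close> takes unions over all representatives; by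
      \<open>coset_mult\<close> they all give the same coset of layer \<open>m\<close>.\<close>
    have "finprod (R A_Mod fb m) (\<lambda>(p, s). \<Union>a\<in>symbols v p. \<Union>b\<in>symbols w s. fb m +> (a \<otimes> b)) (splits m) =
        finprod (R A_Mod fb m) (\<lambda>z. coset m (?c z)) (splits m)"
    proof (rule L.finprod_cong'[OF refl])
      show "(\<lambda>z. coset m (?c z)) \<in> splits m \<rightarrow> carrier (R A_Mod fb m)"
        by (intro Pi_I coset_layer[OF m] C)
      fix z assume z: "z \<in> splits m"
      obtain p s where ps: "z = (p, s)" by (cases z)
      have sum: "p + s = m" using z ps by (simp add: splits_def)
      have "kys p \<subseteq> kys m" "kys s \<subseteq> kys m" unfolding sum[symmetric] by (auto simp: in_keys_iff lookup_add)
      then have M: "p \<in> M" "s \<in> M" using m by (auto simp: exps_def)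
      have vw: "lkp v p \<in> C" "lkp w s \<in> C" using v w unfolding Prng_iff by (auto simp: coeff_in_def)
      obtain a where a: "a \<in> coset p (lkp v p)" using coset_ex[OF M(1) vw(1)] by (rule exE)
      obtain b where b: "b \<in> coset s (lkp w s)" using coset_ex[OF M(2) vw(2)] by (rule exE)
      note ab = a b
      have 1: "fb m +> (a \<otimes> b) = coset m (?c z)" if "a \<in> coset p (lkp v p)" "b \<in> coset s (lkp w s)" for a b
        using set_add_coset[OF coset_mult[OF that]] by (simp add: sum ps)
      have "(\<Union>a\<in>coset p (lkp v p). \<Union>b\<in>coset s (lkp w s). fb m +> (a \<otimes> b)) = coset m (?c z)"
      proof
        show "(\<Union>a\<in>coset p (lkp v p). \<Union>b\<in>coset s (lkp w s). fb m +> (a \<otimes> b)) \<subseteq> coset m (?c z)"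
          by (intro UN_least) (simp only: 1 subset_refl)
        show "coset m (?c z) \<subseteq> (\<Union>a\<in>coset p (lkp v p). \<Union>b\<in>coset s (lkp w s). fb m +> (a \<otimes> b))"
          unfolding 1[OF ab, symmetric] using ab by blast
      qed
      then show "(case z of (p, s) \<Rightarrow> \<Union>a\<in>symbols v p. \<Union>b\<in>symbols w s. fb m +> (a \<otimes> b)) = coset m (?c z)"
        using M by (simp add: ps symbols_def)
    qed
    also have "\<dots> = coset m (\<Sum>z\<in>splits m. ?c z)"
      using finprod_coset[OF m finite_splits, where f = ?c] C by blast
    also have "(\<Sum>z\<in>splits m. ?c z) = lkp (bil S.pB v w) m" by (simp add: S.lookup_pB case_prod_beta)
    finally show ?thesis using m by (simp add: symbols_def gr_simps)
  qed
qed (auto simp: symbols_def gr_simps)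

lemma symbols_hom: "symbols \<in> ring_hom Prng G"
proof (rule ring_hom_memI)
  show "symbols v \<in> carrier G" if "v \<in> carrier Prng" for v using imageI[OF that, of symbols] unfolding symbols_image .
  show "symbols (v \<otimes>\<^bsub>Prng\<^esub> w) = symbols v \<otimes>\<^bsub>G\<^esub> symbols w" if "v \<in> carrier Prng" "w \<in> carrier Prng" for v w
    unfolding S.P.R.ring_of_simps by (rule symbols_mult[OF that])
  show "symbols (v \<oplus>\<^bsub>Prng\<^esub> w) = symbols v \<oplus>\<^bsub>G\<^esub> symbols w" if vw: "v \<in> carrier Prng" "w \<in> carrier Prng" for v w
  proof (rule extensionalityI[of _ M])
    show "symbols (v \<oplus>\<^bsub>Prng\<^esub> w) m = (symbols v \<oplus>\<^bsub>G\<^esub> symbols w) m" if m: "m \<in> M" for m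
    proof -
      have "lkp w m \<in> C" using vw(2) unfolding Prng_iff by (simp add: coeff_in_def)
      from coset_set_add[OF m this] show ?thesis using m by (simp add: symbols_def gr_simps lookup_add)
    qed
  qed (auto simp: symbols_def gr_simps)
  have "\<one> \<in> coset 0 1" by (simp add: coset_def crd_one bnd_single del: lookup_crd)
  then show "symbols \<one>\<^bsub>Prng\<^esub> = \<one>\<^bsub>G\<^esub>" using symbols_scalar[OF S.C_one] by (simp add: gr_simps)
qed

theorem gr_embedding:
  obtains h where "ring G" "h \<in> ring_hom G Lring" "inj_on h (carrier G)" "h ` carrier G = S.Pimage"
    "\<And>a. a \<in> K \<Longrightarrow> h (gr_scalar n q R \<eta> x a) = sgl 0 (emb a)" "\<And>a. a \<in> K \<Longrightarrow> gr_scalar n q R \<eta> x a \<in> carrier G"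
proof -
  let ?p = "S.P.phi (\<lambda>_. 0)" and ?i = "inv_into (carrier Prng) symbols"
  have z: "coeff_in V.F (0 :: (nat \<Rightarrow>\<^sub>0 int) \<Rightarrow>\<^sub>0 'k laurent fract)" by (simp add: coeff_in_def V.F_zero)
  have iso: "symbols \<in> ring_iso Prng G"
    unfolding ring_iso_def bij_betw_def using symbols_hom symbols_inj symbols_image by blast
  have inv: "?i \<in> ring_iso G Prng" by (rule ring_iso_set_sym[OF S.P.ring_Rring iso])
  have ph: "?p \<in> ring_hom Prng Lring" by (rule S.P.phi_hom) (rule S.P_good z)+
  have zero: "symbols \<zero>\<^bsub>Prng\<^esub> = \<zero>\<^bsub>G\<^esub>" by (simp add: symbols_def gr_simps fb_eq)
  \<comment> \<open>The ring axioms of \<open>gr\<close> are transported along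
    \<open>symbols\<close> instead of being checked on families of cosets.\<close>
  have "ring (G \<lparr>carrier := symbols ` carrier Prng, ring.zero := symbols \<zero>\<^bsub>Prng\<^esub>\<rparr>)"
    by (rule ring.ring_hom_imp_img_ring[OF S.P.ring_Rring symbols_hom])
  then have rG: "ring G" unfolding symbols_image zero by simp
  have ib: "?i ` carrier G = carrier Prng" "inj_on ?i (carrier G)" "?i \<in> ring_hom G Prng"
    using inv unfolding ring_iso_def bij_betw_def by blast+
  have sc: "gr_scalar n q R \<eta> x a = symbols (sgl 0 (emb a))" "sgl 0 (emb a) \<in> carrier Prng" if a: "a \<in> K" for a
  proof -
    have c: "emb a \<in> C" using a by (simp add: C_def)
    have "\<eta> a \<in> coset 0 (emb a)" using a by (simp add: coset_def crd_scalar bnd_single del: lookup_crd)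
    from symbols_scalar[OF c this] show "gr_scalar n q R \<eta> x a = symbols (sgl 0 (emb a))"
      by (simp add: gr_scalar_def multi_exponents_exps)
    show "sgl 0 (emb a) \<in> carrier Prng" unfolding Prng_iff
      using c S.C_zero by (auto simp: coeff_in_def lookup_single when_def)
  qed
  show ?thesis
  proof (rule that[of "?p \<circ> ?i"])
    show "ring G" by (rule rG)
    show "?p \<circ> ?i \<in> ring_hom G Lring" by (rule ring_hom_trans[OF ib(3) ph])
    have "inj_on ?p (S.P.Rs 1)" by (rule S.P.phi_inj) (rule S.P_good z)+
    then have "inj_on ?p (?i ` carrier G)" unfolding ib(1)
      by (rule inj_on_subset) (rule subsetI, drule S.P.Rring_carrier[THEN iffD1], erule conjunct1)
    then show "inj_on (?p \<circ> ?i) (carrier G)" by (rule comp_inj_on[OF ib(2)])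
    show "(?p \<circ> ?i) ` carrier G = S.Pimage" unfolding image_comp[symmetric] ib(1) ..
    show "(?p \<circ> ?i) (gr_scalar n q R \<eta> x a) = sgl 0 (emb a)" if "a \<in> K" for a
      unfolding sc(1)[OF that] o_apply inv_into_f_f[OF symbols_inj sc(2)[OF that]] by (rule S.P.phi_scalar)
    show "gr_scalar n q R \<eta> x a \<in> carrier G" if "a \<in> K" for a
      unfolding sc(1)[OF that] symbols_image[symmetric] using sc(2)[OF that] by (rule imageI)
  qed
qed

end
end

section \<open>Twisted polynomials\<close>

context q_matrix
begin

definition wB :: "nat list \<Rightarrow> nat list \<Rightarrow> (nat list \<Rightarrow>\<^sub>0 'k laurent)" where "wB u v = sgl (u @ v) 1"

sublocale W: balg wB "[]" by unfold_locales (simp_all add: wB_def bil_single)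

abbreviation "FA \<equiv> free_algebra n q"
abbreviation "J \<equiv> twisted_ideal n q"

lemma free_algebra_ring_of: "FA = W.ring_of K {w. set w \<subseteq> {1..n}}"
  unfolding free_algebra_def W.ring_of_def
  by (auto simp: kQ_coeffs_def coeff_in_def bil_def lin_def wB_def scl_sum fun_eq_iff)

lemma FA_simps: "f \<in> carrier FA \<longleftrightarrow> kys f \<subseteq> {w. set w \<subseteq> {1..n}} \<and> coeff_in K f"
  "f \<otimes>\<^bsub>FA\<^esub> g = bil wB f g" "f \<oplus>\<^bsub>FA\<^esub> g = f + g" "\<one>\<^bsub>FA\<^esub> = sgl [] 1" "\<zero>\<^bsub>FA\<^esub> = 0"
  unfolding free_algebra_ring_of by simp_all

lemma ring_FA: "ring FA"
  unfolding free_algebra_ring_of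
proof (rule W.ring_ring_of)
  let ?T = "{w. set w \<subseteq> {1..n}}"
  fix f g assume f: "f \<in> carrier (W.ring_of K ?T)" and g: "g \<in> carrier (W.ring_of K ?T)"
  have "kys (bil wB f g) \<subseteq> ?T"
    using f g by (intro keys_bil) (auto simp: wB_def split: if_splits)
  moreover have "coeff_in K (bil wB f g)"
    by (rule coeff_in_bil[where I = K and J = K])
      (use f g in \<open>auto simp: K_zero K_add wB_def lookup_single when_def intro: K_mult\<close>)
  ultimately show "bil wB f g \<in> carrier (W.ring_of K ?T)" by simp
qed (auto intro: K_one K_uminus K_add)

lemma FA_single: "set w \<subseteq> {1..n} \<Longrightarrow> a \<in> K \<Longrightarrow> sgl w a \<in> carrier FA"
  by (auto simp: FA_simps coeff_in_def lookup_single when_def K_zero)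

fun ymon :: "nat list \<Rightarrow> (nat \<Rightarrow>\<^sub>0 int) \<Rightarrow>\<^sub>0 'k laurent fract" where
  "ymon [] = sgl 0 1" | "ymon (i # w) = bil S.tB (S.Y i) (ymon w)"

definition ev :: "(nat list \<Rightarrow>\<^sub>0 'k laurent) \<Rightarrow> ((nat \<Rightarrow>\<^sub>0 int) \<Rightarrow>\<^sub>0 'k laurent fract)" where
  "ev f = lin ymon (map_coeff emb f)"

lemma map_coeff_add: "map_coeff emb (f + g) = map_coeff emb f + map_coeff emb g"
  by (rule poly_mapping_eqI) (simp add: lookup_map_coeff lookup_add)

lemma map_coeff_single: "map_coeff emb (sgl w a) = sgl w (emb a)"
  by (rule poly_mapping_eqI) (simp add: lookup_map_coeff lookup_single when_def)

lemma ev_add: "ev (f + g) = ev f + ev g" by (simp add: ev_def map_coeff_add lin_add)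
lemma ev_single: "ev (sgl w a) = smul (emb a) (ymon w)" by (simp add: ev_def map_coeff_single)
lemma ev_zero [simp]: "ev 0 = 0" using ev_single[of "[]" 0] by simp
lemma ev_uminus: "ev (- f) = - ev f"
  using ev_add[of f "- f"] by (simp add: eq_neg_iff_add_eq_0 add.commute)
lemma ev_diff: "ev (f - g) = ev f - ev g" using ev_add[of f "- g"] by (simp add: ev_uminus)

lemma ymon_append: "ymon (u @ w) = bil S.tB (ymon u) (ymon w)"
  by (induction u) (simp_all add: S.T.mul_assoc)

lemma ev_mult: "ev (bil wB f g) = bil S.tB (ev f) (ev g)"
proof -
  have 1: "ev (bil wB (sgl u a) (sgl w b)) = bil S.tB (ev (sgl u a)) (ev (sgl w b))" for u w a b
    by (simp add: bil_single wB_def ev_single ymon_append bil_smul_left bil_smul_right smul_smul mult.commute)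
  have 2: "ev (bil wB (sgl u a) g) = bil S.tB (ev (sgl u a)) (ev g)" for u a
    using subset_UNIV[of "kys g"] by (induction g rule: pm_induct_keys) (simp_all add: 1 bil_distribs ev_add)
  show ?thesis
    using subset_UNIV[of "kys f"] by (induction f rule: pm_induct_keys) (simp_all add: 2 bil_distribs ev_add)
qed

definition wt :: "nat list \<Rightarrow> (nat \<Rightarrow>\<^sub>0 nat)" where "wt w = (\<Sum>i\<leftarrow>w. sgl i 1)"

lemma wt_simps [simp]: "wt [] = 0" "wt (i # w) = sgl i 1 + wt w" by (simp_all add: wt_def)
lemma lookup_wt: "lkp (wt w) i = count_list w i"
  by (induction w) (auto simp: lookup_add lookup_single when_def)
lemma wt_exps: "set w \<subseteq> T \<Longrightarrow> wt w \<in> exps T"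
  by (induction w) (auto intro: exps_add exps_single)

lemma ymon_scalar: "\<exists>c\<in>C. ymon w = sgl (toi (wt w)) c"
proof (induction w)
  case Nil
  show ?case using S.C_one by auto
next
  case (Cons i w)
  then obtain c where c: "c \<in> C" "ymon w = sgl (toi (wt w)) c" by blast
  have "ymon (i # w) = sgl (toi (wt (i # w))) (c * S.eps (sgl i 1) (toi (wt w)))"
    by (simp add: c(2) S.Y_def bil_single S.tB_def toi_add)
  then show ?case using c(1) S.eps_C S.C_mult by blast
qed

lemma ymon_sorted: "sorted w \<Longrightarrow> ymon w = sgl (toi (wt w)) 1"
proof (induction w)
  case (Cons i w)
  then have w: "ymon w = sgl (toi (wt w)) 1" by simp
  have "S.eps (sgl i 1) (toi (wt w)) = 1"
    by (rule S.eps_ordered[of _ "{i}" _ "{i..}"]) (use Cons(2) in \<open>auto intro: exps_single wt_exps\<close>)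
  then show ?case by (simp add: w S.Y_def bil_single S.tB_def toi_add)
qed simp

lemma sorted_wt_inj: assumes "sorted u" "sorted w" "wt u = wt w" shows "u = w"
proof -
  have "count_list u i = count_list w i" for i using assms(3) by (simp flip: lookup_wt)
  then have "mset u = mset w" by (intro multiset_eqI) (simp add: count_mset)
  then show ?thesis using assms(1,2) by (metis properties_for_sort sorted_sort_id)
qed

lemma exists_sorted_word:
  assumes "m \<in> exps {j..n}" shows "\<exists>w. sorted w \<and> set w \<subseteq> {j..n} \<and> wt w = m"
  using assms
proof (induction m rule: exponent_induct)
  case zero
  show ?case by (intro exI[of _ "[]"]) simp
next
  case (step i m)
  then obtain w where w: "sorted w" "set w \<subseteq> {j..n}" "wt w = m" by blast
  have "i \<le> k" if k: "k \<in> set w" for k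
  proof -
    have "count_list w k \<noteq> 0" using k by (simp add: count_list_0_iff)
    then have "k \<in> kys m" unfolding w(3)[symmetric] by (simp add: in_keys_iff lookup_wt)
    then show ?thesis using step(2) by (auto simp: exps_def)
  qed
  then show ?case using w step(1) by (intro exI[of _ "i # w"]) auto
qed

lemma ideal_J: "ideal J FA" and rel_J: "i \<in> {1..n} \<Longrightarrow> j \<in> {1..n} \<Longrightarrow> sgl [i, j] 1 - sgl [j, i] (q i j) \<in> J"
proof -
  interpret FA: ring FA by (rule ring_FA)
  let ?S = "{sgl [i, j] 1 - sgl [j, i] (q i j) | i j. i \<in> {1..n} \<and> j \<in> {1..n}}"
  have S: "?S \<subseteq> carrier FA"
  proof
    fix f assume "f \<in> ?S"
    then obtain i j where ij: "i \<in> {1..n}" "j \<in> {1..n}" "f = sgl [i, j] 1 - sgl [j, i] (q i j)" by blast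
    have "sgl [i, j] 1 + sgl [j, i] (- q i j) \<in> carrier FA"
      using FA.a_closed[OF FA_single[of "[i, j]" 1] FA_single[of "[j, i]" "- q i j"]] ij K_one K_uminus[OF K_q]
      by (simp add: FA_simps(3))
    moreover have "f = sgl [i, j] 1 + sgl [j, i] (- q i j)" using ij(3) by (simp add: single_uminus)
    ultimately show "f \<in> carrier FA" by simp
  qed
  show "ideal J FA" unfolding twisted_ideal_def by (rule FA.genideal_ideal[OF S])
  show "sgl [i, j] 1 - sgl [j, i] (q i j) \<in> J" if "i \<in> {1..n}" "j \<in> {1..n}" for i j
    unfolding twisted_ideal_def using FA.genideal_self[OF S] that by blast
qed

lemma J_FA: "f \<in> J \<Longrightarrow> f \<in> carrier FA" and J_add: "f \<in> J \<Longrightarrow> g \<in> J \<Longrightarrow> f + g \<in> J"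
  and J_left: "f \<in> J \<Longrightarrow> g \<in> carrier FA \<Longrightarrow> bil wB g f \<in> J"
  and J_right: "f \<in> J \<Longrightarrow> g \<in> carrier FA \<Longrightarrow> bil wB f g \<in> J" and J_zero: "0 \<in> J"
proof -
  interpret ideal J FA by (rule ideal_J)
  show "f \<in> J \<Longrightarrow> f \<in> carrier FA" by (rule a_Hcarr)
  show "f \<in> J \<Longrightarrow> g \<in> J \<Longrightarrow> f + g \<in> J" using additive_subgroup.a_closed[OF ideal.axioms(1)[OF ideal_J], of f g] by (simp only: FA_simps(3))
  show "f \<in> J \<Longrightarrow> g \<in> carrier FA \<Longrightarrow> bil wB g f \<in> J" using I_l_closed[of f g] by (simp only: FA_simps(2))
  show "f \<in> J \<Longrightarrow> g \<in> carrier FA \<Longrightarrow> bil wB f g \<in> J" using I_r_closed[of f g] by (simp only: FA_simps(2))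
  show "0 \<in> J" using additive_subgroup.zero_closed[OF ideal.axioms(1)[OF ideal_J]] by (simp only: FA_simps(5))
qed

lemma w_single: "bil wB (sgl u a) (sgl w b) = sgl (u @ w) (a * b)" by (simp add: bil_single wB_def)

text \<open>A relation exchanges neighbouring letters at the cost of a factor in \<open>K\<close>,
  so one letter can be carried to its place. Repeating this sorts a word as insertion sort
  does.\<close>

lemma insert_word:
  assumes "i \<in> {1..n}" "set w \<subseteq> {1..n}"
  shows "\<exists>c\<in>K. sgl (i # w) 1 - sgl (insort i w) c \<in> J"
  using assms
proof (induction w)
  case Nil
  show ?case by (intro bexI[of _ 1]) (simp_all add: J_zero K_one)
next
  case (Cons j w)
  show ?case
  proof (cases "i \<le> j")
    case True
    then show ?thesis by (intro bexI[of _ 1]) (simp_all add: J_zero K_one)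
  next
    case False
    from Cons obtain c where c: "c \<in> K" "sgl (i # w) 1 - sgl (insort i w) c \<in> J" by auto
    have j: "j \<in> {1..n}" using Cons(3) by simp
    have qK: "q i j \<in> K" by (rule K_q[OF Cons(2) j])
    have "bil wB (sgl [i, j] 1 - sgl [j, i] (q i j)) (sgl w 1) \<in> J"
      by (rule J_right[OF rel_J[OF Cons(2) j]]) (use Cons(3) K_one in \<open>auto intro: FA_single\<close>)
    moreover have "bil wB (sgl [j] (q i j)) (sgl (i # w) 1 - sgl (insort i w) c) \<in> J"
      by (rule J_left[OF c(2)]) (use j qK in \<open>auto intro: FA_single\<close>)
    ultimately have "bil wB (sgl [i, j] 1 - sgl [j, i] (q i j)) (sgl w 1) +
        bil wB (sgl [j] (q i j)) (sgl (i # w) 1 - sgl (insort i w) c) \<in> J" by (rule J_add)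
    moreover have "bil wB (sgl [i, j] 1 - sgl [j, i] (q i j)) (sgl w 1) +
        bil wB (sgl [j] (q i j)) (sgl (i # w) 1 - sgl (insort i w) c) =
        sgl (i # j # w) 1 - sgl (insort i (j # w)) (q i j * c)"
      using False by (simp add: bil_diff_left bil_diff_right w_single)
    ultimately show ?thesis using K_mult[OF qK c(1)] by (intro bexI) simp_all
  qed
qed

lemma sort_word:
  assumes "set w \<subseteq> {1..n}" shows "\<exists>c\<in>K. sgl w 1 - sgl (sort w) c \<in> J"
  using assms
proof (induction w)
  case Nil
  show ?case by (intro bexI[of _ 1]) (simp_all add: J_zero K_one)
next
  case (Cons i w)
  then obtain c where c: "c \<in> K" "sgl w 1 - sgl (sort w) c \<in> J" by auto
  obtain d where d: "d \<in> K" "sgl (i # sort w) 1 - sgl (insort i (sort w)) d \<in> J"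
    using insert_word[of i "sort w"] Cons(2) by auto
  have "bil wB (sgl [i] 1) (sgl w 1 - sgl (sort w) c) \<in> J"
    by (rule J_left[OF c(2)]) (use Cons(2) K_one in \<open>auto intro: FA_single\<close>)
  moreover have "bil wB (sgl [] c) (sgl (i # sort w) 1 - sgl (insort i (sort w)) d) \<in> J"
    by (rule J_left[OF d(2)]) (use c(1) in \<open>auto intro: FA_single\<close>)
  ultimately have "bil wB (sgl [i] 1) (sgl w 1 - sgl (sort w) c) +
      bil wB (sgl [] c) (sgl (i # sort w) 1 - sgl (insort i (sort w)) d) \<in> J" by (rule J_add)
  moreover have "bil wB (sgl [i] 1) (sgl w 1 - sgl (sort w) c) +
      bil wB (sgl [] c) (sgl (i # sort w) 1 - sgl (insort i (sort w)) d) = sgl (i # w) 1 - sgl (sort (i # w)) (c * d)"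
    by (simp add: bil_diff_right w_single)
  ultimately show ?case using K_mult[OF c(1) d(1)] by (intro bexI) simp_all
qed

lemma normal_form:
  assumes "f \<in> carrier FA"
  shows "\<exists>g. kys g \<subseteq> {w. sorted w} \<and> f - g \<in> J"
proof -
  have "\<exists>g. kys g \<subseteq> {w. sorted w} \<and> (\<Sum>w\<in>A. sgl w (lkp f w)) - g \<in> J" if "finite A" "A \<subseteq> kys f" for A
    using that
  proof (induction A rule: finite_induct)
    case empty
    show ?case by (intro exI[of _ 0]) (simp add: J_zero)
  next
    case (insert w A)
    then obtain g where g: "kys g \<subseteq> {w. sorted w}" "(\<Sum>w\<in>A. sgl w (lkp f w)) - g \<in> J" by auto
    have w: "set w \<subseteq> {1..n}" and fw: "lkp f w \<in> K" using insert(4) assms by (auto simp: FA_simps coeff_in_def)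
    obtain c where c: "c \<in> K" "sgl w 1 - sgl (sort w) c \<in> J" using sort_word[OF w] by blast
    have "bil wB (sgl [] (lkp f w)) (sgl w 1 - sgl (sort w) c) \<in> J"
      by (rule J_left[OF c(2)]) (use fw in \<open>auto intro: FA_single\<close>)
    then have "sgl w (lkp f w) - sgl (sort w) (lkp f w * c) \<in> J" by (simp add: bil_diff_right w_single)
    from J_add[OF this g(2)]
    have "(\<Sum>w\<in>insert w A. sgl w (lkp f w)) - (sgl (sort w) (lkp f w * c) + g) \<in> J"
      using insert(1,2) by (simp add: algebra_simps)
    moreover have "kys (sgl (sort w) (lkp f w * c) + g) \<subseteq> {w. sorted w}"
    proof (rule order_trans[OF keys_add])
      show "kys (sgl (sort w) (lkp f w * c)) \<union> kys g \<subseteq> {w. sorted w}"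
        using g(1) by (auto simp: in_keys_iff lookup_single when_def split: if_splits)
    qed
    ultimately show ?case by blast
  qed
  from this[of "kys f"] show ?thesis by (simp flip: pm_sum_single)
qed

text \<open>Sorted words have pairwise different exponents and evaluate to monomials with
  coefficient 1, so \<open>ev\<close> is injective on normal forms. With \<open>normal_form\<close>
  this shows that the kernel of \<open>ev\<close> contains nothing beyond the relations.\<close>

lemma ev_sorted:
  assumes "kys g \<subseteq> {w. sorted w}" "sorted w" shows "lkp (ev g) (toi (wt w)) = emb (lkp g w)"
  using assms(1)
proof (induction g rule: pm_induct_keys)
  case (single u a)
  have "toi (wt u) = toi (wt w) \<longleftrightarrow> u = w" unfolding toi_inj using sorted_wt_inj[of u w] single assms(2) by blast
  then show ?case using single by (simp add: ev_single ymon_sorted lookup_single when_def)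
qed (simp_all add: ev_add lookup_add)

abbreviation "TL \<equiv> S.P.Lring"

lemma ev_Pimage: "f \<in> carrier FA \<Longrightarrow> ev f \<in> S.Pimage"
proof -
  assume f: "f \<in> carrier FA"
  have s: "smul (emb (lkp f w)) (ymon w) \<in> S.Pimage" if w: "w \<in> kys f" for w
  proof -
    obtain c where c: "c \<in> C" "ymon w = sgl (toi (wt w)) c" using ymon_scalar[of w] by blast
    have "emb (lkp f w) \<in> C" using f by (simp add: FA_simps coeff_in_def C_def)
    then have "emb (lkp f w) * c \<in> C" using c(1) by (rule S.C_mult)
    moreover have "wt w \<in> exps {1..n}" by (rule wt_exps) (use f w in \<open>auto simp: FA_simps\<close>)
    ultimately show ?thesis unfolding S.Pimage_iff c(2)
      by (auto simp: coeff_in_def lookup_single when_def S.C_zero split: if_splits)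
  qed
  have z: "0 \<in> S.Pimage" by (simp add: S.Pimage_iff coeff_in_def S.C_zero)
  have a: "v + w \<in> S.Pimage" if "v \<in> S.Pimage" "w \<in> S.Pimage" for v w
    using subringE(7)[OF S.Pimage_ore(1) that] by (simp only: S.T.ring_of_simps(4))
  have "(\<Sum>w\<in>A. smul (emb (lkp f w)) (ymon w)) \<in> S.Pimage" if "finite A" "A \<subseteq> kys f" for A
    using that by (induction A rule: finite_induct) (auto intro: z a s)
  then have "(\<Sum>w\<in>kys f. smul (emb (lkp f w)) (ymon w)) \<in> S.Pimage" by simp
  moreover have "ev f = (\<Sum>w\<in>kys f. smul (emb (lkp f w)) (ymon w))"
    unfolding ev_def by (subst lin_superset[of "kys f"]) (auto simp: lookup_map_coeff in_keys_iff)
  ultimately show ?thesis by simp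
qed

lemma ev_image: "ev ` carrier FA = S.Pimage"
proof
  show "ev ` carrier FA \<subseteq> S.Pimage" using ev_Pimage by (rule image_subsetI)
  show "S.Pimage \<subseteq> ev ` carrier FA"
  proof
    interpret FA: ring FA by (rule ring_FA)
    fix v assume v: "v \<in> S.Pimage"
    have 1: "\<exists>f\<in>carrier FA. ev f = sgl k (lkp v k)" if k: "k \<in> kys v" for k
    proof -
      obtain m where m: "m \<in> exps {1..n}" "k = toi m" using v k unfolding S.Pimage_iff by blast
      obtain w where w: "sorted w" "set w \<subseteq> {1..n}" "wt w = m" using exists_sorted_word[OF m(1)] by blast
      have "lkp v k \<in> C" using v unfolding S.Pimage_iff coeff_in_def by blast
      then obtain a where a: "a \<in> K" "lkp v k = emb a" unfolding C_def by blast
      have "ev (sgl w a) = sgl k (lkp v k)" using a(2) by (simp add: ev_single ymon_sorted w m(2))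
      then show ?thesis using FA_single[OF w(2) a(1)] by blast
    qed
    have "\<exists>f\<in>carrier FA. ev f = (\<Sum>k\<in>A. sgl k (lkp v k))" if "finite A" "A \<subseteq> kys v" for A
      using that
    proof (induction A rule: finite_induct)
      case empty
      show ?case using FA.zero_closed by (intro bexI[of _ 0]) (simp_all add: FA_simps(5))
    next
      case (insert k A)
      then obtain f where f: "f \<in> carrier FA" "ev f = (\<Sum>k\<in>A. sgl k (lkp v k))" by auto
      obtain g where g: "g \<in> carrier FA" "ev g = sgl k (lkp v k)" using 1 insert(4) by blast
      show ?case using FA.a_closed[OF g(1) f(1)] insert(1,2) f(2) g(2)
        by (intro bexI[of _ "g + f"]) (simp_all add: ev_add FA_simps(3))
    qed
    from this[of "kys v"] obtain f where "f \<in> carrier FA" "ev f = v" by (auto simp flip: pm_sum_single)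
    then show "v \<in> ev ` carrier FA" by blast
  qed
qed

lemma ev_hom: "ring_hom_ring FA TL ev"
proof (rule ring_hom_ringI2[OF ring_FA S.P.ring_Lring], rule ring_hom_memI)
  show "ev f \<in> carrier TL" if "f \<in> carrier FA" for f
    using ev_Pimage[OF that] subringE(1)[OF S.Pimage_ore(1)] by blast
  show "ev (f \<otimes>\<^bsub>FA\<^esub> g) = ev f \<otimes>\<^bsub>TL\<^esub> ev g" for f g by (simp add: FA_simps(2) ev_mult)
  show "ev (f \<oplus>\<^bsub>FA\<^esub> g) = ev f \<oplus>\<^bsub>TL\<^esub> ev g" for f g by (simp add: FA_simps(3) ev_add)
  show "ev \<one>\<^bsub>FA\<^esub> = \<one>\<^bsub>TL\<^esub>" by (simp add: FA_simps(4) ev_single)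
qed

lemma ev_kernel_iff: "f \<in> a_kernel FA TL ev \<longleftrightarrow> f \<in> carrier FA \<and> ev f = 0"
  unfolding a_kernel_def' S.T.ring_of_simps by (rule mem_Collect_eq)

lemma ev_kernel: "a_kernel FA TL ev = J"
proof
  interpret h: ring_hom_ring FA TL ev by (rule ev_hom)
  have JK: "J \<subseteq> a_kernel FA TL ev"
    unfolding twisted_ideal_def
  proof (rule h.R.genideal_minimal[OF h.kernel_is_ideal], rule subsetI)
    fix f assume "f \<in> {sgl [i, j] 1 - sgl [j, i] (q i j) | i j. i \<in> {1..n} \<and> j \<in> {1..n}}"
    then obtain i j where ij: "i \<in> {1..n}" "j \<in> {1..n}" "f = sgl [i, j] 1 - sgl [j, i] (q i j)" by blast
    have "bil S.tB (S.Y i) (S.Y j) = smul (emb (q i j)) (bil S.tB (S.Y j) (S.Y i))"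
    proof -
      have "emb (q i j) = Qm i j" using ij by (simp add: Qm_def)
      then show ?thesis
        by (cases i j rule: linorder_cases)
          (simp_all add: S.Y_def bil_single S.tB_def S.eps_single add.commute S.Q_inv S.Q_diag)
    qed
    then have "ev f = 0" by (simp add: ij(3) ev_diff ev_single smul_smul S.T.mul_one)
    moreover have "f \<in> carrier FA" unfolding ij(3) by (rule J_FA[OF rel_J[OF ij(1,2)]])
    ultimately show "f \<in> a_kernel FA TL ev" unfolding ev_kernel_iff by (intro conjI)
  qed
  then show "J \<subseteq> a_kernel FA TL ev" .
  show "a_kernel FA TL ev \<subseteq> J"
  proof
    fix f assume "f \<in> a_kernel FA TL ev"
    then have f: "f \<in> carrier FA" "ev f = 0" unfolding ev_kernel_iff by blast+
    obtain g where g: "kys g \<subseteq> {w. sorted w}" "f - g \<in> J" using normal_form[OF f(1)] by (elim exE conjE) (rule that)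
    have "f - g \<in> a_kernel FA TL ev" using JK g(2) by (rule subsetD)
    then have "ev (f - g) = 0" unfolding ev_kernel_iff by (rule conjunct2)
    then have "ev g = 0" using f(2) by (simp add: ev_diff)
    have "g = 0"
    proof (rule poly_mapping_eqI)
      fix w
      show "lkp g w = lkp 0 w"
      proof (cases "sorted w")
        case True
        then show ?thesis using ev_sorted[OF g(1) True] \<open>ev g = 0\<close> by simp
      qed (use g(1) in \<open>auto simp: in_keys_iff subset_iff\<close>)
    qed
    then show "f \<in> J" using g(2) by simp
  qed
qed

theorem twisted_embedding:
  obtains h where "ring (twisted_poly n q)" "h \<in> ring_hom (twisted_poly n q) TL" "inj_on h (carrier (twisted_poly n q))"
    "h ` carrier (twisted_poly n q) = S.Pimage" "\<And>a. a \<in> K \<Longrightarrow> h (twisted_scalar n q a) = sgl 0 (emb a)"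
    "\<And>a. a \<in> K \<Longrightarrow> twisted_scalar n q a \<in> carrier (twisted_poly n q)"
proof -
  interpret h: ring_hom_ring FA TL ev by (rule ev_hom)
  let ?h = "\<lambda>U. the_elem (ev ` U)"
  have T: "twisted_poly n q = FA Quot a_kernel FA TL ev" by (simp add: twisted_poly_def ev_kernel)
  have a: "sgl [] a \<in> carrier FA" if "a \<in> K" for a using that by (intro FA_single) auto
  show ?thesis
  proof (rule that[of ?h])
    show "ring (twisted_poly n q)" unfolding T by (rule ideal.quotient_is_ring[OF h.kernel_is_ideal])
    show "?h \<in> ring_hom (twisted_poly n q) TL" unfolding T by (rule h.the_elem_hom)
    show "inj_on ?h (carrier (twisted_poly n q))" unfolding T by (rule inj_onI) (rule h.the_elem_inj)
    show "?h ` carrier (twisted_poly n q) = S.Pimage" unfolding T h.the_elem_surj by (rule ev_image)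
    show "?h (twisted_scalar n q a) = sgl 0 (emb a)" if "a \<in> K" for a
      using h.the_elem_simp[OF a[OF that]] unfolding twisted_scalar_def ev_kernel by (simp add: ev_single)
    show "twisted_scalar n q a \<in> carrier (twisted_poly n q)" if "a \<in> K" for a
      unfolding twisted_scalar_def twisted_poly_def FactRing_def A_RCOSETS_def'
      using a[OF that] by (simp only: partial_object.select_convs) blast
  qed
qed

end

section \<open>Comparison of the skew fields\<close>

text \<open>Both skew fields are compared with that of \<open>L\<close>; the scalars correspond
  because their images in \<open>L\<close> agree.\<close>

lemma k_algebra_iso_of_embeddings:
  assumes L: "nc_domain L"
    and P: "ring P" "h \<in> ring_hom P L" "inj_on h (carrier P)" "right_ore L (h ` carrier P)"
      "denominated L (h ` carrier P) = carrier L"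
    and Q: "ring Q" "g \<in> ring_hom Q L" "inj_on g (carrier Q)" "right_ore L (g ` carrier Q)"
      "denominated L (g ` carrier Q) = carrier L"
    and a: "\<And>c. \<alpha> c \<in> carrier P" and b: "\<And>c. \<beta> c \<in> carrier Q" and ab: "\<And>c. h (\<alpha> c) = g (\<beta> c)"
  shows "k_algebra_iso (ore_Fract P) (\<lambda>c. fract_embed P (\<alpha> c)) (ore_Fract Q) (\<lambda>c. fract_embed Q (\<beta> c))"
proof -
  note IP = ore_Fract_iso_of_denominated[OF P(1) L P(2-5)] and IQ = ore_Fract_iso_of_denominated[OF Q(1) L Q(2-5)]
  interpret P: ore_domain P by (rule IP(1))
  interpret Q: ore_domain Q by (rule IQ(1))
  obtain \<Phi> where \<Phi>: "\<Phi> \<in> ring_iso (ore_Fract P) (ore_Fract L)" "\<forall>a\<in>carrier P. \<Phi> (fract_embed P a) = fract_embed L (h a)"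
    using IP(3) by (rule bexE)
  obtain \<Psi> where \<Psi>: "\<Psi> \<in> ring_iso (ore_Fract Q) (ore_Fract L)" "\<forall>a\<in>carrier Q. \<Psi> (fract_embed Q a) = fract_embed L (g a)"
    using IQ(3) by (rule bexE)
  show ?thesis
  proof (rule k_algebra_iso_via[OF IP(1) IQ(1) \<Phi>(1) \<Psi>(1)])
    show "fract_embed P (\<alpha> c) \<in> carrier (ore_Fract P)" for c
      unfolding fract_embed_def by (rule P.fract_class_in[OF a P.one_closed P.nontrivial])
    show "fract_embed Q (\<beta> c) \<in> carrier (ore_Fract Q)" for c
      unfolding fract_embed_def by (rule Q.fract_class_in[OF b Q.one_closed Q.nontrivial])
    show "\<Phi> (fract_embed P (\<alpha> c)) = \<Psi> (fract_embed Q (\<beta> c))" for c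
      unfolding bspec[OF \<Phi>(2) a] bspec[OF \<Psi>(2) b] ab ..
  qed
qed

theorem mainTheorem1:
  fixes n :: nat
    and q :: "nat \<Rightarrow> nat \<Rightarrow> 'k::field_char_0 laurent"
    and R :: "('r, 'm) ring_scheme"
    and \<eta> :: "'k laurent \<Rightarrow> 'r"
    and x :: "nat \<Rightarrow> 'r"
  assumes "Q_matrix n q"
    and "Q_solvable n q R \<eta> x"
    and "pure_Q_algebra n q R \<eta>"
  shows "k_algebra_iso
           (ore_Fract R) (\<lambda>c. fract_embed R (\<eta> (const c)))
           (ore_Fract (gr n q R \<eta> x))
             (\<lambda>c. fract_embed (gr n q R \<eta> x) (gr_scalar n q R \<eta> x (const c)))
       \<and> k_algebra_iso
           (ore_Fract R) (\<lambda>c. fract_embed R (\<eta> (const c)))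
           (ore_Fract (twisted_poly n q))
             (\<lambda>c. fract_embed (twisted_poly n q) (twisted_scalar n q (const c)))"
proof -
  interpret solvable_data n q R \<eta> x
    by (intro solvable_data.intro q_matrix.intro solvable_data_axioms.intro assms)
  \<comment> \<open>The same \<open>W\<close> serves twice: for the embedding of R and, through
    leading terms, for the product in \<open>gr\<close>.\<close>
  obtain W where W: "\<forall>l\<in>{1..n}. V.good W l" "\<forall>l\<in>{1..n}. coeff_in V.F (W l)"
    using exists_good[OF assms(3)] by (elim exE conjE) (rule that)
  have "\<exists>h. h \<in> ring_hom R Lring \<and> inj_on h (carrier R) \<and> right_ore Lring (h ` carrier R) \<and>
      denominated Lring (h ` carrier R) = carrier Lring \<and> (\<forall>a\<in>K. h (\<eta> a) = sgl 0 (emb a))"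
  proof (rule torus_embedding[OF bspec[OF W(1)] bspec[OF W(2)]])
    fix h assume h: "h \<in> ring_hom R Lring" "inj_on h (carrier R)" "right_ore Lring (h ` carrier R)"
      "denominated Lring (h ` carrier R) = carrier Lring" "\<And>a. a \<in> K \<Longrightarrow> h (\<eta> a) = sgl 0 (emb a)"
    show ?thesis by (intro exI[of _ h] conjI ballI h)
  qed
  then obtain h where h: "h \<in> ring_hom R Lring" "inj_on h (carrier R)" "right_ore Lring (h ` carrier R)"
    "denominated Lring (h ` carrier R) = carrier Lring" "\<forall>a\<in>K. h (\<eta> a) = sgl 0 (emb a)"
    by (elim exE conjE) (rule that)
  have "\<exists>g. ring G \<and> g \<in> ring_hom G Lring \<and> inj_on g (carrier G) \<and> g ` carrier G = S.Pimage \<and>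
      (\<forall>a\<in>K. g (gr_scalar n q R \<eta> x a) = sgl 0 (emb a)) \<and> (\<forall>a\<in>K. gr_scalar n q R \<eta> x a \<in> carrier G)"
  proof (rule gr_embedding[OF bspec[OF W(1)]])
    fix g assume g: "ring G" "g \<in> ring_hom G Lring" "inj_on g (carrier G)" "g ` carrier G = S.Pimage"
      "\<And>a. a \<in> K \<Longrightarrow> g (gr_scalar n q R \<eta> x a) = sgl 0 (emb a)" "\<And>a. a \<in> K \<Longrightarrow> gr_scalar n q R \<eta> x a \<in> carrier G"
    show ?thesis by (intro exI[of _ g] conjI ballI g)
  qed
  then obtain g where g: "ring G" "g \<in> ring_hom G Lring" "inj_on g (carrier G)" "g ` carrier G = S.Pimage"
    "\<forall>a\<in>K. g (gr_scalar n q R \<eta> x a) = sgl 0 (emb a)" "\<forall>a\<in>K. gr_scalar n q R \<eta> x a \<in> carrier G"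
    by (elim exE conjE) (rule that)
  \<comment> \<open>\<open>F\<close>, and with it the ring of Laurent polynomials, depends on the
    scalars \<open>C\<close> and not on the structure constants. So the torus of the twisted
    polynomials is the one already used for R.\<close>
  let ?T = "twisted_poly n q"
  have "\<exists>t. ring ?T \<and> t \<in> ring_hom ?T Lring \<and> inj_on t (carrier ?T) \<and> t ` carrier ?T = S.Pimage \<and>
      (\<forall>a\<in>K. t (twisted_scalar n q a) = sgl 0 (emb a)) \<and> (\<forall>a\<in>K. twisted_scalar n q a \<in> carrier ?T)"
  proof (rule twisted_embedding)
    fix t assume t: "ring ?T" "t \<in> ring_hom ?T Lring" "inj_on t (carrier ?T)" "t ` carrier ?T = S.Pimage"
      "\<And>a. a \<in> K \<Longrightarrow> t (twisted_scalar n q a) = sgl 0 (emb a)" "\<And>a. a \<in> K \<Longrightarrow> twisted_scalar n q a \<in> carrier ?T"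
    show ?thesis by (intro exI[of _ t] conjI ballI t)
  qed
  then obtain t where t: "ring ?T" "t \<in> ring_hom ?T Lring" "inj_on t (carrier ?T)" "t ` carrier ?T = S.Pimage"
    "\<forall>a\<in>K. t (twisted_scalar n q a) = sgl 0 (emb a)" "\<forall>a\<in>K. twisted_scalar n q a \<in> carrier ?T"
    by (elim exE conjE) (rule that)
  note k = K_const
  show ?thesis
  proof
    show "k_algebra_iso (ore_Fract R) (\<lambda>c. fract_embed R (\<eta> (const c))) (ore_Fract G)
        (\<lambda>c. fract_embed G (gr_scalar n q R \<eta> x (const c)))"
      by (rule k_algebra_iso_of_embeddings[OF V.nc_domain_Lring ring_axioms h(1-4) g(1-3),
            unfolded g(4), OF S.Pimage_ore(2,3)])
        (simp_all only: bspec[OF h(5) k] bspec[OF g(5) k] bspec[OF g(6) k] eta_closed[OF k])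
    show "k_algebra_iso (ore_Fract R) (\<lambda>c. fract_embed R (\<eta> (const c))) (ore_Fract (twisted_poly n q))
        (\<lambda>c. fract_embed (twisted_poly n q) (twisted_scalar n q (const c)))"
      by (rule k_algebra_iso_of_embeddings[OF V.nc_domain_Lring ring_axioms h(1-4) t(1-3),
            unfolded t(4), OF S.Pimage_ore(2,3)])
        (simp_all only: bspec[OF h(5) k] bspec[OF t(5) k] bspec[OF t(6) k] eta_closed[OF k])
  qed
qed

end
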